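(* Let $\mathcal{X}$ be a compact metric space and $\Theta\subseteq\mathbb{R}^p$ a compact set (Euclidean metric) with nonempty interior $\mathrm{int}(\Theta)$. Let $\mu:\mathcal{X}\times\Theta\to\mathbb{R}$ be continuous, with $\theta\mapsto\mu(x,\theta)$ twice continuously differentiable on $\mathrm{int}(\Theta)$ for each $x\in\mathcal{X}$. Let $f_\theta:\mathcal{X}\to\mathbb{R}^p$, $\theta\in\Theta$, be functions such that for each $\theta$ the image $f_\theta(\mathcal{X})$ spans $\mathbb{R}^p$, $(x,\theta)\mapsto f_\theta(x)$ is continuous on $\mathcal{X}\times\Theta$, and $f_\theta(x)=\nabla\mu(x,\theta)$ (gradient in $\theta$) for all $\theta\in\mathrm{int}(\Theta)$, $x\in\mathcal{X}$. Assume saturated identifiability: whenever $z_1,\ldots,z_p\in\mathcal{X}$ are pairwise distinct and $\theta,\theta'\in\Theta$ satisfy $\mu(z_j,\theta)=\mu(z_j,\theta')$ for $1\le j\le p$, then $\theta=\theta'$. Consider random variables $X_i$ ($\mathcal{X}$-valued) and $Y_i$ (real), $i\in\mathbb{N}$, on a probability space $(\Omega,\mathcal{F},\mathbb{P}_{\bar\theta})$, with true parameter $\bar\theta\in\mathrm{int}(\Theta)$, generated by the adaptive Wynn algorithm: $X_1,\ldots,X_{n_{\rm st}}$ are fixed points such that $M(\xi_{n_{\rm st}},\theta)$ is positive definite for all $\theta\in\Theta$; for $n\ge n_{\rm st}$, $\hat\theta_n=\hat\theta_n(X_1,Y_1,\ldots,X_n,Y_n)\in\Theta$ are adaptive estimators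 and $$X_{n+1}\in\arg\max_{x\in\mathcal{X}} f_{\hat\theta_n}^{\mathsf T}(x)\,M^{-1}(\xi_n,\hat\theta_n)\,f_{\hat\theta_n}(x),\qquad \xi_n=\tfrac1n\sum_{i=1}^n\delta_{X_i}.$$ Assume: (A1) there is a nondecreasing sequence of sub-$\sigma$-fields $\mathcal{F}_0\subseteq\mathcal{F}_1\subseteq\cdots\subseteq\mathcal{F}$ with $X_i$ $\mathcal{F}_{i-1}$-measurable and $Y_i$ $\mathcal{F}_i$-measurable; (A2) $Y_i=\mu(X_i,\bar\theta)+e_i$ with square-integrable errors, $\mathrm{E}(e_i\mid\mathcal{F}_{i-1})=0$ a.s. and $\sup_i\mathrm{E}(e_i^2\mid\mathcal{F}_{i-1})<\infty$ a.s.; (L) $\frac1n\sum_{i=1}^n\mathrm{E}\bigl(e_i^2\mathbf{1}(|e_i|>\varepsilon\sqrt n)\mid\mathcal{F}_{i-1}\bigr)\to0$ a.s. for all $\varepsilon>0$; (AH) $\mathrm{E}(e_n^2\mid\mathcal{F}_{n-1})\to\sigma^2(\bar\theta)$ a.s. for some positive constant $\sigma^2(\bar\theta)$. Moreover assume the adaptive estimators employed by the algorithm are strongly consistent: $\hat\theta_n\to\bar\theta$ a.s. Let $\hat\theta_n^{(\mathrm{LS})}\in\arg\min_{\theta\in\Theta}\sum_{i=1}^n(Y_i-\mu(X_i,\theta))^2$ be the adaptive least squares estimators. Then $$\sqrt n\,\sigma^{-1}(\bar\theta)\,M^{1/2}\bigl(\xi_n,\hat\theta_n^{(\mathrm{LS})}\bigr)\bigl(\hat\theta_n^{(\mathrm{LS})}-\bar\theta\bigr)\xrightarrow{d}\mathrm{N}(0,I_p),$$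 and, with $M_*=M(\xi^*_{\bar\theta},\bar\theta)$ the information matrix of a locally D-optimal design $\xi^*_{\bar\theta}$ at $\bar\theta$, $$\sqrt n\,\bigl(\hat\theta_n^{(\mathrm{LS})}-\bar\theta\bigr)\xrightarrow{d}\mathrm{N}\bigl(0,\sigma^2(\bar\theta)M_*^{-1}\bigr).$$
   Context: A design is a finitely supported probability measure on $\mathcal{X}$; $\delta_x$ is the point mass at $x$. The information matrix of a design $\xi$ at $\theta$ is $M(\xi,\theta)=\sum_{x\in\mathrm{supp}(\xi)}\xi(x)f_\theta(x)f_\theta^{\mathsf T}(x)$. A locally D-optimal design at $\bar\theta$ is a design maximizing $\det M(\xi,\bar\theta)$ over all designs. $M^{1/2}$ denotes the symmetric positive definite square root; $\mathbf{1}(A)$ is the indicator of an event $A$; $\mathrm{N}(0,C)$ is the centered normal distribution with covariance $C$, and $\xrightarrow{d}$ denotes convergence in distribution. *)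

theory Defs
  imports "HOL-Probability.Probability"
begin

definition twice_cont_diff_on ::
  "('a::euclidean_space) set \<Rightarrow> ('a \<Rightarrow> real) \<Rightarrow> bool" where
  "twice_cont_diff_on S g \<longleftrightarrow>
     (\<exists>(D :: 'a \<Rightarrow> ('a \<Rightarrow>\<^sub>L real)) (D2 :: 'a \<Rightarrow> ('a \<Rightarrow>\<^sub>L ('a \<Rightarrow>\<^sub>L real))).
        (\<forall>t\<in>S. (g has_derivative blinfun_apply (D t)) (at t) \<and>
                (D has_derivative blinfun_apply (D2 t)) (at t)) \<and>
        continuous_on S D2)"

definition supp_design :: "('x \<Rightarrow> real) \<Rightarrow> 'x set" where
  "supp_design \<xi> = {x. \<xi> x \<noteq> 0}"

text \<open>A design on XX: finitely supported probability measure on XX, represented by its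
  probability mass function.\<close>
definition is_design :: "'x set \<Rightarrow> ('x \<Rightarrow> real) \<Rightarrow> bool" where
  "is_design XX \<xi> \<longleftrightarrow> finite (supp_design \<xi>) \<and> supp_design \<xi> \<subseteq> XX \<and>
     (\<forall>x. 0 \<le> \<xi> x) \<and> (\<Sum>x\<in>supp_design \<xi>. \<xi> x) = 1"

definition outer_prod :: "real^'p \<Rightarrow> real^'p \<Rightarrow> real^'p^'p" where
  "outer_prod v w = (\<chi> i j. v $ i * w $ j)"

definition info_matrix ::
  "(real^'p \<Rightarrow> 'x \<Rightarrow> real^'p) \<Rightarrow> ('x \<Rightarrow> real) \<Rightarrow> real^'p \<Rightarrow> real^'p^'p" where
  "info_matrix f \<xi> \<theta> = (\<Sum>x\<in>supp_design \<xi>. \<xi> x *\<^sub>R outer_prod (f \<theta> x) (f \<theta> x))"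

definition emp_design :: "(nat \<Rightarrow> 'x) \<Rightarrow> nat \<Rightarrow> 'x \<Rightarrow> real" where
  "emp_design xs n x = real (card {i\<in>{1..n}. xs i = x}) / real n"

definition locally_D_optimal ::
  "'x set \<Rightarrow> (real^'p \<Rightarrow> 'x \<Rightarrow> real^'p) \<Rightarrow> real^'p \<Rightarrow> ('x \<Rightarrow> real) \<Rightarrow> bool" where
  "locally_D_optimal XX f \<theta> \<xi> \<longleftrightarrow> is_design XX \<xi> \<and>
     (\<forall>\<eta>. is_design XX \<eta> \<longrightarrow> det (info_matrix f \<eta> \<theta>) \<le> det (info_matrix f \<xi> \<theta>))"

definition pos_def :: "real^'p^'p \<Rightarrow> bool" where
  "pos_def A \<longleftrightarrow> (\<forall>v. v \<noteq> 0 \<longrightarrow> 0 < v \<bullet> (A *v v))"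

definition matrix_sqrt :: "real^'p^'p \<Rightarrow> real^'p^'p" where
  "matrix_sqrt A = (THE B. transpose B = B \<and> pos_def B \<and> B ** B = A)"

definition normal_density :: "real^'p^'p \<Rightarrow> real^'p \<Rightarrow> real" where
  "normal_density C x =
     (2 * pi) powr (- real CARD('p) / 2) / sqrt (det C) * exp (- (x \<bullet> (matrix_inv C *v x)) / 2)"

definition mv_normal :: "real^'p^'p \<Rightarrow> (real^'p) measure" where
  "mv_normal C = density lborel (\<lambda>x. ennreal (normal_density C x))"

definition conv_distr ::
  "'w measure \<Rightarrow> (nat \<Rightarrow> 'w \<Rightarrow> real^'p) \<Rightarrow> (real^'p) measure \<Rightarrow> bool" where
  "conv_distr M Z \<nu> \<longleftrightarrow>
     (\<forall>g :: real^'p \<Rightarrow> real. continuous_on UNIV g \<and> bounded (range g) \<longrightarrow>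
        (\<lambda>n. integral\<^sup>L M (\<lambda>\<omega>. g (Z n \<omega>))) \<longlonglongrightarrow> integral\<^sup>L \<nu> g)"

end

theory Submission
  imports Defs
begin

text \<open>Along a path with \<open>\<theta>hat n \<longlonglongrightarrow> \<theta>bar\<close> the Wynn iteration is an asymptotically exact steepest ascent
  for \<open>ln det\<close> on the compact convex set \<open>info_hull\<close> of information matrices, so the information
  matrices of the empirical designs converge to the unique maximizer \<open>m\<close> of the determinant.
  Saturated identifiability then bounds the least squares contrast from below away from \<open>\<theta>bar\<close>, and
  a uniform law of large numbers gives consistency in probability.

  For the limit law, put \<open>\<theta> = \<theta>bar + u / \<surd>n\<close>. In terms of \<open>u\<close>, the
  least squares objective equals \<open>u \<bullet> m u - 2 (u \<bullet> S)\<close> up to a constant and an error of order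
  \<open>o(1 + |u|\<^sup>2)\<close>, where \<open>S\<close> is the normalized score: the linearization remainder of \<open>\<mu>\<close> has a small
  Lipschitz constant near \<open>\<theta>bar\<close>, and chaining over dyadic grids with exponential moments of truncated
  errors bounds its correlation with the errors uniformly in \<open>u\<close>. Comparing the minimizer with
  \<open>m\<^sup>-\<^sup>1 S\<close> shows that the two are close, and \<open>S\<close> obeys a martingale central limit theorem, proved with
  characteristic functions and transferred to bounded continuous test functions by tightness and
  Stone--Weierstrass.\<close>

section \<open>Symmetric positive definite matrices\<close>

text \<open>Three obstacles shape the argument. The estimator depends on all the data, so its
  linearization remainder multiplied by the errors is no martingale transform and must be bounded
  uniformly in the parameter. With \<open>\<theta>bar + h\<close> as parameter this remainder is
  controlled only by a small Lipschitz constant in h, uniformly in x, and a termwise bound of the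
  sum loses a factor \<open>sqrt n\<close>; chaining recovers it. Finally, the errors have only
  second moments, hence truncation at \<open>sqrt n\<close>, paid for by the Lindeberg condition,
  and their conditional variances are controlled only path by path, hence a predictable gate that
  sets an error to 0 when its conditional variance is large. Suprema over parameters are never
  formed: each uniform estimate delivers one integrable random bound, which avoids measurability
  questions and feeds Markov's inequality. On the design side, the smallest eigenvalue must be kept
  away from 0 before the ascent for \<open>ln det\<close> can be analysed; this is a pigeonhole
  argument on repeated visits.\<close>

definition diag_mat :: "('p::finite \<Rightarrow> real) \<Rightarrow> real^'p^'p" where
  "diag_mat d = (\<chi> i j. if i = j then d i else 0)"

section \<open>Spectral theorem for symmetric matrices\<close>

lemma sym_matrix_inner:
  fixes A :: "real^'p^'p"
  assumes "transpose A = A"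
  shows "x \<bullet> (A *v y) = (A *v x) \<bullet> y"
  by (metis assms dot_lmul_matrix transpose_matrix_vector)

lemma inner_transpose_mult: "x \<bullet> (transpose R *v y) = ((R :: real^'p^'q) *v x) \<bullet> y"
  by (metis dot_lmul_matrix inner_commute transpose_matrix_vector)

text \<open>First-order condition for the Rayleigh quotient. The residual
  \<open>w = A *v v - c *\<^sub>R v\<close> lies in \<open>S\<close> by invariance and is orthogonal
  to \<open>v\<close>; moving from \<open>v\<close> in the direction \<open>w\<close> would increase
  the quotient to first order unless \<open>w\<close> vanishes.\<close>

lemma sym_matrix_maximizer_eigenvector:
  fixes A :: "real^'p^'p"
  assumes sym: "transpose A = A" and S: "subspace S" and inv: "\<And>x. x \<in> S \<Longrightarrow> A *v x \<in> S"
    and v: "v \<in> S" "norm v = 1"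
    and mx: "\<And>x. x \<in> S \<Longrightarrow> norm x = 1 \<Longrightarrow> x \<bullet> (A *v x) \<le> v \<bullet> (A *v v)"
  shows "A *v v = (v \<bullet> (A *v v)) *\<^sub>R v"
proof -
  define c where "c = v \<bullet> (A *v v)"
  have vv: "v \<bullet> v = 1" using v(2) by (simp add: norm_eq_1)
  have hom: "x \<bullet> (A *v x) \<le> c * (x \<bullet> x)" if "x \<in> S" for x
  proof (cases "x = 0")
    case False
    have "(x /\<^sub>R norm x) \<bullet> (A *v (x /\<^sub>R norm x)) \<le> c"
      unfolding c_def using False that S by (intro mx) (auto simp: subspace_scale)
    moreover have "(x /\<^sub>R norm x) \<bullet> (A *v (x /\<^sub>R norm x)) = (x \<bullet> (A *v x)) / (x \<bullet> x)"
      by (simp add: matrix_vector_mult_scaleR divide_inverse dot_square_norm power2_eq_square)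
    ultimately show ?thesis using False
      by (simp add: pos_divide_le_eq)
  qed auto
  define w where "w = A *v v - c *\<^sub>R v"
  have wS: "w \<in> S" unfolding w_def using S v inv by (intro subspace_diff subspace_scale) auto
  have wv: "w \<bullet> v = 0" unfolding w_def by (simp add: inner_diff_left vv c_def) (simp add: inner_commute)
  define k where "k = c * (w \<bullet> w) - w \<bullet> (A *v w)"
  have q: "2 * t * (w \<bullet> (A *v v)) \<le> t\<^sup>2 * k" for t
  proof -
    have "(v + t *\<^sub>R w) \<bullet> (A *v (v + t *\<^sub>R w)) \<le> c * ((v + t *\<^sub>R w) \<bullet> (v + t *\<^sub>R w))"
      by (rule hom) (use S v wS in \<open>auto intro: subspace_add subspace_scale\<close>)
    moreover have "v \<bullet> (A *v w) = w \<bullet> (A *v v)"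
      using sym_matrix_inner[OF sym, of v w] by (simp add: inner_commute)
    moreover have "v \<bullet> w = 0" using wv by (simp add: inner_commute)
    ultimately show ?thesis
      using wv vv by (simp add: k_def matrix_vector_right_distrib matrix_vector_mult_scaleR inner_add_left
          inner_add_right c_def power2_eq_square algebra_simps)
  qed
  have "w \<bullet> (A *v v) = 0"
  proof (rule ccontr)
    assume n: "w \<bullet> (A *v v) \<noteq> 0"
    define a where "a = w \<bullet> (A *v v)"
    \<comment> \<open>A small step with the sign of \<open>a\<close>: the linear gain
      \<open>2 * t * a\<close> then exceeds \<open>t\<^sup>2 * k\<close>, whatever the sign of
      \<open>k\<close>.\<close>
    define t where "t = a / (\<bar>k\<bar> + 1)"
    have "2 * t * a \<le> t\<^sup>2 * k" unfolding a_def by (rule q)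
    also have "\<dots> \<le> t\<^sup>2 * (\<bar>k\<bar> + 1)" by (intro mult_left_mono) auto
    also have "\<dots> = t * a" proof -
      have "t * (\<bar>k\<bar> + 1) = a" unfolding t_def by simp
      then show ?thesis by (simp add: power2_eq_square)
    qed
    finally have "t * a \<le> 0" by (simp add: mult_ac)
    moreover have "t * a > 0" using n unfolding t_def a_def
      by (auto simp: linorder_neq_iff mult_neg_neg divide_pos_pos)
    ultimately show False by simp
  qed
  then have "w \<bullet> (A *v v - c *\<^sub>R v) = 0" using wv by (simp add: inner_diff_right)
  then have "w \<bullet> w = 0" by (simp only: w_def[symmetric])
  then show ?thesis by (simp add: w_def c_def)
qed

text \<open>Induction on the dimension: a maximizer of the quadratic form on the compact unit sphere
  of \<open>S\<close> is an eigenvector \<open>v\<close>, and symmetry of \<open>A\<close> makes the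
  orthogonal complement of \<open>v\<close> in \<open>S\<close> invariant again. Invariant subspaces
  appear in the statement because the induction leaves the whole space.\<close>

lemma sym_matrix_eigenbasis_subspace:
  fixes A :: "real^'p^'p"
  assumes sym: "transpose A = A"
  shows "subspace S \<Longrightarrow> (\<And>x. x \<in> S \<Longrightarrow> A *v x \<in> S) \<Longrightarrow>
    \<exists>B. B \<subseteq> S \<and> pairwise orthogonal B \<and> (\<forall>b\<in>B. norm b = 1) \<and> span B = S \<and>
      (\<forall>b\<in>B. \<exists>c. A *v b = c *\<^sub>R b)"
proof (induction "dim S" arbitrary: S rule: less_induct)
  case less
  show ?case
  proof (cases "S \<subseteq> {0}")
    case True
    then have "S = {0}" using less.prems(1) subspace_0 by auto
    then show ?thesis by (intro exI[of _ "{}"]) auto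
  next
    case False
    let ?K = "S \<inter> sphere 0 1"
    have cK: "compact ?K" using closed_subspace[OF less.prems(1)] by (intro closed_Int_compact) auto
    obtain y where y: "y \<in> S" "y \<noteq> 0" using False by auto
    then have "y /\<^sub>R norm y \<in> ?K" using less.prems(1) by (simp add: subspace_scale)
    then have neK: "?K \<noteq> {}" by auto
    have "continuous_on ?K (\<lambda>x. x \<bullet> (A *v x))"
      by (intro continuous_intros linear_continuous_on) (simp add: matrix_vector_mul_bounded_linear)
    from continuous_attains_sup[OF cK neK this]
    obtain v where v: "v \<in> S" "norm v = 1"
      and mx: "\<And>x. x \<in> S \<Longrightarrow> norm x = 1 \<Longrightarrow> x \<bullet> (A *v x) \<le> v \<bullet> (A *v v)" by auto
    note ev = sym_matrix_maximizer_eigenvector[OF sym less.prems v mx]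
    define c where "c = v \<bullet> (A *v v)"
    define S' where "S' = {x\<in>S. x \<bullet> v = 0}"
    have S': "subspace S'" unfolding S'_def using less.prems(1)
      by (auto simp: subspace_def inner_add_left)
    have inv': "A *v x \<in> S'" if "x \<in> S'" for x
    proof -
      have "(A *v x) \<bullet> v = x \<bullet> (A *v v)" using sym_matrix_inner[OF sym, of x v] by simp
      also have "\<dots> = x \<bullet> (c *\<^sub>R v)" unfolding c_def by (rule arg_cong[OF ev])
      also have "\<dots> = 0" using that by (simp add: S'_def)
      finally show ?thesis using that less.prems(2) by (auto simp: S'_def)
    qed
    have "v \<notin> S'" using v by (auto simp: S'_def norm_eq_1)
    then have "S' \<noteq> S" using v by auto
    moreover have "S' \<subseteq> S" by (auto simp: S'_def)
    ultimately have "dim S' < dim S"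
      using subspace_dim_equal[OF S' less.prems(1)] by (auto simp: not_le[symmetric])
    from less.hyps[OF this S' inv'] obtain B where B: "B \<subseteq> S'" "pairwise orthogonal B"
      "\<forall>b\<in>B. norm b = 1" "span B = S'" "\<forall>b\<in>B. \<exists>c. A *v b = c *\<^sub>R b" by blast
    have "span (insert v B) = S"
    proof
      show "span (insert v B) \<subseteq> S" using B v \<open>S' \<subseteq> S\<close> less.prems(1)
        by (intro span_minimal) auto
      show "S \<subseteq> span (insert v B)"
      proof
        fix x assume "x \<in> S"
        then have "x - (x \<bullet> v) *\<^sub>R v \<in> S'" unfolding S'_def using v less.prems(1)
          by (auto intro!: subspace_diff subspace_scale simp: inner_diff_left norm_eq_1)
        then show "x \<in> span (insert v B)" using B(4) span_breakdown_eq by blast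
      qed
    qed
    moreover have "pairwise orthogonal (insert v B)"
      using B(1,2) by (auto simp: pairwise_insert orthogonal_def S'_def inner_commute)
    moreover have "\<exists>c. A *v v = c *\<^sub>R v" using ev by blast
    ultimately show ?thesis using B v \<open>S' \<subseteq> S\<close>
      by (intro exI[of _ "insert v B"]) auto
  qed
qed

lemma diag_mat_simps:
  "diag_mat d *v x = (\<chi> i. d i * x $ i)"
  "diag_mat d ** diag_mat e = diag_mat (\<lambda>i. d i * e i)"
  "transpose (diag_mat d) = diag_mat d"
  "det (diag_mat d) = prod d UNIV"
  "trace (diag_mat d) = sum d UNIV"
  "diag_mat (\<lambda>i. 1) = mat 1"
proof -
  show "diag_mat d *v x = (\<chi> i. d i * x $ i)"
    by (simp add: diag_mat_def matrix_vector_mult_def vec_eq_iff if_distrib[where f="\<lambda>a. a * _"] cong: if_cong)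
  show "diag_mat d ** diag_mat e = diag_mat (\<lambda>i. d i * e i)"
    by (simp add: diag_mat_def matrix_matrix_mult_def vec_eq_iff if_distrib[where f="\<lambda>a. a * _"]
        if_distrib[where f="\<lambda>a. _ * a"] cong: if_cong)
  show "transpose (diag_mat d) = diag_mat d" by (auto simp: diag_mat_def transpose_def vec_eq_iff)
  show "det (diag_mat d) = prod d UNIV" by (subst det_diagonal) (auto simp: diag_mat_def)
  show "trace (diag_mat d) = sum d UNIV" by (simp add: trace_def diag_mat_def)
  show "diag_mat (\<lambda>i. 1) = mat 1" by (simp add: diag_mat_def mat_def)
qed

text \<open>An orthonormal eigenbasis has exactly \<open>CARD('p)\<close> elements, so it can be
  indexed by \<open>'p\<close> and used as the columns of \<open>P\<close>.\<close>

theorem sym_matrix_spectral: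
  fixes A :: "real^'p^'p"
  assumes sym: "transpose A = A"
  obtains P d where "orthogonal_matrix P" "A = P ** diag_mat d ** transpose P"
proof -
  obtain B where B: "pairwise orthogonal B" "\<forall>b\<in>B. norm b = 1" "span B = UNIV"
      "\<forall>b\<in>B. \<exists>c. A *v b = c *\<^sub>R b"
    using sym_matrix_eigenbasis_subspace[OF sym, of UNIV] by auto
  have ind: "independent B" using B(1,2) by (intro pairwise_orthogonal_independent) auto
  then have "card B = CARD('p)" using dim_span_eq_card_independent[OF ind] B(3) by simp
  moreover have "finite B" using ind by (rule independent_imp_finite)
  ultimately obtain b :: "'p \<Rightarrow> real^'p" where b: "bij_betw b UNIV B"
    by (metis finite_same_card_bij finite_class.finite_UNIV)
  have bB: "b i \<in> B" for i using b by (auto simp: bij_betw_def)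
  obtain c where c: "\<And>x. x \<in> B \<Longrightarrow> A *v x = c x *\<^sub>R x" using B(4) by metis
  define P where "P = (\<chi> i j. b j $ i)"
  have col: "column j P = b j" for j by (simp add: column_def P_def vec_eq_iff)
  have orth: "orthogonal_matrix P"
    unfolding orthogonal_matrix_orthonormal_columns col
    using B(1,2) bB b unfolding pairwise_def bij_betw_def inj_def by metis
  have "A ** P = P ** diag_mat (\<lambda>j. c (b j))"
  proof -
    have "(A ** P) $ i $ j = (P ** diag_mat (\<lambda>j. c (b j))) $ i $ j" for i j
    proof -
      have "(A ** P) $ i $ j = (A *v b j) $ i"
        by (simp add: matrix_matrix_mult_def matrix_vector_mult_def P_def)
      also have "\<dots> = c (b j) * b j $ i" using c[OF bB] by simp
      also have "\<dots> = (P ** diag_mat (\<lambda>j. c (b j))) $ i $ j"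
        by (simp add: matrix_matrix_mult_def P_def diag_mat_def if_distrib[where f="\<lambda>a. _ * a"] cong: if_cong)
      finally show ?thesis .
    qed
    then show ?thesis by (simp add: vec_eq_iff)
  qed
  then have "A ** P ** transpose P = P ** diag_mat (\<lambda>j. c (b j)) ** transpose P" by simp
  then have "A = P ** diag_mat (\<lambda>j. c (b j)) ** transpose P"
    using orth by (simp add: matrix_mul_assoc[symmetric] orthogonal_matrix_def)
  with orth show ?thesis using that by blast
qed

section \<open>Positive definite matrices, inverses and square roots\<close>

lemma pos_def_conj:
  fixes A R :: "real^'p^'p"
  assumes "pos_def A" "invertible R"
  shows "pos_def (transpose R ** A ** R)"
  unfolding pos_def_def
proof (intro allI impI)
  fix v :: "real^'p" assume "v \<noteq> 0"
  then have "R *v v \<noteq> 0"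
    using assms(2) by (metis invertible_def matrix_vector_mul_assoc matrix_vector_mul_lid matrix_vector_mult_0_right)
  then have "0 < (R *v v) \<bullet> (A *v (R *v v))" using assms(1) by (auto simp: pos_def_def)
  also have "\<dots> = v \<bullet> (transpose R ** A ** R *v v)"
    by (simp only: matrix_vector_mul_assoc[symmetric] inner_transpose_mult)
  finally show "0 < v \<bullet> (transpose R ** A ** R *v v)" .
qed

lemma orthogonal_matrix_invertible: "orthogonal_matrix (P :: real^'p^'p) \<Longrightarrow> invertible P"
  by (auto simp: orthogonal_matrix_def invertible_def)

lemma pos_def_diag_mat: "pos_def (diag_mat d :: real^'p^'p) \<longleftrightarrow> (\<forall>i. 0 < d i)"
proof
  assume *: "pos_def (diag_mat d :: real^'p^'p)"
  show "\<forall>i. 0 < d i"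
  proof
    fix i
    have "(axis i 1 :: real^'p) \<noteq> 0" by (simp add: axis_eq_0_iff)
    then have "0 < (axis i 1 :: real^'p) \<bullet> (diag_mat d *v axis i 1)" using * unfolding pos_def_def by blast
    then show "0 < d i" by (simp add: diag_mat_simps inner_axis' )
  qed
next
  assume *: "\<forall>i. 0 < d i"
  show "pos_def (diag_mat d :: real^'p^'p)" unfolding pos_def_def
  proof (intro allI impI)
    fix v :: "real^'p" assume "v \<noteq> 0"
    then obtain i where i: "v $ i \<noteq> 0" by (auto simp: vec_eq_iff)
    have "v \<bullet> (diag_mat d *v v) = (\<Sum>i\<in>UNIV. d i * (v $ i)\<^sup>2)"
      by (simp add: inner_vec_def diag_mat_simps power2_eq_square mult_ac)
    moreover have "\<dots> > 0"
      by (rule sum_pos2[of _ i]) (use * i in \<open>auto simp: less_imp_le\<close>)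
    ultimately show "0 < v \<bullet> (diag_mat d *v v)" by simp
  qed
qed

lemma spd_spectral:
  fixes A :: "real^'p^'p"
  assumes "transpose A = A" "pos_def A"
  obtains P d where "orthogonal_matrix P" "A = P ** diag_mat d ** transpose P" "\<forall>i. 0 < d i"
proof -
  obtain P d where P: "orthogonal_matrix P" "A = P ** diag_mat d ** transpose P"
    by (rule sym_matrix_spectral[OF assms(1)])
  have "transpose P ** A ** P = diag_mat d"
  proof -
    have "transpose P ** A ** P = (transpose P ** P) ** diag_mat d ** (transpose P ** P)"
      by (simp only: P(2) matrix_mul_assoc)
    then show ?thesis using P(1) by (simp add: orthogonal_matrix_def)
  qed
  then have "pos_def (diag_mat d)"
    using pos_def_conj[OF assms(2) orthogonal_matrix_invertible[OF P(1)]] by simp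
  then show ?thesis using that P by (auto simp: pos_def_diag_mat)
qed

lemma pos_def_invertible:
  fixes A :: "real^'p^'p"
  assumes "pos_def A"
  shows "invertible A"
proof -
  have "x = 0" if "A *v x = 0" for x
    using assms that by (auto simp: pos_def_def)
  then have "inj ((*v) A)" by (simp add: inj_on_def) (metis eq_iff_diff_eq_0 matrix_vector_mult_diff_distrib)
  then show ?thesis by (simp add: invertible_left_inverse matrix_left_invertible_injective)
qed

lemma matrix_inv_mult:
  assumes "invertible (A :: real^'p^'p)"
  shows "A ** matrix_inv A = mat 1" "matrix_inv A ** A = mat 1"
    "A *v (matrix_inv A *v x) = x" "matrix_inv A *v (A *v x) = x"
proof -
  obtain A' where "A ** A' = mat 1 \<and> A' ** A = mat 1" using assms by (auto simp: invertible_def)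
  then have "A ** matrix_inv A = mat 1 \<and> matrix_inv A ** A = mat 1"
    unfolding matrix_inv_def by (rule someI)
  then show "A ** matrix_inv A = mat 1" "matrix_inv A ** A = mat 1"
    "A *v (matrix_inv A *v x) = x" "matrix_inv A *v (A *v x) = x"
    by (auto simp: matrix_vector_mul_assoc)
qed

lemma matrix_inv_unique:
  assumes "A ** B = mat 1"
  shows "matrix_inv (A :: real^'p^'p) = B"
proof -
  have "B ** A = mat 1" using assms matrix_left_right_inverse by blast
  then have "invertible A" using assms by (auto simp: invertible_def)
  then have "matrix_inv A ** (A ** B) = B"
    by (simp add: matrix_mul_assoc matrix_inv_mult)
  then show ?thesis using assms by simp
qed

lemma sym_matrix_inv:
  assumes "transpose A = A" "invertible (A :: real^'p^'p)"
  shows "transpose (matrix_inv A) = matrix_inv A"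
proof -
  have "A ** transpose (matrix_inv A) = transpose (matrix_inv A ** A)"
    by (simp add: matrix_transpose_mul assms(1))
  then have "A ** transpose (matrix_inv A) = mat 1" by (simp add: matrix_inv_mult assms(2) transpose_mat)
  then show ?thesis using matrix_inv_unique by metis
qed

lemma pos_def_matrix_inv:
  assumes "transpose A = A" "pos_def (A :: real^'p^'p)"
  shows "pos_def (matrix_inv A)"
proof -
  have i: "invertible A" using assms(2) by (rule pos_def_invertible)
  have i': "invertible (matrix_inv A)" using i matrix_inv_mult(1,2)[OF i] by (auto simp: invertible_def)
  show ?thesis using pos_def_conj[OF assms(2) i'] sym_matrix_inv[OF assms(1) i]
    by (simp add: matrix_inv_mult[OF i] )
qed

lemma matrix_sub_ldistrib: "(A :: real^'p^'q) ** (B - C) = A ** B - A ** C"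
  by (simp add: matrix_matrix_mult_def vec_eq_iff algebra_simps sum_subtractf)

lemma matrix_sub_rdistrib: "((A :: real^'p^'q) - B) ** C = A ** C - B ** C"
  by (simp add: matrix_matrix_mult_def vec_eq_iff algebra_simps sum_subtractf)

lemma sum_inner_axis_trace:
  "trace (A :: real^'p^'p) = (\<Sum>i\<in>UNIV. axis i 1 \<bullet> (A *v axis i 1))"
  by (simp add: trace_def inner_axis' matrix_vector_mult_basis column_def)

text \<open>The difference of two symmetric positive definite roots of the same matrix satisfies
  \<open>B D + D C = 0\<close>, and taking the trace after multiplying by \<open>D\<close> gives \<open>tr (D B D) + tr (D C D) = 0\<close>.\<close>
lemma spd_root_unique:
  fixes B C :: "real^'p^'p"
  assumes B: "transpose B = B" "pos_def B" and C: "transpose C = C" "pos_def C" and eq: "B ** B = C ** C"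
  shows "B = C"
proof -
  define D where "D = B - C"
  have symD: "transpose D = D" unfolding D_def using B C by (simp add: transpose_def vec_eq_iff)
  have "B ** D + D ** C = 0" unfolding D_def
    by (simp add: matrix_sub_ldistrib matrix_sub_rdistrib eq)
  then have "0 = trace (D ** (B ** D + D ** C))" by (simp add: trace_def)
  also have "\<dots> = trace (D ** B ** D) + trace (D ** (D ** C))"
    by (simp add: matrix_add_ldistrib trace_add matrix_mul_assoc)
  also have "trace (D ** (D ** C)) = trace (D ** C ** D)"
    by (subst trace_mul_sym) simp
  finally have tr: "trace (D ** B ** D) + trace (D ** C ** D) = 0" by simp
  have eqt: "trace (D ** Q ** D) = (\<Sum>i\<in>UNIV. (D *v axis i 1) \<bullet> (Q *v (D *v axis i 1)))" for Q :: "real^'p^'p"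
    unfolding sum_inner_axis_trace
    by (simp add: sym_matrix_inner[OF symD] matrix_vector_mul_assoc[symmetric])
  have nn: "0 \<le> v \<bullet> (Q *v v)" if "pos_def Q" for Q :: "real^'p^'p" and v
    using that by (cases "v = 0") (auto simp: pos_def_def less_imp_le)
  have "(\<Sum>i\<in>UNIV. (D *v axis i 1) \<bullet> (B *v (D *v axis i 1))) = 0"
  proof -
    have "0 \<le> (\<Sum>i\<in>UNIV. (D *v axis i 1) \<bullet> (B *v (D *v axis i 1)))" by (intro sum_nonneg nn B)
    moreover have "0 \<le> (\<Sum>i\<in>UNIV. (D *v axis i 1) \<bullet> (C *v (D *v axis i 1)))" by (intro sum_nonneg nn C)
    ultimately show ?thesis using tr unfolding eqt by linarith
  qed
  then have "\<forall>i. (D *v axis i 1) \<bullet> (B *v (D *v axis i 1)) = 0"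
    using nn[OF B(2)] by (subst (asm) sum_nonneg_eq_0_iff) auto
  then have "\<forall>i. D *v axis i 1 = 0" using B(2) unfolding pos_def_def by (metis less_irrefl)
  then have "D = 0" by (auto simp: matrix_vector_mult_basis column_def vec_eq_iff)
  then show ?thesis by (simp add: D_def)
qed

lemma spd_root_exists:
  fixes A :: "real^'p^'p"
  assumes "transpose A = A" "pos_def A"
  obtains B where "transpose B = B" "pos_def B" "B ** B = A"
proof -
  obtain P d where P: "orthogonal_matrix P" "A = P ** diag_mat d ** transpose P" "\<forall>i. 0 < d i"
    by (rule spd_spectral[OF assms])
  define B where "B = P ** diag_mat (\<lambda>i. sqrt (d i)) ** transpose P"
  have "pos_def (transpose (transpose P) ** diag_mat (\<lambda>i. sqrt (d i)) ** transpose P)"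
    by (intro pos_def_conj orthogonal_matrix_invertible) (use P in \<open>auto simp: pos_def_diag_mat\<close>)
  then have "pos_def B" by (simp add: B_def)
  moreover have "transpose B = B" by (simp add: B_def matrix_transpose_mul diag_mat_simps matrix_mul_assoc)
  moreover have "B ** B = A"
  proof -
    have "B ** B = P ** diag_mat (\<lambda>i. sqrt (d i)) ** (transpose P ** P) ** diag_mat (\<lambda>i. sqrt (d i)) ** transpose P"
      by (simp only: B_def matrix_mul_assoc)
    also have "\<dots> = P ** (diag_mat (\<lambda>i. sqrt (d i)) ** diag_mat (\<lambda>i. sqrt (d i))) ** transpose P"
      using P(1) by (simp add: orthogonal_matrix_def matrix_mul_assoc)
    also have "\<dots> = A" using P by (simp add: diag_mat_simps less_imp_le)
    finally show ?thesis .
  qed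
  ultimately show ?thesis using that by blast
qed

lemma matrix_sqrt_eqI:
  assumes "transpose B = B" "pos_def B" "B ** B = (A :: real^'p^'p)"
  shows "matrix_sqrt A = B"
  unfolding matrix_sqrt_def
proof (rule the_equality)
  show "transpose B = B \<and> pos_def B \<and> B ** B = A" using assms by blast
  fix C assume "transpose C = C \<and> pos_def C \<and> C ** C = A"
  then have C: "transpose C = C" "pos_def C" "C ** C = B ** B" using assms(3) by auto
  show "C = B" by (rule spd_root_unique[OF C(1,2) assms(1,2) C(3)])
qed

lemma matrix_sqrt_props:
  fixes A :: "real^'p^'p"
  assumes "transpose A = A" "pos_def A"
  shows "transpose (matrix_sqrt A) = matrix_sqrt A" "pos_def (matrix_sqrt A)"
    "matrix_sqrt A ** matrix_sqrt A = A"
proof -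
  obtain B where B: "transpose B = B" "pos_def B" "B ** B = A" by (rule spd_root_exists[OF assms])
  have "matrix_sqrt A = B" by (rule matrix_sqrt_eqI[OF B])
  then show "transpose (matrix_sqrt A) = matrix_sqrt A" "pos_def (matrix_sqrt A)"
    "matrix_sqrt A ** matrix_sqrt A = A" using B by simp_all
qed

section \<open>Determinants and the tangent inequality for \<open>ln det\<close>\<close>

lemma spd_det_pos:
  fixes A :: "real^'p^'p"
  assumes "transpose A = A" "pos_def A"
  shows "0 < det A"
proof -
  have "matrix_sqrt A ** matrix_sqrt A = A" "invertible (matrix_sqrt A)"
    using matrix_sqrt_props[OF assms] pos_def_invertible by auto
  moreover have "det (matrix_sqrt A) \<noteq> 0" using calculation(2) invertible_det_nz by blast
  moreover have "det A = det (matrix_sqrt A) * det (matrix_sqrt A)"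
    using calculation(1) by (metis det_mul)
  ultimately show ?thesis by (simp add: zero_less_mult_iff linorder_neq_iff) argo
qed

text \<open>The scalar inequality ln x <= x - 1, summed over the eigenvalues. Equality in it holds
  only at 1, which forces the identity matrix.\<close>

lemma ln_det_le_trace:
  fixes G :: "real^'p^'p"
  assumes "transpose G = G" "pos_def G"
  shows "ln (det G) \<le> trace G - CARD('p)"
    and "ln (det G) = trace G - CARD('p) \<Longrightarrow> G = mat 1"
proof -
  obtain P d where P: "orthogonal_matrix P" "G = P ** diag_mat d ** transpose P" "\<forall>i. 0 < d i"
    by (rule spd_spectral[OF assms])
  have "trace G = trace (transpose P ** (P ** diag_mat d))" unfolding P(2) by (rule trace_mul_sym)
  then have tr: "trace G = sum d UNIV"
    using P(1) by (simp add: matrix_mul_assoc orthogonal_matrix_def diag_mat_simps)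
  have "det P * det P = 1" using det_orthogonal_matrix[OF P(1)] by auto
  then have "det G = prod d UNIV" unfolding P(2) by (simp add: det_mul diag_mat_simps mult_ac)
  then have ld: "ln (det G) = (\<Sum>i\<in>UNIV. ln (d i))" by (simp add: ln_prod P(3)[rule_format] less_imp_neq[symmetric])
  have gap: "trace G - CARD('p) - ln (det G) = (\<Sum>i\<in>UNIV. d i - 1 - ln (d i))"
    by (simp add: tr ld sum_subtractf)
  have nn: "0 \<le> d i - 1 - ln (d i)" for i using ln_le_minus_one[OF P(3)[rule_format, of i]] by simp
  have "0 \<le> (\<Sum>i\<in>UNIV. d i - 1 - ln (d i))" by (intro sum_nonneg nn)
  then show "ln (det G) \<le> trace G - CARD('p)" using gap by simp
  assume "ln (det G) = trace G - CARD('p)"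
  then have "(\<Sum>i\<in>UNIV. d i - 1 - ln (d i)) = 0" using gap by simp
  then have "\<forall>i. d i - 1 - ln (d i) = 0" using nn by (subst (asm) sum_nonneg_eq_0_iff) auto
  then have "d i = 1" for i using ln_eq_minus_one[OF P(3)[rule_format, of i]] by (simp add: algebra_simps)
  then have "d = (\<lambda>i. 1)" by auto
  then show "G = mat 1" using P by (simp add: diag_mat_simps orthogonal_matrix_def)
qed

text \<open>Concavity of \<open>ln det\<close> as a tangent inequality at \<open>B\<close>, where
  the gradient is \<open>matrix_inv B\<close>. Passing to G = B^(-1/2) A B^(-1/2) reduces it to the
  tangent at the identity. The equality case is strict concavity, the source of uniqueness of the
  optimal matrix.\<close>

lemma ln_det_diff_le_trace:
  fixes A B :: "real^'p^'p"
  assumes A: "transpose A = A" "pos_def A" and B: "transpose B = B" "pos_def B"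
  shows "ln (det A) - ln (det B) \<le> trace (matrix_inv B ** A) - CARD('p)"
    and "ln (det A) - ln (det B) = trace (matrix_inv B ** A) - CARD('p) \<Longrightarrow> A = B"
proof -
  define R where "R = matrix_sqrt B"
  have R: "transpose R = R" "pos_def R" "R ** R = B" unfolding R_def using matrix_sqrt_props[OF B] by auto
  have iR: "invertible R" using R(2) by (rule pos_def_invertible)
  define S where "S = matrix_inv R"
  have S: "R ** S = mat 1" "S ** R = mat 1" unfolding S_def using matrix_inv_mult[OF iR] by auto
  have symS: "transpose S = S" unfolding S_def by (rule sym_matrix_inv[OF R(1) iR])
  have iS: "invertible S" using S by (auto simp: invertible_def)
  define G where "G = S ** A ** S"
  have symG: "transpose G = G" by (simp add: G_def matrix_transpose_mul symS A matrix_mul_assoc)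
  have pdG: "pos_def G" using pos_def_conj[OF A(2) iS] by (simp add: G_def symS)
  have "B ** (S ** S) = R ** (R ** S) ** S" by (simp add: R(3)[symmetric] matrix_mul_assoc)
  then have "matrix_inv B = S ** S" using S by (intro matrix_inv_unique) simp
  then have "trace (matrix_inv B ** A) = trace (S ** (S ** A))" by (simp add: matrix_mul_assoc)
  also have "\<dots> = trace G" unfolding G_def by (subst trace_mul_sym) simp
  finally have tr: "trace (matrix_inv B ** A) = trace G" .
  have RGR: "R ** G ** R = A"
  proof -
    have "R ** G ** R = (R ** S) ** A ** (S ** R)" by (simp only: G_def matrix_mul_assoc)
    then show ?thesis using S by simp
  qed
  have "det A = det B * det G" by (simp add: RGR[symmetric] R(3)[symmetric] det_mul)
  then have ld: "ln (det A) - ln (det B) = ln (det G)"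
    using spd_det_pos[OF B] spd_det_pos[OF symG pdG] by (simp add: ln_mult)
  show "ln (det A) - ln (det B) \<le> trace (matrix_inv B ** A) - CARD('p)"
    unfolding ld tr by (rule ln_det_le_trace[OF symG pdG])
  assume "ln (det A) - ln (det B) = trace (matrix_inv B ** A) - CARD('p)"
  then have "G = mat 1" unfolding ld tr by (rule ln_det_le_trace[OF symG pdG])
  then show "A = B" using RGR R(3) by simp
qed

section \<open>Norm bounds, perturbation of inverses, continuity of the square root\<close>

lemma norm_matrix_vector_le:
  fixes A :: "real^'p^'q"
  shows "norm (A *v x) \<le> norm A * norm x"
proof -
  have "norm (A *v x) = L2_set (\<lambda>i. \<bar>A $ i \<bullet> x\<bar>) UNIV"
    by (simp add: norm_vec_def matrix_vector_mul_component)
  also have "\<dots> \<le> L2_set (\<lambda>i. norm (A $ i) * norm x) UNIV"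
    by (intro L2_set_mono) (auto simp: Cauchy_Schwarz_ineq2)
  also have "\<dots> = norm A * norm x"
    by (simp add: L2_set_left_distrib norm_vec_def)
  finally show ?thesis .
qed

lemma norm_matrix_inv_vector_le:
  fixes A :: "real^'p^'p"
  assumes lb: "\<And>v. l * (v \<bullet> v) \<le> v \<bullet> (A *v v)" and l: "0 < l"
  shows "norm (matrix_inv A *v x) \<le> norm x / l"
proof -
  have pd: "pos_def A" unfolding pos_def_def
    using lb l by (metis inner_gt_zero_iff less_le_trans mult_pos_pos)
  define y where "y = matrix_inv A *v x"
  have xy: "x = A *v y" unfolding y_def using matrix_inv_mult[OF pos_def_invertible[OF pd]] by simp
  have "l * (norm y)\<^sup>2 \<le> y \<bullet> x" using lb[of y] by (simp add: xy power2_norm_eq_inner)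
  also have "\<dots> \<le> norm y * norm x" by (rule norm_cauchy_schwarz)
  finally have "norm y * (l * norm y) \<le> norm y * norm x" by (simp add: power2_eq_square mult_ac)
  then have "l * norm y \<le> norm x"
    by (cases "norm y = 0") (auto dest: mult_left_le_imp_le)
  then show ?thesis using l by (simp add: y_def field_simps)
qed

text \<open>Lipschitz dependence of the variance function on the regressor and on the information
  matrix. The vector part is the polarization (u - v) . A^-1 (u + v), the matrix part the resolvent
  identity A^-1 - B^-1 = A^-1 (B - A) B^-1. The matrices enter the constants only through the common
  eigenvalue bound \<open>l\<close>.\<close>

lemma matrix_inv_form_perturb:
  fixes A B :: "real^'p^'p"
  assumes A: "transpose A = A" "\<And>v. l * (v \<bullet> v) \<le> v \<bullet> (A *v v)"
    and B: "transpose B = B" "\<And>v. l * (v \<bullet> v) \<le> v \<bullet> (B *v v)" and l: "0 < l"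
    and u: "norm u \<le> K" and v: "norm v \<le> K"
  shows "\<bar>u \<bullet> (matrix_inv A *v u) - v \<bullet> (matrix_inv B *v v)\<bar>
    \<le> 2 * K / l * norm (u - v) + K\<^sup>2 / l\<^sup>2 * norm (A - B)"
proof -
  have pd: "pos_def A" "pos_def B" unfolding pos_def_def
    using A B l by (metis inner_gt_zero_iff less_le_trans mult_pos_pos)+
  note iA = pos_def_invertible[OF pd(1)] and iB = pos_def_invertible[OF pd(2)]
  define Ai where "Ai = matrix_inv A"
  define Bi where "Bi = matrix_inv B"
  have symAi: "transpose Ai = Ai" unfolding Ai_def by (rule sym_matrix_inv[OF A(1) iA])
  have nA: "norm (Ai *v x) \<le> norm x / l" for x
    unfolding Ai_def by (rule norm_matrix_inv_vector_le[OF A(2) l])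
  have nB: "norm (Bi *v x) \<le> norm x / l" for x
    unfolding Bi_def by (rule norm_matrix_inv_vector_le[OF B(2) l])
  have K: "0 \<le> K" using u norm_ge_zero order_trans by blast
  have "u \<bullet> (Ai *v u) - v \<bullet> (Ai *v v) = (u - v) \<bullet> (Ai *v (u + v))"
    using sym_matrix_inner[OF symAi, of u v]
    by (simp add: inner_diff_left matrix_vector_right_distrib inner_add_right inner_commute[of "Ai *v u" v])
  also have "\<bar>\<dots>\<bar> \<le> norm (u - v) * norm (Ai *v (u + v))" by (rule Cauchy_Schwarz_ineq2)
  also have "\<dots> \<le> norm (u - v) * (2 * K / l)"
  proof (intro mult_left_mono)
    have "norm (u + v) \<le> 2 * K" using norm_triangle_ineq[of u v] u v by simp
    then show "norm (Ai *v (u + v)) \<le> 2 * K / l"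
      using nA[of "u + v"] l by (smt (verit) divide_right_mono)
  qed simp
  finally have 1: "\<bar>u \<bullet> (Ai *v u) - v \<bullet> (Ai *v v)\<bar> \<le> 2 * K / l * norm (u - v)" by (simp add: mult_ac)
  have "Ai *v v - Bi *v v = Ai *v ((B - A) *v (Bi *v v))"
    unfolding Ai_def Bi_def using matrix_inv_mult[OF iA] matrix_inv_mult[OF iB]
    by (simp add: matrix_vector_mult_diff_rdistrib matrix_vector_mult_diff_distrib)
  then have "v \<bullet> (Ai *v v) - v \<bullet> (Bi *v v) = (Ai *v v) \<bullet> ((B - A) *v (Bi *v v))"
    by (metis inner_diff_right sym_matrix_inner[OF symAi])
  also have "\<bar>\<dots>\<bar> \<le> norm (Ai *v v) * norm ((B - A) *v (Bi *v v))" by (rule Cauchy_Schwarz_ineq2)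
  also have "\<dots> \<le> (K / l) * (norm (B - A) * (K / l))"
  proof (intro mult_mono)
    have "norm v / l \<le> K / l" using v l by (simp add: divide_right_mono)
    then show "norm (Ai *v v) \<le> K / l" using nA[of v] by simp
    have "norm (Bi *v v) \<le> K / l" using nB[of v] \<open>norm v / l \<le> K / l\<close> by simp
    then show "norm ((B - A) *v (Bi *v v)) \<le> norm (B - A) * (K / l)"
      by (meson mult_left_mono norm_ge_zero norm_matrix_vector_le order_trans)
  qed (use K l in auto)
  also have "\<dots> = K\<^sup>2 / l\<^sup>2 * norm (A - B)" by (simp add: power2_eq_square norm_minus_commute)
  finally show ?thesis using 1 unfolding Ai_def Bi_def by linarith
qed

lemma spd_lower_bound:
  fixes A :: "real^'p^'p"
  assumes "pos_def A"
  obtains l where "0 < l" "\<And>v. l * (v \<bullet> v) \<le> v \<bullet> (A *v v)"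
proof -
  have "continuous_on (sphere 0 1) (\<lambda>x::real^'p. x \<bullet> (A *v x))"
    by (intro continuous_intros linear_continuous_on) (simp add: matrix_vector_mul_bounded_linear)
  moreover have "sphere (0::real^'p) 1 \<noteq> {}" by (simp add: sphere_eq_empty)
  ultimately obtain w where w: "w \<in> sphere 0 1" "\<And>x. x \<in> sphere 0 1 \<Longrightarrow> w \<bullet> (A *v w) \<le> x \<bullet> (A *v x)"
    using continuous_attains_inf[OF compact_sphere, of 0 1 "\<lambda>x::real^'p. x \<bullet> (A *v x)"] by blast
  show ?thesis
  proof
    have "w \<noteq> 0" using w(1) by auto
    then show "0 < w \<bullet> (A *v w)" using assms by (simp add: pos_def_def)
    fix v show "(w \<bullet> (A *v w)) * (v \<bullet> v) \<le> v \<bullet> (A *v v)"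
    proof (cases "v = 0")
      case False
      have "w \<bullet> (A *v w) \<le> (v /\<^sub>R norm v) \<bullet> (A *v (v /\<^sub>R norm v))"
        by (rule w(2)) (use False in auto)
      also have "\<dots> = (v \<bullet> (A *v v)) / (v \<bullet> v)"
        by (simp add: matrix_vector_mult_scaleR divide_inverse dot_square_norm power2_eq_square)
      finally show ?thesis using False by (simp add: pos_le_divide_eq)
    qed auto
  qed
qed

text \<open>The eigenvalues are nonnegative and their product is nonzero. This recovers definiteness
  for limits of positive definite matrices and for elements of the information hull with positive
  determinant.\<close>

lemma psd_det_pos_def:
  fixes l :: "real^'p^'p"
  assumes sl: "transpose l = l" and nn: "\<And>v. 0 \<le> v \<bullet> (l *v v)" and det: "det l \<noteq> 0"
  shows "pos_def l"
proof -
  obtain P d where P: "orthogonal_matrix P" "l = P ** diag_mat d ** transpose P"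
    by (rule sym_matrix_spectral[OF sl])
  have Pd: "transpose P ** l ** P = diag_mat d"
  proof -
    have "transpose P ** l ** P = (transpose P ** P) ** diag_mat d ** (transpose P ** P)"
      by (simp only: P(2) matrix_mul_assoc)
    then show ?thesis using P(1) by (simp add: orthogonal_matrix_def)
  qed
  have d0: "0 \<le> d i" for i
  proof -
    have "0 \<le> (P *v axis i 1) \<bullet> (l *v (P *v axis i 1))" by (rule nn)
    also have "\<dots> = axis i 1 \<bullet> ((transpose P ** l ** P) *v axis i 1)"
      by (simp only: matrix_vector_mul_assoc[symmetric] inner_transpose_mult)
    also have "\<dots> = d i" by (simp add: Pd diag_mat_simps inner_axis')
    finally show ?thesis .
  qed
  have "prod d UNIV \<noteq> 0" using det unfolding P(2) by (auto simp: det_mul diag_mat_simps)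
  then have "pos_def (diag_mat d :: real^'p^'p)" unfolding pos_def_diag_mat using d0 by (auto simp: less_le)
  then have "pos_def (transpose (transpose P) ** diag_mat d ** transpose P)"
    by (intro pos_def_conj orthogonal_matrix_invertible) (use P in auto)
  then show ?thesis unfolding P(2) by simp
qed

lemma tendsto_matrix_mult:
  fixes A :: "'a \<Rightarrow> real^'p^'q" and B :: "'a \<Rightarrow> real^'r^'p"
  assumes "(A \<longlongrightarrow> a) F" "(B \<longlongrightarrow> b) F"
  shows "((\<lambda>x. A x ** B x) \<longlongrightarrow> a ** b) F"
  unfolding matrix_matrix_mult_def by (intro tendsto_intros assms)

text \<open>Compactness: the roots of a convergent sequence are bounded, since |B|^2 = tr (B^2), and
  every subsequential limit is a symmetric positive semidefinite root of \<open>A\<close> with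
  nonzero determinant, hence the root by uniqueness.\<close>

lemma continuous_on_matrix_sqrt:
  "continuous_on {A :: real^'p^'p. transpose A = A \<and> pos_def A} matrix_sqrt"
  unfolding continuous_on_sequentially
proof (intro ballI allI impI, elim conjE)
  fix X :: "nat \<Rightarrow> real^'p^'p" and A
  assume A': "A \<in> {A. transpose A = A \<and> pos_def A}"
    and X: "\<forall>n. X n \<in> {A. transpose A = A \<and> pos_def A}" and lim: "X \<longlonglongrightarrow> A"
  have A: "transpose A = A" "pos_def A" using A' by auto
  define B where "B = (\<lambda>n. matrix_sqrt (X n))"
  have B: "transpose (B n) = B n" "pos_def (B n)" "B n ** B n = X n" for n
    unfolding B_def using X matrix_sqrt_props[of "X n"] by auto
  have nB: "(norm (B n))\<^sup>2 = trace (X n)" for n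
  proof -
    have "(norm (B n))\<^sup>2 = B n \<bullet> B n" by (simp add: power2_norm_eq_inner)
    also have "\<dots> = trace (transpose (B n) ** B n)"
      by (simp add: inner_vec_def trace_def matrix_matrix_mult_def transpose_def) (rule sum.swap)
    finally show ?thesis using B by simp
  qed
  have "(\<lambda>n. trace (X n)) \<longlonglongrightarrow> trace A" unfolding trace_def by (intro tendsto_intros lim)
  then have "Bseq (\<lambda>n. trace (X n))" by (rule convergent_imp_Bseq[OF convergentI])
  then obtain K where K: "\<And>n. norm (trace (X n)) \<le> K" by (meson BseqE)
  have bdd: "bounded (range B)"
  proof (rule boundedI)
    fix x assume "x \<in> range B"
    then obtain n where "x = B n" by auto
    then have "(norm x)\<^sup>2 \<le> K" using nB[of n] K[of n] by simp
    then show "norm x \<le> sqrt K" by (simp add: real_le_rsqrt)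
  qed
  have "B \<longlonglongrightarrow> matrix_sqrt A"
  proof (rule ccontr)
    assume "\<not> B \<longlonglongrightarrow> matrix_sqrt A"
    then obtain e where e: "e > 0" "\<forall>N. \<exists>n\<ge>N. e \<le> dist (B n) (matrix_sqrt A)"
      unfolding lim_sequentially by (meson not_le)
    then have "\<exists>r::nat\<Rightarrow>nat. strict_mono r \<and> (\<forall>n. e \<le> dist (B (r n)) (matrix_sqrt A))"
    proof -
      have "infinite {n. e \<le> dist (B n) (matrix_sqrt A)}"
        using e(2) by (auto simp: infinite_nat_iff_unbounded_le)
      then show ?thesis using infinite_enumerate by fastforce
    qed
    then obtain r :: "nat \<Rightarrow> nat" where r: "strict_mono r" "\<And>n. e \<le> dist (B (r n)) (matrix_sqrt A)" by auto
    have "bounded (range (B \<circ> r))" using bdd by (rule bounded_subset) auto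
    from bounded_imp_convergent_subsequence[OF this]
    obtain l s where s: "strict_mono s" "((B \<circ> r) \<circ> s) \<longlonglongrightarrow> l" by auto
    have ls: "(\<lambda>n. B (r (s n))) \<longlonglongrightarrow> l" using s(2) by (simp add: o_def)
    have rs: "strict_mono (\<lambda>n. r (s n))" using r(1) s(1) by (simp add: strict_mono_def)
    have lX: "(\<lambda>n. X (r (s n))) \<longlonglongrightarrow> A" using LIMSEQ_subseq_LIMSEQ[OF lim rs] by (simp add: o_def)
    have "(\<lambda>n. transpose (B (r (s n)))) \<longlonglongrightarrow> transpose l"
      unfolding transpose_def by (intro tendsto_intros ls)
    then have sl: "transpose l = l" using LIMSEQ_unique ls unfolding B(1) by blast
    have "(\<lambda>n. B (r (s n)) ** B (r (s n))) \<longlonglongrightarrow> l ** l" by (intro tendsto_matrix_mult ls)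
    then have ll: "l ** l = A" using LIMSEQ_unique lX unfolding B(3) by blast
    have nn: "0 \<le> v \<bullet> (l *v v)" for v
    proof (rule LIMSEQ_le_const)
      show "(\<lambda>n. v \<bullet> (B (r (s n)) *v v)) \<longlonglongrightarrow> v \<bullet> (l *v v)"
        unfolding matrix_vector_mult_def by (intro tendsto_intros ls)
      show "\<exists>N. \<forall>n\<ge>N. 0 \<le> v \<bullet> (B (r (s n)) *v v)"
        using B(2) unfolding pos_def_def by (metis inner_zero_left less_imp_le order_refl)
    qed
    have "det A \<noteq> 0" using spd_det_pos[OF A] by simp
    then have "det l \<noteq> 0" using ll by (metis det_mul mult_zero_left)
    then have "pos_def l" by (intro psd_det_pos_def sl nn)
    then have "matrix_sqrt A = l" by (intro matrix_sqrt_eqI sl ll)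
    then have "(\<lambda>n. dist (B (r (s n))) (matrix_sqrt A)) \<longlonglongrightarrow> 0"
      using ls by (simp add: tendsto_dist_iff[symmetric])
    then have "e \<le> 0" using r(2) by (intro LIMSEQ_le_const) auto
    then show False using e by simp
  qed
  then show "(matrix_sqrt \<circ> X) \<longlonglongrightarrow> matrix_sqrt A" by (simp add: B_def o_def)
qed

section \<open>Information matrices and convergence of the Wynn algorithm\<close>

text \<open>An average over time rather than over support points, so that a new observation is one
  new summand and repeated points need no bookkeeping. It is the information matrix of the empirical
  design when \<open>1 \<le> n\<close>; at \<open>n = 0\<close> it is 0.\<close>

definition gram :: "('t \<Rightarrow> 'x \<Rightarrow> real^'p) \<Rightarrow> (nat \<Rightarrow> 'x) \<Rightarrow> nat \<Rightarrow> 't \<Rightarrow> real^'p^'p" where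
  "gram f xs n \<theta> = (1 / real n) *\<^sub>R (\<Sum>i=1..n. outer_prod (f \<theta> (xs i)) (f \<theta> (xs i)))"

lemma info_matrix_emp_design:
  assumes "1 \<le> n"
  shows "info_matrix f (emp_design xs n) \<theta> = gram f xs n \<theta>"
proof -
  have supp: "supp_design (emp_design xs n) = xs ` {1..n}"
    using assms by (auto simp: supp_design_def emp_design_def card_eq_0_iff)
  have "(\<Sum>i=1..n. outer_prod (f \<theta> (xs i)) (f \<theta> (xs i)))
      = (\<Sum>y\<in>xs ` {1..n}. \<Sum>i\<in>{i\<in>{1..n}. xs i = y}. outer_prod (f \<theta> (xs i)) (f \<theta> (xs i)))"
    by (rule sum.image_gen) simp
  also have "\<dots> = (\<Sum>y\<in>xs ` {1..n}. real (card {i\<in>{1..n}. xs i = y}) *\<^sub>R outer_prod (f \<theta> y) (f \<theta> y))"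
    by (intro sum.cong refl) (simp add: sum_constant_scaleR del: sum_constant)
  finally show ?thesis
    by (simp add: info_matrix_def gram_def supp emp_design_def scaleR_sum_right)
qed

section \<open>Rank-one matrices and their averages\<close>

lemma outer_prod_mult: "outer_prod u v *v x = (v \<bullet> x) *\<^sub>R u"
  by (simp add: outer_prod_def matrix_vector_mult_def vec_eq_iff inner_vec_def sum_distrib_left mult_ac)

lemma outer_prod_form: "x \<bullet> (outer_prod u u *v x) = (u \<bullet> x)\<^sup>2"
  by (simp add: outer_prod_mult power2_eq_square inner_commute)

lemma transpose_outer_prod: "transpose (outer_prod u u) = outer_prod u u"
  by (simp add: outer_prod_def transpose_def vec_eq_iff mult.commute)

lemma trace_mult_outer_prod: "trace (B ** outer_prod u v) = v \<bullet> (B *v u)"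
  unfolding trace_def matrix_matrix_mult_def outer_prod_def inner_vec_def matrix_vector_mult_def
  by (simp add: sum_distrib_left mult_ac)

lemma norm_outer_prod: "norm (outer_prod u v) = norm u * norm v"
proof -
  have "outer_prod u v $ i = (u $ i) *\<^sub>R v" for i by (simp add: outer_prod_def vec_eq_iff)
  then show ?thesis by (simp add: norm_vec_def[of "outer_prod u v"] L2_set_left_distrib[symmetric] norm_vec_def[of u])
qed

lemma norm_outer_prod_diff:
  "norm (outer_prod u u - outer_prod v v) \<le> (norm u + norm v) * norm (u - v)"
proof -
  have "outer_prod u u - outer_prod v v = outer_prod (u - v) u + outer_prod v (u - v)"
    by (simp add: outer_prod_def vec_eq_iff algebra_simps)
  then have "norm (outer_prod u u - outer_prod v v) \<le> norm (outer_prod (u - v) u) + norm (outer_prod v (u - v))"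
    using norm_triangle_ineq by metis
  then show ?thesis by (simp add: norm_outer_prod algebra_simps)
qed

lemma transpose_sum: "transpose (\<Sum>i\<in>I. A i) = (\<Sum>i\<in>I. transpose (A i :: real^'p^'q))"
  by (simp add: transpose_def vec_eq_iff)

lemma transpose_scaleR: "transpose (c *\<^sub>R A) = c *\<^sub>R transpose (A :: real^'p^'q)"
  by (simp add: transpose_def vec_eq_iff)

lemma sum_matrix_vector: "(\<Sum>i\<in>I. A i) *v x = (\<Sum>i\<in>I. A i *v (x :: real^'p))"
  by (induction I rule: infinite_finite_induct) (auto simp: matrix_vector_mult_add_rdistrib)

lemma transpose_gram: "transpose (gram f xs n \<theta>) = gram f xs n \<theta>"
  by (simp add: gram_def transpose_scaleR transpose_sum transpose_outer_prod)

lemma gram_form: "v \<bullet> (gram f xs n \<theta> *v v) = (1 / real n) * (\<Sum>i=1..n. (f \<theta> (xs i) \<bullet> v)\<^sup>2)"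
  by (simp add: gram_def scaleR_matrix_vector_assoc[symmetric] sum_matrix_vector inner_sum_right outer_prod_form)

lemma gram_form_mono:
  assumes "1 \<le> m" "m \<le> n"
  shows "real m / real n * (v \<bullet> (gram f xs m \<theta> *v v)) \<le> v \<bullet> (gram f xs n \<theta> *v v)"
proof -
  have "(\<Sum>i=1..m. (f \<theta> (xs i) \<bullet> v)\<^sup>2) \<le> (\<Sum>i=1..n. (f \<theta> (xs i) \<bullet> v)\<^sup>2)"
    using assms by (intro sum_mono2) auto
  then show ?thesis using assms unfolding gram_form by (simp add: divide_right_mono)
qed

lemma norm_gram_diff:
  assumes "\<And>i. 1 \<le> i \<Longrightarrow> i \<le> n \<Longrightarrow> norm (f \<theta> (xs i)) \<le> K" "\<And>i. 1 \<le> i \<Longrightarrow> i \<le> n \<Longrightarrow> norm (f \<theta>' (xs i)) \<le> K"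
    and "\<And>i. 1 \<le> i \<Longrightarrow> i \<le> n \<Longrightarrow> norm (f \<theta> (xs i) - f \<theta>' (xs i)) \<le> e" and "1 \<le> n"
  shows "norm (gram f xs n \<theta> - gram f xs n \<theta>') \<le> 2 * K * e"
proof -
  let ?O = "\<lambda>\<theta> i. outer_prod (f \<theta> (xs i)) (f \<theta> (xs i))"
  have "gram f xs n \<theta> - gram f xs n \<theta>' = (1 / real n) *\<^sub>R (\<Sum>i=1..n. ?O \<theta> i - ?O \<theta>' i)"
    by (simp add: gram_def scaleR_diff_right sum_subtractf)
  also have "norm \<dots> \<le> (1 / real n) * (\<Sum>i=1..n. norm (?O \<theta> i - ?O \<theta>' i))"
    by (simp add: divide_right_mono norm_sum)
  also have "\<dots> \<le> (1 / real n) * (\<Sum>i=1..n. 2 * K * e)"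
  proof (intro mult_left_mono sum_mono)
    fix i assume i: "i \<in> {1..n}"
    have "norm (?O \<theta> i - ?O \<theta>' i) \<le> (norm (f \<theta> (xs i)) + norm (f \<theta>' (xs i))) * norm (f \<theta> (xs i) - f \<theta>' (xs i))"
      by (rule norm_outer_prod_diff)
    also have "\<dots> \<le> (K + K) * e"
    proof (intro mult_mono add_mono)
      show "0 \<le> K + K" using order_trans[OF norm_ge_zero assms(1)[of i]] i by simp
    qed (use assms i in auto)
    finally show "norm (?O \<theta> i - ?O \<theta>' i) \<le> 2 * K * e" by simp
  qed simp
  also have "\<dots> = 2 * K * e" using assms(4) by simp
  finally show ?thesis .
qed

section \<open>Uniform estimates from compactness of the design and parameter sets\<close>

lemma uniformly_continuous_prodE:
  fixes g :: "'x::metric_space \<Rightarrow> 't::metric_space \<Rightarrow> 'b::metric_space"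
  assumes "compact XX" "compact \<Theta>" "continuous_on (XX \<times> \<Theta>) (\<lambda>(x, \<theta>). g x \<theta>)" "0 < e"
  obtains d where "0 < d" "\<And>x x' \<theta> \<theta>'. x \<in> XX \<Longrightarrow> x' \<in> XX \<Longrightarrow> \<theta> \<in> \<Theta> \<Longrightarrow> \<theta>' \<in> \<Theta> \<Longrightarrow>
    dist x x' < d \<Longrightarrow> dist \<theta> \<theta>' < d \<Longrightarrow> dist (g x \<theta>) (g x' \<theta>') < e"
proof -
  have "uniformly_continuous_on (XX \<times> \<Theta>) (\<lambda>(x, \<theta>). g x \<theta>)"
    using assms by (intro compact_uniformly_continuous compact_Times)
  then obtain d where d: "0 < d" "\<And>y y'. y \<in> XX \<times> \<Theta> \<Longrightarrow> y' \<in> XX \<times> \<Theta> \<Longrightarrow> dist y' y < d \<Longrightarrow>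
      dist ((\<lambda>(x, \<theta>). g x \<theta>) y') ((\<lambda>(x, \<theta>). g x \<theta>) y) < e"
    using assms(4) unfolding uniformly_continuous_on_def by metis
  show ?thesis
  proof
    show "0 < d / 2" using d by simp
    fix x x' \<theta> \<theta>' assume *: "x \<in> XX" "x' \<in> XX" "\<theta> \<in> \<Theta>" "\<theta>' \<in> \<Theta>" "dist x x' < d / 2" "dist \<theta> \<theta>' < d / 2"
    have "dist (x, \<theta>) (x', \<theta>') \<le> dist x x' + dist \<theta> \<theta>'"
      by (simp add: dist_Pair_Pair sqrt_sum_squares_le_sum)
    then have "dist (x, \<theta>) (x', \<theta>') < d" using * by simp
    then show "dist (g x \<theta>) (g x' \<theta>') < e" using d(2)[of "(x', \<theta>')" "(x, \<theta>)"] * by simp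
  qed
qed

lemma bounded_prodE:
  fixes g :: "'x::metric_space \<Rightarrow> 't::metric_space \<Rightarrow> 'b::real_normed_vector"
  assumes "compact XX" "compact \<Theta>" "continuous_on (XX \<times> \<Theta>) (\<lambda>(x, \<theta>). g x \<theta>)"
  obtains K where "0 < K" "\<And>x \<theta>. x \<in> XX \<Longrightarrow> \<theta> \<in> \<Theta> \<Longrightarrow> norm (g x \<theta>) \<le> K"
proof -
  have "bounded ((\<lambda>(x, \<theta>). g x \<theta>) ` (XX \<times> \<Theta>))"
    using assms by (intro compact_imp_bounded compact_continuous_image compact_Times)
  then obtain K where "0 < K" "\<forall>y\<in>(\<lambda>(x, \<theta>). g x \<theta>) ` (XX \<times> \<Theta>). norm y \<le> K"
    unfolding bounded_pos by auto
  then show ?thesis by (intro that[of K]) auto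
qed

text \<open>If no \<open>\<kappa>\<close> worked, compactness would give a limit parameter and a
  unit vector orthogonal to all regressors there, against the spanning condition.\<close>

lemma span_uniformE:
  fixes f :: "'t::metric_space \<Rightarrow> 'x::metric_space \<Rightarrow> real^'p"
  assumes c: "compact \<Theta>" and cont: "continuous_on (XX \<times> \<Theta>) (\<lambda>(x, \<theta>). f \<theta> x)"
    and span: "\<forall>\<theta>\<in>\<Theta>. span (f \<theta> ` XX) = UNIV"
  obtains \<kappa> where "0 < \<kappa>" "\<And>\<theta> v. \<theta> \<in> \<Theta> \<Longrightarrow> norm v = 1 \<Longrightarrow> \<exists>x\<in>XX. \<kappa> \<le> \<bar>f \<theta> x \<bullet> v\<bar>"
proof (rule ccontr)
  assume nt: "\<not> thesis"
  have "\<exists>\<theta> v. \<theta> \<in> \<Theta> \<and> norm v = 1 \<and> (\<forall>x\<in>XX. \<bar>f \<theta> x \<bullet> v\<bar> < 1 / real (Suc k))" for k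
  proof (rule ccontr)
    assume *: "\<not> ?thesis"
    show False
      by (rule notE[OF nt], rule that[of "1 / real (Suc k)"]) (use * in \<open>auto simp: not_less\<close>)
  qed
  then have "\<forall>k. \<exists>\<theta>. \<exists>v. \<theta> \<in> \<Theta> \<and> norm v = 1 \<and> (\<forall>x\<in>XX. \<bar>f \<theta> x \<bullet> v\<bar> < 1 / real (Suc k))" by blast
  from choice[OF this] obtain t
    where "\<forall>k. \<exists>v. t k \<in> \<Theta> \<and> norm v = 1 \<and> (\<forall>x\<in>XX. \<bar>f (t k) x \<bullet> v\<bar> < 1 / real (Suc k))" by blast
  from choice[OF this] obtain w
    where tw: "\<And>k. t k \<in> \<Theta> \<and> norm (w k) = 1 \<and> (\<forall>x\<in>XX. \<bar>f (t k) x \<bullet> w k\<bar> < 1 / real (Suc k))" by blast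
  have cS: "compact (\<Theta> \<times> sphere (0::real^'p) 1)" using c by (intro compact_Times) auto
  have inS: "\<forall>k. (t k, w k) \<in> \<Theta> \<times> sphere 0 1" using tw by auto
  obtain l r where l: "l \<in> \<Theta> \<times> sphere 0 1" "strict_mono r" "((\<lambda>k. (t k, w k)) \<circ> r) \<longlonglongrightarrow> l"
    by (rule seq_compactE[OF compact_imp_seq_compact[OF cS] inS])
  obtain \<theta> v where lv: "l = (\<theta>, v)" by (cases l)
  have \<theta>: "\<theta> \<in> \<Theta>" and v: "norm v = 1" using l lv by auto
  have t: "(\<lambda>k. t (r k)) \<longlonglongrightarrow> \<theta>" and w: "(\<lambda>k. w (r k)) \<longlonglongrightarrow> v"
    using tendsto_fst[OF l(3)] tendsto_snd[OF l(3)] lv by (simp_all add: o_def)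
  have "f \<theta> x \<bullet> v = 0" if x: "x \<in> XX" for x
  proof -
    have "continuous_on \<Theta> ((\<lambda>(x, \<theta>). f \<theta> x) \<circ> (\<lambda>\<theta>. (x, \<theta>)))"
      by (intro continuous_on_compose continuous_on_subset[OF cont] continuous_intros) (use x in auto)
    then have "continuous_on \<Theta> (\<lambda>\<theta>. f \<theta> x)" by (simp add: o_def)
    then have "(\<lambda>k. f (t (r k)) x) \<longlonglongrightarrow> f \<theta> x"
      using t \<theta> tw by (auto intro: continuous_on_tendsto_compose)
    then have "(\<lambda>k. \<bar>f (t (r k)) x \<bullet> w (r k)\<bar>) \<longlonglongrightarrow> \<bar>f \<theta> x \<bullet> v\<bar>"
      by (intro tendsto_intros w)
    moreover have "(\<lambda>k. 1 / real (Suc (r k))) \<longlonglongrightarrow> 0"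
      using LIMSEQ_subseq_LIMSEQ[OF LIMSEQ_Suc[OF lim_1_over_n] l(2)] by (simp add: o_def)
    ultimately have "\<bar>f \<theta> x \<bullet> v\<bar> \<le> 0"
      by (rule LIMSEQ_le) (use tw x in \<open>auto intro: less_imp_le\<close>)
    then show ?thesis by simp
  qed
  then have "span (f \<theta> ` XX) \<subseteq> {y. y \<bullet> v = 0}"
    by (intro span_minimal) (auto simp: subspace_def inner_add_left)
  then have "v \<bullet> v = 0" using span \<theta> by blast
  then show False using v by simp
qed

text \<open>Cauchy--Schwarz in the inner product defined by \<open>A\<close>, applied to
  \<open>v\<close> and \<open>matrix_inv A *v u\<close>. It converts a bound on the variance
  function into a lower bound on the form of \<open>A\<close>.\<close>

lemma spd_form_cauchy:
  fixes A :: "real^'p^'p"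
  assumes "transpose A = A" "pos_def A"
  shows "(u \<bullet> v)\<^sup>2 \<le> (u \<bullet> (matrix_inv A *v u)) * (v \<bullet> (A *v v))"
proof -
  define R where "R = matrix_sqrt A"
  have R: "transpose R = R" "R ** R = A" unfolding R_def using matrix_sqrt_props[OF assms] by auto
  have q: "x \<bullet> (A *v y) = (R *v x) \<bullet> (R *v y)" for x y
    by (simp add: R(2)[symmetric] matrix_vector_mul_assoc[symmetric] sym_matrix_inner[OF R(1)])
  define y where "y = matrix_inv A *v u"
  have u: "u = A *v y" unfolding y_def using matrix_inv_mult[OF pos_def_invertible[OF assms(2)]] by simp
  have "u \<bullet> v = (R *v v) \<bullet> (R *v y)" by (simp add: u inner_commute[of _ v] q)
  moreover have "u \<bullet> (matrix_inv A *v u) = (R *v y) \<bullet> (R *v y)"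
    unfolding y_def[symmetric] by (simp add: u inner_commute[of _ y] q)
  ultimately show ?thesis using Cauchy_Schwarz_ineq[of "R *v v" "R *v y"] by (simp add: q mult.commute)
qed

lemma spd_inv_form_pos:
  fixes A :: "real^'p^'p"
  assumes "transpose A = A" "pos_def A"
  shows "0 \<le> u \<bullet> (matrix_inv A *v u)"
  using pos_def_matrix_inv[OF assms] by (cases "u = 0") (auto simp: pos_def_def less_imp_le)

text \<open>A maximizer of the variance function that has many earlier design points nearby has bounded
  variance, and the maximal variance bounds the smallest eigenvalue from below.\<close>
lemma gram_lower_bound_of_repeated:
  fixes f :: "'t \<Rightarrow> 'x \<Rightarrow> real^'p"
  assumes pd: "pos_def (gram f xs n \<theta>)" and n: "1 \<le> n"
    and mx: "\<And>x. x \<in> XX \<Longrightarrow> f \<theta> x \<bullet> (matrix_inv (gram f xs n \<theta>) *v f \<theta> x) \<le> g \<bullet> (matrix_inv (gram f xs n \<theta>) *v g)"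
    and \<kappa>: "0 < \<kappa>" "\<And>v. norm v = 1 \<Longrightarrow> \<exists>x\<in>XX. \<kappa> \<le> \<bar>f \<theta> x \<bullet> v\<bar>"
    and I: "I \<subseteq> {1..n}" "\<beta> * real n \<le> real (card I)" "0 < \<beta>"
    and near: "\<And>i. i \<in> I \<Longrightarrow> norm (f \<theta> (xs i) - g) \<le> \<kappa> / 2"
  shows "\<kappa>\<^sup>2 * \<beta> / 4 * (v \<bullet> v) \<le> v \<bullet> (gram f xs n \<theta> *v v)"
proof -
  define A where "A = gram f xs n \<theta>"
  have A: "transpose A = A" "pos_def A" unfolding A_def by (rule transpose_gram) (rule pd)
  define D where "D = g \<bullet> (matrix_inv A *v g)"
  have D0: "0 \<le> D" unfolding D_def by (rule spd_inv_form_pos[OF A])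
  have q0: "0 \<le> v \<bullet> (A *v v)" for v unfolding A_def gram_form by (intro mult_nonneg_nonneg sum_nonneg) auto
  have unit: "\<kappa>\<^sup>2 \<le> D * (v \<bullet> (A *v v))" if v: "norm v = 1" for v
  proof -
    obtain x where x: "x \<in> XX" "\<kappa> \<le> \<bar>f \<theta> x \<bullet> v\<bar>" using \<kappa>(2)[OF v] by auto
    have "\<kappa>\<^sup>2 \<le> (f \<theta> x \<bullet> v)\<^sup>2" using x(2) \<kappa>(1) by (simp add: abs_le_square_iff[symmetric])
    also have "\<dots> \<le> (f \<theta> x \<bullet> (matrix_inv A *v f \<theta> x)) * (v \<bullet> (A *v v))" by (rule spd_form_cauchy[OF A])
    also have "\<dots> \<le> D * (v \<bullet> (A *v v))"
      using mx[OF x(1)] q0 unfolding D_def A_def by (intro mult_right_mono)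
    finally show ?thesis .
  qed
  have all: "\<kappa>\<^sup>2 * (v \<bullet> v) \<le> D * (v \<bullet> (A *v v))" for v
  proof (cases "v = 0")
    case False
    have "\<kappa>\<^sup>2 \<le> D * ((v /\<^sub>R norm v) \<bullet> (A *v (v /\<^sub>R norm v)))" by (rule unit) (use False in simp)
    also have "(v /\<^sub>R norm v) \<bullet> (A *v (v /\<^sub>R norm v)) = (v \<bullet> (A *v v)) / (v \<bullet> v)"
      by (simp add: matrix_vector_mult_scaleR divide_inverse dot_square_norm power2_eq_square)
    finally show ?thesis using False by (simp add: pos_le_divide_eq)
  qed simp
  \<comment> \<open>Regressors within \<open>\<kappa> / 2\<close> of \<open>g\<close> satisfy f . w
    >= D / 2, so the fraction \<open>\<beta>\<close> of them already contributes \<beta> (D / 2)^2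
    to \<open>D = w \<bullet> (A *v w)\<close>. Hence \<open>D \<le> 4 / \<beta>\<close>.\<close>
  define w where "w = matrix_inv A *v g"
  have Aw: "A *v w = g" unfolding w_def using matrix_inv_mult[OF pos_def_invertible[OF A(2)]] by simp
  have Dw: "w \<bullet> (A *v w) = D" unfolding Aw unfolding D_def w_def by (rule inner_commute)
  have "(\<kappa> * norm w)\<^sup>2 \<le> D\<^sup>2" using all[of w] unfolding Dw by (simp add: power2_eq_square dot_square_norm mult_ac)
  then have nw: "\<kappa> * norm w \<le> D" using D0 by (rule power2_le_imp_le)
  have gw: "g \<bullet> w = D" by (simp add: D_def w_def)
  have fi: "D / 2 \<le> f \<theta> (xs i) \<bullet> w" if "i \<in> I" for i
  proof -
    have "\<bar>(f \<theta> (xs i) - g) \<bullet> w\<bar> \<le> norm (f \<theta> (xs i) - g) * norm w" by (rule Cauchy_Schwarz_ineq2)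
    also have "\<dots> \<le> \<kappa> / 2 * norm w" using near[OF that] by (intro mult_right_mono) auto
    also have "\<dots> \<le> D / 2" using nw by simp
    finally have "\<bar>f \<theta> (xs i) \<bullet> w - D\<bar> \<le> D / 2" using gw by (simp add: inner_diff_left)
    then show ?thesis by linarith
  qed
  have "D = (1 / real n) * (\<Sum>i=1..n. (f \<theta> (xs i) \<bullet> w)\<^sup>2)" using Dw unfolding A_def gram_form by simp
  also have "(1 / real n) * (\<Sum>i=1..n. (f \<theta> (xs i) \<bullet> w)\<^sup>2) \<ge> (1 / real n) * (\<Sum>i\<in>I. (D / 2)\<^sup>2)"
  proof (intro mult_left_mono)
    have "(\<Sum>i\<in>I. (D / 2)\<^sup>2) \<le> (\<Sum>i\<in>I. (f \<theta> (xs i) \<bullet> w)\<^sup>2)"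
      using fi D0 by (intro sum_mono power_mono) auto
    also have "\<dots> \<le> (\<Sum>i=1..n. (f \<theta> (xs i) \<bullet> w)\<^sup>2)" using I(1) by (intro sum_mono2) auto
    finally show "(\<Sum>i\<in>I. (D / 2)\<^sup>2) \<le> (\<Sum>i=1..n. (f \<theta> (xs i) \<bullet> w)\<^sup>2)" .
  qed simp
  finally have "D \<ge> (1 / real n) * (real (card I) * (D / 2)\<^sup>2)" by simp
  also have "(1 / real n) * (real (card I) * (D / 2)\<^sup>2) = (real (card I) / real n) * (D / 2)\<^sup>2" by simp
  also have "\<dots> \<ge> \<beta> * (D / 2)\<^sup>2" using I n by (intro mult_right_mono) (auto simp: pos_le_divide_eq)
  finally have DD: "\<beta> * (D / 2)\<^sup>2 \<le> D" .
  have "D \<le> 4 / \<beta>"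
  proof (cases "D = 0")
    case False
    then have "D > 0" using D0 by simp
    moreover have "D * (\<beta> * D) \<le> D * 4" using DD by (simp add: power2_eq_square algebra_simps)
    ultimately have "\<beta> * D \<le> 4" by (simp add: mult_le_cancel_left_pos)
    then show ?thesis using I(3) by (simp add: pos_le_divide_eq mult.commute)
  qed (use I in auto)
  then have "\<kappa>\<^sup>2 * (v \<bullet> v) \<le> 4 / \<beta> * (v \<bullet> (A *v v))"
    using all[of v] q0[of v] by (meson mult_right_mono order_trans)
  then show ?thesis unfolding A_def[symmetric] using I(3) by (simp add: field_simps)
qed

text \<open>The recursion says that (n - 1) g n grows by at most \<open>e\<close> per step, so it
  telescopes, and division by n leaves at most \<open>e\<close> in the limit. This is the
  convergence mechanism of an ascent with step size 1/n.\<close>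

lemma recursive_average_tendsto_0:
  fixes g :: "nat \<Rightarrow> real"
  assumes nn: "\<forall>\<^sub>F n in sequentially. 0 \<le> g n"
    and rec: "\<And>e. 0 < e \<Longrightarrow> \<forall>\<^sub>F n in sequentially. real n * g (Suc n) \<le> (real n - 1) * g n + e"
  shows "g \<longlonglongrightarrow> 0"
proof (rule LIMSEQ_I)
  fix r :: real assume r: "0 < r"
  have "\<forall>\<^sub>F n in sequentially. real n * g (Suc n) \<le> (real n - 1) * g n + r / 2 \<and> 0 \<le> g n"
    using rec[of "r / 2"] nn r by (auto intro: eventually_conj)
  then obtain N0 where N0: "\<And>n. n \<ge> N0 \<Longrightarrow> real n * g (Suc n) \<le> (real n - 1) * g n + r / 2 \<and> 0 \<le> g n"
    unfolding eventually_sequentially by auto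
  define N where "N = max N0 1"
  have N: "N \<ge> 1" "\<And>n. n \<ge> N \<Longrightarrow> real n * g (Suc n) \<le> (real n - 1) * g n + r / 2" "\<And>n. n \<ge> N \<Longrightarrow> 0 \<le> g n"
    unfolding N_def using N0 by auto
  define c where "c = (real N - 1) * g N"
  have ind: "(real (N + k) - 1) * g (N + k) \<le> c + real k * (r / 2)" for k
  proof (induction k)
    case (Suc k)
    have "(real (N + Suc k) - 1) * g (N + Suc k) = real (N + k) * g (Suc (N + k))" by simp
    also have "\<dots> \<le> (real (N + k) - 1) * g (N + k) + r / 2" by (rule N(2)) simp
    also have "\<dots> \<le> c + real k * (r / 2) + r / 2" using Suc by simp
    finally show ?case by (simp add: field_simps)
  qed (simp add: c_def)
  obtain m :: nat where m: "real m > 2 * c / r" using reals_Archimedean2 by blast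
  show "\<exists>no. \<forall>n\<ge>no. norm (g n - 0) < r"
  proof (intro exI allI impI)
    fix n assume n: "n \<ge> N + m + 2"
    define k where "k = n - N"
    have nk: "n = N + k" "k \<ge> m + 2" using n by (auto simp: k_def)
    have "c < real m * (r / 2)" using m r by (simp add: field_simps)
    also have "\<dots> \<le> (real n - 1) * (r / 2)" using n r N(1) by (intro mult_right_mono) auto
    finally have "c < (real n - 1) * (r / 2)" .
    moreover have "real k * (r / 2) \<le> (real n - 1) * (r / 2)" using nk r N(1) by (intro mult_right_mono) auto
    ultimately have "(real n - 1) * g n < (real n - 1) * r" using ind[of k] unfolding nk(1)[symmetric] by (simp add: field_simps)
    then have "g n < r" using n by (simp add: mult_less_cancel_left_pos)
    then show "norm (g n - 0) < r" using N(3)[of n] n by simp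
  qed
qed

text \<open>On the compact part of \<open>H\<close> outside a ball around \<open>m\<close> the
  function attains a maximum strictly below \<open>\<phi> m\<close>, so values close to
  \<open>\<phi> m\<close> force the sequence into the ball.\<close>

lemma tendsto_unique_maximizer:
  fixes G :: "nat \<Rightarrow> 'a::metric_space" and \<phi> :: "'a \<Rightarrow> real"
  assumes H: "compact H" and cont: "continuous_on H \<phi>" and m: "m \<in> H"
    and mx: "\<And>y. y \<in> H \<Longrightarrow> y \<noteq> m \<Longrightarrow> \<phi> y < \<phi> m"
    and G: "\<forall>\<^sub>F n in sequentially. G n \<in> H" and lim: "(\<lambda>n. \<phi> (G n)) \<longlonglongrightarrow> \<phi> m"
  shows "G \<longlonglongrightarrow> m"
  unfolding tendsto_iff
proof (intro allI impI)
  fix e :: real assume e: "0 < e"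
  have cK: "compact (H - ball m e)" using H by (intro compact_diff) auto
  show "\<forall>\<^sub>F n in sequentially. dist (G n) m < e"
  proof (cases "H - ball m e = {}")
    case True
    then show ?thesis using G by (auto elim!: eventually_mono simp: dist_commute)
  next
    case False
    have "continuous_on (H - ball m e) \<phi>" using cont by (rule continuous_on_subset) auto
    from continuous_attains_sup[OF cK False this]
    obtain y where y: "y \<in> H - ball m e" "\<And>z. z \<in> H - ball m e \<Longrightarrow> \<phi> z \<le> \<phi> y" by blast
    have "\<phi> y < \<phi> m" by (rule mx) (use y e in auto)
    then have "\<forall>\<^sub>F n in sequentially. \<phi> y < \<phi> (G n)" using lim by (rule order_tendstoD[rotated])
    then show ?thesis using G
    proof eventually_elim
      case (elim n)
      then show ?case using y(2)[of "G n"] by (force simp: dist_commute)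
    qed
  qed
qed

text \<open>By \<open>info_matrix_in_info_hull\<close> and \<open>info_hull_design\<close> these are
  exactly the information matrices of designs. The hull form gives compactness, and linear
  inequalities checked on rank-one matrices pass to all of it.\<close>

definition info_hull :: "('t \<Rightarrow> 'x \<Rightarrow> real^'p) \<Rightarrow> 'x set \<Rightarrow> 't \<Rightarrow> (real^'p^'p) set" where
  "info_hull f XX \<theta> = convex hull ((\<lambda>x. outer_prod (f \<theta> x) (f \<theta> x)) ` XX)"

lemma info_hull_psd:
  assumes "A \<in> info_hull f XX \<theta>"
  shows "transpose A = A" "0 \<le> v \<bullet> (A *v v)"
proof -
  have "info_hull f XX \<theta> \<subseteq> {A. transpose A = A \<and> (\<forall>v. 0 \<le> v \<bullet> (A *v v))}"
    unfolding info_hull_def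
  proof (rule hull_minimal)
    show "(\<lambda>x. outer_prod (f \<theta> x) (f \<theta> x)) ` XX \<subseteq> {A. transpose A = A \<and> (\<forall>v. 0 \<le> v \<bullet> (A *v v))}"
      by (auto simp: transpose_outer_prod outer_prod_form)
    show "convex {A :: real^'a^'a. transpose A = A \<and> (\<forall>v. 0 \<le> v \<bullet> (A *v v))}"
      unfolding convex_def
      by (auto simp: matrix_vector_mult_add_rdistrib scaleR_matrix_vector_assoc[symmetric] inner_add_right transpose_def vec_eq_iff)
  qed
  then show "transpose A = A" "0 \<le> v \<bullet> (A *v v)" using assms by auto
qed

lemma gram_in_info_hull:
  assumes "1 \<le> n" "\<And>i. 1 \<le> i \<Longrightarrow> i \<le> n \<Longrightarrow> xs i \<in> XX"
  shows "gram f xs n \<theta> \<in> info_hull f XX \<theta>"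
proof -
  have "(\<Sum>i\<in>{1..n}. (1 / real n) *\<^sub>R outer_prod (f \<theta> (xs i)) (f \<theta> (xs i))) \<in> info_hull f XX \<theta>"
    unfolding info_hull_def
    by (rule convex_sum) (use assms in \<open>auto intro: hull_inc\<close>)
  then show ?thesis by (simp add: gram_def scaleR_sum_right)
qed

lemma continuous_on_det: "continuous_on S (det :: real^'p^'p \<Rightarrow> real)"
  unfolding det_def by (intro continuous_intros)

lemma compact_info_hull:
  assumes "compact XX" "continuous_on XX (f \<theta>)"
  shows "compact (info_hull f XX \<theta>)"
  unfolding info_hull_def outer_prod_def
  by (intro compact_convex_hull compact_continuous_image continuous_intros assms)

lemma trace_add_scaleR: "trace (a *\<^sub>R A + b *\<^sub>R B) = a * trace A + b * trace (B :: real^'p^'p)"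
  by (simp add: trace_def sum.distrib sum_distrib_left)

lemma matrix_mult_scaleR_right: "(A :: real^'p^'q) ** (c *\<^sub>R B) = c *\<^sub>R (A ** B)"
  by (simp add: matrix_matrix_mult_def vec_eq_iff sum_distrib_left mult_ac)

lemma trace_mat1: "trace (mat 1 :: real^'p^'p) = CARD('p)"
  by (simp add: trace_def mat_def)

text \<open>Strict concavity at the midpoint \<open>N\<close>: the two traces in the tangent
  inequalities at \<open>N\<close> add up to twice the dimension, while \<open>det N\<close> cannot
  exceed the common maximum. Both inequalities must be equalities, so \<open>A = N\<close> and
  \<open>B = N\<close>.\<close>

lemma info_hull_det_max_unique:
  fixes A B :: "real^'p^'p"
  assumes A: "A \<in> info_hull f XX \<theta>" and B: "B \<in> info_hull f XX \<theta>"
    and mx: "\<And>C. C \<in> info_hull f XX \<theta> \<Longrightarrow> det C \<le> det A" and eq: "det B = det A" and pos: "0 < det A"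
  shows "B = A"
proof -
  define N where "N = (1/2) *\<^sub>R A + (1/2) *\<^sub>R B"
  have N: "N \<in> info_hull f XX \<theta>" unfolding N_def using A B unfolding info_hull_def
    by (intro convexD[OF convex_convex_hull]) auto
  have A': "transpose A = A" "pos_def A" using info_hull_psd[OF A] psd_det_pos_def[of A] pos by auto
  have B': "transpose B = B" "pos_def B" using info_hull_psd[OF B] psd_det_pos_def[of B] pos eq by auto
  have N': "transpose N = N" using info_hull_psd[OF N] by auto
  have "pos_def N" unfolding pos_def_def N_def
    using A'(2) B'(2) by (auto simp: pos_def_def matrix_vector_mult_add_rdistrib scaleR_matrix_vector_assoc[symmetric] inner_add_right intro: add_pos_pos)
  note N' = N' this
  have "trace (matrix_inv N ** A) / 2 + trace (matrix_inv N ** B) / 2 = trace (matrix_inv N ** N)"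
    by (subst (3) N_def) (simp add: matrix_add_ldistrib matrix_mult_scaleR_right trace_add_scaleR)
  also have "\<dots> = CARD('p)" using matrix_inv_mult(2)[OF pos_def_invertible[OF N'(2)]] by (simp add: trace_mat1)
  finally have s: "trace (matrix_inv N ** A) + trace (matrix_inv N ** B) = 2 * real CARD('p)" by simp
  have "ln (det N) \<le> ln (det A)" using mx[OF N] spd_det_pos[OF N'] pos by simp
  then have "ln (det A) - ln (det N) = trace (matrix_inv N ** A) - CARD('p)"
    "ln (det B) - ln (det N) = trace (matrix_inv N ** B) - CARD('p)"
    using ln_det_diff_le_trace(1)[OF A' N'] ln_det_diff_le_trace(1)[OF B' N'] s eq by simp_all
  then have "A = N" "B = N" using ln_det_diff_le_trace(2)[OF A' N'] ln_det_diff_le_trace(2)[OF B' N'] by auto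
  then show ?thesis by simp
qed

lemma info_matrix_in_info_hull:
  assumes "is_design XX \<xi>"
  shows "info_matrix f \<xi> \<theta> \<in> info_hull f XX \<theta>"
  unfolding info_matrix_def info_hull_def
  using assms by (intro convex_sum) (auto simp: is_design_def intro: hull_inc)

text \<open>A convex combination of rank-one matrices may arise from several design points with
  equal matrix; the section \<open>g\<close> chooses one point per matrix, which makes the weights a
  well-defined design. Maximizing over designs and over the hull thereby become the same
  problem.\<close>

lemma info_hull_design:
  assumes "A \<in> info_hull f XX \<theta>"
  obtains \<xi> where "is_design XX \<xi>" "info_matrix f \<xi> \<theta> = A"
proof -
  define F where "F = (\<lambda>x. outer_prod (f \<theta> x) (f \<theta> x))"
  from assms obtain S u where S: "finite S" "S \<subseteq> F ` XX" "\<forall>v\<in>S. 0 \<le> u v" "sum u S = 1" "(\<Sum>v\<in>S. u v *\<^sub>R v) = A"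
    unfolding info_hull_def F_def[symmetric] convex_hull_explicit by auto
  define g where "g = inv_into XX F"
  have g: "g v \<in> XX" "F (g v) = v" if "v \<in> S" for v
    using that S(2) unfolding g_def by (auto intro: inv_into_into f_inv_into_f)
  define \<xi> where "\<xi> x = (if x \<in> g ` S then u (F x) else 0)" for x
  have inj: "inj_on g S" by (rule inj_on_inverseI[of _ F]) (use g in auto)
  have supp: "supp_design \<xi> \<subseteq> g ` S" by (auto simp: supp_design_def \<xi>_def)
  have sums: "(\<Sum>x\<in>supp_design \<xi>. h x) = (\<Sum>v\<in>S. h (g v))" if "\<And>x. \<xi> x = 0 \<Longrightarrow> h x = 0" for h :: "_ \<Rightarrow> 'c::comm_monoid_add"
  proof -
    have "(\<Sum>x\<in>supp_design \<xi>. h x) = (\<Sum>x\<in>g ` S. h x)"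
      using supp S(1) that by (intro sum.mono_neutral_left) (auto simp: supp_design_def)
    also have "\<dots> = (\<Sum>v\<in>S. h (g v))" by (simp add: sum.reindex[OF inj])
    finally show ?thesis .
  qed
  have "is_design XX \<xi>" unfolding is_design_def
  proof (intro conjI allI)
    show "finite (supp_design \<xi>)" using supp S(1) finite_subset by blast
    show "supp_design \<xi> \<subseteq> XX" using supp g by auto
    show "0 \<le> \<xi> x" for x using S(3) g by (auto simp: \<xi>_def)
    show "(\<Sum>x\<in>supp_design \<xi>. \<xi> x) = 1" by (subst sums) (use g S(4) in \<open>auto simp: \<xi>_def\<close>)
  qed
  moreover have "info_matrix f \<xi> \<theta> = A" unfolding info_matrix_def
  proof (subst sums)
    have "outer_prod (f \<theta> (g v)) (f \<theta> (g v)) = v" if "v \<in> S" for v using g(2)[OF that] by (simp add: F_def)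
    then have "(\<Sum>v\<in>S. \<xi> (g v) *\<^sub>R outer_prod (f \<theta> (g v)) (f \<theta> (g v))) = (\<Sum>v\<in>S. u v *\<^sub>R v)"
      using g by (intro sum.cong) (auto simp: \<xi>_def)
    then show "(\<Sum>v\<in>S. \<xi> (g v) *\<^sub>R outer_prod (f \<theta> (g v)) (f \<theta> (g v))) = A" using S(5) by simp
  qed simp
  ultimately show ?thesis using that by blast
qed

lemma form_diff_le:
  fixes A B :: "real^'p^'p"
  assumes "norm (A - B) \<le> e"
  shows "v \<bullet> (A *v v) - e * (v \<bullet> v) \<le> v \<bullet> (B *v v)"
proof -
  have "v \<bullet> (A *v v) - v \<bullet> (B *v v) = v \<bullet> ((A - B) *v v)"
    by (simp add: matrix_vector_mult_diff_rdistrib inner_diff_right)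
  also have "\<dots> \<le> norm v * norm ((A - B) *v v)" by (rule norm_cauchy_schwarz)
  also have "\<dots> \<le> norm v * (e * norm v)"
    using norm_matrix_vector_le[of "A - B" v] assms by (intro mult_left_mono) (auto intro: order_trans[OF _ mult_right_mono])
  finally show ?thesis by (simp add: dot_square_norm power2_eq_square mult_ac)
qed

text \<open>The deterministic content of the algorithm for a single realization; the random setting
  applies it to almost every outcome. The estimators are just a sequence converging to
  \<open>\<theta>bar\<close>, and \<open>xs (Suc n)\<close> is the point chosen with
  \<open>\<theta>s n\<close>.\<close>

locale wynn_path =
  fixes XX :: "'x::metric_space set" and \<Theta> :: "'t::metric_space set" and f :: "'t \<Rightarrow> 'x \<Rightarrow> real^'p"
    and xs :: "nat \<Rightarrow> 'x" and \<theta>s :: "nat \<Rightarrow> 't" and \<theta>bar :: 't and n0 :: nat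
  assumes compact_XX: "compact XX" and compact_\<Theta>: "compact \<Theta>"
    and f_cont: "continuous_on (XX \<times> \<Theta>) (\<lambda>(x, \<theta>). f \<theta> x)"
    and f_span: "\<forall>\<theta>\<in>\<Theta>. span (f \<theta> ` XX) = UNIV"
    and n0: "1 \<le> n0" and xs: "\<And>i. 1 \<le> i \<Longrightarrow> xs i \<in> XX"
    and \<theta>s: "\<And>n. n0 \<le> n \<Longrightarrow> \<theta>s n \<in> \<Theta>" and \<theta>bar: "\<theta>bar \<in> \<Theta>" and \<theta>s_lim: "\<theta>s \<longlonglongrightarrow> \<theta>bar"
    and start: "\<And>\<theta>. \<theta> \<in> \<Theta> \<Longrightarrow> pos_def (gram f xs n0 \<theta>)"
    and wynn: "\<And>n x. n0 \<le> n \<Longrightarrow> x \<in> XX \<Longrightarrow>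
      f (\<theta>s n) x \<bullet> (matrix_inv (gram f xs n (\<theta>s n)) *v f (\<theta>s n) x)
      \<le> f (\<theta>s n) (xs (Suc n)) \<bullet> (matrix_inv (gram f xs n (\<theta>s n)) *v f (\<theta>s n) (xs (Suc n)))"
begin

section \<open>Eigenvalue bounds along a path and the ascent argument\<close>

lemma gram_pos_def:
  assumes "n0 \<le> n" "\<theta> \<in> \<Theta>"
  shows "pos_def (gram f xs n \<theta>)"
  unfolding pos_def_def
proof (intro allI impI)
  fix v :: "real^'p" assume "v \<noteq> 0"
  then have "0 < real n0 / real n * (v \<bullet> (gram f xs n0 \<theta> *v v))"
    using start[OF assms(2)] n0 assms(1) by (auto simp: pos_def_def intro!: mult_pos_pos)
  also have "\<dots> \<le> v \<bullet> (gram f xs n \<theta> *v v)" by (rule gram_form_mono[OF n0 assms(1)])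
  finally show "0 < v \<bullet> (gram f xs n \<theta> *v v)" .
qed

lemma gram_uniform:
  assumes "0 < e"
  obtains d where "0 < d"
    "\<And>n \<theta>. 1 \<le> n \<Longrightarrow> \<theta> \<in> \<Theta> \<Longrightarrow> dist \<theta> \<theta>bar < d \<Longrightarrow> norm (gram f xs n \<theta> - gram f xs n \<theta>bar) \<le> e"
proof -
  obtain K where K: "0 < K" "\<And>x \<theta>. x \<in> XX \<Longrightarrow> \<theta> \<in> \<Theta> \<Longrightarrow> norm (f \<theta> x) \<le> K"
    using bounded_prodE[OF compact_XX compact_\<Theta> f_cont] by metis
  have "0 < e / (2 * K)" using assms K by simp
  from uniformly_continuous_prodE[OF compact_XX compact_\<Theta> f_cont this]
  obtain d where d: "0 < d" "\<And>x x' \<theta> \<theta>'. x \<in> XX \<Longrightarrow> x' \<in> XX \<Longrightarrow> \<theta> \<in> \<Theta> \<Longrightarrow> \<theta>' \<in> \<Theta> \<Longrightarrow>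
    dist x x' < d \<Longrightarrow> dist \<theta> \<theta>' < d \<Longrightarrow> dist (f \<theta> x) (f \<theta>' x') < e / (2 * K)" by metis
  show ?thesis
  proof (rule that[OF d(1)])
    fix n \<theta> assume *: "1 \<le> (n::nat)" "\<theta> \<in> \<Theta>" "dist \<theta> \<theta>bar < d"
    have "norm (gram f xs n \<theta> - gram f xs n \<theta>bar) \<le> 2 * K * (e / (2 * K))"
    proof (rule norm_gram_diff)
      fix i assume i: "1 \<le> i" "i \<le> n"
      show "norm (f \<theta> (xs i) - f \<theta>bar (xs i)) \<le> e / (2 * K)"
        using d(2)[of "xs i" "xs i" \<theta> \<theta>bar] xs[OF i(1)] * \<theta>bar d(1) by (simp add: dist_norm)
    qed (use K * xs \<theta>bar in auto)
    then show "norm (gram f xs n \<theta> - gram f xs n \<theta>bar) \<le> e" using K by simp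
  qed
qed

text \<open>Pigeonhole: among \<open>N\<close> balls of radius \<open>r / 2\<close> covering the
  space, one receives at least the fraction 1/N of the times in the second half. Its last visit is
  \<open>Suc m\<close>, and the earlier visits form \<open>I\<close>. The 4 comes from using half of
  the times and from removing the last visit itself, which \<open>4 * N \<le> n\<close> makes
  harmless.\<close>

lemma repeated_visits:
  assumes "0 < r"
  obtains N :: nat where "1 \<le> N" "\<And>n. 4 * N \<le> n \<Longrightarrow>
    \<exists>m I. n div 2 \<le> m \<and> m < n \<and> I \<subseteq> {1..m} \<and> (\<forall>i\<in>I. dist (xs i) (xs (Suc m)) < r) \<and> real n / (4 * real N) \<le> real (card I)"
proof -
  obtain k where k: "finite k" "XX \<subseteq> (\<Union>x\<in>k. ball x (r / 2))"
    using compact_XX assms unfolding compact_eq_totally_bounded by (meson half_gt_zero)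
  have kne: "k \<noteq> {}" using k(2) xs[of 1] by auto
  define N where "N = card k"
  have N1: "1 \<le> N" using k(1) kne by (simp add: N_def Suc_le_eq card_gt_0_iff)
  show ?thesis
  proof (rule that[OF N1])
    fix n assume n: "4 * N \<le> n"
    define J where "J = {n div 2 + 1..n}"
    define Jc where "Jc c = {i\<in>J. xs i \<in> ball c (r / 2)}" for c
    have fin: "finite (Jc c)" for c by (simp add: Jc_def J_def)
    have "J \<subseteq> (\<Union>c\<in>k. Jc c)"
    proof
      fix i assume i: "i \<in> J"
      then have "xs i \<in> XX" using xs by (simp add: J_def)
      then show "i \<in> (\<Union>c\<in>k. Jc c)" using k(2) i unfolding Jc_def by blast
    qed
    then have "card J \<le> card (\<Union>c\<in>k. Jc c)" using k(1) fin by (intro card_mono) auto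
    also have "\<dots> \<le> (\<Sum>c\<in>k. card (Jc c))" by (rule card_UN_le[OF k(1)])
    finally have le: "card J \<le> (\<Sum>c\<in>k. card (Jc c))" .
    have "\<exists>c\<in>k. card J \<le> N * card (Jc c)"
    proof (rule ccontr)
      assume "\<not> ?thesis"
      then have *: "N * card (Jc c) < card J" if "c \<in> k" for c using that by auto
      have "N * (\<Sum>c\<in>k. card (Jc c)) < (\<Sum>c\<in>k. card J)"
        unfolding sum_distrib_left using * k(1) kne by (intro sum_strict_mono) auto
      also have "\<dots> = N * card J" by (simp add: N_def)
      finally show False using le N1 by simp
    qed
    then obtain c where c: "c \<in> k" "card J \<le> N * card (Jc c)" by auto
    have cJ: "2 * card J \<ge> n" by (simp add: J_def)
    have "card (Jc c) > 0" using c cJ n N1 by (cases "card (Jc c)") auto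
    then have ne: "Jc c \<noteq> {}" by auto
    define M where "M = Max (Jc c)"
    have M: "M \<in> Jc c" "\<And>i. i \<in> Jc c \<Longrightarrow> i \<le> M" unfolding M_def using fin ne by auto
    define m where "m = M - 1"
    have Mm: "M = Suc m" "n div 2 \<le> m" "m < n" using M(1) by (auto simp: m_def Jc_def J_def)
    define I where "I = Jc c - {M}"
    have "I \<subseteq> {1..m}"
    proof
      fix i assume "i \<in> I"
      then show "i \<in> {1..m}" using M(2)[of i] Mm by (auto simp: I_def Jc_def J_def)
    qed
    moreover have "dist (xs i) (xs (Suc m)) < r" if "i \<in> I" for i
    proof -
      have "dist c (xs i) < r / 2" "dist c (xs (Suc m)) < r / 2"
        using that M(1) Mm(1) by (auto simp: I_def Jc_def)
      then show ?thesis using dist_triangle_half_r by blast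
    qed
    moreover have "real n / (4 * real N) \<le> real (card I)"
    proof -
      have "card (Jc c) = Suc (card I)" unfolding I_def using M(1) fin by (metis card_Suc_Diff1)
      then have "n \<le> 2 * (N * Suc (card I))" using c(2) cJ by simp
      then have "real n \<le> real (2 * (N * Suc (card I)))" by (rule of_nat_mono)
      moreover have "2 * (2 * real N) \<le> real n" using n by (simp add: of_nat_mono[of "4 * N" n, simplified])
      ultimately have "real n \<le> 4 * real N * real (card I)" by (simp add: algebra_simps)
      then show ?thesis using N1 by (simp add: pos_divide_le_eq mult.commute)
    qed
    ultimately show "\<exists>m I. n div 2 \<le> m \<and> m < n \<and> I \<subseteq> {1..m} \<and> (\<forall>i\<in>I. dist (xs i) (xs (Suc m)) < r) \<and> real n / (4 * real N) \<le> real (card I)"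
      using Mm by blast
  qed
qed

text \<open>At the repeated visit the chosen point maximizes the variance and has many design points
  nearby, which bounds the smallest eigenvalue by \<open>l0\<close>. Passing from time
  \<open>m\<close> to \<open>n\<close> costs the factor 1/3, each change of parameter costs
  \<open>l0 / 12\<close>, and 1/3 - 1/12 >= 1/6, 1/6 - 1/12 = 1/12.\<close>

lemma gram_lower_bound:
  obtains l where "0 < l" "\<forall>\<^sub>F n in sequentially. (\<forall>v. l * (v \<bullet> v) \<le> v \<bullet> (gram f xs n \<theta>bar *v v))
    \<and> (\<forall>v. l * (v \<bullet> v) \<le> v \<bullet> (gram f xs n (\<theta>s n) *v v))"
proof -
  obtain \<kappa> where \<kappa>: "0 < \<kappa>" "\<And>\<theta> v. \<theta> \<in> \<Theta> \<Longrightarrow> norm v = 1 \<Longrightarrow> \<exists>x\<in>XX. \<kappa> \<le> \<bar>f \<theta> x \<bullet> v\<bar>"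
    using span_uniformE[OF compact_\<Theta> f_cont f_span] by metis
  have "0 < \<kappa> / 2" using \<kappa> by simp
  from uniformly_continuous_prodE[OF compact_XX compact_\<Theta> f_cont this]
  obtain r where r: "0 < r" "\<And>x x' \<theta> \<theta>'. x \<in> XX \<Longrightarrow> x' \<in> XX \<Longrightarrow> \<theta> \<in> \<Theta> \<Longrightarrow> \<theta>' \<in> \<Theta> \<Longrightarrow>
    dist x x' < r \<Longrightarrow> dist \<theta> \<theta>' < r \<Longrightarrow> dist (f \<theta> x) (f \<theta>' x') < \<kappa> / 2" by metis
  obtain N where N: "1 \<le> N" "\<And>n. 4 * N \<le> n \<Longrightarrow>
    \<exists>m I. n div 2 \<le> m \<and> m < n \<and> I \<subseteq> {1..m} \<and> (\<forall>i\<in>I. dist (xs i) (xs (Suc m)) < r) \<and> real n / (4 * real N) \<le> real (card I)"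
    using repeated_visits[OF r(1)] by metis
  define \<beta> where "\<beta> = 1 / (4 * real N)"
  have \<beta>: "0 < \<beta>" using N(1) by (simp add: \<beta>_def)
  define l0 where "l0 = \<kappa>\<^sup>2 * \<beta> / 4"
  have l0: "0 < l0" using \<kappa> \<beta> by (simp add: l0_def)
  have "0 < l0 / 12" using l0 by simp
  then obtain d where d: "0 < d"
    "\<And>n \<theta>. 1 \<le> n \<Longrightarrow> \<theta> \<in> \<Theta> \<Longrightarrow> dist \<theta> \<theta>bar < d \<Longrightarrow> norm (gram f xs n \<theta> - gram f xs n \<theta>bar) \<le> l0 / 12"
    by (rule gram_uniform) blast
  obtain n1 where n1: "\<And>n. n1 \<le> n \<Longrightarrow> dist (\<theta>s n) \<theta>bar < d"
    using \<theta>s_lim d(1) unfolding lim_sequentially by metis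
  have key: "l0 / 6 * (v \<bullet> v) \<le> v \<bullet> (gram f xs n \<theta>bar *v v)
    \<and> l0 / 12 * (v \<bullet> v) \<le> v \<bullet> (gram f xs n (\<theta>s n) *v v)"
    if n: "4 * N + 2 * n0 + 2 * n1 + 4 \<le> n" for n v
  proof -
    obtain m I where m: "n div 2 \<le> m" "m < n" and I: "I \<subseteq> {1..m}" "\<forall>i\<in>I. dist (xs i) (xs (Suc m)) < r"
        "real n / (4 * real N) \<le> real (card I)"
      using N(2)[of n] n by auto
    have mn: "n0 \<le> m" "n1 \<le> m" "1 \<le> m" "n0 \<le> n" using m n n0 by auto
    have tm: "\<theta>s m \<in> \<Theta>" "\<theta>s n \<in> \<Theta>" using \<theta>s mn by auto
    have "l0 * (v \<bullet> v) \<le> v \<bullet> (gram f xs m (\<theta>s m) *v v)" unfolding l0_def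
    proof (rule gram_lower_bound_of_repeated[where XX=XX and I=I and g="f (\<theta>s m) (xs (Suc m))"])
      show "\<beta> * real m \<le> real (card I)"
      proof -
        have "\<beta> * real m \<le> real n / (4 * real N)" using m(2) by (simp add: \<beta>_def divide_right_mono)
        then show ?thesis using I(3) by simp
      qed
      fix i assume "i \<in> I"
      then have "dist (f (\<theta>s m) (xs i)) (f (\<theta>s m) (xs (Suc m))) < \<kappa> / 2"
        using r I xs tm by (intro r(2)) auto
      then show "norm (f (\<theta>s m) (xs i) - f (\<theta>s m) (xs (Suc m))) \<le> \<kappa> / 2" by (simp add: dist_norm)
    qed (use gram_pos_def mn tm \<kappa> \<beta> I wynn in auto)
    then have "real m / real n * (l0 * (v \<bullet> v)) \<le> real m / real n * (v \<bullet> (gram f xs m (\<theta>s m) *v v))"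
      by (intro mult_left_mono) auto
    also have "\<dots> \<le> v \<bullet> (gram f xs n (\<theta>s m) *v v)" using mn m by (intro gram_form_mono) auto
    finally have "real m / real n * (l0 * (v \<bullet> v)) \<le> v \<bullet> (gram f xs n (\<theta>s m) *v v)" .
    moreover have "1 / 3 * (l0 * (v \<bullet> v)) \<le> real m / real n * (l0 * (v \<bullet> v))"
      using m n l0 by (intro mult_right_mono) (auto simp: field_simps)
    moreover have "v \<bullet> (gram f xs n (\<theta>s m) *v v) - l0 / 12 * (v \<bullet> v) \<le> v \<bullet> (gram f xs n \<theta>bar *v v)"
      using d(2)[OF _ tm(1) n1[OF mn(2)], of n] n by (intro form_diff_le) auto
    moreover have "0 \<le> l0 * (v \<bullet> v)" using l0 by simp
    ultimately have 1: "l0 / 6 * (v \<bullet> v) \<le> v \<bullet> (gram f xs n \<theta>bar *v v)" by (simp add: algebra_simps)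
    have "norm (gram f xs n \<theta>bar - gram f xs n (\<theta>s n)) \<le> l0 / 12"
      using d(2)[OF _ tm(2) n1[of n], of n] n by (simp add: norm_minus_commute)
    then have "v \<bullet> (gram f xs n \<theta>bar *v v) - l0 / 12 * (v \<bullet> v) \<le> v \<bullet> (gram f xs n (\<theta>s n) *v v)"
      by (rule form_diff_le)
    then show ?thesis using 1 by (simp add: algebra_simps)
  qed
  show ?thesis
  proof (rule that[of "l0 / 12"])
    show "0 < l0 / 12" using l0 by simp
    show "\<forall>\<^sub>F n in sequentially. (\<forall>v. l0 / 12 * (v \<bullet> v) \<le> v \<bullet> (gram f xs n \<theta>bar *v v))
      \<and> (\<forall>v. l0 / 12 * (v \<bullet> v) \<le> v \<bullet> (gram f xs n (\<theta>s n) *v v))"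
      unfolding eventually_sequentially
    proof (intro exI[of _ "4 * N + 2 * n0 + 2 * n1 + 4"] allI impI conjI)
      fix n v assume "4 * N + 2 * n0 + 2 * n1 + 4 \<le> n"
      note k = key[OF this, of v]
      then show "l0 / 12 * (v \<bullet> v) \<le> v \<bullet> (gram f xs n (\<theta>s n) *v v)" by simp
      have "l0 / 12 * (v \<bullet> v) \<le> l0 / 6 * (v \<bullet> v)" using l0 by (intro mult_right_mono) auto
      then show "l0 / 12 * (v \<bullet> v) \<le> v \<bullet> (gram f xs n \<theta>bar *v v)" using k by linarith
    qed
  qed
qed

lemma gram_Suc_scaled:
  "real (Suc n) *\<^sub>R gram f xs (Suc n) \<theta> = real n *\<^sub>R gram f xs n \<theta> + outer_prod (f \<theta> (xs (Suc n))) (f \<theta> (xs (Suc n)))"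
  by (cases "n = 0") (simp_all add: gram_def)

text \<open>The gap \<open>\<gamma> n\<close> to the maximal \<open>ln det\<close> obeys the
  recursion of \<open>recursive_average_tendsto_0\<close>. One step reduces n times the gap by at
  least \<open>q n - CARD('p)\<close>; up to an error \<open>q n\<close> dominates all variances at
  \<open>G n\<close>, and the tangent inequality at \<open>G n\<close> towards \<open>m\<close>
  bounds the gap itself by the maximal variance minus the dimension.\<close>

theorem gram_tendsto_det_max:
  assumes m: "m \<in> info_hull f XX \<theta>bar" and mx: "\<And>A. A \<in> info_hull f XX \<theta>bar \<Longrightarrow> det A \<le> det m"
  shows "(\<lambda>n. gram f xs n \<theta>bar) \<longlonglongrightarrow> m" and "pos_def m"
proof -
  define G where "G = (\<lambda>n. gram f xs n \<theta>bar)"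
  have GH: "G n \<in> info_hull f XX \<theta>bar" if "1 \<le> n" for n
    unfolding G_def using that xs by (intro gram_in_info_hull) auto
  have Gspd: "transpose (G n) = G n" "pos_def (G n)" if "n0 \<le> n" for n
    unfolding G_def using transpose_gram gram_pos_def[OF that \<theta>bar] by auto
  have detG: "0 < det (G n)" if "n0 \<le> n" for n using spd_det_pos Gspd that by blast
  have detm: "0 < det m" using detG[of n0] mx[OF GH[OF n0]] by simp
  have mspd: "transpose m = m" "pos_def m" using info_hull_psd[OF m] psd_det_pos_def[of m] detm by auto
  then show "pos_def m" by simp
  obtain K where K: "0 < K" "\<And>x \<theta>. x \<in> XX \<Longrightarrow> \<theta> \<in> \<Theta> \<Longrightarrow> norm (f \<theta> x) \<le> K"
    using bounded_prodE[OF compact_XX compact_\<Theta> f_cont] by metis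
  obtain l where l: "0 < l" "\<forall>\<^sub>F n in sequentially. (\<forall>v. l * (v \<bullet> v) \<le> v \<bullet> (G n *v v))
    \<and> (\<forall>v. l * (v \<bullet> v) \<le> v \<bullet> (gram f xs n (\<theta>s n) *v v))"
    unfolding G_def by (rule gram_lower_bound)
  define \<gamma> where "\<gamma> n = ln (det m) - ln (det (G n))" for n
  define q where "q n = f \<theta>bar (xs (Suc n)) \<bullet> (matrix_inv (G (Suc n)) *v f \<theta>bar (xs (Suc n)))" for n
  \<comment> \<open>The tangent inequality is taken at the new matrix \<open>G (Suc n)\<close>: the
    rank-one update makes the trace explicit, and no second-order term in the step size
    appears.\<close>
  have step: "real n * \<gamma> (Suc n) \<le> real n * \<gamma> n - (q n - CARD('p))" if n: "n0 \<le> n" for n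
  proof -
    have n': "n0 \<le> Suc n" "0 < real n" using n n0 by auto
    let ?B = "matrix_inv (G (Suc n))" and ?o = "outer_prod (f \<theta>bar (xs (Suc n))) (f \<theta>bar (xs (Suc n)))"
    have "?B ** (real (Suc n) *\<^sub>R G (Suc n)) = real (Suc n) *\<^sub>R mat 1"
      unfolding matrix_mult_scaleR_right using matrix_inv_mult(2)[OF pos_def_invertible[OF Gspd(2)[OF n'(1)]]] by simp
    then have "?B ** (real n *\<^sub>R G n) + ?B ** ?o = real (Suc n) *\<^sub>R mat 1"
      by (simp only: G_def gram_Suc_scaled matrix_add_ldistrib)
    then have "trace (real n *\<^sub>R (?B ** G n) + 1 *\<^sub>R (?B ** ?o)) = trace (real (Suc n) *\<^sub>R (mat 1 :: real^'p^'p) + 0 *\<^sub>R mat 1)"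
      by (simp add: matrix_mult_scaleR_right)
    then have tr: "real n * trace (?B ** G n) + q n = real (Suc n) * CARD('p)"
      unfolding trace_add_scaleR by (simp add: trace_mult_outer_prod q_def trace_mat1)
    have "ln (det (G n)) - ln (det (G (Suc n))) \<le> trace (?B ** G n) - CARD('p)"
      by (rule ln_det_diff_le_trace(1)[OF Gspd[OF n] Gspd[OF n'(1)]])
    then have "real n * (ln (det (G n)) - ln (det (G (Suc n)))) \<le> real n * (trace (?B ** G n) - CARD('p))"
      using n' by (intro mult_left_mono) auto
    also have "\<dots> = - (q n - CARD('p))" using tr by (simp add: algebra_simps)
    finally show ?thesis by (simp add: \<gamma>_def algebra_simps)
  qed
  have "\<gamma> \<longlonglongrightarrow> 0"
  proof (rule recursive_average_tendsto_0)
    show "\<forall>\<^sub>F n in sequentially. 0 \<le> \<gamma> n"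
      using eventually_ge_at_top[of n0]
    proof eventually_elim
      case (elim n)
      then show ?case using mx[OF GH[of n]] detG[of n] detm n0 by (simp add: \<gamma>_def)
    qed
    fix e :: real assume e: "0 < e"
    \<comment> \<open>\<open>c * e'\<close> is twice the error of one application of
      \<open>matrix_inv_form_perturb\<close>: one is spent on an arbitrary competitor
      \<open>x\<close>, one on the chosen point.\<close>
    define c where "c = 4 * K / l + 4 * K\<^sup>2 / l\<^sup>2"
    have c: "0 < c" using K l by (simp add: c_def add_pos_pos)
    define e' where "e' = e / (2 * c)"
    have e': "0 < e'" using e c by (simp add: e'_def)
    obtain d1 where d1: "0 < d1"
      "\<And>n \<theta>. 1 \<le> n \<Longrightarrow> \<theta> \<in> \<Theta> \<Longrightarrow> dist \<theta> \<theta>bar < d1 \<Longrightarrow> norm (gram f xs n \<theta> - gram f xs n \<theta>bar) \<le> e'"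
      using gram_uniform[OF e'] by blast
    obtain d2 where d2: "0 < d2" "\<And>x x' \<theta> \<theta>'. x \<in> XX \<Longrightarrow> x' \<in> XX \<Longrightarrow> \<theta> \<in> \<Theta> \<Longrightarrow> \<theta>' \<in> \<Theta> \<Longrightarrow>
      dist x x' < d2 \<Longrightarrow> dist \<theta> \<theta>' < d2 \<Longrightarrow> dist (f \<theta> x) (f \<theta>' x') < e'"
      using uniformly_continuous_prodE[OF compact_XX compact_\<Theta> f_cont e'] by metis
    have "\<forall>\<^sub>F n in sequentially. dist (\<theta>s n) \<theta>bar < min d1 d2"
      using \<theta>s_lim[unfolded tendsto_iff, rule_format, of "min d1 d2"] d1(1) d2(1) by simp
    moreover have "\<forall>\<^sub>F n in sequentially. 2 * K\<^sup>2 / e' \<le> real n"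
      using filterlim_real_sequentially unfolding filterlim_at_top by blast
    moreover have "\<forall>\<^sub>F n in sequentially. (\<forall>v. l * (v \<bullet> v) \<le> v \<bullet> (G (Suc n) *v v))"
      using l(2) eventually_sequentially_Suc[of "\<lambda>n. \<forall>v. l * (v \<bullet> v) \<le> v \<bullet> (G n *v v)"] by (auto elim: eventually_mono)
    ultimately show "\<forall>\<^sub>F n in sequentially. real n * \<gamma> (Suc n) \<le> (real n - 1) * \<gamma> n + e"
      using l(2) eventually_ge_at_top[of n0]
    proof eventually_elim
      case (elim n)
      have n1: "1 \<le> n" using elim n0 by simp
      have ts: "\<theta>s n \<in> \<Theta>" using \<theta>s elim by simp
      have fx: "norm (f \<theta>bar x - f (\<theta>s n) x) \<le> e'" if "x \<in> XX" for x
        using d2(2)[of x x \<theta>bar "\<theta>s n"] that \<theta>bar ts elim(1) d2(1) by (simp add: dist_norm dist_commute norm_minus_commute)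
      define g where "g = xs (Suc n)"
      have gX: "g \<in> XX" using xs by (simp add: g_def)
      have "real (Suc n) *\<^sub>R (G (Suc n) - G n) = outer_prod (f \<theta>bar g) (f \<theta>bar g) - G n"
        using gram_Suc_scaled[of n \<theta>bar] by (simp add: G_def g_def algebra_simps)
      then have "real (Suc n) * norm (G (Suc n) - G n) = norm (outer_prod (f \<theta>bar g) (f \<theta>bar g) - G n)"
        by (metis norm_scaleR abs_of_nat)
      also have "\<dots> \<le> norm (outer_prod (f \<theta>bar g) (f \<theta>bar g)) + norm (G n)" by (rule norm_triangle_ineq4)
      also have "norm (outer_prod (f \<theta>bar g) (f \<theta>bar g)) \<le> K\<^sup>2"
        unfolding norm_outer_prod power2_eq_square using K(2)[OF gX \<theta>bar] by (intro mult_mono) (use K in auto)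
      also have "norm (G n) \<le> (1 / real n) * (\<Sum>i=1..n. K\<^sup>2)"
      proof -
        have "norm (outer_prod (f \<theta>bar (xs i)) (f \<theta>bar (xs i))) \<le> K\<^sup>2" if "i \<in> {1..n}" for i
          unfolding norm_outer_prod power2_eq_square using K xs \<theta>bar that by (intro mult_mono) auto
        then have "norm (\<Sum>i=1..n. outer_prod (f \<theta>bar (xs i)) (f \<theta>bar (xs i))) \<le> (\<Sum>i=1..n. K\<^sup>2)"
          by (intro sum_norm_le) auto
        then show ?thesis unfolding G_def gram_def norm_scaleR by (intro mult_mono) auto
      qed
      also have "\<dots> = K\<^sup>2" using n1 by simp
      finally have "real (Suc n) * norm (G (Suc n) - G n) \<le> 2 * K\<^sup>2" by simp
      also have "\<dots> \<le> real n * e'" using elim(2) e' by (simp add: pos_divide_le_eq)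
      also have "\<dots> \<le> real (Suc n) * e'" using e' by simp
      finally have GG: "norm (G (Suc n) - G n) \<le> e'" by (simp add: mult_le_cancel_left_pos del: of_nat_Suc)
      have Gs: "norm (gram f xs n (\<theta>s n) - G n) \<le> e'"
        unfolding G_def using d1(2)[OF n1 ts] elim(1) by simp
      have GsS: "norm (G (Suc n) - gram f xs n (\<theta>s n)) \<le> 2 * e'"
        using norm_triangle_ineq4[of "G (Suc n) - G n" "gram f xs n (\<theta>s n) - G n"] GG Gs by simp
      define T where "T = 2 * K / l * e' + K\<^sup>2 / l\<^sup>2 * (2 * e')"
      have p1: "\<bar>q n - f (\<theta>s n) g \<bullet> (matrix_inv (gram f xs n (\<theta>s n)) *v f (\<theta>s n) g)\<bar>
        \<le> 2 * K / l * e' + K\<^sup>2 / l\<^sup>2 * (2 * e')"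
      proof -
        have "\<bar>f \<theta>bar g \<bullet> (matrix_inv (G (Suc n)) *v f \<theta>bar g) - f (\<theta>s n) g \<bullet> (matrix_inv (gram f xs n (\<theta>s n)) *v f (\<theta>s n) g)\<bar>
          \<le> 2 * K / l * norm (f \<theta>bar g - f (\<theta>s n) g) + K\<^sup>2 / l\<^sup>2 * norm (G (Suc n) - gram f xs n (\<theta>s n))"
          by (rule matrix_inv_form_perturb) (use elim l K gX \<theta>bar ts transpose_gram Gspd in auto)
        also have "\<dots> \<le> 2 * K / l * e' + K\<^sup>2 / l\<^sup>2 * (2 * e')"
          using fx[OF gX] GsS K l by (intro add_mono mult_left_mono) auto
        finally show ?thesis by (simp add: q_def g_def)
      qed
      \<comment> \<open>The point was optimal for the estimated parameter at time \<open>n\<close>;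
        two perturbations turn this into near-optimality at \<open>\<theta>bar\<close>, measured
        with the updated matrix as in \<open>q\<close>.\<close>
      have bnd: "f \<theta>bar x \<bullet> (matrix_inv (G n) *v f \<theta>bar x) \<le> q n + e" if x: "x \<in> XX" for x
      proof -
        have "\<bar>f \<theta>bar x \<bullet> (matrix_inv (G n) *v f \<theta>bar x) - f (\<theta>s n) x \<bullet> (matrix_inv (gram f xs n (\<theta>s n)) *v f (\<theta>s n) x)\<bar>
          \<le> 2 * K / l * norm (f \<theta>bar x - f (\<theta>s n) x) + K\<^sup>2 / l\<^sup>2 * norm (G n - gram f xs n (\<theta>s n))"
          by (rule matrix_inv_form_perturb) (use elim l K x \<theta>bar ts transpose_gram Gspd in auto)
        also have "\<dots> \<le> 2 * K / l * e' + K\<^sup>2 / l\<^sup>2 * (2 * e')"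
          using fx[OF x] Gs K l e' by (intro add_mono mult_left_mono) (auto simp: norm_minus_commute)
        finally have "f \<theta>bar x \<bullet> (matrix_inv (G n) *v f \<theta>bar x)
          \<le> f (\<theta>s n) x \<bullet> (matrix_inv (gram f xs n (\<theta>s n)) *v f (\<theta>s n) x) + (2 * K / l * e' + K\<^sup>2 / l\<^sup>2 * (2 * e'))"
          by linarith
        moreover have "f (\<theta>s n) x \<bullet> (matrix_inv (gram f xs n (\<theta>s n)) *v f (\<theta>s n) x)
          \<le> f (\<theta>s n) g \<bullet> (matrix_inv (gram f xs n (\<theta>s n)) *v f (\<theta>s n) g)"
          unfolding g_def by (rule wynn) (use elim x in auto)
        moreover have "2 * (2 * K / l * e' + K\<^sup>2 / l\<^sup>2 * (2 * e')) = c * e'" by (simp add: c_def algebra_simps)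
        moreover have "c * e' \<le> e" using c e by (simp add: e'_def)
        ultimately show ?thesis using p1 unfolding T_def[symmetric] by linarith
      qed
      \<comment> \<open>A trace against a fixed matrix is linear, so the bound on rank-one matrices
        extends to the hull and in particular to \<open>m\<close>.\<close>
      have "info_hull f XX \<theta>bar \<subseteq> {A. trace (matrix_inv (G n) ** A) \<le> q n + e}"
        unfolding info_hull_def
      proof (rule hull_minimal)
        show "(\<lambda>x. outer_prod (f \<theta>bar x) (f \<theta>bar x)) ` XX \<subseteq> {A. trace (matrix_inv (G n) ** A) \<le> q n + e}"
          using bnd by (auto simp: trace_mult_outer_prod)
        show "convex {A. trace (matrix_inv (G n) ** A) \<le> q n + e}"
          unfolding convex_def
          by (auto simp: matrix_add_ldistrib matrix_mult_scaleR_right trace_add_scaleR intro: convex_bound_le)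
      qed
      then have "trace (matrix_inv (G n) ** m) \<le> q n + e" using m by auto
      moreover have "\<gamma> n \<le> trace (matrix_inv (G n) ** m) - CARD('p)"
        unfolding \<gamma>_def by (rule ln_det_diff_le_trace(1)[OF mspd Gspd]) (use elim in auto)
      moreover have "real n * \<gamma> (Suc n) \<le> real n * \<gamma> n - (q n - CARD('p))" by (rule step) (use elim in auto)
      ultimately show ?case by (simp add: algebra_simps)
    qed
  qed
  then have "(\<lambda>n. ln (det m) - \<gamma> n) \<longlonglongrightarrow> ln (det m) - 0" by (intro tendsto_intros)
  then have "(\<lambda>n. exp (ln (det m) - \<gamma> n)) \<longlonglongrightarrow> exp (ln (det m) - 0)" by (rule tendsto_exp)
  then have "(\<lambda>n. exp (ln (det m) - \<gamma> n)) \<longlonglongrightarrow> det m" using detm by simp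
  moreover have "\<forall>\<^sub>F n in sequentially. exp (ln (det m) - \<gamma> n) = det (G n)"
    using eventually_ge_at_top[of n0] by eventually_elim (simp add: \<gamma>_def detG)
  ultimately have limdet: "(\<lambda>n. det (G n)) \<longlonglongrightarrow> det m" by (rule Lim_transform_eventually)
  have "continuous_on XX ((\<lambda>(x, \<theta>). f \<theta> x) \<circ> (\<lambda>x. (x, \<theta>bar)))"
    by (intro continuous_on_compose continuous_on_subset[OF f_cont] continuous_intros) (use \<theta>bar in auto)
  then have cf: "continuous_on XX (f \<theta>bar)" by (simp add: o_def)
  have "G \<longlonglongrightarrow> m"
  proof (rule tendsto_unique_maximizer[OF compact_info_hull[of XX f \<theta>bar, OF compact_XX cf] continuous_on_det m _ _ limdet])
    show "\<forall>\<^sub>F n in sequentially. G n \<in> info_hull f XX \<theta>bar"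
      using eventually_ge_at_top[of 1] by eventually_elim (rule GH)
    fix y assume y: "y \<in> info_hull f XX \<theta>bar" "y \<noteq> m"
    have "det y \<noteq> det m" using info_hull_det_max_unique[OF m y(1) mx _ detm] y(2) by blast
    then show "det y < det m" using mx[OF y(1)] by simp
  qed
  then show "(\<lambda>n. gram f xs n \<theta>bar) \<longlonglongrightarrow> m" by (simp add: G_def)
qed

end

section \<open>Multivariate normal distributions and convergence of characteristic functions\<close>

text \<open>Only linear combinations are built in, so that convergence of characteristic functions
  transfers by induction. Closure under products, needed to substitute into polynomials, follows
  from the product-to-sum formulas in \<open>trig_poly_mult\<close>.\<close>

inductive_set trig_poly :: "(real^'p \<Rightarrow> real) set" where
  cos: "(\<lambda>x. cos (t \<bullet> x)) \<in> trig_poly"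
| sin: "(\<lambda>x. sin (t \<bullet> x)) \<in> trig_poly"
| add: "g \<in> trig_poly \<Longrightarrow> h \<in> trig_poly \<Longrightarrow> (\<lambda>x. g x + h x) \<in> trig_poly"
| scale: "g \<in> trig_poly \<Longrightarrow> (\<lambda>x. c * g x) \<in> trig_poly"

lemma trig_poly_const: "(\<lambda>x::real^'p. c) \<in> trig_poly"
  using trig_poly.scale[OF trig_poly.cos[of 0], of c] by simp

lemma trig_poly_sum:
  assumes "\<And>i. i \<in> I \<Longrightarrow> g i \<in> trig_poly"
  shows "(\<lambda>x::real^'p. \<Sum>i\<in>I. g i x) \<in> trig_poly"
  using assms
proof (induction I rule: infinite_finite_induct)
  case (insert i I)
  then show ?case using trig_poly.add[of "g i" "\<lambda>x. \<Sum>i\<in>I. g i x"] by simp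
qed (auto intro: trig_poly_const)

lemma trig_poly_mult:
  assumes g: "g \<in> trig_poly" and h: "h \<in> trig_poly"
  shows "(\<lambda>x::real^'p. g x * h x) \<in> trig_poly"
  using g
proof induction
  case (cos t)
  show ?case using h
  proof induction
    case (cos s)
    have "(\<lambda>x. (1/2) * (cos ((t - s) \<bullet> x) + cos ((t + s) \<bullet> x))) \<in> trig_poly"
      by (intro trig_poly.intros)
    then show ?case by (simp add: cos_times_cos inner_diff_left inner_add_left)
  next
    case (sin s)
    have "(\<lambda>x. (1/2) * (sin ((t + s) \<bullet> x) + (-1) * sin ((t - s) \<bullet> x))) \<in> trig_poly"
      by (intro trig_poly.intros)
    then show ?case by (simp add: cos_times_sin inner_diff_left inner_add_left)
  next
    case (add g h)
    then show ?case using trig_poly.add[OF add.IH] by (simp add: distrib_left)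
  next
    case (scale g c)
    then show ?case using trig_poly.scale[OF scale.IH, of c] by (simp add: mult_ac)
  qed
next
  case (sin t)
  show ?case using h
  proof induction
    case (cos s)
    have "(\<lambda>x. (1/2) * (sin ((t + s) \<bullet> x) + sin ((t - s) \<bullet> x))) \<in> trig_poly"
      by (intro trig_poly.intros)
    then show ?case by (simp add: sin_times_cos inner_diff_left inner_add_left)
  next
    case (sin s)
    have "(\<lambda>x. (1/2) * (cos ((t - s) \<bullet> x) + (-1) * cos ((t + s) \<bullet> x))) \<in> trig_poly"
      by (intro trig_poly.intros)
    then show ?case by (simp add: sin_times_sin inner_diff_left inner_add_left)
  next
    case (add g h)
    then show ?case using trig_poly.add[OF add.IH] by (simp add: distrib_left)
  next
    case (scale g c)
    then show ?case using trig_poly.scale[OF scale.IH, of c] by (simp add: mult_ac)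
  qed
next
  case (add g h)
  then show ?case using trig_poly.add[OF add.IH] by (simp add: distrib_right)
next
  case (scale g c)
  then show ?case using trig_poly.scale[OF scale.IH, of c] by (simp add: mult_ac)
qed

lemma trig_poly_polynomial_sin:
  assumes "real_polynomial_function q"
  shows "(\<lambda>x::real^'p. q (\<chi> i. sin (s * x $ i))) \<in> trig_poly"
  using assms
proof induction
  case (linear q)
  have sc: "(\<lambda>x::real^'p. sin (s * x $ i)) \<in> trig_poly" for i
    using trig_poly.sin[of "axis i s :: real^'p"] by (simp add: inner_axis')
  have qv: "q v = (\<Sum>i\<in>UNIV. q (axis i 1) * v $ i)" for v
  proof -
    have "(\<Sum>i\<in>UNIV. v $ i *\<^sub>R axis i 1) = v" by (simp add: vec_eq_iff axis_def if_distrib cong: if_cong)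
    then have "q v = q (\<Sum>i\<in>UNIV. v $ i *\<^sub>R axis i 1)" by simp
    also have "\<dots> = (\<Sum>i\<in>UNIV. q (axis i 1) * v $ i)"
      using linear by (simp add: linear_sum[OF bounded_linear.linear] linear_scale[OF bounded_linear.linear] mult.commute)
    finally show ?thesis .
  qed
  have "(\<lambda>x::real^'p. q (\<chi> i. sin (s * x $ i))) = (\<lambda>x. \<Sum>i\<in>UNIV. q (axis i 1) * sin (s * x $ i))"
    by (rule ext, subst qv) simp
  moreover have "(\<lambda>x::real^'p. \<Sum>i\<in>UNIV. q (axis i 1) * sin (s * x $ i)) \<in> trig_poly"
    by (intro trig_poly_sum trig_poly.scale sc)
  ultimately show ?case by simp
next
  case (const c)
  then show ?case by (rule trig_poly_const)
next
  case (add p q)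
  then show ?case by (intro trig_poly.add)
next
  case (mult p q)
  then show ?case by (intro trig_poly_mult)
qed

lemma trig_poly_borel_bounded:
  assumes "h \<in> trig_poly"
  shows "h \<in> borel_measurable borel \<and> (\<exists>B. \<forall>x::real^'p. \<bar>h x\<bar> \<le> B)"
  using assms
proof induction
  case (cos t) then show ?case using abs_cos_le_one by (auto intro!: exI[of _ 1])
next
  case (sin t) then show ?case using abs_sin_le_one by (auto intro!: exI[of _ 1])
next
  case (add g h)
  then obtain B C where "\<And>x. \<bar>g x\<bar> \<le> B" "\<And>x. \<bar>h x\<bar> \<le> C" by auto
  then have "\<bar>g x + h x\<bar> \<le> B + C" for x by (meson abs_triangle_ineq add_mono order_trans)
  then show ?case using add by auto
next
  case (scale g c)
  then obtain B where "\<And>x. \<bar>g x\<bar> \<le> B" by auto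
  then have "\<bar>c * g x\<bar> \<le> \<bar>c\<bar> * B" for x by (simp add: abs_mult mult_left_mono)
  then show ?case using scale by auto
qed

lemma (in prob_space) integrable_trig_poly:
  assumes "h \<in> trig_poly" "Z \<in> borel_measurable M"
  shows "integrable M (\<lambda>\<omega>. h (Z \<omega> :: real^'p))"
proof -
  obtain B where B: "\<And>x. \<bar>h x\<bar> \<le> B" and [measurable]: "h \<in> borel_measurable borel"
    using trig_poly_borel_bounded[OF assms(1)] by auto
  note [measurable] = assms(2)
  show ?thesis by (rule integrable_const_bound[of _ B]) (use B in auto)
qed

text \<open>The generators are real and imaginary parts of \<open>iexp (t \<bullet> x)\<close>, and
  the remaining cases are linear.\<close>

lemma trig_poly_expectation_tendsto:
  fixes Z :: "nat \<Rightarrow> 'w \<Rightarrow> real^'p"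
  assumes M: "prob_space M" and N: "prob_space N" "sets N = sets borel"
    and Z: "\<And>n. Z n \<in> borel_measurable M"
    and cf: "\<And>t. (\<lambda>n. integral\<^sup>L M (\<lambda>\<omega>. iexp (t \<bullet> Z n \<omega>))) \<longlonglongrightarrow> integral\<^sup>L N (\<lambda>x. iexp (t \<bullet> x))"
    and h: "h \<in> trig_poly"
  shows "(\<lambda>n. integral\<^sup>L M (\<lambda>\<omega>. h (Z n \<omega>))) \<longlonglongrightarrow> integral\<^sup>L N h"
proof -
  interpret M: prob_space M by (rule M)
  interpret N: prob_space N by (rule N)
  note [measurable] = Z
  have idN: "(\<lambda>x. x) \<in> borel_measurable N" using N(2) by (simp add: measurable_def)
  have iM: "integrable M (\<lambda>\<omega>. iexp (t \<bullet> Z n \<omega>))" for t n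
    by (rule M.integrable_const_bound[of _ 1]) auto
  have iN: "integrable N (\<lambda>x. iexp (t \<bullet> x))" for t
  proof (rule N.integrable_const_bound[of _ 1])
    have "(\<lambda>x. iexp (t \<bullet> x)) \<in> borel_measurable borel" by measurable
    then show "(\<lambda>x. iexp (t \<bullet> x)) \<in> borel_measurable N" using N(2) measurable_cong_sets by blast
  qed auto
  show ?thesis using h
  proof induction
    case (cos t)
    have "(\<lambda>n. Re (integral\<^sup>L M (\<lambda>\<omega>. iexp (t \<bullet> Z n \<omega>)))) \<longlonglongrightarrow> Re (integral\<^sup>L N (\<lambda>x. iexp (t \<bullet> x)))"
      by (intro tendsto_Re cf)
    then show ?case by (simp add: integral_Re[OF iM, symmetric] integral_Re[OF iN, symmetric] Re_exp)
  next
    case (sin t)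
    have "(\<lambda>n. Im (integral\<^sup>L M (\<lambda>\<omega>. iexp (t \<bullet> Z n \<omega>)))) \<longlonglongrightarrow> Im (integral\<^sup>L N (\<lambda>x. iexp (t \<bullet> x)))"
      by (intro tendsto_Im cf)
    then show ?case by (simp add: integral_Im[OF iM, symmetric] integral_Im[OF iN, symmetric] Im_exp)
  next
    case (add g h)
    then show ?case
      using M.integrable_trig_poly[OF _ Z] N.integrable_trig_poly[OF _ idN]
      by (simp add: Bochner_Integration.integral_add tendsto_add)
  next
    case (scale g c)
    then show ?case by (simp add: tendsto_mult_left)
  qed
qed

text \<open>A bounded continuous \<open>g\<close> agrees on a large cube with \<open>g (arcsin (sin (s x)) / s)\<close> (componentwise),
  and by Stone--Weierstrass the latter is uniformly close on the whole space to a polynomial in the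
  functions \<open>sin (s x\<^sub>i)\<close>; this keeps the approximant bounded outside the cube.\<close>
lemma trig_poly_approx:
  fixes g :: "real^'p \<Rightarrow> real"
  assumes cont: "continuous_on UNIV g" and B: "\<And>x. \<bar>g x\<bar> \<le> B" and e: "0 < e" and R: "0 < R"
  obtains h where "h \<in> trig_poly" "\<And>x. \<bar>h x\<bar> \<le> B + e" "\<And>x. norm x \<le> R \<Longrightarrow> \<bar>h x - g x\<bar> \<le> e"
proof -
  \<comment> \<open>With this scale \<open>s * x $ i\<close> stays within \<open>pi / 2\<close> for
    \<open>norm x \<le> R\<close>, where \<open>arcsin\<close> inverts \<open>sin\<close>.\<close>
  define s where "s = pi / (2 * R)"
  have s: "0 < s" "s * R = pi / 2" using R by (auto simp: s_def)
  define S :: "(real^'p) set" where "S = cbox (\<chi> i. -1) (\<chi> i. 1)"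
  define G where "G = (\<lambda>u::real^'p. g (\<chi> i. arcsin (u $ i) / s))"
  have "continuous_on S (\<lambda>u. (\<chi> i. arcsin (u $ i) / s))"
    by (intro continuous_intros) (auto simp: S_def mem_box_cart s less_imp_neq[symmetric])
  then have "continuous_on S (g \<circ> (\<lambda>u. (\<chi> i. arcsin (u $ i) / s)))"
    by (intro continuous_on_compose continuous_on_subset[OF cont]) auto
  then have "continuous_on S G" by (simp add: o_def G_def)
  moreover have "compact S" by (simp add: S_def)
  ultimately obtain q where q: "real_polynomial_function q" "\<And>u. u \<in> S \<Longrightarrow> \<bar>G u - q u\<bar> < e"
    using Stone_Weierstrass_real_polynomial_function[OF _ _ e, of S G] by metis
  define h where "h = (\<lambda>x::real^'p. q (\<chi> i. sin (s * x $ i)))"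
  have inS: "(\<chi> i. sin (s * x $ i)) \<in> S" for x :: "real^'p" by (simp add: S_def mem_box_cart)
  show ?thesis
  proof
    show "h \<in> trig_poly" unfolding h_def by (rule trig_poly_polynomial_sin[OF q(1)])
    show "\<bar>h x\<bar> \<le> B + e" for x
      using q(2)[OF inS[of x]] B[of "\<chi> i. arcsin ((\<chi> i. sin (s * x $ i)) $ i) / s"] by (simp add: h_def G_def)
    fix x :: "real^'p" assume x: "norm x \<le> R"
    have "arcsin (sin (s * x $ i)) / s = x $ i" for i
    proof -
      have "\<bar>x $ i\<bar> \<le> R" using component_le_norm_cart[of x i] x by simp
      then have "\<bar>s * x $ i\<bar> \<le> pi / 2" unfolding abs_mult using s by (metis abs_of_pos mult_left_mono less_imp_le)
      then have "arcsin (sin (s * x $ i)) = s * x $ i" by (intro arcsin_sin) (simp_all add: abs_le_iff)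
      then show ?thesis using s by simp
    qed
    then have "G (\<chi> i. sin (s * x $ i)) = g x" by (simp add: G_def)
    then show "\<bar>h x - g x\<bar> \<le> e" using q(2)[OF inS[of x]] by (simp add: h_def abs_minus_commute)
  qed
qed

text \<open>The integrands differ by at most \<open>e\<close> inside the ball and by at most
  \<open>2 * B + e\<close> outside. Used twice: for the random vectors and, with the identity map,
  for the limit measure.\<close>

lemma (in prob_space) expectation_diff_tail:
  fixes g h :: "'b::real_normed_vector \<Rightarrow> real"
  assumes [measurable]: "Z \<in> borel_measurable M" "g \<in> borel_measurable borel" "h \<in> borel_measurable borel"
    and g: "\<And>x. \<bar>g x\<bar> \<le> B" and h: "\<And>x. \<bar>h x\<bar> \<le> B + e" and gh: "\<And>x. norm x \<le> R \<Longrightarrow> \<bar>h x - g x\<bar> \<le> e" and e: "0 < e"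
  shows "\<bar>expectation (\<lambda>\<omega>. h (Z \<omega>)) - expectation (\<lambda>\<omega>. g (Z \<omega>))\<bar> \<le> e + (2 * B + e) * prob {\<omega>\<in>space M. R < norm (Z \<omega>)}"
proof -
  let ?A = "{\<omega>\<in>space M. R < norm (Z \<omega>)}"
  have B0: "0 \<le> B" using g abs_ge_zero order_trans by blast
  have ig: "integrable M (\<lambda>\<omega>. g (Z \<omega>))" by (rule integrable_const_bound[of _ B]) (use g in auto)
  have ih: "integrable M (\<lambda>\<omega>. h (Z \<omega>))" by (rule integrable_const_bound[of _ "B + e"]) (use h in auto)
  have "\<bar>expectation (\<lambda>\<omega>. h (Z \<omega>)) - expectation (\<lambda>\<omega>. g (Z \<omega>))\<bar> = \<bar>expectation (\<lambda>\<omega>. h (Z \<omega>) - g (Z \<omega>))\<bar>"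
    using ig ih by simp
  also have "\<dots> \<le> expectation (\<lambda>\<omega>. \<bar>h (Z \<omega>) - g (Z \<omega>)\<bar>)" by (rule integral_abs_bound)
  also have "\<dots> \<le> expectation (\<lambda>\<omega>. e + (2 * B + e) * indicator ?A \<omega>)"
  proof (rule integral_mono)
    show "integrable M (\<lambda>\<omega>. \<bar>h (Z \<omega>) - g (Z \<omega>)\<bar>)" using ig ih by auto
    show "integrable M (\<lambda>\<omega>. e + (2 * B + e) * indicator ?A \<omega>)" by (auto intro!: integrable_real_indicator simp: emeasure_eq_measure)
    fix \<omega> assume w: "\<omega> \<in> space M"
    show "\<bar>h (Z \<omega>) - g (Z \<omega>)\<bar> \<le> e + (2 * B + e) * indicator ?A \<omega>"
    proof (cases "R < norm (Z \<omega>)")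
      case True
      then show ?thesis using g[of "Z \<omega>"] h[of "Z \<omega>"] w e by (simp add: indicator_def)
    next
      case False
      then show ?thesis using gh[of "Z \<omega>"] by (simp add: indicator_def)
    qed
  qed
  also have "\<dots> = e + (2 * B + e) * prob ?A"
    by (simp add: integral_add integrable_real_indicator emeasure_eq_measure prob_space)
  finally show ?thesis .
qed

text \<open>Trigonometric polynomials approximate \<open>g\<close> only on a ball, so mass outside
  has to be uniformly small. For the sequence this is the hypothesis \<open>tight\<close>; for the
  single measure \<open>N\<close> it follows from continuity from above.\<close>

theorem conv_distr_char_tight:
  fixes Z :: "nat \<Rightarrow> 'w \<Rightarrow> real^'p"
  assumes M: "prob_space M" and N: "prob_space N" "sets N = sets borel"
    and Z: "\<And>n. Z n \<in> borel_measurable M"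
    and cf: "\<And>t. (\<lambda>n. integral\<^sup>L M (\<lambda>\<omega>. iexp (t \<bullet> Z n \<omega>))) \<longlonglongrightarrow> integral\<^sup>L N (\<lambda>x. iexp (t \<bullet> x))"
    and tight: "\<And>e. 0 < e \<Longrightarrow> \<exists>R. \<forall>\<^sub>F n in sequentially. measure M {\<omega>\<in>space M. R < norm (Z n \<omega>)} \<le> e"
  shows "conv_distr M Z N"
  unfolding conv_distr_def
proof (intro allI impI, elim conjE)
  fix g :: "real^'p \<Rightarrow> real" assume cont: "continuous_on UNIV g" and bdd: "bounded (range g)"
  interpret M: prob_space M by (rule M)
  interpret N: prob_space N by (rule N)
  have g_meas: "g \<in> borel_measurable borel" using cont by (rule borel_measurable_continuous_onI)
  obtain B where B: "\<And>x. \<bar>g x\<bar> \<le> B" using bdd unfolding bounded_iff by auto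
  have B0: "0 \<le> B" using B abs_ge_zero order_trans by blast
  have idN: "(\<lambda>x. x) \<in> borel_measurable N" using N(2) by (simp add: measurable_def)
  show "(\<lambda>n. integral\<^sup>L M (\<lambda>\<omega>. g (Z n \<omega>))) \<longlonglongrightarrow> integral\<^sup>L N g"
    unfolding tendsto_iff
  proof (intro allI impI)
    fix r :: real assume r: "0 < r"
    define e where "e = min 1 (r / 8)"
    have e: "0 < e" "e \<le> 1" "e \<le> r / 8" using r by (auto simp: e_def)
    \<comment> \<open>Tails of mass \<open>d\<close> cost at most \<open>r / 8\<close>, and so does
      \<open>e\<close>. Each replacement of \<open>g\<close> by \<open>h\<close> therefore costs
      \<open>r / 4\<close>, as does the convergence for \<open>h\<close>, and three quarters stay
      below \<open>r\<close>.\<close>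
    define d where "d = r / (8 * (2 * B + 1))"
    have "2 * B + 1 > 0" using B0 by simp
    then have d: "0 < d" "(2 * B + 1) * d = r / 8" using r by (auto simp: d_def field_simps)
    obtain R1 where R1: "\<forall>\<^sub>F n in sequentially. measure M {\<omega>\<in>space M. R1 < norm (Z n \<omega>)} \<le> d" using tight[OF d(1)] by auto
    have normN: "norm \<in> borel_measurable N" using idN by measurable
    have "\<exists>R2::nat. N.prob {x\<in>space N. real R2 < norm x} \<le> d"
    proof -
      have dec: "decseq (\<lambda>k::nat. {x\<in>space N. real k < norm x})" by (auto simp: decseq_def)
      have "(\<lambda>k::nat. N.prob {x\<in>space N. real k < norm x}) \<longlonglongrightarrow> N.prob (\<Inter>k::nat. {x\<in>space N. real k < norm x})"
        by (intro N.finite_Lim_measure_decseq dec) (use normN in auto)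
      moreover have "(\<Inter>k::nat. {x\<in>space N. real k < norm x}) = {}"
      proof (rule equals0I)
        fix x assume "x \<in> (\<Inter>k::nat. {x\<in>space N. real k < norm x})"
        then have "real k < norm x" for k :: nat by blast
        then show False using reals_Archimedean2[of "norm x"] by (meson less_asym)
      qed
      ultimately have "(\<lambda>k::nat. N.prob {x\<in>space N. real k < norm x}) \<longlonglongrightarrow> 0" by simp
      then have "\<forall>\<^sub>F k in sequentially. N.prob {x\<in>space N. real k < norm x} < d" using d(1) by (rule order_tendstoD)
      then show ?thesis by (auto simp: eventually_sequentially intro: less_imp_le)
    qed
    then obtain R2 :: nat where R2: "N.prob {x\<in>space N. real R2 < norm x} \<le> d" by auto
    define R where "R = max (max R1 (real R2)) 1"
    have R: "0 < R" "R1 \<le> R" "real R2 \<le> R" by (auto simp: R_def)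
    obtain h where h: "h \<in> trig_poly" "\<And>x. \<bar>h x\<bar> \<le> B + e" "\<And>x. norm x \<le> R \<Longrightarrow> \<bar>h x - g x\<bar> \<le> e"
      using trig_poly_approx[OF cont B e(1) R(1)] by metis
    have h_meas: "h \<in> borel_measurable borel" using trig_poly_borel_bounded[OF h(1)] by auto
    have bnd: "(2 * B + e) * p \<le> r / 8" if "p \<le> d" "0 \<le> p" for p
    proof -
      have "(2 * B + e) * p \<le> (2 * B + 1) * d" using that e B0 by (intro mult_mono) auto
      then show ?thesis using d by simp
    qed
    have "\<bar>N.expectation (\<lambda>x. h x) - N.expectation (\<lambda>x. g x)\<bar> \<le> e + (2 * B + e) * N.prob {x\<in>space N. R < norm x}"
      by (rule N.expectation_diff_tail[OF idN g_meas h_meas B h(2,3) e(1)])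
    moreover have "N.prob {x\<in>space N. R < norm x} \<le> d"
      using R2 R(3) normN by (intro order_trans[OF N.finite_measure_mono R2]) auto
    ultimately have hN: "\<bar>N.expectation h - N.expectation g\<bar> \<le> r / 4" using bnd[of "N.prob {x\<in>space N. R < norm x}"] e by simp
    have "\<forall>\<^sub>F n in sequentially. dist (integral\<^sup>L M (\<lambda>\<omega>. h (Z n \<omega>))) (integral\<^sup>L N h) < r / 4"
      using trig_poly_expectation_tendsto[OF M N Z cf h(1), unfolded tendsto_iff, rule_format, of "r / 4"] r by simp
    then show "\<forall>\<^sub>F n in sequentially. dist (integral\<^sup>L M (\<lambda>\<omega>. g (Z n \<omega>))) (integral\<^sup>L N g) < r"
      using R1
    proof eventually_elim
      case (elim n)
      note [measurable] = Z
      have "M.prob {\<omega>\<in>space M. R < norm (Z n \<omega>)} \<le> d"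
        using R(2) by (intro order_trans[OF M.finite_measure_mono elim(2)]) auto
      moreover have "\<bar>M.expectation (\<lambda>\<omega>. h (Z n \<omega>)) - M.expectation (\<lambda>\<omega>. g (Z n \<omega>))\<bar> \<le> e + (2 * B + e) * M.prob {\<omega>\<in>space M. R < norm (Z n \<omega>)}"
        by (rule M.expectation_diff_tail[OF Z g_meas h_meas B h(2,3) e(1)])
      ultimately have "\<bar>M.expectation (\<lambda>\<omega>. h (Z n \<omega>)) - M.expectation (\<lambda>\<omega>. g (Z n \<omega>))\<bar> \<le> r / 4"
        using bnd[of "M.prob {\<omega>\<in>space M. R < norm (Z n \<omega>)}"] e by simp
      then show ?case using elim(1) hN r unfolding dist_real_def by linarith
    qed
  qed
qed

text \<open>Rotation invariance of Lebesgue measure from translation invariance and Tonelli. The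
  double integral of b(x) g(x + P y) is evaluated in two ways, where \<open>b\<close> is the
  indicator of the unit ball: shifting y gives the left side times the ball volume, while shifting x
  and using that the ball is invariant under \<open>P\<close> gives the right side times the same
  volume, which is finite and positive.\<close>

lemma nn_integral_orthogonal_image:
  fixes P :: "real^'p^'p"
  assumes P: "orthogonal_matrix P" and g[measurable]: "g \<in> borel_measurable borel"
  shows "(\<integral>\<^sup>+y. g (P *v y) \<partial>lborel) = (\<integral>\<^sup>+y. g y \<partial>lborel)"
proof -
  define b where "b = (indicator (cball (0::real^'p) 1) :: real^'p \<Rightarrow> ennreal)"
  have bm[measurable]: "b \<in> borel_measurable borel" unfolding b_def by (intro borel_measurable_indicator) simp
  have Pm[measurable]: "(\<lambda>x. P *v x) \<in> borel_measurable borel"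
    by (intro borel_measurable_continuous_onI linear_continuous_on matrix_vector_mul_bounded_linear)
  have PP: "P *v (transpose P *v x) = x" for x
    using P by (simp only: matrix_vector_mul_assoc orthogonal_matrix_def) simp
  have nP: "norm (P *v x) = norm x" for x
    using P orthogonal_transformation_matrix[of "\<lambda>x. P *v x"] by (simp add: orthogonal_transformation)
  have shift: "(\<integral>\<^sup>+y. h (c + y) \<partial>lborel) = (\<integral>\<^sup>+y. h y \<partial>lborel)"
    if [measurable]: "h \<in> borel_measurable borel" for h :: "real^'p \<Rightarrow> ennreal" and c
    by (subst (2) lborel_distr_plus[of c, symmetric]) (simp add: nn_integral_distr)
  \<comment> \<open>Reflection invariance is required for \<open>b\<close> alone, where it comes
    from the symmetry of the ball.\<close>
  have refl: "(\<integral>\<^sup>+y. b (c - y) \<partial>lborel) = (\<integral>\<^sup>+y. b y \<partial>lborel)" for c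
  proof -
    have "b (c - y) = b (- c + y)" for y
      unfolding b_def indicator_def by (simp add: norm_minus_commute)
    then show ?thesis using shift[of b "- c"] by simp
  qed
  have "(\<integral>\<^sup>+x. b x \<partial>lborel) * (\<integral>\<^sup>+y. g (P *v y) \<partial>lborel) = (\<integral>\<^sup>+x. (\<integral>\<^sup>+y. b x * g (P *v y) \<partial>lborel) \<partial>lborel)"
    by (simp add: nn_integral_cmult nn_integral_multc)
  also have "\<dots> = (\<integral>\<^sup>+x. (\<integral>\<^sup>+y. b x * g (x + P *v y) \<partial>lborel) \<partial>lborel)"
  proof (rule nn_integral_cong)
    fix x
    have "(\<integral>\<^sup>+y. b x * g (P *v (transpose P *v x + y)) \<partial>lborel) = (\<integral>\<^sup>+y. b x * g (P *v y) \<partial>lborel)"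
      by (rule shift[of "\<lambda>y. b x * g (P *v y)"]) measurable
    then show "(\<integral>\<^sup>+y. b x * g (P *v y) \<partial>lborel) = (\<integral>\<^sup>+y. b x * g (x + P *v y) \<partial>lborel)"
      by (simp only: matrix_vector_right_distrib PP)
  qed
  also have "\<dots> = (\<integral>\<^sup>+y. (\<integral>\<^sup>+x. b x * g (x + P *v y) \<partial>lborel) \<partial>lborel)"
    by (rule lborel_pair.Fubini') measurable
  also have "\<dots> = (\<integral>\<^sup>+y. (\<integral>\<^sup>+x. b (x - P *v y) * g x \<partial>lborel) \<partial>lborel)"
  proof (rule nn_integral_cong)
    fix y
    have "(\<integral>\<^sup>+x. b ((P *v y + x) - P *v y) * g (P *v y + x) \<partial>lborel) = (\<integral>\<^sup>+x. b (x - P *v y) * g x \<partial>lborel)"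
      by (rule shift[of "\<lambda>x. b (x - P *v y) * g x"]) measurable
    then show "(\<integral>\<^sup>+x. b x * g (x + P *v y) \<partial>lborel) = (\<integral>\<^sup>+x. b (x - P *v y) * g x \<partial>lborel)"
      by (simp add: add.commute)
  qed
  also have "\<dots> = (\<integral>\<^sup>+x. (\<integral>\<^sup>+y. b (x - P *v y) * g x \<partial>lborel) \<partial>lborel)"
    by (rule lborel_pair.Fubini') measurable
  also have "\<dots> = (\<integral>\<^sup>+x. (\<integral>\<^sup>+y. b (transpose P *v x - y) * g x \<partial>lborel) \<partial>lborel)"
  proof -
    have "norm (x - P *v y) = norm (transpose P *v x - y)" for x y
      using nP[of "transpose P *v x - y"] by (simp only: matrix_vector_mult_diff_distrib PP)
    then have "b (x - P *v y) = b (transpose P *v x - y)" for x y by (simp only: b_def indicator_def mem_cball_0)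
    then show ?thesis by (simp only:)
  qed
  also have "\<dots> = (\<integral>\<^sup>+x. b x \<partial>lborel) * (\<integral>\<^sup>+x. g x \<partial>lborel)"
    by (simp add: nn_integral_multc refl nn_integral_cmult)
  finally have eq: "(\<integral>\<^sup>+x. b x \<partial>lborel) * (\<integral>\<^sup>+y. g (P *v y) \<partial>lborel) = (\<integral>\<^sup>+x. b x \<partial>lborel) * (\<integral>\<^sup>+x. g x \<partial>lborel)" .
  have bb: "(\<integral>\<^sup>+x. b x \<partial>lborel) = emeasure lborel (cball (0::real^'p) 1)" by (simp add: b_def)
  have "emeasure lborel (cball (0::real^'p) 1) \<noteq> \<top>" using emeasure_lborel_cball_finite[of "0::real^'p" 1] by auto
  moreover have "emeasure lborel (cball (0::real^'p) 1) \<noteq> 0"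
  proof
    assume "emeasure lborel (cball (0::real^'p) 1) = 0"
    then have "negligible (cball (0::real^'p) 1)" by (simp add: negligible_iff_null_sets null_sets_completionI null_setsI)
    then show False using open_not_negligible[of "ball (0::real^'p) 1"] negligible_subset[OF _ ball_subset_cball] by auto
  qed
  ultimately show ?thesis using eq unfolding bb by (simp add: ennreal_mult_cancel_left)
qed

lemma distr_lborel_orthogonal:
  fixes P :: "real^'p^'p"
  assumes P: "orthogonal_matrix P"
  shows "distr lborel borel (\<lambda>x. P *v x) = lborel"
proof (rule measure_eqI)
  have Pm[measurable]: "(\<lambda>x. P *v x) \<in> borel_measurable borel"
    by (intro borel_measurable_continuous_onI linear_continuous_on matrix_vector_mul_bounded_linear)
  fix A assume "A \<in> sets (distr lborel borel (\<lambda>x. P *v x))"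
  then have A[measurable]: "A \<in> sets borel" by simp
  have "emeasure (distr lborel borel (\<lambda>x. P *v x)) A = (\<integral>\<^sup>+y. indicator A y \<partial>distr lborel borel (\<lambda>x. P *v x))"
    by (subst nn_integral_indicator) auto
  also have "\<dots> = (\<integral>\<^sup>+y. indicator A (P *v y) \<partial>lborel)" by (subst nn_integral_distr) auto
  also have "\<dots> = (\<integral>\<^sup>+y. indicator A y \<partial>lborel)" by (rule nn_integral_orthogonal_image[OF P]) simp
  finally show "emeasure (distr lborel borel (\<lambda>x. P *v x)) A = emeasure lborel A" by simp
qed simp

section \<open>Gaussian characteristic functions\<close>

lemma bij_betw_axis_Basis: "bij_betw (\<lambda>i. axis i 1) UNIV (Basis :: (real^'p) set)"
  by (auto simp: bij_betw_def inj_def axis_eq_axis Basis_vec_def)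

lemma normal_density_char:
  assumes s: "0 < s"
  shows "integrable lborel (\<lambda>x. complex_of_real (Distributions.normal_density 0 s x) * iexp (t * x))"
    and "integral\<^sup>L lborel (\<lambda>x. complex_of_real (Distributions.normal_density 0 s x) * iexp (t * x)) = complex_of_real (exp (- (s\<^sup>2 * t\<^sup>2) / 2))"
proof -
  show "integrable lborel (\<lambda>x. complex_of_real (Distributions.normal_density 0 s x) * iexp (t * x))"
  proof (rule Bochner_Integration.integrable_bound)
    show "integrable lborel (Distributions.normal_density 0 s)" using s by (rule integrable_normal_density)
  qed (auto simp: norm_mult)
  have "integral\<^sup>L lborel (\<lambda>x. complex_of_real (Distributions.normal_density 0 s x) * iexp (t * x))
    = \<bar>s\<bar> *\<^sub>R integral\<^sup>L lborel (\<lambda>x. complex_of_real (Distributions.normal_density 0 s (0 + s * x)) * iexp (t * (0 + s * x)))"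
    by (rule lborel_integral_real_affine) (use s in simp)
  also have "\<dots> = integral\<^sup>L lborel (\<lambda>x. complex_of_real (std_normal_density x) * iexp ((s * t) * x))"
  proof -
    have "s * Distributions.normal_density 0 s (s * x) = std_normal_density x" for x
      using s by (simp add: Distributions.normal_density_def real_sqrt_mult power_mult_distrib)
    then have "s *\<^sub>R (complex_of_real (Distributions.normal_density 0 s (s * x)) * iexp (t * (s * x))) = complex_of_real (std_normal_density x) * iexp ((s * t) * x)" for x
      by (simp add: scaleR_conv_of_real mult.assoc[symmetric] mult.commute[of t] flip: of_real_mult)
    then show ?thesis using s by (simp flip: integral_scaleR_right)
  qed
  also have "\<dots> = char std_normal_distribution (s * t)"
    unfolding char_def by (subst integral_density) (auto simp: scaleR_conv_of_real)
  finally show "integral\<^sup>L lborel (\<lambda>x. complex_of_real (Distributions.normal_density 0 s x) * iexp (t * x)) = complex_of_real (exp (- (s\<^sup>2 * t\<^sup>2) / 2))"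
    by (simp add: char_std_normal_distribution power_mult_distrib)
qed

text \<open>With independent coordinates the integrand is a product of one-dimensional ones.
  \<open>lborel\<close> is the image of a product measure indexed by \<open>Basis\<close>, so the
  index type \<open>'p\<close> is exchanged for basis vectors through \<open>k\<close> before Fubini
  applies.\<close>

lemma diag_gaussian_integral:
  fixes t :: "real^'p"
  assumes s: "\<And>i. 0 < s i"
  shows "integral\<^sup>L lborel (\<lambda>y::real^'p. complex_of_real (\<Prod>i\<in>UNIV. Distributions.normal_density 0 (s i) (y $ i)) * iexp (t \<bullet> y))
    = complex_of_real (exp (- (\<Sum>i\<in>UNIV. (s i)\<^sup>2 * (t $ i)\<^sup>2) / 2))"
proof -
  interpret P: product_sigma_finite "\<lambda>_::real^'p. lborel :: real measure" by standard
  define k where "k = the_inv_into UNIV (\<lambda>i. axis i 1 :: real^'p)"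
  have k: "k (axis i 1) = i" for i
    unfolding k_def by (rule the_inv_into_f_f) (auto simp: inj_def axis_eq_axis)
  have reidx: "(\<Prod>i\<in>UNIV. h i) = (\<Prod>b\<in>Basis. h (k b))" for h :: "'p \<Rightarrow> complex"
    by (subst prod.reindex_bij_betw[OF bij_betw_axis_Basis, symmetric]) (simp add: k)
  define \<phi> where "\<phi> = (\<lambda>(b::real^'p) x. complex_of_real (Distributions.normal_density 0 (s (k b)) x) * iexp ((t $ (k b)) * x))"
  have "integral\<^sup>L lborel (\<lambda>y::real^'p. complex_of_real (\<Prod>i\<in>UNIV. Distributions.normal_density 0 (s i) (y $ i)) * iexp (t \<bullet> y))
    = integral\<^sup>L lborel (\<lambda>y::real^'p. \<Prod>b\<in>Basis. \<phi> b (y \<bullet> b))"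
  proof (intro Bochner_Integration.integral_cong refl)
    fix y :: "real^'p"
    have "iexp (t \<bullet> y) = (\<Prod>i\<in>UNIV. iexp (t $ i * y $ i))"
      by (simp add: exp_sum[symmetric] sum_distrib_left inner_vec_def)
    then have "complex_of_real (\<Prod>i\<in>UNIV. Distributions.normal_density 0 (s i) (y $ i)) * iexp (t \<bullet> y)
      = (\<Prod>i\<in>UNIV. complex_of_real (Distributions.normal_density 0 (s i) (y $ i)) * iexp (t $ i * y $ i))"
      by (simp add: prod.distrib)
    also have "\<dots> = (\<Prod>b\<in>Basis. \<phi> b (y $ k b))" unfolding reidx \<phi>_def by simp
    also have "\<dots> = (\<Prod>b\<in>Basis. \<phi> b (y \<bullet> b))"
    proof (intro prod.cong refl)
      fix b :: "real^'p" assume "b \<in> Basis"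
      then obtain i where "b = axis i 1" using bij_betw_axis_Basis by (auto simp: bij_betw_def)
      then show "\<phi> b (y $ k b) = \<phi> b (y \<bullet> b)" by (simp add: k inner_axis)
    qed
    finally show "complex_of_real (\<Prod>i\<in>UNIV. Distributions.normal_density 0 (s i) (y $ i)) * iexp (t \<bullet> y) = (\<Prod>b\<in>Basis. \<phi> b (y \<bullet> b))" .
  qed
  also have "\<dots> = integral\<^sup>L (\<Pi>\<^sub>M b\<in>Basis. lborel) (\<lambda>f. \<Prod>b\<in>Basis. \<phi> b ((\<Sum>c\<in>Basis. f c *\<^sub>R c) \<bullet> b))"
  proof -
    have "(\<lambda>y::real^'p. \<Prod>b\<in>Basis. \<phi> b (y \<bullet> b)) \<in> borel_measurable borel" unfolding \<phi>_def by measurable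
    then show ?thesis by (subst lborel_eq) (subst integral_distr, auto)
  qed
  also have "\<dots> = integral\<^sup>L (\<Pi>\<^sub>M b\<in>Basis. lborel) (\<lambda>f. \<Prod>b\<in>Basis. \<phi> b (f b))"
    by (intro Bochner_Integration.integral_cong refl prod.cong) (simp add: inner_sum_left inner_Basis if_distrib cong: if_cong)
  also have "\<dots> = (\<Prod>b\<in>Basis. integral\<^sup>L lborel (\<phi> b))"
    by (rule P.product_integral_prod) (auto intro!: normal_density_char(1)[OF s, simplified] simp: \<phi>_def)
  also have "\<dots> = (\<Prod>i\<in>UNIV. complex_of_real (exp (- ((s i)\<^sup>2 * (t $ i)\<^sup>2) / 2)))"
    unfolding reidx \<phi>_def by (intro prod.cong refl) (rule normal_density_char(2)[OF s])
  also have "\<dots> = complex_of_real (exp (\<Sum>i\<in>UNIV. - ((s i)\<^sup>2 * (t $ i)\<^sup>2) / 2))" by (simp add: exp_sum)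
  also have "(\<Sum>i\<in>UNIV. - ((s i)\<^sup>2 * (t $ i)\<^sup>2) / 2) = - (\<Sum>i\<in>UNIV. (s i)\<^sup>2 * (t $ i)\<^sup>2) / 2"
    by (simp add: sum_negf sum_divide_distrib)
  finally show ?thesis .
qed

text \<open>The orthogonal substitution x = P y diagonalizes the covariance and leaves
  \<open>lborel\<close> invariant; the density then factors into one-dimensional normal densities
  with variances \<open>d i\<close>.\<close>

theorem mv_normal_char:
  fixes C :: "real^'p^'p"
  assumes C: "transpose C = C" "pos_def C"
  shows "integral\<^sup>L (mv_normal C) (\<lambda>x. iexp (t \<bullet> x)) = complex_of_real (exp (- (t \<bullet> (C *v t)) / 2))"
    and "prob_space (mv_normal C)" and "sets (mv_normal C) = sets borel"
proof -
  show sets: "sets (mv_normal C) = sets borel" by (simp add: mv_normal_def)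
  obtain P d where P: "orthogonal_matrix P" "C = P ** diag_mat d ** transpose P" "\<forall>i. 0 < d i"
    by (rule spd_spectral[OF C])
  have d0: "0 < d i" for i using P(3) by simp
  have PP: "transpose P ** P = mat 1" "P ** transpose P = mat 1" using P(1) by (auto simp: orthogonal_matrix_def)
  have Pm: "(\<lambda>x. P *v x) \<in> borel_measurable borel"
    by (intro borel_measurable_continuous_onI linear_continuous_on matrix_vector_mul_bounded_linear)
  have "det P * det P = 1" using det_orthogonal_matrix[OF P(1)] by auto
  then have detC: "det C = prod d UNIV" unfolding P(2) by (simp add: det_mul diag_mat_simps mult_ac)
  have detC0: "0 < det C" by (rule spd_det_pos[OF C])
  have "C ** (P ** diag_mat (\<lambda>i. 1 / d i) ** transpose P) = P ** diag_mat d ** (transpose P ** P) ** diag_mat (\<lambda>i. 1 / d i) ** transpose P"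
    unfolding P(2) by (simp only: matrix_mul_assoc)
  also have "\<dots> = P ** (diag_mat d ** diag_mat (\<lambda>i. 1 / d i)) ** transpose P" by (simp add: PP matrix_mul_assoc)
  also have "\<dots> = mat 1" using d0 by (simp add: diag_mat_simps PP less_imp_neq[symmetric])
  finally have Ci: "matrix_inv C = P ** diag_mat (\<lambda>i. 1 / d i) ** transpose P" by (rule matrix_inv_unique)
  have dens0: "0 \<le> Defs.normal_density C x" for x using detC0 by (simp add: Defs.normal_density_def)
  have dens_meas: "Defs.normal_density C \<in> borel_measurable borel"
    unfolding Defs.normal_density_def[abs_def]
    by (intro borel_measurable_continuous_onI continuous_intros linear_continuous_on matrix_vector_mul_bounded_linear) (use detC0 in auto)
  have dens: "Defs.normal_density C (P *v y) = (\<Prod>i\<in>UNIV. Distributions.normal_density 0 (sqrt (d i)) (y $ i))" for y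
  proof -
    have "(P *v y) \<bullet> (matrix_inv C *v (P *v y)) = y \<bullet> ((transpose P ** P) *v (diag_mat (\<lambda>i. 1 / d i) *v ((transpose P ** P) *v y)))"
      unfolding Ci by (simp only: matrix_vector_mul_assoc[symmetric] inner_transpose_mult)
    also have "\<dots> = (\<Sum>i\<in>UNIV. (y $ i)\<^sup>2 / d i)"
      by (simp add: PP diag_mat_simps inner_vec_def power2_eq_square)
    finally have "exp (- ((P *v y) \<bullet> (matrix_inv C *v (P *v y))) / 2) = (\<Prod>i\<in>UNIV. exp (- ((y $ i)\<^sup>2 / (2 * d i))))"
      by (subst exp_sum[symmetric]) (simp_all add: sum_negf sum_divide_distrib mult.commute)
    moreover have "(2 * pi) powr (- real CARD('p) / 2) / sqrt (det C) = (\<Prod>i\<in>(UNIV::'p set). 1 / sqrt (2 * pi * d i))"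
    proof -
      have "(1 / sqrt (2 * pi)) = (2 * pi) powr (- (1 / 2))"
        by (simp add: powr_minus_divide powr_half_sqrt)
      then have "(1 / sqrt (2 * pi)) ^ CARD('p) = ((2 * pi) powr (- (1 / 2))) ^ CARD('p)" by simp
      also have "\<dots> = (2 * pi) powr (- real CARD('p) / 2)" by (simp add: powr_power)
      finally have "(2 * pi) powr (- real CARD('p) / 2) = (\<Prod>i\<in>(UNIV::'p set). 1 / sqrt (2 * pi))" by simp
      moreover have "sqrt (det C) = (\<Prod>i\<in>(UNIV::'p set). sqrt (d i))"
        unfolding detC by (rule real_sqrt_unique) (simp_all add: prod_power_distrib less_imp_le[OF d0] prod_nonneg)
      ultimately have "(2 * pi) powr (- real CARD('p) / 2) / sqrt (det C) = (\<Prod>i\<in>(UNIV::'p set). (1 / sqrt (2 * pi)) / sqrt (d i))"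
        by (simp only: prod_dividef)
      then show ?thesis by (simp add: real_sqrt_mult mult.assoc)
    qed
    ultimately show ?thesis unfolding Defs.normal_density_def
      by (simp add: Distributions.normal_density_def prod.distrib[symmetric] d0 less_imp_le)
  qed
  have gen: "integral\<^sup>L (mv_normal C) (\<lambda>x. iexp (t \<bullet> x)) = complex_of_real (exp (- (t \<bullet> (C *v t)) / 2))" for t
  proof -
    have m1: "(\<lambda>x::real^'p. complex_of_real (Defs.normal_density C x) * iexp (t \<bullet> x)) \<in> borel_measurable borel"
      using dens_meas by measurable
    have "integral\<^sup>L (mv_normal C) (\<lambda>x. iexp (t \<bullet> x)) = integral\<^sup>L lborel (\<lambda>x. complex_of_real (Defs.normal_density C x) * iexp (t \<bullet> x))"
      unfolding mv_normal_def using dens0 dens_meas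
      by (subst integral_density) (auto simp: scaleR_conv_of_real)
    also have "\<dots> = integral\<^sup>L (distr lborel borel (\<lambda>x. P *v x)) (\<lambda>x. complex_of_real (Defs.normal_density C x) * iexp (t \<bullet> x))"
      by (simp only: distr_lborel_orthogonal[OF P(1)])
    also have "\<dots> = integral\<^sup>L lborel (\<lambda>y. complex_of_real (Defs.normal_density C (P *v y)) * iexp (t \<bullet> (P *v y)))"
      using m1 Pm by (subst integral_distr) auto
    also have "\<dots> = integral\<^sup>L lborel (\<lambda>y. complex_of_real (\<Prod>i\<in>UNIV. Distributions.normal_density 0 (sqrt (d i)) (y $ i)) * iexp ((transpose P *v t) \<bullet> y))"
      by (simp only: dens inner_transpose_mult[of _ "transpose P", simplified transpose_transpose])
    also have "\<dots> = complex_of_real (exp (- (\<Sum>i\<in>UNIV. (sqrt (d i))\<^sup>2 * ((transpose P *v t) $ i)\<^sup>2) / 2))"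
      by (rule diag_gaussian_integral) (simp add: d0)
    also have "(\<Sum>i\<in>UNIV. (sqrt (d i))\<^sup>2 * ((transpose P *v t) $ i)\<^sup>2) = (transpose P *v t) \<bullet> (diag_mat d *v (transpose P *v t))"
      using d0 by (simp add: inner_vec_def diag_mat_simps power2_eq_square less_imp_le mult_ac flip: transpose_matrix_vector)
    also have "\<dots> = t \<bullet> (C *v t)"
      unfolding P(2) matrix_vector_mul_assoc[symmetric] by (simp only: inner_transpose_mult[of _ "transpose P", simplified transpose_transpose])
    finally show ?thesis .
  qed
  then show "integral\<^sup>L (mv_normal C) (\<lambda>x. iexp (t \<bullet> x)) = complex_of_real (exp (- (t \<bullet> (C *v t)) / 2))" .
  \<comment> \<open>Total mass is read off from the characteristic function at 0. Since a
    nonintegrable function has Bochner integral 0, the value 1 also shows that the measure is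
    finite.\<close>
  have one: "integral\<^sup>L (mv_normal C) (\<lambda>x. 1 :: complex) = 1" using gen[of 0] by simp
  then have "integrable (mv_normal C) (\<lambda>x. 1 :: complex)" using not_integrable_integral_eq by fastforce
  then have fin: "emeasure (mv_normal C) (space (mv_normal C)) < \<infinity>" by (simp add: integrable_iff_bounded)
  have "measure (mv_normal C) (space (mv_normal C)) = 1" using one by (simp add: scaleR_conv_of_real)
  then show "prob_space (mv_normal C)"
    using fin by (intro prob_spaceI) (simp add: emeasure_eq_ennreal_measure less_top)
qed

section \<open>Identifiability\<close>

text \<open>A \<open>d\<close>-separated subset of \<open>Z\<close> of maximal size is a net, since
  a point far from all its elements could be added. It has fewer than \<open>CARD('p)\<close>
  elements, because otherwise it would contain a tuple excluded by \<open>no\<close>.\<close>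

lemma separated_cover:
  fixes Z :: "'x::metric_space set"
  assumes no: "\<And>z :: 'p::finite \<Rightarrow> 'x. range z \<subseteq> Z \<Longrightarrow> \<exists>i j. i \<noteq> j \<and> dist (z i) (z j) < d" and d: "0 < d"
  obtains S where "finite S" "S \<subseteq> Z" "card S < CARD('p)" "\<And>x. x \<in> Z \<Longrightarrow> \<exists>c\<in>S. dist x c < d"
proof -
  define P where "P S \<longleftrightarrow> finite S \<and> S \<subseteq> Z \<and> (\<forall>x\<in>S. \<forall>y\<in>S. x \<noteq> y \<longrightarrow> d \<le> dist x y)" for S
  have card: "card S < CARD('p)" if "P S" for S
  proof (rule ccontr)
    assume "\<not> card S < CARD('p)"
    moreover have "finite S" using that by (simp add: P_def)
    ultimately obtain z :: "'p \<Rightarrow> 'x" where z: "inj z" "range z \<subseteq> S"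
      using card_le_inj[of "UNIV :: 'p set" S] by (auto simp: not_less)
    have "range z \<subseteq> Z" using z that by (auto simp: P_def)
    from no[OF this] obtain i j where ij: "i \<noteq> j" "dist (z i) (z j) < d" by auto
    have "z i \<in> S" "z j \<in> S" "z i \<noteq> z j" using z ij(1) by (auto simp: inj_def)
    then have "d \<le> dist (z i) (z j)" using that by (auto simp: P_def)
    then show False using ij by simp
  qed
  have "P {}" by (simp add: P_def)
  obtain S where S: "P S" "\<And>T. P T \<Longrightarrow> card T \<le> card S"
    using ex_has_greatest_nat[of P "{}" card "CARD('p)"] \<open>P {}\<close> card by (meson less_imp_le)
  show ?thesis
  proof (rule that[of S])
    fix x assume x: "x \<in> Z"
    show "\<exists>c\<in>S. dist x c < d"
    proof (rule ccontr)
      assume *: "\<not> ?thesis"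
      then have "x \<notin> S" using d by force
      moreover have "P (insert x S)" using * S(1) x by (auto simp: P_def not_less dist_commute)
      ultimately show False using S(2)[of "insert x S"] S(1) by (auto simp: P_def)
    qed
  qed (use S card in \<open>auto simp: P_def\<close>)
qed

text \<open>A quantitative form of saturated identifiability by compactness. Distinctness of design
  points is not a closed condition, so it is replaced by \<open>d\<close>-separation; on the compact
  set \<open>W\<close> of separated tuples and remote parameters the total discrepancy of the means
  is continuous and positive.\<close>

lemma separated_identifiability:
  fixes XX :: "'x::metric_space set" and \<mu> :: "'x \<Rightarrow> 't::metric_space \<Rightarrow> real"
  assumes cX: "compact XX" and cT: "compact \<Theta>" and cont: "continuous_on (XX \<times> \<Theta>) (\<lambda>(x, \<theta>). \<mu> x \<theta>)"
    and ident: "\<forall>z :: 'p::finite \<Rightarrow> 'x. inj z \<and> range z \<subseteq> XX \<longrightarrow>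
         (\<forall>\<theta>\<in>\<Theta>. \<forall>\<theta>'\<in>\<Theta>. (\<forall>j. \<mu> (z j) \<theta> = \<mu> (z j) \<theta>') \<longrightarrow> \<theta> = \<theta>')"
    and \<theta>bar: "\<theta>bar \<in> \<Theta>" and d: "0 < d" and e: "0 < e"
  obtains \<beta> where "0 < \<beta>" "\<And>\<theta> (z :: 'p \<Rightarrow> 'x). \<theta> \<in> \<Theta> \<Longrightarrow> e \<le> dist \<theta> \<theta>bar \<Longrightarrow>
    range z \<subseteq> {x\<in>XX. \<bar>\<mu> x \<theta> - \<mu> x \<theta>bar\<bar> < \<beta>} \<Longrightarrow> \<exists>i j. i \<noteq> j \<and> dist (z i) (z j) < d"
proof -
  define Zs where "Zs = {z :: 'p \<Rightarrow> 'x. range z \<subseteq> XX}"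
  have "Zs = PiE UNIV (\<lambda>_. XX)" by (auto simp: Zs_def PiE_def Pi_def)
  moreover have "compactin (product_topology (\<lambda>_::'p. euclidean) UNIV) (PiE UNIV (\<lambda>_. XX))"
    using cX by (subst compactin_PiE) auto
  ultimately have cZ: "compact Zs" by (simp add: euclidean_product_topology)
  \<comment> \<open>Tuples are functions on the finite type \<open>'p\<close>, and compactness of
    their set is that of a product space.\<close>
  define W where "W = (Zs \<times> (\<Theta> \<inter> {\<theta>. e \<le> dist \<theta> \<theta>bar})) \<inter> {y. \<forall>i j. i \<noteq> j \<longrightarrow> d \<le> dist (fst y i) (fst y j)}"
  have ev: "continuous_on A (\<lambda>y. fst y i)" for A :: "(('p \<Rightarrow> 'x) \<times> 't) set" and i
    using continuous_on_product_then_coordinatewise[OF continuous_on_fst[OF continuous_on_id]] by fastforce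
  have "closed {\<theta>. e \<le> dist \<theta> \<theta>bar}" by (intro closed_Collect_le continuous_intros)
  then have c1: "compact (Zs \<times> (\<Theta> \<inter> {\<theta>. e \<le> dist \<theta> \<theta>bar}))" using cZ cT by (intro compact_Times compact_Int_closed)
  have "closed {y :: ('p \<Rightarrow> 'x) \<times> 't. i \<noteq> j \<longrightarrow> d \<le> dist (fst y i) (fst y j)}" for i j
    by (cases "i = j") (auto intro!: closed_Collect_le continuous_intros ev)
  then have c2: "closed {y :: ('p \<Rightarrow> 'x) \<times> 't. \<forall>i j. i \<noteq> j \<longrightarrow> d \<le> dist (fst y i) (fst y j)}"
    by (intro closed_Collect_all) auto
  have cW: "compact W" unfolding W_def by (rule compact_Int_closed[OF c1 c2])
  define \<phi> where "\<phi> y = (\<Sum>j\<in>UNIV. \<bar>\<mu> (fst y j) (snd y) - \<mu> (fst y j) \<theta>bar\<bar>)" for y :: "('p \<Rightarrow> 'x) \<times> 't"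
  have "continuous_on W (\<lambda>y. \<mu> (fst y j) (snd y))" for j
  proof -
    have "continuous_on W ((\<lambda>(x, \<theta>). \<mu> x \<theta>) \<circ> (\<lambda>y. (fst y j, snd y)))"
      by (intro continuous_on_compose continuous_on_subset[OF cont] continuous_intros ev) (auto simp: W_def Zs_def)
    then show ?thesis by (simp add: o_def)
  qed
  moreover have "continuous_on W (\<lambda>y. \<mu> (fst y j) \<theta>bar)" for j
  proof -
    have "continuous_on W ((\<lambda>(x, \<theta>). \<mu> x \<theta>) \<circ> (\<lambda>y. (fst y j, \<theta>bar)))"
      by (intro continuous_on_compose continuous_on_subset[OF cont] continuous_intros ev) (auto simp: W_def Zs_def \<theta>bar)
    then show ?thesis by (simp add: o_def)
  qed
  ultimately have c\<phi>: "continuous_on W \<phi>" unfolding \<phi>_def[abs_def] by (intro continuous_intros)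
  show ?thesis
  proof (cases "W = {}")
    case True
    show ?thesis
    proof (rule that[of 1])
      fix \<theta> and z :: "'p \<Rightarrow> 'x"
      assume *: "\<theta> \<in> \<Theta>" "e \<le> dist \<theta> \<theta>bar" "range z \<subseteq> {x\<in>XX. \<bar>\<mu> x \<theta> - \<mu> x \<theta>bar\<bar> < 1}"
      have "(z, \<theta>) \<notin> W" using True by simp
      then have "\<not> (\<forall>i j. i \<noteq> j \<longrightarrow> d \<le> dist (z i) (z j))" using * by (auto simp: W_def Zs_def)
      then show "\<exists>i j. i \<noteq> j \<and> dist (z i) (z j) < d" by (auto simp: not_le)
    qed simp
  next
    case False
    obtain y where y: "y \<in> W" "\<And>y'. y' \<in> W \<Longrightarrow> \<phi> y \<le> \<phi> y'"
      using continuous_attains_inf[OF cW False c\<phi>] by blast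
    have "\<phi> y > 0"
    proof (rule ccontr)
      assume "\<not> \<phi> y > 0"
      moreover have "\<phi> y \<ge> 0" unfolding \<phi>_def by (intro sum_nonneg) auto
      ultimately have "\<phi> y = 0" by simp
      then have eq: "\<forall>j. \<mu> (fst y j) (snd y) = \<mu> (fst y j) \<theta>bar"
        unfolding \<phi>_def by (subst (asm) sum_nonneg_eq_0_iff) auto
      have "inj (fst y)"
      proof (rule injI, rule ccontr)
        fix i j assume "fst y i = fst y j" "i \<noteq> j"
        then have "d \<le> dist (fst y i) (fst y j)" using y(1) unfolding W_def by blast
        then show False using \<open>fst y i = fst y j\<close> d by simp
      qed
      moreover have "range (fst y) \<subseteq> XX" "snd y \<in> \<Theta>" "e \<le> dist (snd y) \<theta>bar" using y(1) by (auto simp: W_def Zs_def)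
      ultimately have "snd y = \<theta>bar" using ident eq \<theta>bar by blast
      then show False using \<open>e \<le> dist (snd y) \<theta>bar\<close> e by simp
    qed
    \<comment> \<open>If all \<open>CARD('p)\<close> discrepancies were below
      \<open>\<beta>\<close>, their sum would fall below the minimum
      \<open>\<phi> y\<close>.\<close>
    define \<beta> where "\<beta> = \<phi> y / CARD('p)"
    show ?thesis
    proof (rule that[of \<beta>])
      show "0 < \<beta>" using \<open>\<phi> y > 0\<close> by (simp add: \<beta>_def)
      fix \<theta> and z :: "'p \<Rightarrow> 'x"
      assume *: "\<theta> \<in> \<Theta>" "e \<le> dist \<theta> \<theta>bar" "range z \<subseteq> {x\<in>XX. \<bar>\<mu> x \<theta> - \<mu> x \<theta>bar\<bar> < \<beta>}"
      show "\<exists>i j. i \<noteq> j \<and> dist (z i) (z j) < d"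
      proof (rule ccontr)
        assume "\<not> ?thesis"
        then have "(z, \<theta>) \<in> W" using * by (auto simp: W_def Zs_def not_less)
        then have "\<phi> y \<le> \<phi> (z, \<theta>)" by (rule y(2))
        also have "\<phi> (z, \<theta>) < (\<Sum>j\<in>(UNIV :: 'p set). \<beta>)"
          unfolding \<phi>_def by (intro sum_strict_mono) (use * in auto)
        also have "\<dots> = \<phi> y" by (simp add: \<beta>_def)
        finally show False by simp
      qed
    qed
  qed
qed

text \<open>The points where \<open>\<theta>\<close> and \<open>\<theta>bar\<close> give nearly
  equal means lie within \<open>d\<close> of fewer than \<open>CARD('p)\<close> points, so some unit
  vector \<open>v\<close> is orthogonal to the regressors at those points and nearly orthogonal to
  all regressors at such design points. The lower bound on the form at \<open>v\<close> must then
  come from the remaining observations, which are a fixed fraction, and each of them contributes at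
  least \<open>\<beta>\<^sup>2\<close>.\<close>

theorem contrast_lower_bound:
  fixes XX :: "'x::metric_space set" and \<mu> :: "'x \<Rightarrow> 't::metric_space \<Rightarrow> real" and g :: "'t \<Rightarrow> 'x \<Rightarrow> real^'p"
  assumes cX: "compact XX" and cT: "compact \<Theta>" and cont: "continuous_on (XX \<times> \<Theta>) (\<lambda>(x, \<theta>). \<mu> x \<theta>)"
    and ident: "\<forall>z :: 'p::finite \<Rightarrow> 'x. inj z \<and> range z \<subseteq> XX \<longrightarrow>
         (\<forall>\<theta>\<in>\<Theta>. \<forall>\<theta>'\<in>\<Theta>. (\<forall>j. \<mu> (z j) \<theta> = \<mu> (z j) \<theta>') \<longrightarrow> \<theta> = \<theta>')"
    and \<theta>bar: "\<theta>bar \<in> \<Theta>" and g: "continuous_on (XX \<times> \<Theta>) (\<lambda>(x, \<theta>). g \<theta> x)" and l: "0 < l" and e: "0 < e"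
  obtains c where "0 < c" "\<And>xs n \<theta>. 1 \<le> n \<Longrightarrow> (\<And>i. 1 \<le> i \<Longrightarrow> xs i \<in> XX) \<Longrightarrow>
    (\<And>v. l * (v \<bullet> v) \<le> v \<bullet> (gram g xs n \<theta>bar *v v)) \<Longrightarrow> \<theta> \<in> \<Theta> \<Longrightarrow> e \<le> dist \<theta> \<theta>bar \<Longrightarrow>
    c * real n \<le> (\<Sum>i=1..n. (\<mu> (xs i) \<theta> - \<mu> (xs i) \<theta>bar)\<^sup>2)"
proof -
  obtain K where K: "0 < K" "\<And>x \<theta>. x \<in> XX \<Longrightarrow> \<theta> \<in> \<Theta> \<Longrightarrow> norm (g \<theta> x) \<le> K"
    using bounded_prodE[OF cX cT g] by metis
  have "0 < sqrt (l / 2)" using l by simp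
  from uniformly_continuous_prodE[OF cX cT g this]
  obtain d where d: "0 < d" "\<And>x x' \<theta> \<theta>'. x \<in> XX \<Longrightarrow> x' \<in> XX \<Longrightarrow> \<theta> \<in> \<Theta> \<Longrightarrow> \<theta>' \<in> \<Theta> \<Longrightarrow>
    dist x x' < d \<Longrightarrow> dist \<theta> \<theta>' < d \<Longrightarrow> dist (g \<theta> x) (g \<theta>' x') < sqrt (l / 2)" by metis
  obtain \<beta> where \<beta>: "0 < \<beta>" "\<And>\<theta> (z :: 'p \<Rightarrow> 'x). \<theta> \<in> \<Theta> \<Longrightarrow> e \<le> dist \<theta> \<theta>bar \<Longrightarrow>
    range z \<subseteq> {x\<in>XX. \<bar>\<mu> x \<theta> - \<mu> x \<theta>bar\<bar> < \<beta>} \<Longrightarrow> \<exists>i j. i \<noteq> j \<and> dist (z i) (z j) < d"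
    by (rule separated_identifiability[OF cX cT cont ident \<theta>bar d(1) e]) blast
  \<comment> \<open>From l n <= n l / 2 + K^2 card I: near points contribute at most
    \<open>l / 2\<close> each, the others at most an additional \<open>K\<^sup>2\<close>.\<close>
  define \<alpha> where "\<alpha> = l / (2 * K\<^sup>2)"
  have \<alpha>: "0 < \<alpha>" using l K by (simp add: \<alpha>_def)
  show ?thesis
  proof (rule that[of "\<beta>\<^sup>2 * \<alpha>"])
    show "0 < \<beta>\<^sup>2 * \<alpha>" using \<alpha> \<beta> by simp
    fix xs n \<theta> assume n: "1 \<le> (n::nat)" and xs: "\<And>i. 1 \<le> i \<Longrightarrow> xs i \<in> XX"
      and lb: "\<And>v. l * (v \<bullet> v) \<le> v \<bullet> (gram g xs n \<theta>bar *v v)" and \<theta>: "\<theta> \<in> \<Theta>" "e \<le> dist \<theta> \<theta>bar"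
    define Z where "Z = {x\<in>XX. \<bar>\<mu> x \<theta> - \<mu> x \<theta>bar\<bar> < \<beta>}"
    obtain S where S: "finite S" "S \<subseteq> Z" "card S < CARD('p)" "\<And>x. x \<in> Z \<Longrightarrow> \<exists>c\<in>S. dist x c < d"
    proof (rule separated_cover[where 'p='p, of Z d])
      show "\<exists>i j. i \<noteq> j \<and> dist (z i) (z j) < d" if "range z \<subseteq> Z" for z :: "'p \<Rightarrow> 'x"
        using \<beta>(2)[OF \<theta>, of z] that unfolding Z_def by simp
    qed (use d(1) in auto)
    have "dim (g \<theta>bar ` S) \<le> card (g \<theta>bar ` S)" using S(1) by (intro dim_le_card') simp
    also have "\<dots> \<le> card S" by (rule card_image_le[OF S(1)])
    finally have "dim (g \<theta>bar ` S) < DIM(real^'p)" using S(3) by simp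
    from orthogonal_to_subspace_exists[OF this]
    obtain v0 where v0: "v0 \<noteq> 0" "\<And>y. y \<in> span (g \<theta>bar ` S) \<Longrightarrow> orthogonal v0 y" by blast
    define v where "v = v0 /\<^sub>R norm v0"
    have v: "norm v = 1" "\<And>c. c \<in> S \<Longrightarrow> g \<theta>bar c \<bullet> v = 0"
    proof -
      show "norm v = 1" using v0(1) by (simp add: v_def)
      fix c assume "c \<in> S"
      then have "orthogonal v0 (g \<theta>bar c)" by (intro v0(2) span_base) simp
      then show "g \<theta>bar c \<bullet> v = 0" by (simp add: v_def orthogonal_def inner_commute)
    qed
    define I where "I = {i\<in>{1..n}. xs i \<notin> Z}"
    have bnd: "(g \<theta>bar (xs i) \<bullet> v)\<^sup>2 \<le> l / 2 + (if i \<in> I then K\<^sup>2 else 0)" if i: "i \<in> {1..n}" for i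
    proof (cases "xs i \<in> Z")
      case True
      then obtain c where c: "c \<in> S" "dist (xs i) c < d" using S(4) by auto
      have cX': "c \<in> XX" using c S(2) by (auto simp: Z_def)
      have "\<bar>g \<theta>bar (xs i) \<bullet> v\<bar> = \<bar>(g \<theta>bar (xs i) - g \<theta>bar c) \<bullet> v\<bar>" using v(2)[OF c(1)] by (simp add: inner_diff_left)
      also have "\<dots> \<le> norm (g \<theta>bar (xs i) - g \<theta>bar c) * norm v" by (rule Cauchy_Schwarz_ineq2)
      also have "\<dots> \<le> sqrt (l / 2)"
        using d(2)[OF xs cX' \<theta>bar \<theta>bar c(2)] i d(1) v(1) by (simp add: dist_norm less_imp_le)
      finally have "(g \<theta>bar (xs i) \<bullet> v)\<^sup>2 \<le> (sqrt (l / 2))\<^sup>2" by (simp add: abs_le_square_iff[symmetric])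
      then have "(g \<theta>bar (xs i) \<bullet> v)\<^sup>2 \<le> l / 2" using l by simp
      then show ?thesis by (simp add: add_increasing2)
    next
      case False
      have "\<bar>g \<theta>bar (xs i) \<bullet> v\<bar> \<le> norm (g \<theta>bar (xs i)) * norm v" by (rule Cauchy_Schwarz_ineq2)
      also have "\<dots> \<le> K" using K(2)[OF xs \<theta>bar] i v(1) by simp
      finally have "(g \<theta>bar (xs i) \<bullet> v)\<^sup>2 \<le> K\<^sup>2" using K(1) by (simp add: abs_le_square_iff[symmetric])
      then show ?thesis using l False i by (simp add: I_def)
    qed
    have "l = l * (v \<bullet> v)" using v(1) by (simp add: dot_square_norm)
    also have "\<dots> \<le> (1 / real n) * (\<Sum>i=1..n. (g \<theta>bar (xs i) \<bullet> v)\<^sup>2)" using lb[of v] by (simp only: gram_form)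
    finally have "l * real n \<le> (\<Sum>i=1..n. (g \<theta>bar (xs i) \<bullet> v)\<^sup>2)" using n by (simp add: field_simps)
    also have "\<dots> \<le> (\<Sum>i=1..n. l / 2 + (if i \<in> I then K\<^sup>2 else 0))" by (intro sum_mono bnd)
    also have "\<dots> = real n * l / 2 + (\<Sum>i\<in>I. K\<^sup>2)"
      unfolding sum.distrib by (subst sum.inter_restrict[symmetric]) (auto simp: I_def intro!: arg_cong[where f=card])
    finally have cardI: "\<alpha> * real n \<le> real (card I)" using K(1) by (simp add: \<alpha>_def field_simps)
    have "\<beta>\<^sup>2 * \<alpha> * real n = \<beta>\<^sup>2 * (\<alpha> * real n)" by simp
    also have "\<dots> \<le> \<beta>\<^sup>2 * real (card I)" using cardI by (intro mult_left_mono) auto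
    also have "\<dots> = (\<Sum>i\<in>I. \<beta>\<^sup>2)" by simp
    also have "\<dots> \<le> (\<Sum>i\<in>I. (\<mu> (xs i) \<theta> - \<mu> (xs i) \<theta>bar)\<^sup>2)"
    proof (intro sum_mono)
      fix i assume "i \<in> I"
      then have "\<beta> \<le> \<bar>\<mu> (xs i) \<theta> - \<mu> (xs i) \<theta>bar\<bar>" using xs by (auto simp: I_def Z_def)
      then show "\<beta>\<^sup>2 \<le> (\<mu> (xs i) \<theta> - \<mu> (xs i) \<theta>bar)\<^sup>2" using \<beta>(1) by (simp add: abs_le_square_iff[symmetric])
    qed
    also have "\<dots> \<le> (\<Sum>i=1..n. (\<mu> (xs i) \<theta> - \<mu> (xs i) \<theta>bar)\<^sup>2)" by (intro sum_mono2) (auto simp: I_def)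
    finally show "\<beta>\<^sup>2 * \<alpha> * real n \<le> (\<Sum>i=1..n. (\<mu> (xs i) \<theta> - \<mu> (xs i) \<theta>bar)\<^sup>2)" .
  qed
qed

section \<open>Martingale difference sequences with bounded conditional variances\<close>

text \<open>The product of 1 - x + x^2/2 and 1 + x + x^2/2 is 1 + x^4/4, and the second factor is a
  lower bound for \<open>exp x\<close>.\<close>

lemma exp_minus_le_quadratic:
  fixes x :: real
  assumes "0 \<le> x"
  shows "exp (- x) \<le> 1 - x + x\<^sup>2 / 2"
proof -
  have pos: "0 < 1 + x + x\<^sup>2 / 2" using assms by (intro add_pos_nonneg) auto
  have "1 \<le> (1 - x + x\<^sup>2 / 2) * (1 + x + x\<^sup>2 / 2)"
  proof -
    have "(1 - x + x\<^sup>2 / 2) * (1 + x + x\<^sup>2 / 2) = 1 + x ^ 4 / 4"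
      by (simp add: field_simps power2_eq_square power4_eq_xxxx)
    then show ?thesis by simp
  qed
  then have "1 / (1 + x + x\<^sup>2 / 2) \<le> 1 - x + x\<^sup>2 / 2" using pos by (simp add: divide_le_eq)
  moreover have "exp (- x) \<le> 1 / (1 + x + x\<^sup>2 / 2)"
    using exp_lower_Taylor_quadratic[OF assms] pos
    by (simp add: exp_minus inverse_eq_divide frac_le)
  ultimately show ?thesis by simp
qed

lemma exp_le_quadratic:
  fixes x :: real
  assumes "\<bar>x\<bar> \<le> 1"
  shows "exp x \<le> 1 + x + x\<^sup>2"
proof (cases "0 \<le> x")
  case True
  then show ?thesis using exp_bound[of x] assms by simp
next
  case False
  then have "exp x \<le> 1 + x + x\<^sup>2 / 2" using exp_minus_le_quadratic[of "- x"] by simp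
  moreover have "x\<^sup>2 / 2 \<le> x\<^sup>2" by simp
  ultimately show ?thesis by linarith
qed

text \<open>The third-order bound is used for \<open>\<bar>x\<bar> \<le> d\<close>, the second-order
  bound beyond; the latter contribution is the one a Lindeberg condition controls.\<close>

lemma iexp_quadratic_remainder:
  fixes x d :: real
  assumes "0 \<le> d"
  shows "cmod (iexp x - (1 + \<i> * x - x\<^sup>2 / 2)) \<le> d * x\<^sup>2 + x\<^sup>2 * (if d < \<bar>x\<bar> then 1 else 0)"
proof -
  have s: "(\<Sum>k\<le>2. (\<i> * x) ^ k / fact k) = 1 + \<i> * x - x\<^sup>2 / 2"
    by (simp add: numeral_2_eq_2 power2_eq_square algebra_simps)
  have a: "cmod (iexp x - (1 + \<i> * x - x\<^sup>2 / 2)) \<le> \<bar>x\<bar> ^ 3 / 6"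
    using iexp_approx1[of x 2] unfolding s by (simp add: numeral_3_eq_3 fact_numeral)
  have b: "cmod (iexp x - (1 + \<i> * x - x\<^sup>2 / 2)) \<le> x\<^sup>2"
    using iexp_approx2[of x 2] unfolding s by simp
  show ?thesis
  proof (cases "d < \<bar>x\<bar>")
    case True
    have "0 \<le> d * x\<^sup>2" using assms by simp
    then show ?thesis using b True by simp
  next
    case False
    have "\<bar>x\<bar> ^ 3 / 6 \<le> \<bar>x\<bar> ^ 3" by simp
    also have "\<dots> = \<bar>x\<bar> * x\<^sup>2" by (simp add: power3_eq_cube power2_eq_square)
    also have "\<dots> \<le> d * x\<^sup>2" using False by (intro mult_right_mono) auto
    finally show ?thesis using a False by simp
  qed
qed

text \<open>Conditional means and variances are expressed by testing against
  \<open>F i\<close>-measurable weights, so that later proofs compute with plain expectations.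
  \<open>e i\<close> is revealed at time \<open>Suc i\<close>, and the bound \<open>C\<close> on its
  conditional variance \<open>V i\<close> is deterministic and holds at every outcome.\<close>

locale bounded_mds = prob_space M for M :: "'w measure" +
  fixes F :: "nat \<Rightarrow> 'w measure" and e V :: "nat \<Rightarrow> 'w \<Rightarrow> real" and C :: real
  assumes sub: "\<And>i. subalgebra M (F i)" and F_mono: "\<And>i j. i \<le> j \<Longrightarrow> sets (F i) \<subseteq> sets (F j)"
    and e_meas: "\<And>i. e i \<in> borel_measurable (F (Suc i))"
    and V_meas: "\<And>i. V i \<in> borel_measurable (F i)"
    and e_sq: "\<And>i. integrable M (\<lambda>\<omega>. (e i \<omega>)\<^sup>2)"
    and V_bd: "\<And>i \<omega>. 0 \<le> V i \<omega> \<and> V i \<omega> \<le> C"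
    and mart: "\<And>i W. W \<in> borel_measurable (F i) \<Longrightarrow> integrable M (\<lambda>\<omega>. W \<omega> * e i \<omega>) \<Longrightarrow>
      expectation (\<lambda>\<omega>. W \<omega> * e i \<omega>) = 0"
    and var: "\<And>i W. W \<in> borel_measurable (F i) \<Longrightarrow> integrable M (\<lambda>\<omega>. W \<omega> * (e i \<omega>)\<^sup>2) \<Longrightarrow>
      expectation (\<lambda>\<omega>. W \<omega> * (e i \<omega>)\<^sup>2) = expectation (\<lambda>\<omega>. W \<omega> * V i \<omega>)"
begin

section \<open>Moment identities for martingale transforms\<close>

lemma C0: "0 \<le> C" using V_bd[of 0 undefined] by auto

lemma spaceF: "space (F i) = space M" using sub[of i] by (simp add: subalgebra_def)

lemma measM: "W \<in> measurable (F i) N \<Longrightarrow> W \<in> measurable M N"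
  by (rule measurable_from_subalg[OF sub])

lemma measF: "i \<le> j \<Longrightarrow> W \<in> measurable (F i) N \<Longrightarrow> W \<in> measurable (F j) N"
  by (rule measurable_from_subalg[of "F j" "F i"]) (auto simp: subalgebra_def spaceF F_mono)

lemma e_measF: "i < j \<Longrightarrow> e i \<in> borel_measurable (F j)"
  by (rule measF[OF _ e_meas]) simp

lemma e_measM [measurable]: "e i \<in> borel_measurable M" by (rule measM[OF e_meas])

lemma V_measM [measurable]: "V i \<in> borel_measurable M" by (rule measM[OF V_meas])

lemma e_int: "integrable M (e i)"
  by (rule square_integrable_imp_integrable[OF e_measM e_sq])

lemma V_int: "integrable M (V i)"
  by (rule integrable_const_bound[of _ C]) (use V_bd in auto)

lemma int_bounded_mult:
  fixes W :: "'w \<Rightarrow> real"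
  assumes "integrable M g" "W \<in> borel_measurable M" "\<And>\<omega>. \<omega> \<in> space M \<Longrightarrow> \<bar>W \<omega>\<bar> \<le> B"
  shows "integrable M (\<lambda>\<omega>. W \<omega> * g \<omega>)"
proof (rule Bochner_Integration.integrable_bound)
  show "integrable M (\<lambda>\<omega>. B * g \<omega>)" using assms(1) by simp
  show "(\<lambda>\<omega>. W \<omega> * g \<omega>) \<in> borel_measurable M" using assms by auto
  show "AE \<omega> in M. norm (W \<omega> * g \<omega>) \<le> norm (B * g \<omega>)"
  proof (rule AE_I2)
    fix \<omega> assume "\<omega> \<in> space M"
    then have "\<bar>W \<omega>\<bar> \<le> \<bar>B\<bar>" using assms(3)[of \<omega>] by simp
    then show "norm (W \<omega> * g \<omega>) \<le> norm (B * g \<omega>)" by (simp add: abs_mult mult_right_mono)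
  qed
qed

lemma mart_bounded:
  assumes "W \<in> borel_measurable (F i)" "\<And>\<omega>. \<omega> \<in> space M \<Longrightarrow> \<bar>W \<omega>\<bar> \<le> B"
  shows "expectation (\<lambda>\<omega>. W \<omega> * e i \<omega>) = 0"
  by (rule mart[OF assms(1) int_bounded_mult[OF e_int measM[OF assms(1)] assms(2)]])

lemma var_bounded:
  assumes "W \<in> borel_measurable (F i)" "\<And>\<omega>. \<omega> \<in> space M \<Longrightarrow> \<bar>W \<omega>\<bar> \<le> B"
  shows "expectation (\<lambda>\<omega>. W \<omega> * (e i \<omega>)\<^sup>2) = expectation (\<lambda>\<omega>. W \<omega> * V i \<omega>)"
  by (rule var[OF assms(1) int_bounded_mult[OF e_sq measM[OF assms(1)] assms(2)]])

lemma var_bound: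
  assumes "W \<in> borel_measurable (F i)" "\<And>\<omega>. \<omega> \<in> space M \<Longrightarrow> 0 \<le> W \<omega> \<and> W \<omega> \<le> B"
  shows "expectation (\<lambda>\<omega>. W \<omega> * (e i \<omega>)\<^sup>2) \<le> C * expectation W"
proof -
  have ab: "\<bar>W \<omega>\<bar> \<le> B" if "\<omega> \<in> space M" for \<omega> using assms(2)[OF that] by auto
  have "expectation (\<lambda>\<omega>. W \<omega> * (e i \<omega>)\<^sup>2) = expectation (\<lambda>\<omega>. W \<omega> * V i \<omega>)" by (rule var_bounded[OF assms(1) ab])
  also have "\<dots> \<le> expectation (\<lambda>\<omega>. C * W \<omega>)"
  proof (rule integral_mono)
    show "integrable M (\<lambda>\<omega>. W \<omega> * V i \<omega>)" by (rule int_bounded_mult[OF V_int measM[OF assms(1)] ab])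
    show "integrable M (\<lambda>\<omega>. C * W \<omega>)"
      using integrable_const_bound[of W B] ab measM[OF assms(1)] by auto
    fix \<omega> assume w: "\<omega> \<in> space M"
    show "W \<omega> * V i \<omega> \<le> C * W \<omega>"
      unfolding mult.commute[of C] using V_bd[of i \<omega>] assms(2)[OF w] by (intro mult_left_mono) auto
  qed
  finally show ?thesis by simp
qed

lemma var_le: "expectation (\<lambda>\<omega>. (e i \<omega>)\<^sup>2) \<le> C"
  using var_bound[of "\<lambda>_. 1" i 1] by (simp add: prob_space)

text \<open>Orthogonality of martingale differences kills the cross term. Its weight,
  \<open>h n\<close> times the partial sum, is unbounded, so the zero mean comes from
  \<open>mart\<close> with an explicit integrability proof.\<close>

lemma second_moment:
  assumes h: "\<And>i. h i \<in> borel_measurable (F i)" "\<And>i \<omega>. \<omega> \<in> space M \<Longrightarrow> \<bar>h i \<omega>\<bar> \<le> K"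
  shows "integrable M (\<lambda>\<omega>. (\<Sum>i<n. h i \<omega> * e i \<omega>)\<^sup>2)"
    and "expectation (\<lambda>\<omega>. (\<Sum>i<n. h i \<omega> * e i \<omega>)\<^sup>2) \<le> real n * (K\<^sup>2 * C)"
proof -
  have "integrable M (\<lambda>\<omega>. (\<Sum>i<n. h i \<omega> * e i \<omega>)\<^sup>2) \<and> expectation (\<lambda>\<omega>. (\<Sum>i<n. h i \<omega> * e i \<omega>)\<^sup>2) \<le> real n * (K\<^sup>2 * C)"
  proof (induction n)
    case (Suc n)
    define S where "S = (\<lambda>\<omega>. \<Sum>i<n. h i \<omega> * e i \<omega>)"
    have SF: "S \<in> borel_measurable (F n)" unfolding S_def
      by (intro borel_measurable_sum borel_measurable_times e_measF measF[OF _ h(1)]) auto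
    have hM: "h n \<in> borel_measurable M" by (rule measM[OF h(1)])
    have SM: "S \<in> borel_measurable M" by (rule measM[OF SF])
    have iS: "integrable M (\<lambda>\<omega>. (S \<omega>)\<^sup>2)" using Suc by (simp add: S_def)
    have h2: "\<bar>(h n \<omega>)\<^sup>2\<bar> \<le> K\<^sup>2" if "\<omega> \<in> space M" for \<omega>
      using h(2)[OF that, of n] by (metis abs_ge_zero abs_power2 power2_abs power_mono)
    have iSe: "integrable M (\<lambda>\<omega>. S \<omega> * e n \<omega>)"
    proof (rule Bochner_Integration.integrable_bound[of _ "\<lambda>\<omega>. (S \<omega>)\<^sup>2 + (e n \<omega>)\<^sup>2"])
      show "integrable M (\<lambda>\<omega>. (S \<omega>)\<^sup>2 + (e n \<omega>)\<^sup>2)" using iS e_sq by auto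
      show "AE \<omega> in M. norm (S \<omega> * e n \<omega>) \<le> norm ((S \<omega>)\<^sup>2 + (e n \<omega>)\<^sup>2)"
      proof (rule AE_I2)
        fix \<omega>
        have "2 * (\<bar>S \<omega>\<bar> * \<bar>e n \<omega>\<bar>) \<le> (S \<omega>)\<^sup>2 + (e n \<omega>)\<^sup>2"
          using sum_squares_bound[of "\<bar>S \<omega>\<bar>" "\<bar>e n \<omega>\<bar>"] by simp
        moreover have "0 \<le> \<bar>S \<omega>\<bar> * \<bar>e n \<omega>\<bar>" by simp
        ultimately have "\<bar>S \<omega>\<bar> * \<bar>e n \<omega>\<bar> \<le> (S \<omega>)\<^sup>2 + (e n \<omega>)\<^sup>2" by linarith
        then show "norm (S \<omega> * e n \<omega>) \<le> norm ((S \<omega>)\<^sup>2 + (e n \<omega>)\<^sup>2)" by (simp add: abs_mult)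
      qed
    qed (use SM in measurable)
    have ihSe: "integrable M (\<lambda>\<omega>. (h n \<omega> * S \<omega>) * e n \<omega>)"
      using int_bounded_mult[OF iSe hM h(2)] by (simp add: mult.assoc)
    have zero: "expectation (\<lambda>\<omega>. (h n \<omega> * S \<omega>) * e n \<omega>) = 0"
      by (rule mart[OF _ ihSe]) (intro borel_measurable_times h SF)
    have ihe: "integrable M (\<lambda>\<omega>. (h n \<omega>)\<^sup>2 * (e n \<omega>)\<^sup>2)"
      by (rule int_bounded_mult[OF e_sq _ h2]) (use hM in measurable)
    have "expectation (\<lambda>\<omega>. (h n \<omega>)\<^sup>2 * (e n \<omega>)\<^sup>2) \<le> expectation (\<lambda>\<omega>. K\<^sup>2 * (e n \<omega>)\<^sup>2)"
    proof (rule integral_mono[OF ihe])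
      show "integrable M (\<lambda>\<omega>. K\<^sup>2 * (e n \<omega>)\<^sup>2)" using e_sq by simp
      fix \<omega> assume "\<omega> \<in> space M"
      then show "(h n \<omega>)\<^sup>2 * (e n \<omega>)\<^sup>2 \<le> K\<^sup>2 * (e n \<omega>)\<^sup>2" using h2[of \<omega>] by (intro mult_right_mono) auto
    qed
    also have "\<dots> \<le> K\<^sup>2 * C" using var_le[of n] by (simp add: mult_left_mono)
    finally have last: "expectation (\<lambda>\<omega>. (h n \<omega>)\<^sup>2 * (e n \<omega>)\<^sup>2) \<le> K\<^sup>2 * C" .
    have eq: "(\<lambda>\<omega>. (\<Sum>i<Suc n. h i \<omega> * e i \<omega>)\<^sup>2) = (\<lambda>\<omega>. (S \<omega>)\<^sup>2 + 2 * ((h n \<omega> * S \<omega>) * e n \<omega>) + (h n \<omega>)\<^sup>2 * (e n \<omega>)\<^sup>2)"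
      by (rule ext) (simp add: S_def power2_eq_square algebra_simps)
    have "integrable M (\<lambda>\<omega>. (\<Sum>i<Suc n. h i \<omega> * e i \<omega>)\<^sup>2)"
      unfolding eq using iS ihSe ihe by auto
    moreover have "expectation (\<lambda>\<omega>. (\<Sum>i<Suc n. h i \<omega> * e i \<omega>)\<^sup>2) = expectation (\<lambda>\<omega>. (S \<omega>)\<^sup>2) + 2 * 0 + expectation (\<lambda>\<omega>. (h n \<omega>)\<^sup>2 * (e n \<omega>)\<^sup>2)"
      unfolding eq zero[symmetric] using iS ihSe ihe by simp
    ultimately show ?case using Suc last by (simp add: S_def algebra_simps)
  qed simp
  then show "integrable M (\<lambda>\<omega>. (\<Sum>i<n. h i \<omega> * e i \<omega>)\<^sup>2)"
    and "expectation (\<lambda>\<omega>. (\<Sum>i<n. h i \<omega> * e i \<omega>)\<^sup>2) \<le> real n * (K\<^sup>2 * C)" by auto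
qed

lemma complex_mart:
  fixes W :: "'w \<Rightarrow> complex"
  assumes W: "W \<in> borel_measurable (F i)" "\<And>\<omega>. \<omega> \<in> space M \<Longrightarrow> cmod (W \<omega>) \<le> B"
  shows "integrable M (\<lambda>\<omega>. W \<omega> * complex_of_real (e i \<omega>))" "integral\<^sup>L M (\<lambda>\<omega>. W \<omega> * complex_of_real (e i \<omega>)) = 0"
    and "integrable M (\<lambda>\<omega>. W \<omega> * complex_of_real ((e i \<omega>)\<^sup>2 - V i \<omega>))"
      "integral\<^sup>L M (\<lambda>\<omega>. W \<omega> * complex_of_real ((e i \<omega>)\<^sup>2 - V i \<omega>)) = 0"
proof -
  have WM[measurable]: "W \<in> borel_measurable M" by (rule measM[OF W(1)])
  have int: "integrable M (\<lambda>\<omega>. W \<omega> * complex_of_real (g \<omega>))" if g: "integrable M g" for g :: "'w \<Rightarrow> real"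
  proof (rule Bochner_Integration.integrable_bound)
    show "integrable M (\<lambda>\<omega>. B * g \<omega>)" using g by simp
    show "(\<lambda>\<omega>. W \<omega> * complex_of_real (g \<omega>)) \<in> borel_measurable M" using g by measurable
    show "AE \<omega> in M. norm (W \<omega> * complex_of_real (g \<omega>)) \<le> norm (B * g \<omega>)"
    proof (rule AE_I2)
      fix \<omega> assume "\<omega> \<in> space M"
      then have "cmod (W \<omega>) \<le> \<bar>B\<bar>" using W(2)[of \<omega>] by simp
      then show "norm (W \<omega> * complex_of_real (g \<omega>)) \<le> norm (B * g \<omega>)" by (simp add: norm_mult abs_mult mult_right_mono)
    qed
  qed
  have re: "(\<lambda>\<omega>. Re (W \<omega>)) \<in> borel_measurable (F i)" "(\<lambda>\<omega>. Im (W \<omega>)) \<in> borel_measurable (F i)" using W(1) by auto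
  have rb: "\<bar>Re (W \<omega>)\<bar> \<le> B" "\<bar>Im (W \<omega>)\<bar> \<le> B" if "\<omega> \<in> space M" for \<omega>
    using W(2)[OF that] abs_Re_le_cmod[of "W \<omega>"] abs_Im_le_cmod[of "W \<omega>"] by auto
  show i1: "integrable M (\<lambda>\<omega>. W \<omega> * complex_of_real (e i \<omega>))" by (rule int[OF e_int])
  show "integral\<^sup>L M (\<lambda>\<omega>. W \<omega> * complex_of_real (e i \<omega>)) = 0"
    using mart_bounded[OF re(1) rb(1)] mart_bounded[OF re(2) rb(2)]
    by (simp add: complex_eq_iff integral_Re[OF i1, symmetric] integral_Im[OF i1, symmetric])
  show i2: "integrable M (\<lambda>\<omega>. W \<omega> * complex_of_real ((e i \<omega>)\<^sup>2 - V i \<omega>))"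
    by (rule int) (use e_sq V_int in auto)
  have z: "expectation (\<lambda>\<omega>. U \<omega> * ((e i \<omega>)\<^sup>2 - V i \<omega>)) = 0"
    if U: "U \<in> borel_measurable (F i)" "\<And>\<omega>. \<omega> \<in> space M \<Longrightarrow> \<bar>U \<omega>\<bar> \<le> B" for U
    using var_bounded[OF U] int_bounded_mult[OF e_sq measM[OF U(1)] U(2)] int_bounded_mult[OF V_int measM[OF U(1)] U(2)]
    by (simp add: right_diff_distrib)
  show "integral\<^sup>L M (\<lambda>\<omega>. W \<omega> * complex_of_real ((e i \<omega>)\<^sup>2 - V i \<omega>)) = 0"
    using z[OF re(1) rb(1)] z[OF re(2) rb(2)]
    by (simp add: complex_eq_iff integral_Re[OF i2, symmetric] integral_Im[OF i2, symmetric] Re_power2 del: of_real_diff)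
qed

text \<open>Unconditional Lindeberg summand of row \<open>n\<close>; the threshold scales with the
  row, not with the index \<open>i\<close>.\<close>

definition lind :: "real \<Rightarrow> nat \<Rightarrow> nat \<Rightarrow> real" where
  "lind d n i = expectation (\<lambda>\<omega>. (e i \<omega>)\<^sup>2 * (if d * sqrt (real n) < \<bar>e i \<omega>\<bar> then 1 else 0))"

lemma lind_int: "integrable M (\<lambda>\<omega>. (e i \<omega>)\<^sup>2 * (if d < \<bar>e i \<omega>\<bar> then 1 else 0))"
  by (rule Bochner_Integration.integrable_bound[OF e_sq[of i]]) auto

text \<open>The factor with the accumulated conditional variance compensates the decay of the
  characteristic function, so the expectation of \<open>Z k\<close> is nearly constant in
  \<open>k\<close>. One step changes \<open>Z\<close> by a predictable weight times iexp x - exp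
  (-v/2); the first-order term vanishes by \<open>mart\<close>, the difference of x^2 and v by
  \<open>var\<close>, and only remainders survive.\<close>

lemma char_step:
  assumes h: "\<And>i. h i \<in> borel_measurable (F i)" "\<And>i \<omega>. \<omega> \<in> space M \<Longrightarrow> \<bar>h i \<omega>\<bar> \<le> K" and K: "0 < K"
    and n: "1 \<le> n" and k: "k < n" and d: "0 < d"
  defines "Z \<equiv> \<lambda>k \<omega>. iexp ((\<Sum>i<k. h i \<omega> * e i \<omega>) / sqrt (real n)) * complex_of_real (exp ((\<Sum>i<k. (h i \<omega>)\<^sup>2 * V i \<omega>) / real n / 2))"
  shows "cmod (integral\<^sup>L M (Z (Suc k)) - integral\<^sup>L M (Z k))
    \<le> exp (K\<^sup>2 * C / 2) * ((d * K\<^sup>2 * C + K\<^sup>2 * lind (d / K) n k + (K\<^sup>2 * C)\<^sup>2 / real n) / real n)"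
proof -
  define b where "b = K\<^sup>2 * C"
  have b0: "0 \<le> b" using C0 by (simp add: b_def)
  define x where "x \<omega> = h k \<omega> * e k \<omega> / sqrt (real n)" for \<omega>
  define v where "v \<omega> = (h k \<omega>)\<^sup>2 * V k \<omega> / real n" for \<omega>
  define S where "S k \<omega> = (\<Sum>i<k. h i \<omega> * e i \<omega>) / sqrt (real n)" for k \<omega>
  define A where "A k \<omega> = (\<Sum>i<k. (h i \<omega>)\<^sup>2 * V i \<omega>) / real n" for k \<omega>
  \<comment> \<open>The variance sum up to \<open>Suc k\<close> is still
    \<open>F k\<close>-measurable, since \<open>V k\<close> is known before \<open>e k\<close>; this
    is why it can be put into the weight.\<close>
  define W where "W \<omega> = iexp (S k \<omega>) * complex_of_real (exp (A (Suc k) \<omega> / 2))" for \<omega>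
  have h2: "(h i \<omega>)\<^sup>2 \<le> K\<^sup>2" if "\<omega> \<in> space M" for i \<omega>
    using h(2)[OF that, of i] K by (simp add: abs_le_square_iff[symmetric])
  have hv: "0 \<le> (h i \<omega>)\<^sup>2 * V i \<omega>" "(h i \<omega>)\<^sup>2 * V i \<omega> \<le> b" if "\<omega> \<in> space M" for i \<omega>
    unfolding b_def using h2[OF that, of i] V_bd[of i \<omega>] by (auto intro!: mult_mono)
  have Abd: "0 \<le> A m \<omega> \<and> A m \<omega> \<le> b" if "\<omega> \<in> space M" "m \<le> n" for m \<omega>
  proof -
    have "(\<Sum>i<m. (h i \<omega>)\<^sup>2 * V i \<omega>) \<le> (\<Sum>i<m. b)" by (intro sum_mono hv that)
    also have "\<dots> \<le> real n * b" using that(2) b0 by (simp add: mult_right_mono)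
    finally have "A m \<omega> \<le> b" using n by (simp add: A_def divide_le_eq mult.commute)
    moreover have "0 \<le> A m \<omega>" unfolding A_def by (intro divide_nonneg_nonneg sum_nonneg hv that) auto
    ultimately show ?thesis by simp
  qed
  have WF: "W \<in> borel_measurable (F k)"
  proof -
    have [measurable]: "S k \<in> borel_measurable (F k)" unfolding S_def
      by (intro borel_measurable_divide borel_measurable_sum borel_measurable_times e_measF measF[OF _ h(1)]) auto
    have [measurable]: "A (Suc k) \<in> borel_measurable (F k)" unfolding A_def
      by (intro borel_measurable_divide borel_measurable_sum borel_measurable_times borel_measurable_power measF[OF _ V_meas] measF[OF _ h(1)]) auto
    show ?thesis unfolding W_def[abs_def] by measurable
  qed
  have Wb: "cmod (W \<omega>) \<le> exp (b / 2)" if "\<omega> \<in> space M" for \<omega>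
    using Abd[OF that, of "Suc k"] k by (simp add: W_def norm_mult)
  have [measurable]: "h i \<in> borel_measurable M" "W \<in> borel_measurable M" for i using measM[OF h(1)] measM[OF WF] by auto
  have ZM: "Z m \<in> borel_measurable M" for m unfolding Z_def by measurable
  have Zint: "integrable M (Z m)" if "m \<le> n" for m
  proof (rule integrable_const_bound[of _ "exp (b / 2)"])
    show "AE \<omega> in M. cmod (Z m \<omega>) \<le> exp (b / 2)"
      using Abd that by (intro AE_I2) (auto simp: Z_def norm_mult A_def)
  qed (rule ZM)
  define R where "R \<omega> = iexp (x \<omega>) - (1 + \<i> * x \<omega> - (x \<omega>)\<^sup>2 / 2)" for \<omega>
  define R' where "R' \<omega> = exp (- v \<omega> / 2) - 1 + v \<omega> / 2" for \<omega>
  have [measurable]: "R \<in> borel_measurable M" "R' \<in> borel_measurable M"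
    unfolding R_def[abs_def] R'_def[abs_def] x_def v_def by measurable
  have diff: "Z (Suc k) \<omega> - Z k \<omega> = (W \<omega> * (\<i> * h k \<omega> / sqrt (real n))) * complex_of_real (e k \<omega>)
      - (W \<omega> * complex_of_real ((h k \<omega>)\<^sup>2 / real n / 2)) * complex_of_real ((e k \<omega>)\<^sup>2 - V k \<omega>) + W \<omega> * (R \<omega> - R' \<omega>)" for \<omega>
  proof -
    have SS: "S (Suc k) \<omega> = S k \<omega> + x \<omega>" by (simp add: S_def x_def add_divide_distrib)
    have AA: "A (Suc k) \<omega> = A k \<omega> + v \<omega>" by (simp add: A_def v_def add_divide_distrib)
    have Z1: "Z (Suc k) \<omega> = W \<omega> * iexp (x \<omega>)"
    proof -
      have "Z (Suc k) \<omega> = iexp (S (Suc k) \<omega>) * complex_of_real (exp (A (Suc k) \<omega> / 2))" by (simp add: Z_def S_def A_def)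
      also have "iexp (S (Suc k) \<omega>) = iexp (S k \<omega>) * iexp (x \<omega>)" unfolding SS by (simp add: distrib_left exp_add)
      finally show ?thesis by (simp add: W_def mult_ac)
    qed
    have Z2: "Z k \<omega> = W \<omega> * complex_of_real (exp (- v \<omega> / 2))"
    proof -
      have "Z k \<omega> = iexp (S k \<omega>) * complex_of_real (exp (A k \<omega> / 2))" by (simp add: Z_def S_def A_def)
      also have "exp (A k \<omega> / 2) = exp (A (Suc k) \<omega> / 2) * exp (- v \<omega> / 2)" unfolding AA by (simp add: exp_add[symmetric] add_divide_distrib)
      finally show ?thesis by (simp only: W_def of_real_mult mult_ac)
    qed
    have x2: "(x \<omega>)\<^sup>2 = (h k \<omega>)\<^sup>2 * (e k \<omega>)\<^sup>2 / real n" by (simp add: x_def power_divide power_mult_distrib)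
    have "iexp (x \<omega>) - complex_of_real (exp (- v \<omega> / 2)) = \<i> * x \<omega> - complex_of_real ((x \<omega>)\<^sup>2 - v \<omega>) / 2 + (R \<omega> - R' \<omega>)"
      by (simp add: R_def R'_def) (simp add: field_simps)
    also have "complex_of_real ((x \<omega>)\<^sup>2 - v \<omega>) = complex_of_real ((h k \<omega>)\<^sup>2 / real n) * complex_of_real ((e k \<omega>)\<^sup>2 - V k \<omega>)"
      unfolding x2 v_def by (simp add: algebra_simps diff_divide_distrib)
    finally have "iexp (x \<omega>) - complex_of_real (exp (- v \<omega> / 2)) = \<i> * x \<omega>
       - complex_of_real ((h k \<omega>)\<^sup>2 / real n) * complex_of_real ((e k \<omega>)\<^sup>2 - V k \<omega>) / 2 + (R \<omega> - R' \<omega>)" .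
    then have "W \<omega> * (iexp (x \<omega>) - complex_of_real (exp (- v \<omega> / 2))) = W \<omega> * (\<i> * x \<omega>
       - complex_of_real ((h k \<omega>)\<^sup>2 / real n) * complex_of_real ((e k \<omega>)\<^sup>2 - V k \<omega>) / 2 + (R \<omega> - R' \<omega>))" by simp
    moreover have "\<i> * complex_of_real (x \<omega>) = \<i> * h k \<omega> / sqrt (real n) * complex_of_real (e k \<omega>)" by (simp add: x_def)
    moreover have "complex_of_real ((h k \<omega>)\<^sup>2 / real n / 2) = complex_of_real ((h k \<omega>)\<^sup>2 / real n) / 2" by simp
    ultimately show ?thesis unfolding Z1 Z2
      by (simp only: right_diff_distrib[symmetric]) (simp only: distrib_left right_diff_distrib mult.assoc times_divide_eq_left times_divide_eq_right)
  qed
  have w1: "(\<lambda>\<omega>. W \<omega> * (\<i> * h k \<omega> / sqrt (real n))) \<in> borel_measurable (F k)"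
    using WF h(1)[of k] by measurable
  have w1b: "cmod (W \<omega> * (\<i> * h k \<omega> / sqrt (real n))) \<le> exp (b / 2) * (K / sqrt (real n))" if "\<omega> \<in> space M" for \<omega>
    unfolding norm_mult norm_divide using Wb[OF that] h(2)[OF that, of k] by (intro mult_mono) (auto simp: divide_right_mono)
  have w2: "(\<lambda>\<omega>. W \<omega> * complex_of_real ((h k \<omega>)\<^sup>2 / real n / 2)) \<in> borel_measurable (F k)"
    using WF h(1)[of k] by measurable
  have w2b: "cmod (W \<omega> * complex_of_real ((h k \<omega>)\<^sup>2 / real n / 2)) \<le> exp (b / 2) * (K\<^sup>2 / real n / 2)" if "\<omega> \<in> space M" for \<omega>
    unfolding norm_mult norm_of_real using Wb[OF that] h2[OF that, of k] by (intro mult_mono) (auto simp: divide_right_mono)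
  note c1 = complex_mart(1,2)[OF w1 w1b] and c2 = complex_mart(3,4)[OF w2 w2b]
  \<comment> \<open>Integrable majorant of the remainder. As
    \<open>\<bar>x\<bar> \<le> K * \<bar>e k\<bar> / sqrt n\<close>, exceeding \<open>d\<close>
    forces \<open>e k\<close> above \<open>d / K * sqrt n\<close>.\<close>
  define Q where "Q \<omega> = exp (b / 2) * ((d * (x \<omega>)\<^sup>2 + K\<^sup>2 / real n * ((e k \<omega>)\<^sup>2 * (if d / K * sqrt (real n) < \<bar>e k \<omega>\<bar> then 1 else 0))) + (b / real n)\<^sup>2)" for \<omega>
  have x2i: "integrable M (\<lambda>\<omega>. (x \<omega>)\<^sup>2)" "expectation (\<lambda>\<omega>. (x \<omega>)\<^sup>2) \<le> b / real n"
  proof -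
    have eq: "(\<lambda>\<omega>. (x \<omega>)\<^sup>2) = (\<lambda>\<omega>. (h k \<omega>)\<^sup>2 / real n * (e k \<omega>)\<^sup>2)" by (simp add: x_def power_divide power_mult_distrib)
    have m: "(\<lambda>\<omega>. (h k \<omega>)\<^sup>2 / real n) \<in> borel_measurable (F k)" using h(1)[of k] by measurable
    have bd: "0 \<le> (h k \<omega>)\<^sup>2 / real n \<and> (h k \<omega>)\<^sup>2 / real n \<le> K\<^sup>2 / real n" if "\<omega> \<in> space M" for \<omega>
      using h2[OF that, of k] by (simp add: divide_right_mono)
    show "integrable M (\<lambda>\<omega>. (x \<omega>)\<^sup>2)" unfolding eq
      by (rule int_bounded_mult[OF e_sq measM[OF m], of "K\<^sup>2 / real n"]) (use bd in auto)
    have "expectation (\<lambda>\<omega>. (x \<omega>)\<^sup>2) \<le> C * expectation (\<lambda>\<omega>. (h k \<omega>)\<^sup>2 / real n)" unfolding eq by (rule var_bound[OF m bd])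
    also have "\<dots> \<le> C * (K\<^sup>2 / real n)"
    proof (intro mult_left_mono C0)
      have "expectation (\<lambda>\<omega>. (h k \<omega>)\<^sup>2 / real n) \<le> expectation (\<lambda>\<omega>. K\<^sup>2 / real n)"
        by (rule integral_mono) (use bd in \<open>auto intro!: integrable_const_bound[of _ "K\<^sup>2 / real n"]\<close>)
      then show "expectation (\<lambda>\<omega>. (h k \<omega>)\<^sup>2 / real n) \<le> K\<^sup>2 / real n" by (simp add: prob_space)
    qed
    finally show "expectation (\<lambda>\<omega>. (x \<omega>)\<^sup>2) \<le> b / real n" by (simp add: b_def mult.commute)
  qed
  have Qint: "integrable M Q" unfolding Q_def[abs_def]
    by (intro integrable_mult_right Bochner_Integration.integrable_add x2i(1) lind_int integrable_const)
  have EQ: "expectation Q = exp (b / 2) * ((d * expectation (\<lambda>\<omega>. (x \<omega>)\<^sup>2) + K\<^sup>2 / real n * lind (d / K) n k) + (b / real n)\<^sup>2)"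
    unfolding Q_def[abs_def] lind_def using x2i(1) lind_int by (simp add: prob_space)
  have Rb: "cmod (W \<omega> * (R \<omega> - R' \<omega>)) \<le> Q \<omega>" if w: "\<omega> \<in> space M" for \<omega>
  proof -
    have "cmod (R \<omega>) \<le> d * (x \<omega>)\<^sup>2 + (x \<omega>)\<^sup>2 * (if d < \<bar>x \<omega>\<bar> then 1 else 0)"
      unfolding R_def by (rule iexp_quadratic_remainder) (use d in simp)
    also have "(x \<omega>)\<^sup>2 * (if d < \<bar>x \<omega>\<bar> then 1 else 0) \<le> K\<^sup>2 / real n * ((e k \<omega>)\<^sup>2 * (if d / K * sqrt (real n) < \<bar>e k \<omega>\<bar> then 1 else 0))"
    proof (cases "d < \<bar>x \<omega>\<bar>")
      case True
      have "\<bar>x \<omega>\<bar> \<le> K * \<bar>e k \<omega>\<bar> / sqrt (real n)"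
        unfolding x_def abs_mult abs_divide using h(2)[OF w, of k] by (simp add: divide_right_mono mult_right_mono)
      then have "d < K * \<bar>e k \<omega>\<bar> / sqrt (real n)" using True by simp
      then have "d / K * sqrt (real n) < \<bar>e k \<omega>\<bar>" using K n by (simp add: field_simps)
      moreover have "(x \<omega>)\<^sup>2 \<le> K\<^sup>2 / real n * (e k \<omega>)\<^sup>2"
        using h2[OF w, of k] by (simp add: x_def power_divide power_mult_distrib divide_right_mono mult_right_mono)
      ultimately show ?thesis using True by simp
    qed auto
    finally have r1: "cmod (R \<omega>) \<le> d * (x \<omega>)\<^sup>2 + K\<^sup>2 / real n * ((e k \<omega>)\<^sup>2 * (if d / K * sqrt (real n) < \<bar>e k \<omega>\<bar> then 1 else 0))" by simp
    have v0: "0 \<le> v \<omega>" "v \<omega> \<le> b / real n" using hv[OF w, of k] by (auto simp: v_def divide_right_mono)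
    have "\<bar>R' \<omega>\<bar> \<le> (v \<omega> / 2)\<^sup>2 / 2"
      using exp_minus_le_quadratic[of "v \<omega> / 2"] exp_ge_add_one_self[of "- v \<omega> / 2"] v0 by (simp add: R'_def)
    also have "\<dots> \<le> (v \<omega>)\<^sup>2" by (simp add: power_divide)
    also have "\<dots> \<le> (b / real n)\<^sup>2" using v0 by (intro power_mono)
    finally have r2: "\<bar>R' \<omega>\<bar> \<le> (b / real n)\<^sup>2" .
    have "cmod (R \<omega> - R' \<omega>) \<le> cmod (R \<omega>) + \<bar>R' \<omega>\<bar>" using norm_triangle_ineq4[of "R \<omega>" "complex_of_real (R' \<omega>)"] by simp
    then have r3: "cmod (R \<omega> - R' \<omega>) \<le> (d * (x \<omega>)\<^sup>2 + K\<^sup>2 / real n * ((e k \<omega>)\<^sup>2 * (if d / K * sqrt (real n) < \<bar>e k \<omega>\<bar> then 1 else 0))) + (b / real n)\<^sup>2"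
      using r1 r2 by linarith
    show ?thesis unfolding norm_mult Q_def using Wb[OF w] r3 by (intro mult_mono) auto
  qed
  have Rint: "integrable M (\<lambda>\<omega>. W \<omega> * (R \<omega> - R' \<omega>))"
  proof (rule Bochner_Integration.integrable_bound[OF Qint])
    show "AE \<omega> in M. norm (W \<omega> * (R \<omega> - R' \<omega>)) \<le> norm (Q \<omega>)"
      unfolding real_norm_def by (intro AE_I2 order_trans[OF Rb abs_ge_self])
  qed measurable
  have "integral\<^sup>L M (Z (Suc k)) - integral\<^sup>L M (Z k) = integral\<^sup>L M (\<lambda>\<omega>. Z (Suc k) \<omega> - Z k \<omega>)"
    using Zint k by simp
  also have "\<dots> = integral\<^sup>L M (\<lambda>\<omega>. W \<omega> * (R \<omega> - R' \<omega>))"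
  proof -
    define T1 where "T1 \<omega> = (W \<omega> * (\<i> * h k \<omega> / sqrt (real n))) * complex_of_real (e k \<omega>)" for \<omega>
    define T2 where "T2 \<omega> = (W \<omega> * complex_of_real ((h k \<omega>)\<^sup>2 / real n / 2)) * complex_of_real ((e k \<omega>)\<^sup>2 - V k \<omega>)" for \<omega>
    have "integrable M T1" unfolding T1_def[abs_def] by (rule c1(1))
    moreover have "integral\<^sup>L M T1 = 0" unfolding T1_def[abs_def] by (rule c1(2))
    moreover have "integrable M T2" unfolding T2_def[abs_def] by (rule c2(1))
    moreover have "integral\<^sup>L M T2 = 0" unfolding T2_def[abs_def] by (rule c2(2))
    ultimately have "integral\<^sup>L M (\<lambda>\<omega>. T1 \<omega> - T2 \<omega> + W \<omega> * (R \<omega> - R' \<omega>)) = integral\<^sup>L M (\<lambda>\<omega>. W \<omega> * (R \<omega> - R' \<omega>))"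
      using Rint by simp
    then show ?thesis by (simp only: diff T1_def T2_def)
  qed
  finally have "cmod (integral\<^sup>L M (Z (Suc k)) - integral\<^sup>L M (Z k)) = cmod (integral\<^sup>L M (\<lambda>\<omega>. W \<omega> * (R \<omega> - R' \<omega>)))" by simp
  also have "\<dots> \<le> expectation (\<lambda>\<omega>. cmod (W \<omega> * (R \<omega> - R' \<omega>)))" by (rule integral_norm_bound)
  also have "\<dots> \<le> expectation Q" using Rint Qint Rb by (intro integral_mono) auto
  also have "\<dots> \<le> exp (b / 2) * ((d * (b / real n) + K\<^sup>2 / real n * lind (d / K) n k) + (b / real n)\<^sup>2)"
    unfolding EQ using x2i(2) d by (intro mult_left_mono add_right_mono) auto
  also have "\<dots> = exp (K\<^sup>2 * C / 2) * ((d * K\<^sup>2 * C + K\<^sup>2 * lind (d / K) n k + (K\<^sup>2 * C)\<^sup>2 / real n) / real n)"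
    by (simp add: b_def add_divide_distrib power_divide power2_eq_square mult_ac)
  finally show ?thesis .
qed

text \<open>Telescoping \<open>char_step\<close> over one row shows that the compensated expectation
  tends to 1. The compensator converges almost surely to a constant and is bounded, so it can
  afterwards be replaced by \<open>exp (\<tau> / 2)\<close> and divided out.\<close>

theorem char_clt:
  assumes h: "\<And>i. h i \<in> borel_measurable (F i)" "\<And>i \<omega>. \<omega> \<in> space M \<Longrightarrow> \<bar>h i \<omega>\<bar> \<le> K" and K: "0 < K"
    and lim: "AE \<omega> in M. (\<lambda>n. (\<Sum>i<n. (h i \<omega>)\<^sup>2 * V i \<omega>) / real n) \<longlonglongrightarrow> \<tau>"
    and lindeberg: "\<And>d. 0 < d \<Longrightarrow> (\<lambda>n. (\<Sum>i<n. lind d n i) / real n) \<longlonglongrightarrow> 0"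
  shows "(\<lambda>n. integral\<^sup>L M (\<lambda>\<omega>. iexp ((\<Sum>i<n. h i \<omega> * e i \<omega>) / sqrt (real n)))) \<longlonglongrightarrow> complex_of_real (exp (- \<tau> / 2))"
proof -
  define b where "b = K\<^sup>2 * C"
  have b0: "0 \<le> b" using C0 by (simp add: b_def)
  define E where "E n \<omega> = iexp ((\<Sum>i<n. h i \<omega> * e i \<omega>) / sqrt (real n))" for n \<omega>
  define A where "A n \<omega> = (\<Sum>i<n. (h i \<omega>)\<^sup>2 * V i \<omega>) / real n" for n \<omega>
  have hM[measurable]: "h i \<in> borel_measurable M" for i by (rule measM[OF h(1)])
  have [measurable]: "E n \<in> borel_measurable M" "A n \<in> borel_measurable M" for n
    unfolding E_def[abs_def] A_def[abs_def] by measurable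
  have h2: "(h i \<omega>)\<^sup>2 \<le> K\<^sup>2" if "\<omega> \<in> space M" for i \<omega>
    using h(2)[OF that, of i] K by (simp add: abs_le_square_iff[symmetric])
  have Abd: "0 \<le> A n \<omega> \<and> A n \<omega> \<le> b" if "\<omega> \<in> space M" for n \<omega>
  proof -
    have "(\<Sum>i<n. (h i \<omega>)\<^sup>2 * V i \<omega>) \<le> (\<Sum>i<n. b)"
      unfolding b_def using h2[OF that] V_bd by (intro sum_mono mult_mono) auto
    then have "A n \<omega> \<le> b" using b0 by (cases "n = 0") (auto simp: A_def divide_le_eq mult.commute)
    moreover have "0 \<le> A n \<omega>" unfolding A_def using V_bd by (intro divide_nonneg_nonneg sum_nonneg mult_nonneg_nonneg) auto
    ultimately show ?thesis by simp
  qed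
  define Z where "Z n \<omega> = E n \<omega> * complex_of_real (exp (A n \<omega> / 2))" for n \<omega>
  have Z_lim: "(\<lambda>n. integral\<^sup>L M (Z n)) \<longlonglongrightarrow> 1"
  proof -
    have bound: "cmod (integral\<^sup>L M (Z n) - 1) \<le> exp (b / 2) * (d * b + K\<^sup>2 * ((\<Sum>i<n. lind (d / K) n i) / real n) + b\<^sup>2 / real n)"
      if n: "1 \<le> n" and d: "0 < d" for n d
    proof -
      define Y where "Y k \<omega> = iexp ((\<Sum>i<k. h i \<omega> * e i \<omega>) / sqrt (real n)) * complex_of_real (exp ((\<Sum>i<k. (h i \<omega>)\<^sup>2 * V i \<omega>) / real n / 2))" for k \<omega>
      have Yn: "Y n = Z n" by (rule ext) (simp add: Y_def Z_def E_def A_def)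
      have Y0: "integral\<^sup>L M (Y 0) = 1" by (simp add: Y_def[abs_def] prob_space)
      have "integral\<^sup>L M (Z n) - 1 = (\<Sum>k<n. integral\<^sup>L M (Y (Suc k)) - integral\<^sup>L M (Y k))"
        using sum_lessThan_telescope[of "\<lambda>k. integral\<^sup>L M (Y k)" n] by (simp add: Yn Y0)
      also have "cmod \<dots> \<le> (\<Sum>k<n. exp (b / 2) * ((d * K\<^sup>2 * C + K\<^sup>2 * lind (d / K) n k + b\<^sup>2 / real n) / real n))"
        unfolding b_def Y_def[abs_def] by (intro sum_norm_le char_step[OF h K n _ d]) auto
      also have "\<dots> = exp (b / 2) * ((\<Sum>k<n. d * K\<^sup>2 * C + K\<^sup>2 * lind (d / K) n k + b\<^sup>2 / real n) / real n)"
        by (simp add: sum_distrib_left sum_divide_distrib)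
      also have "(\<Sum>k<n. d * K\<^sup>2 * C + K\<^sup>2 * lind (d / K) n k + b\<^sup>2 / real n) = real n * (d * b) + K\<^sup>2 * (\<Sum>i<n. lind (d / K) n i) + real n * (b\<^sup>2 / real n)"
        by (simp add: sum.distrib sum_distrib_left b_def mult.assoc)
      also have "\<dots> / real n = d * b + K\<^sup>2 * ((\<Sum>i<n. lind (d / K) n i) / real n) + b\<^sup>2 / real n"
        using n by (simp add: add_divide_distrib)
      finally show ?thesis .
    qed
    show ?thesis unfolding tendsto_iff
    proof (intro allI impI)
      fix r :: real assume r: "0 < r"
      define d where "d = r / (2 * exp (b / 2) * (b + 1))"
      have d: "0 < d" using r b0 by (simp add: d_def)
      have db: "exp (b / 2) * (d * b) \<le> r / 2"
      proof -
        have "exp (b / 2) * (d * b) \<le> exp (b / 2) * (d * (b + 1))" using d b0 by (intro mult_left_mono) auto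
        also have "\<dots> = r / 2" using b0 by (simp add: d_def)
        finally show ?thesis .
      qed
      have "(\<lambda>n. exp (b / 2) * (K\<^sup>2 * ((\<Sum>i<n. lind (d / K) n i) / real n) + b\<^sup>2 / real n)) \<longlonglongrightarrow> exp (b / 2) * (K\<^sup>2 * 0 + 0)"
        using d K by (intro tendsto_intros lindeberg lim_const_over_n) auto
      then have "\<forall>\<^sub>F n in sequentially. exp (b / 2) * (K\<^sup>2 * ((\<Sum>i<n. lind (d / K) n i) / real n) + b\<^sup>2 / real n) < r / 2"
        using r by (intro order_tendstoD(2)[of _ "exp (b / 2) * (K\<^sup>2 * 0 + 0)"]) simp_all
      then show "\<forall>\<^sub>F n in sequentially. dist (integral\<^sup>L M (Z n)) 1 < r"
        using eventually_ge_at_top[of 1]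
      proof eventually_elim
        case (elim n)
        have "dist (integral\<^sup>L M (Z n)) 1 \<le> exp (b / 2) * (d * b) + exp (b / 2) * (K\<^sup>2 * ((\<Sum>i<n. lind (d / K) n i) / real n) + b\<^sup>2 / real n)"
          using bound[OF elim(2) d] by (simp add: dist_norm distrib_left add.assoc)
        then show ?case using elim(1) db by linarith
      qed
    qed
  qed
  \<comment> \<open>Dominated convergence is available because \<open>A n\<close> is bounded by the
    constant \<open>b\<close>.\<close>
  have dom: "(\<lambda>n. expectation (\<lambda>\<omega>. \<bar>exp (\<tau> / 2) - exp (A n \<omega> / 2)\<bar>)) \<longlonglongrightarrow> expectation (\<lambda>\<omega>. 0)"
  proof (rule integral_dominated_convergence[where w="\<lambda>_. exp (\<tau> / 2) + exp (b / 2)"])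
    show "AE \<omega> in M. (\<lambda>n. \<bar>exp (\<tau> / 2) - exp (A n \<omega> / 2)\<bar>) \<longlonglongrightarrow> 0"
      using lim
    proof eventually_elim
      case (elim \<omega>)
      then have "(\<lambda>n. A n \<omega>) \<longlonglongrightarrow> \<tau>" by (simp add: A_def)
      then have "(\<lambda>n. \<bar>exp (\<tau> / 2) - exp (A n \<omega> / 2)\<bar>) \<longlonglongrightarrow> \<bar>exp (\<tau> / 2) - exp (\<tau> / 2)\<bar>" by (intro tendsto_intros) auto
      then show ?case by simp
    qed
    fix n show "AE \<omega> in M. norm \<bar>exp (\<tau> / 2) - exp (A n \<omega> / 2)\<bar> \<le> exp (\<tau> / 2) + exp (b / 2)"
    proof (rule AE_I2)
      fix \<omega> assume "\<omega> \<in> space M"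
      then have "exp (A n \<omega> / 2) \<le> exp (b / 2)" using Abd[of \<omega> n] by simp
      then show "norm \<bar>exp (\<tau> / 2) - exp (A n \<omega> / 2)\<bar> \<le> exp (\<tau> / 2) + exp (b / 2)"
        using abs_triangle_ineq4[of "exp (\<tau> / 2)" "exp (A n \<omega> / 2)"]
        unfolding real_norm_def abs_abs abs_exp_cancel by linarith
    qed
  qed auto
  have Eint: "integrable M (E n)" for n
    by (rule integrable_const_bound[of _ 1]) (auto simp: E_def)
  have Zint: "integrable M (Z n)" for n
  proof (rule integrable_const_bound[of _ "exp (b / 2)"])
    show "AE \<omega> in M. cmod (Z n \<omega>) \<le> exp (b / 2)" using Abd by (intro AE_I2) (auto simp: Z_def E_def norm_mult)
    show "Z n \<in> borel_measurable M" unfolding Z_def[abs_def] by measurable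
  qed
  have "(\<lambda>n. complex_of_real (exp (\<tau> / 2)) * integral\<^sup>L M (E n) - integral\<^sup>L M (Z n)) \<longlonglongrightarrow> 0"
  proof (rule Lim_null_comparison)
    show "(\<lambda>n. expectation (\<lambda>\<omega>. \<bar>exp (\<tau> / 2) - exp (A n \<omega> / 2)\<bar>)) \<longlonglongrightarrow> 0" using dom by simp
    show "\<forall>\<^sub>F n in sequentially. cmod (complex_of_real (exp (\<tau> / 2)) * integral\<^sup>L M (E n) - integral\<^sup>L M (Z n)) \<le> expectation (\<lambda>\<omega>. \<bar>exp (\<tau> / 2) - exp (A n \<omega> / 2)\<bar>)"
    proof (rule always_eventually, rule allI)
      fix n
      have "complex_of_real (exp (\<tau> / 2)) * integral\<^sup>L M (E n) - integral\<^sup>L M (Z n) = integral\<^sup>L M (\<lambda>\<omega>. complex_of_real (exp (\<tau> / 2)) * E n \<omega> - Z n \<omega>)"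
        using Eint Zint by simp
      also have "cmod \<dots> \<le> expectation (\<lambda>\<omega>. cmod (complex_of_real (exp (\<tau> / 2)) * E n \<omega> - Z n \<omega>))" by (rule integral_norm_bound)
      also have "\<dots> = expectation (\<lambda>\<omega>. \<bar>exp (\<tau> / 2) - exp (A n \<omega> / 2)\<bar>)"
      proof (rule Bochner_Integration.integral_cong[OF refl])
        fix \<omega>
        have "complex_of_real (exp (\<tau> / 2)) * E n \<omega> - Z n \<omega> = E n \<omega> * complex_of_real (exp (\<tau> / 2) - exp (A n \<omega> / 2))"
          by (simp add: Z_def algebra_simps)
        then show "cmod (complex_of_real (exp (\<tau> / 2)) * E n \<omega> - Z n \<omega>) = \<bar>exp (\<tau> / 2) - exp (A n \<omega> / 2)\<bar>"
          by (simp only: norm_mult norm_of_real) (simp add: E_def)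
      qed
      finally show "cmod (complex_of_real (exp (\<tau> / 2)) * integral\<^sup>L M (E n) - integral\<^sup>L M (Z n)) \<le> expectation (\<lambda>\<omega>. \<bar>exp (\<tau> / 2) - exp (A n \<omega> / 2)\<bar>)" .
    qed
  qed
  from tendsto_add[OF this Z_lim]
  have "(\<lambda>n. complex_of_real (exp (\<tau> / 2)) * integral\<^sup>L M (E n)) \<longlonglongrightarrow> 1" by simp
  then have "(\<lambda>n. complex_of_real (exp (- \<tau> / 2)) * (complex_of_real (exp (\<tau> / 2)) * integral\<^sup>L M (E n))) \<longlonglongrightarrow> complex_of_real (exp (- \<tau> / 2)) * 1"
    by (intro tendsto_intros)
  moreover have "complex_of_real (exp (- \<tau> / 2)) * (complex_of_real (exp (\<tau> / 2)) * z) = z" for z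
  proof -
    have "exp (- \<tau> / 2) * exp (\<tau> / 2) = 1" by (simp add: exp_add[symmetric])
    then show ?thesis by (simp only: mult.assoc[symmetric] of_real_mult[symmetric]) simp
  qed
  ultimately have "(\<lambda>n. integral\<^sup>L M (E n)) \<longlonglongrightarrow> complex_of_real (exp (- \<tau> / 2))" by (simp only: mult_1_right)
  then show ?thesis by (simp only: E_def[abs_def])
qed

text \<open>The level \<open>sqrt n\<close> keeps \<open>trunc n i / sqrt n\<close> in [-1, 1],
  where the exponential has a quadratic upper bound.\<close>

definition trunc :: "nat \<Rightarrow> nat \<Rightarrow> 'w \<Rightarrow> real" where
  "trunc n i \<omega> = (if \<bar>e i \<omega>\<bar> \<le> sqrt (real n) then e i \<omega> else 0)"

lemma trunc_measF: "i < j \<Longrightarrow> trunc n i \<in> borel_measurable (F j)"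
  unfolding trunc_def[abs_def] using e_measF[of i j] by measurable

lemma trunc_measM [measurable]: "trunc n i \<in> borel_measurable M"
  unfolding trunc_def[abs_def] by measurable

lemma trunc_le: "\<bar>trunc n i \<omega>\<bar> \<le> sqrt (real n)"
  by (simp add: trunc_def)

text \<open>The conditional mean of the truncated error is not zero, but it is of the same order as its
  conditional variance divided by \<open>\<surd>n\<close>, so no recentring is needed.\<close>
lemma exp_moment:
  assumes a: "\<And>i. a i \<in> borel_measurable (F i)" "\<And>i \<omega>. \<omega> \<in> space M \<Longrightarrow> \<bar>a i \<omega>\<bar> \<le> 1" and n: "1 \<le> n"
  shows "expectation (\<lambda>\<omega>. exp (\<Sum>i<n. a i \<omega> * trunc n i \<omega> / sqrt (real n))) \<le> exp (2 * C)"
proof -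
  define x where "x i \<omega> = a i \<omega> * trunc n i \<omega> / sqrt (real n)" for i \<omega>
  define P where "P k \<omega> = exp (\<Sum>i<k. x i \<omega>)" for k \<omega>
  have aM[measurable]: "a i \<in> borel_measurable M" for i by (rule measM[OF a(1)])
  have xb: "\<bar>x i \<omega>\<bar> \<le> 1" if "\<omega> \<in> space M" for i \<omega>
  proof -
    have "\<bar>a i \<omega>\<bar> * \<bar>trunc n i \<omega>\<bar> \<le> 1 * sqrt (real n)"
      by (intro mult_mono a trunc_le that) auto
    then show ?thesis using n by (simp add: x_def abs_mult)
  qed
  have PF: "P k \<in> borel_measurable (F k)" for k
  proof -
    have "(\<lambda>\<omega>. \<Sum>i<k. x i \<omega>) \<in> borel_measurable (F k)" unfolding x_def
      by (intro borel_measurable_sum borel_measurable_times borel_measurable_divide trunc_measF measF[OF _ a(1)]) auto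
    then show ?thesis unfolding P_def[abs_def] by measurable
  qed
  have PM[measurable]: "P k \<in> borel_measurable M" for k by (rule measM[OF PF])
  have Pb: "0 \<le> P k \<omega> \<and> P k \<omega> \<le> exp (real k)" if "\<omega> \<in> space M" for k \<omega>
  proof -
    have "(\<Sum>i<k. x i \<omega>) \<le> (\<Sum>i<k. 1)" using xb[OF that] by (intro sum_mono) (simp add: abs_le_iff)
    then show ?thesis by (simp add: P_def)
  qed
  have Pint: "integrable M (P k)" for k
    by (rule integrable_const_bound[of _ "exp (real k)"]) (use Pb in auto)
  have step: "expectation (P (Suc k)) \<le> (1 + 2 * C / real n) * expectation (P k)" for k
  proof -
    have Pe2: "integrable M (\<lambda>\<omega>. P k \<omega> * (e k \<omega>)\<^sup>2)"
      by (rule int_bounded_mult[OF e_sq PM, where B="exp (real k)"]) (use Pb in auto)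
    have pa: "(\<lambda>\<omega>. P k \<omega> * a k \<omega>) \<in> borel_measurable (F k)" by (intro borel_measurable_times PF a)
    have pab: "\<bar>P k \<omega> * a k \<omega>\<bar> \<le> exp (real k)" if "\<omega> \<in> space M" for \<omega>
      using mult_mono[of "\<bar>P k \<omega>\<bar>" "exp (real k)" "\<bar>a k \<omega>\<bar>" 1] Pb[OF that, of k] a(2)[OF that, of k] by (simp add: abs_mult)
    have Pae: "integrable M (\<lambda>\<omega>. (P k \<omega> * a k \<omega>) * e k \<omega>)"
      by (rule int_bounded_mult[OF e_int measM[OF pa] pab])
    have "expectation (P (Suc k)) \<le> expectation (\<lambda>\<omega>. P k \<omega> + ((P k \<omega> * a k \<omega>) * e k \<omega>) / sqrt (real n) + 2 / real n * (P k \<omega> * (e k \<omega>)\<^sup>2))"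
    proof (rule integral_mono[OF Pint])
      show "integrable M (\<lambda>\<omega>. P k \<omega> + ((P k \<omega> * a k \<omega>) * e k \<omega>) / sqrt (real n) + 2 / real n * (P k \<omega> * (e k \<omega>)\<^sup>2))"
        using Pint Pae Pe2 by auto
      fix \<omega> assume w: "\<omega> \<in> space M"
      have sq: "sqrt (real n) > 0" using n by simp
      have x2: "(x k \<omega>)\<^sup>2 \<le> (e k \<omega>)\<^sup>2 / real n"
      proof -
        have "(a k \<omega>)\<^sup>2 \<le> 1" using a(2)[OF w, of k] by (simp add: abs_square_le_1)
        then have "(a k \<omega>)\<^sup>2 * (trunc n k \<omega>)\<^sup>2 \<le> 1 * (e k \<omega>)\<^sup>2" by (intro mult_mono) (auto simp: trunc_def)
        then show ?thesis by (simp add: x_def power_divide power_mult_distrib divide_right_mono)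
      qed
      \<comment> \<open>Where truncation acts, \<open>x k\<close> is 0 and |a e| / sqrt n <= e^2 /
        n. The martingale term may therefore be written with the untruncated error, at the price of
        one more e^2 / n.\<close>
      have x1: "x k \<omega> \<le> a k \<omega> * e k \<omega> / sqrt (real n) + (e k \<omega>)\<^sup>2 / real n"
      proof (cases "\<bar>e k \<omega>\<bar> \<le> sqrt (real n)")
        case False
        have "\<bar>a k \<omega> * e k \<omega>\<bar> \<le> 1 * \<bar>e k \<omega>\<bar>" unfolding abs_mult using a(2)[OF w, of k] by (intro mult_right_mono) auto
        then have "- (a k \<omega> * e k \<omega>) * sqrt (real n) \<le> \<bar>e k \<omega>\<bar> * \<bar>e k \<omega>\<bar>"
          using False sq by (intro mult_mono) auto
        then have "- (a k \<omega> * e k \<omega>) * sqrt (real n) / real n \<le> (e k \<omega>)\<^sup>2 / real n"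
          by (intro divide_right_mono) (auto simp: power2_eq_square)
        moreover have "- (a k \<omega> * e k \<omega>) * sqrt (real n) / real n = - (a k \<omega> * e k \<omega> / sqrt (real n))"
          using n by (simp add: field_simps real_sqrt_mult_self flip: power2_eq_square)
        ultimately show ?thesis using False by (simp add: x_def trunc_def)
      qed (simp add: x_def trunc_def)
      have "P (Suc k) \<omega> = P k \<omega> * exp (x k \<omega>)" by (simp add: P_def exp_add)
      also have "\<dots> \<le> P k \<omega> * (1 + (a k \<omega> * e k \<omega> / sqrt (real n) + (e k \<omega>)\<^sup>2 / real n) + (e k \<omega>)\<^sup>2 / real n)"
        using exp_le_quadratic[OF xb[OF w, of k]] x1 x2 Pb[OF w, of k] by (intro mult_left_mono) auto
      finally show "P (Suc k) \<omega> \<le> P k \<omega> + ((P k \<omega> * a k \<omega>) * e k \<omega>) / sqrt (real n) + 2 / real n * (P k \<omega> * (e k \<omega>)\<^sup>2)"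
        by (simp add: algebra_simps)
    qed
    also have "\<dots> = expectation (P k) + 0 / sqrt (real n) + 2 / real n * expectation (\<lambda>\<omega>. P k \<omega> * (e k \<omega>)\<^sup>2)"
      using Pint Pae Pe2 mart[OF pa Pae] by simp
    also have "\<dots> \<le> expectation (P k) + 0 / sqrt (real n) + 2 / real n * (C * expectation (P k))"
      using var_bound[OF PF Pb] by (intro add_left_mono mult_left_mono) auto
    finally show ?thesis by (simp add: algebra_simps)
  qed
  have "expectation (P k) \<le> (1 + 2 * C / real n) ^ k" for k
  proof (induction k)
    case 0 then show ?case by (simp add: P_def prob_space)
  next
    case (Suc k)
    have "0 \<le> 1 + 2 * C / real n" using C0 by simp
    then show ?case using step[of k] Suc by (simp add: mult_left_mono order_trans[OF step])
  qed
  then have "expectation (P n) \<le> (1 + 2 * C / real n) ^ n" .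
  also have "\<dots> \<le> exp (2 * C / real n) ^ n" using C0 exp_ge_add_one_self[of "2 * C / real n"] by (intro power_mono) auto
  also have "\<dots> = exp (2 * C)" using n by (simp add: exp_of_nat_mult[symmetric])
  finally show ?thesis by (simp add: P_def[abs_def] x_def)
qed

lemma exp_abs_moment:
  assumes a: "\<And>i. a i \<in> borel_measurable (F i)" "\<And>i \<omega>. \<omega> \<in> space M \<Longrightarrow> \<bar>a i \<omega>\<bar> \<le> 1" and n: "1 \<le> n"
  shows "integrable M (\<lambda>\<omega>. exp \<bar>\<Sum>i<n. a i \<omega> * trunc n i \<omega> / sqrt (real n)\<bar>)"
    and "expectation (\<lambda>\<omega>. exp \<bar>\<Sum>i<n. a i \<omega> * trunc n i \<omega> / sqrt (real n)\<bar>) \<le> 2 * exp (2 * C)"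
proof -
  define S where "S \<omega> = (\<Sum>i<n. a i \<omega> * trunc n i \<omega> / sqrt (real n))" for \<omega>
  have aM[measurable]: "a i \<in> borel_measurable M" for i by (rule measM[OF a(1)])
  have SM[measurable]: "S \<in> borel_measurable M" unfolding S_def[abs_def] by measurable
  have Sb: "\<bar>S \<omega>\<bar> \<le> real n" if "\<omega> \<in> space M" for \<omega>
  proof -
    have "\<bar>a i \<omega> * trunc n i \<omega> / sqrt (real n)\<bar> \<le> 1" for i
    proof -
      have "\<bar>a i \<omega>\<bar> * \<bar>trunc n i \<omega>\<bar> \<le> 1 * sqrt (real n)" by (intro mult_mono a trunc_le that) auto
      then show ?thesis using n by (simp add: abs_mult)
    qed
    then have "\<bar>S \<omega>\<bar> \<le> (\<Sum>i<n. 1)" unfolding S_def by (intro order_trans[OF sum_abs] sum_mono) auto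
    then show ?thesis by simp
  qed
  have i1: "integrable M (\<lambda>\<omega>. exp (S \<omega>))" "integrable M (\<lambda>\<omega>. exp (- S \<omega>))" "integrable M (\<lambda>\<omega>. exp \<bar>S \<omega>\<bar>)"
    by (rule integrable_const_bound[of _ "exp (real n)"]; use Sb in \<open>auto simp: abs_le_iff\<close>)+
  then show "integrable M (\<lambda>\<omega>. exp \<bar>\<Sum>i<n. a i \<omega> * trunc n i \<omega> / sqrt (real n)\<bar>)" by (simp add: S_def)
  have "expectation (\<lambda>\<omega>. exp \<bar>S \<omega>\<bar>) \<le> expectation (\<lambda>\<omega>. exp (S \<omega>) + exp (- S \<omega>))"
    by (rule integral_mono) (use i1 in \<open>auto simp: abs_if\<close>)
  also have "\<dots> = expectation (\<lambda>\<omega>. exp (S \<omega>)) + expectation (\<lambda>\<omega>. exp (- S \<omega>))" using i1 by simp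
  also have "expectation (\<lambda>\<omega>. exp (S \<omega>)) \<le> exp (2 * C)" unfolding S_def by (rule exp_moment[OF a n])
  also have "expectation (\<lambda>\<omega>. exp (- S \<omega>)) \<le> exp (2 * C)"
    using exp_moment[of "\<lambda>i \<omega>. - a i \<omega>" n] a n by (simp add: S_def sum_negf)
  finally show "expectation (\<lambda>\<omega>. exp \<bar>\<Sum>i<n. a i \<omega> * trunc n i \<omega> / sqrt (real n)\<bar>) \<le> 2 * exp (2 * C)"
    by (simp add: S_def)
qed

end

section \<open>Dyadic grids and chaining\<close>

definition grid :: "real \<Rightarrow> nat \<Rightarrow> (real^'p) set" where
  "grid \<rho> k = (\<lambda>m :: 'p \<Rightarrow> int. \<chi> j. \<rho> * real_of_int (m j) / 2 ^ k) ` (UNIV \<rightarrow>\<^sub>E {- (2 ^ k)..2 ^ k})"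

lemma grid_finite: "finite (grid \<rho> k :: (real^'p) set)"
  unfolding grid_def by (intro finite_imageI finite_PiE) auto

lemma grid_card: "real (card (grid \<rho> k :: (real^'p) set)) \<le> 2 ^ ((k + 2) * CARD('p))"
proof -
  have "card (grid \<rho> k :: (real^'p) set) \<le> card ((UNIV :: 'p set) \<rightarrow>\<^sub>E {- (2 ^ k)..2 ^ k :: int})"
    unfolding grid_def by (intro card_image_le finite_PiE) auto
  also have "\<dots> = (nat (2 * 2 ^ k + 1)) ^ CARD('p)" by (simp add: card_PiE)
  also have "\<dots> \<le> (2 ^ (k + 2)) ^ CARD('p)"
  proof (intro power_mono)
    have "(1::int) \<le> 2 ^ k" by simp
    moreover have "(2::int) ^ (k + 2) = 4 * 2 ^ k" by simp
    ultimately have "(2::int) * 2 ^ k + 1 \<le> 2 ^ (k + 2)" by linarith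
    then show "nat (2 * 2 ^ k + 1) \<le> 2 ^ (k + 2)" by (simp add: nat_le_iff)
  qed simp
  also have "\<dots> = 2 ^ ((k + 2) * CARD('p))" by (rule power_mult[symmetric])
  finally have "real (card (grid \<rho> k :: (real^'p) set)) \<le> real (2 ^ ((k + 2) * CARD('p)))" by (rule of_nat_mono)
  then show ?thesis by simp
qed

lemma grid_cube:
  assumes "g \<in> grid \<rho> k" "0 < \<rho>"
  shows "\<bar>g $ j\<bar> \<le> \<rho>"
proof -
  obtain m where m: "g = (\<chi> j. \<rho> * real_of_int (m j) / 2 ^ k)" and mP: "m \<in> UNIV \<rightarrow>\<^sub>E {- (2 ^ k)..2 ^ k}"
    using assms(1) unfolding grid_def by blast
  have "m j \<in> {- (2 ^ k)..2 ^ k}" using PiE_mem[OF mP, of j] by simp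
  then have "\<bar>m j\<bar> \<le> 2 ^ k" by auto
  then have "real_of_int \<bar>m j\<bar> \<le> real_of_int (2 ^ k)" by (simp only: of_int_le_iff)
  then have "\<rho> * \<bar>real_of_int (m j)\<bar> \<le> \<rho> * 2 ^ k" using assms(2) by (intro mult_left_mono) auto
  then show ?thesis using assms(2) by (simp add: m abs_mult divide_le_eq)
qed

text \<open>Coordinatewise rounding down; the Euclidean norm is bounded by the sum of the
  coordinates, which produces the factor \<open>CARD('p)\<close>.\<close>

lemma grid_approx:
  fixes h :: "real^'p"
  assumes "0 < \<rho>" "\<And>j. \<bar>h $ j\<bar> \<le> \<rho>"
  obtains g where "g \<in> grid \<rho> k" "norm (h - g) \<le> real CARD('p) * \<rho> / 2 ^ k"
proof -
  define m where "m = (\<lambda>j. \<lfloor>2 ^ k * (h $ j / \<rho>)\<rfloor>)"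
  have hb: "- 1 \<le> h $ j / \<rho> \<and> h $ j / \<rho> \<le> 1" for j
    using assms(2)[of j] assms(1) by (auto simp: abs_le_iff field_simps)
  have "m j \<in> {- (2 ^ k)..2 ^ k}" for j
  proof -
    have "2 ^ k * (h $ j / \<rho>) \<le> 2 ^ k * 1" "2 ^ k * (- 1) \<le> 2 ^ k * (h $ j / \<rho>)" using hb[of j] by (intro mult_left_mono; simp)+
    then have "m j \<le> \<lfloor>2 ^ k :: real\<rfloor>" "\<lfloor>- (2 ^ k) :: real\<rfloor> \<le> m j" unfolding m_def by (intro floor_mono; simp)+
    moreover have "\<lfloor>2 ^ k :: real\<rfloor> = 2 ^ k" "\<lfloor>- (2 ^ k) :: real\<rfloor> = - (2 ^ k)"
      using floor_of_int[of "2 ^ k"] floor_of_int[of "- (2 ^ k)"] by simp_all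
    ultimately show ?thesis by simp
  qed
  then have mP: "m \<in> UNIV \<rightarrow>\<^sub>E {- (2 ^ k)..2 ^ k}" by auto
  define g :: "real^'p" where "g = (\<chi> j. \<rho> * real_of_int (m j) / 2 ^ k)"
  show ?thesis
  proof (rule that[of g])
    show "g \<in> grid \<rho> k" unfolding grid_def g_def using mP by blast
    have "\<bar>(h - g) $ j\<bar> \<le> \<rho> / 2 ^ k" for j
    proof -
      have fl: "0 \<le> 2 ^ k * (h $ j / \<rho>) - real_of_int (m j)" "2 ^ k * (h $ j / \<rho>) - real_of_int (m j) \<le> 1"
        unfolding m_def by linarith+
      have "(h - g) $ j = (\<rho> / 2 ^ k) * (2 ^ k * (h $ j / \<rho>) - real_of_int (m j))"
        using assms(1) by (simp add: g_def field_simps)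
      then have "\<bar>(h - g) $ j\<bar> = (\<rho> / 2 ^ k) * (2 ^ k * (h $ j / \<rho>) - real_of_int (m j))"
        using fl assms(1) by simp
      also have "\<dots> \<le> (\<rho> / 2 ^ k) * 1" using fl assms(1) by (intro mult_left_mono) auto
      finally show ?thesis by simp
    qed
    then have "(\<Sum>j\<in>UNIV. \<bar>(h - g) $ j\<bar>) \<le> (\<Sum>j\<in>(UNIV::'p set). \<rho> / 2 ^ k)" by (intro sum_mono) auto
    then show "norm (h - g) \<le> real CARD('p) * \<rho> / 2 ^ k" using norm_le_l1_cart[of "h - g"] by simp
  qed
qed

text \<open>The partial sum has a closed form whose subtracted remainder is nonnegative; 14 is the
  sum of (2 k + 5) / 2^k over all k.\<close>

lemma sum_dyadic_linear: "(\<Sum>k<n. (a * (2 * real k + 5) + b) / 2 ^ k) \<le> 14 * a + 2 * b" if "0 \<le> a" "0 \<le> b"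
proof -
  have "(\<Sum>k<n. (a * (2 * real k + 5) + b) / 2 ^ k) = 14 * a + 2 * b - (a * (4 * real n + 14) + 2 * b) / 2 ^ n"
  proof (induction n)
    case (Suc n)
    show ?case unfolding sum.lessThan_Suc Suc.IH by (simp add: field_simps)
  qed simp
  moreover have "0 \<le> (a * (4 * real n + 14) + 2 * b) / 2 ^ n" using that by simp
  ultimately show ?thesis by linarith
qed

context bounded_mds
begin

text \<open>Each \<open>h\<close> is reached from 0 through grid points \<open>\<pi> 0\<close>,
  \<open>\<pi> 1\<close>, and so on. Increments divided by their size \<open>q k\<close> have
  bounded exponential moments by \<open>exp_abs_moment\<close>. The elementary bound x <= a + exp (x
  - a), with the exponentials summed over all pairs in \<open>T k\<close>, replaces a maximum by a
  sum and yields one integrable \<open>U\<close> valid for all \<open>h\<close>.\<close>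

lemma chaining:
  fixes r :: "nat \<Rightarrow> 'w \<Rightarrow> real^'p \<Rightarrow> real"
  assumes \<rho>: "0 < \<rho>" and w: "0 < w" and n: "1 \<le> n"
    and r_meas: "\<And>i h. (\<And>j. \<bar>h $ j\<bar> \<le> \<rho>) \<Longrightarrow> (\<lambda>\<omega>. r i \<omega> h) \<in> borel_measurable (F i)"
    and r0: "\<And>i \<omega>. \<omega> \<in> space M \<Longrightarrow> r i \<omega> 0 = 0"
    and r_lip: "\<And>i \<omega> h h'. \<omega> \<in> space M \<Longrightarrow> (\<And>j. \<bar>h $ j\<bar> \<le> \<rho>) \<Longrightarrow> (\<And>j. \<bar>h' $ j\<bar> \<le> \<rho>) \<Longrightarrow>
      \<bar>r i \<omega> h - r i \<omega> h'\<bar> \<le> w * norm (h - h')"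
  obtains U where "integrable M U" "\<And>\<omega>. 0 \<le> U \<omega>"
    "expectation U \<le> real CARD('p) * (1 + 28 * real CARD('p) + 8 * exp (2 * C)) * w * \<rho>"
    "\<And>\<omega> h. \<omega> \<in> space M \<Longrightarrow> (\<And>j. \<bar>h $ j\<bar> \<le> \<rho>) \<Longrightarrow> \<bar>\<Sum>i<n. r i \<omega> h * trunc n i \<omega> / sqrt (real n)\<bar> \<le> U \<omega>"
proof -
  define p where "p = real CARD('p)"
  have p1: "1 \<le> p" by (simp add: p_def Suc_le_eq)
  define s where "s = p * \<rho>"
  have s: "0 < s" using p1 \<rho> by (simp add: s_def)
  define q where "q k = w * (2 * s / 2 ^ k)" for k :: nat
  have q: "0 < q k" for k using w s by (simp add: q_def)
  define D :: "nat \<Rightarrow> (real^'p) set" where "D = grid \<rho>"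
  have Dfin: "finite (D k)" and Dcube: "g \<in> D k \<Longrightarrow> \<bar>g $ j\<bar> \<le> \<rho>" for k g j
    unfolding D_def using grid_finite grid_cube[OF _ \<rho>] by auto
  define T where "T k = {(g, g'). g \<in> D (Suc k) \<and> g' \<in> D k \<and> norm (g - g') \<le> 2 * s / 2 ^ k}" for k
  have T_sub: "T k \<subseteq> D (Suc k) \<times> D k" for k by (auto simp: T_def)
  have Tfin: "finite (T k)" for k using finite_subset[OF T_sub] Dfin by auto
  \<comment> \<open>Upper bound for the logarithm of the number of links: \<open>grid_card\<close>
    at levels \<open>k\<close> and \<open>Suc k\<close>, with base 2 enlarged to
    \<open>exp 1\<close>.\<close>
  define ak where "ak k = p * (2 * real k + 5)" for k :: nat
  have Tcard: "real (card (T k)) \<le> exp (ak k)" for k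
  proof -
    have "card (T k) \<le> card (D (Suc k)) * card (D k)"
      using card_mono[OF _ T_sub] Dfin by (metis card_cartesian_product finite_cartesian_product)
    then have "real (card (T k)) \<le> real (card (D (Suc k))) * real (card (D k))" by (metis of_nat_le_iff of_nat_mult)
    also have "\<dots> \<le> 2 ^ ((Suc k + 2) * CARD('p)) * 2 ^ ((k + 2) * CARD('p))"
      unfolding D_def using grid_card[of \<rho> "Suc k", where 'p='p] grid_card[of \<rho> k, where 'p='p] by (intro mult_mono) auto
    also have "\<dots> = (2::real) ^ ((2 * k + 5) * CARD('p))" by (simp add: power_add[symmetric] algebra_simps)
    also have "\<dots> \<le> exp 1 ^ ((2 * k + 5) * CARD('p))" using exp_ge_add_one_self[of 1] by (intro power_mono) auto
    also have "\<dots> = exp (ak k)" by (simp add: exp_of_nat_mult[symmetric] ak_def p_def mult_ac)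
    finally show ?thesis .
  qed
  define G where "G h \<omega> = (\<Sum>i<n. r i \<omega> h * trunc n i \<omega> / sqrt (real n))" for h \<omega>
  define X where "X k g g' \<omega> = (\<Sum>i<n. ((r i \<omega> g - r i \<omega> g') / q k) * trunc n i \<omega> / sqrt (real n))" for k g g' \<omega>
  have GX: "G g \<omega> - G g' \<omega> = q k * X k g g' \<omega>" for k g g' \<omega>
    unfolding G_def X_def sum_subtractf[symmetric] sum_distrib_left
    using q[of k] by (intro sum.cong refl) (simp add: field_simps)
  have Xexp: "integrable M (\<lambda>\<omega>. exp \<bar>X k g g' \<omega>\<bar>) \<and> expectation (\<lambda>\<omega>. exp \<bar>X k g g' \<omega>\<bar>) \<le> 2 * exp (2 * C)" if t: "(g, g') \<in> T k" for k g g'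
  proof -
    have gg: "\<And>j. \<bar>g $ j\<bar> \<le> \<rho>" "\<And>j. \<bar>g' $ j\<bar> \<le> \<rho>" "norm (g - g') \<le> 2 * s / 2 ^ k"
      using t Dcube by (auto simp: T_def)
    have m: "(\<lambda>\<omega>. (r i \<omega> g - r i \<omega> g') / q k) \<in> borel_measurable (F i)" for i
      by (intro borel_measurable_divide borel_measurable_diff r_meas gg) auto
    have b: "\<bar>(r i \<omega> g - r i \<omega> g') / q k\<bar> \<le> 1" if "\<omega> \<in> space M" for i \<omega>
    proof -
      have "\<bar>r i \<omega> g - r i \<omega> g'\<bar> \<le> w * norm (g - g')" by (rule r_lip[OF that gg(1,2)])
      also have "\<dots> \<le> q k" unfolding q_def using gg(3) w by (intro mult_left_mono) auto
      finally show ?thesis using q[of k] by simp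
    qed
    show ?thesis unfolding X_def using exp_abs_moment[OF m b n] by simp
  qed
  \<comment> \<open>The first term pays for stopping the chain, the k-th summand for its k-th link.
    Since \<open>card (T k) \<le> exp (ak k)\<close>, each weighted sum of exponentials has
    expectation at most \<open>2 * exp (2 * C)\<close>.\<close>
  define U where "U \<omega> = w * s + (\<Sum>k<n. q k * (ak k + exp (- ak k) * (\<Sum>(g, g')\<in>T k. exp \<bar>X k g g' \<omega>\<bar>)))" for \<omega>
  have ak0: "0 \<le> ak k" for k using p1 by (simp add: ak_def)
  show ?thesis
  proof (rule that[of U])
    have int: "integrable M (\<lambda>\<omega>. \<Sum>(g, g')\<in>T k. exp \<bar>X k g g' \<omega>\<bar>)" for k
      using Xexp by (intro Bochner_Integration.integrable_sum) auto
    show "integrable M U" unfolding U_def[abs_def] using int by auto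
    show "0 \<le> U \<omega>" for \<omega> unfolding U_def using w s q[THEN less_imp_le] ak0
      by (intro add_nonneg_nonneg sum_nonneg mult_nonneg_nonneg) auto
    have "expectation U = w * s + (\<Sum>k<n. q k * (ak k + exp (- ak k) * (\<Sum>(g, g')\<in>T k. expectation (\<lambda>\<omega>. exp \<bar>X k g g' \<omega>\<bar>))))"
    proof -
      have "expectation (\<lambda>\<omega>. \<Sum>(g, g')\<in>T k. exp \<bar>X k g g' \<omega>\<bar>) = (\<Sum>(g, g')\<in>T k. expectation (\<lambda>\<omega>. exp \<bar>X k g g' \<omega>\<bar>))" for k
        unfolding case_prod_beta using Xexp by (intro Bochner_Integration.integral_sum) (metis prod.collapse)
      then show ?thesis unfolding U_def[abs_def] using int by (simp add: prob_space)
    qed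
    also have "\<dots> \<le> w * s + (\<Sum>k<n. q k * (ak k + 2 * exp (2 * C)))"
    proof (intro add_left_mono sum_mono mult_left_mono)
      fix k
      have "(\<Sum>(g, g')\<in>T k. expectation (\<lambda>\<omega>. exp \<bar>X k g g' \<omega>\<bar>)) \<le> (\<Sum>(g, g')\<in>T k. 2 * exp (2 * C))"
        by (intro sum_mono) (use Xexp in auto)
      also have "\<dots> = real (card (T k)) * (2 * exp (2 * C))" by simp
      also have "\<dots> \<le> exp (ak k) * (2 * exp (2 * C))" by (intro mult_right_mono Tcard) simp
      finally have "exp (- ak k) * (\<Sum>(g, g')\<in>T k. expectation (\<lambda>\<omega>. exp \<bar>X k g g' \<omega>\<bar>)) \<le> exp (- ak k) * (exp (ak k) * (2 * exp (2 * C)))"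
        by (intro mult_left_mono) auto
      also have "\<dots> = 2 * exp (2 * C)" by (simp add: mult.assoc[symmetric] exp_add[symmetric])
      finally show "exp (- ak k) * (\<Sum>(g, g')\<in>T k. expectation (\<lambda>\<omega>. exp \<bar>X k g g' \<omega>\<bar>)) \<le> 2 * exp (2 * C)" .
    qed (use q in \<open>auto intro: less_imp_le\<close>)
    also have "(\<Sum>k<n. q k * (ak k + 2 * exp (2 * C))) = 2 * w * s * (\<Sum>k<n. (p * (2 * real k + 5) + 2 * exp (2 * C)) / 2 ^ k)"
      unfolding sum_distrib_left by (intro sum.cong refl) (simp add: q_def ak_def)
    also have "\<dots> \<le> 2 * w * s * (14 * p + 2 * (2 * exp (2 * C)))"
      using w s p1 by (intro mult_left_mono sum_dyadic_linear) auto
    finally show "expectation U \<le> real CARD('p) * (1 + 28 * real CARD('p) + 8 * exp (2 * C)) * w * \<rho>"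
      by (simp add: s_def p_def algebra_simps)
    fix \<omega> and h :: "real^'p" assume om: "\<omega> \<in> space M" and h: "\<And>j. \<bar>h $ j\<bar> \<le> \<rho>"
    have "\<exists>g. g \<in> D k \<and> norm (h - g) \<le> s / 2 ^ k" for k
      using grid_approx[OF \<rho> h, of k] unfolding D_def s_def p_def by blast
    then obtain \<pi>' where \<pi>': "\<And>k. \<pi>' k \<in> D k \<and> norm (h - \<pi>' k) \<le> s / 2 ^ k" by metis
    \<comment> \<open>The chain starts at 0, where \<open>r\<close> vanishes, so no initial term
      remains.\<close>
    define \<pi> where "\<pi> k = (if k = 0 then 0 else \<pi>' k)" for k
    have "(0 :: real^'p) \<in> D 0"
      unfolding D_def grid_def by (rule image_eqI[of _ _ "\<lambda>_. 0"]) (auto simp: vec_eq_iff)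
    moreover have "norm h \<le> s"
    proof -
      have "(\<Sum>j\<in>UNIV. \<bar>h $ j\<bar>) \<le> (\<Sum>j\<in>(UNIV::'p set). \<rho>)" by (intro sum_mono h)
      then show ?thesis using norm_le_l1_cart[of h] by (simp add: s_def p_def)
    qed
    ultimately have \<pi>: "\<pi> k \<in> D k" "norm (h - \<pi> k) \<le> s / 2 ^ k" for k using \<pi>'[of k] by (auto simp: \<pi>_def)
    have stepT: "(\<pi> (Suc k), \<pi> k) \<in> T k" for k
    proof -
      have "norm (\<pi> (Suc k) - \<pi> k) \<le> norm (h - \<pi> k) + norm (h - \<pi> (Suc k))"
        using norm_triangle_ineq4[of "h - \<pi> k" "h - \<pi> (Suc k)"] by simp
      also have "\<dots> \<le> s / 2 ^ k + s / 2 ^ Suc k" by (intro add_mono \<pi>)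
      also have "\<dots> \<le> 2 * s / 2 ^ k" using s by (simp add: field_simps)
      finally show ?thesis using \<pi> by (auto simp: T_def)
    qed
    have G0: "G (\<pi> 0) \<omega> = 0" by (simp add: G_def \<pi>_def r0[OF om])
    have "G (\<pi> n) \<omega> = (\<Sum>k<n. G (\<pi> (Suc k)) \<omega> - G (\<pi> k) \<omega>)"
      using sum_lessThan_telescope[of "\<lambda>k. G (\<pi> k) \<omega>" n] G0 by simp
    also have "\<bar>\<dots>\<bar> \<le> (\<Sum>k<n. \<bar>G (\<pi> (Suc k)) \<omega> - G (\<pi> k) \<omega>\<bar>)" by (rule sum_abs)
    also have "\<dots> \<le> (\<Sum>k<n. q k * (ak k + exp (- ak k) * (\<Sum>(g, g')\<in>T k. exp \<bar>X k g g' \<omega>\<bar>)))"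
    proof (intro sum_mono)
      fix k
      define x where "x = \<bar>X k (\<pi> (Suc k)) (\<pi> k) \<omega>\<bar>"
      have "x \<le> ak k + exp (x - ak k)" using exp_ge_add_one_self[of "x - ak k"] by linarith
      also have "exp (x - ak k) = exp (- ak k) * exp x" by (simp add: exp_add[symmetric])
      also have "exp x \<le> (\<Sum>(g, g')\<in>T k. exp \<bar>X k g g' \<omega>\<bar>)"
        unfolding x_def using member_le_sum[OF stepT[of k], of "\<lambda>(g, g'). exp \<bar>X k g g' \<omega>\<bar>"] Tfin[of k] by auto
      finally have "x \<le> ak k + exp (- ak k) * (\<Sum>(g, g')\<in>T k. exp \<bar>X k g g' \<omega>\<bar>)" by simp
      then have "q k * x \<le> q k * (ak k + exp (- ak k) * (\<Sum>(g, g')\<in>T k. exp \<bar>X k g g' \<omega>\<bar>))"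
        using q[of k] by (intro mult_left_mono) auto
      then show "\<bar>G (\<pi> (Suc k)) \<omega> - G (\<pi> k) \<omega>\<bar> \<le> q k * (ak k + exp (- ak k) * (\<Sum>(g, g')\<in>T k. exp \<bar>X k g g' \<omega>\<bar>))"
        unfolding GX[of _ _ _ k] x_def using q[of k] by (simp add: abs_mult)
    qed
    finally have main: "\<bar>G (\<pi> n) \<omega>\<bar> \<le> (\<Sum>k<n. q k * (ak k + exp (- ak k) * (\<Sum>(g, g')\<in>T k. exp \<bar>X k g g' \<omega>\<bar>)))" .
    \<comment> \<open>Level \<open>n\<close> is deep enough for a crude bound: each of the
      \<open>n\<close> summands is at most \<open>w * s / 2 ^ n\<close>, and n <= 2^n.\<close>
    have "G h \<omega> - G (\<pi> n) \<omega> = (\<Sum>i<n. (r i \<omega> h - r i \<omega> (\<pi> n)) * (trunc n i \<omega> / sqrt (real n)))"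
      unfolding G_def sum_subtractf[symmetric] by (intro sum.cong refl) (simp add: left_diff_distrib diff_divide_distrib)
    also have "\<bar>\<dots>\<bar> \<le> (\<Sum>i<n. \<bar>(r i \<omega> h - r i \<omega> (\<pi> n)) * (trunc n i \<omega> / sqrt (real n))\<bar>)" by (rule sum_abs)
    also have "\<dots> \<le> (\<Sum>i<n. (w * (s / 2 ^ n)) * 1)"
    proof (rule sum_mono)
      fix i
      have "\<bar>r i \<omega> h - r i \<omega> (\<pi> n)\<bar> \<le> w * norm (h - \<pi> n)" by (rule r_lip[OF om h]) (rule Dcube[OF \<pi>(1)])
      also have "\<dots> \<le> w * (s / 2 ^ n)" using w \<pi>(2) by (intro mult_left_mono) auto
      finally have 1: "\<bar>r i \<omega> h - r i \<omega> (\<pi> n)\<bar> \<le> w * (s / 2 ^ n)" .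
      have 2: "\<bar>trunc n i \<omega> / sqrt (real n)\<bar> \<le> 1" using trunc_le[of n i \<omega>] n by simp
      show "\<bar>(r i \<omega> h - r i \<omega> (\<pi> n)) * (trunc n i \<omega> / sqrt (real n))\<bar> \<le> (w * (s / 2 ^ n)) * 1"
        unfolding abs_mult using 1 2 w s by (intro mult_mono) auto
    qed
    also have "\<dots> = w * s * (real n / 2 ^ n)" by simp
    also have "\<dots> \<le> w * s * 1"
    proof (intro mult_left_mono)
      have "real n \<le> 2 ^ n" by (rule of_nat_less_two_power[THEN less_imp_le])
      then show "real n / 2 ^ n \<le> 1" by simp
    qed (use w s in auto)
    finally have "\<bar>G h \<omega> - G (\<pi> n) \<omega>\<bar> \<le> w * s" by simp
    then show "\<bar>\<Sum>i<n. r i \<omega> h * trunc n i \<omega> / sqrt (real n)\<bar> \<le> U \<omega>"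
      using main unfolding U_def G_def[symmetric] by linarith
  qed
qed

text \<open>Chaining over the whole cube alone gives a bound of order \<open>sqrt n\<close>, useless
  for small \<open>h\<close>. It is therefore applied on every cube of half-width
  \<open>2 ^ j / sqrt n\<close>, and the results are combined with weights decreasing like 4^-j. The
  expectation stays of order \<open>w\<close>, and the price is the factor 1 + 4 n |h|^2, a growth
  that a quadratic objective can absorb.\<close>

lemma multiscale_chaining:
  fixes r :: "nat \<Rightarrow> 'w \<Rightarrow> real^'p \<Rightarrow> real"
  assumes \<delta>: "0 < \<delta>" and w: "0 < w" and n: "1 \<le> n" "1 \<le> 2 * \<delta> * sqrt (real n)"
    and r_meas: "\<And>i h. (\<And>j. \<bar>h $ j\<bar> \<le> 2 * \<delta>) \<Longrightarrow> (\<lambda>\<omega>. r i \<omega> h) \<in> borel_measurable (F i)"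
    and r0: "\<And>i \<omega>. \<omega> \<in> space M \<Longrightarrow> r i \<omega> 0 = 0"
    and r_lip: "\<And>i \<omega> h h'. \<omega> \<in> space M \<Longrightarrow> (\<And>j. \<bar>h $ j\<bar> \<le> 2 * \<delta>) \<Longrightarrow> (\<And>j. \<bar>h' $ j\<bar> \<le> 2 * \<delta>) \<Longrightarrow>
      \<bar>r i \<omega> h - r i \<omega> h'\<bar> \<le> w * norm (h - h')"
  obtains W where "integrable M W" "\<And>\<omega>. 0 \<le> W \<omega>"
    "expectation W \<le> 2 * (real CARD('p) * (1 + 28 * real CARD('p) + 8 * exp (2 * C))) * w"
    "\<And>\<omega> h. \<omega> \<in> space M \<Longrightarrow> (\<And>j. \<bar>h $ j\<bar> \<le> \<delta>) \<Longrightarrow>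
      \<bar>\<Sum>i<n. r i \<omega> h * trunc n i \<omega>\<bar> \<le> (1 + 4 * (real n * (norm h)\<^sup>2)) * W \<omega>"
proof -
  define c where "c = real CARD('p) * (1 + 28 * real CARD('p) + 8 * exp (2 * C))"
  have c0: "0 \<le> c" by (simp add: c_def)
  have sn: "0 < sqrt (real n)" using n by simp
  \<comment> \<open>The Lipschitz bound is available up to half-width \<open>2 * \<delta>\<close>;
    rounding the size of an \<open>h\<close> from the cube of half-width \<open>\<delta>\<close> up
    to the next dyadic scale stays within it.\<close>
  define J where "J = {j::nat. 2 ^ j \<le> 2 * \<delta> * sqrt (real n)}"
  have "J \<subseteq> {..nat \<lceil>2 * \<delta> * sqrt (real n)\<rceil>}"
  proof
    fix j assume "j \<in> J"
    then have "2 ^ j \<le> 2 * \<delta> * sqrt (real n)" by (simp add: J_def)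
    then have "real j \<le> 2 * \<delta> * sqrt (real n)" using of_nat_less_two_power[of j, where 'a=real] by linarith
    then have "int j \<le> \<lceil>2 * \<delta> * sqrt (real n)\<rceil>" by linarith
    then show "j \<in> {..nat \<lceil>2 * \<delta> * sqrt (real n)\<rceil>}" by simp
  qed
  then have Jfin: "finite J" using finite_subset by blast
  define PU where "PU j U \<longleftrightarrow> integrable M U \<and> (\<forall>\<omega>. 0 \<le> U \<omega>) \<and> expectation U \<le> c * w * (2 ^ j / sqrt (real n)) \<and>
    (\<forall>\<omega> h. \<omega> \<in> space M \<longrightarrow> (\<forall>k. \<bar>h $ k\<bar> \<le> 2 ^ j / sqrt (real n)) \<longrightarrow> \<bar>\<Sum>i<n. r i \<omega> h * trunc n i \<omega> / sqrt (real n)\<bar> \<le> U \<omega>)" for j :: nat and U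
  have ex: "\<exists>U. PU j U" if j: "j \<in> J" for j
  proof -
    have jd: "2 ^ j / sqrt (real n) \<le> 2 * \<delta>" using j sn by (simp add: J_def divide_le_eq)
    have tr: "\<bar>h $ k\<bar> \<le> 2 * \<delta>" if "\<And>k. \<bar>h $ k\<bar> \<le> 2 ^ j / sqrt (real n)" for h :: "real^'p" and k
      using that[of k] jd by simp
    have p: "0 < 2 ^ j / sqrt (real n)" using sn by simp
    show ?thesis
    proof (rule chaining[where r=r, OF p w n(1)])
      show "(\<lambda>\<omega>. r i \<omega> h) \<in> borel_measurable (F i)" if "\<And>k. \<bar>h $ k\<bar> \<le> 2 ^ j / sqrt (real n)" for i h
        by (rule r_meas[OF tr[OF that]])
      show "\<bar>r i \<omega> h - r i \<omega> h'\<bar> \<le> w * norm (h - h')" if "\<omega> \<in> space M" "\<And>k. \<bar>h $ k\<bar> \<le> 2 ^ j / sqrt (real n)" "\<And>k. \<bar>h' $ k\<bar> \<le> 2 ^ j / sqrt (real n)" for i \<omega> h h'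
        by (rule r_lip[OF that(1) tr[OF that(2)] tr[OF that(3)]])
    qed (use r0 in \<open>auto simp: c_def PU_def\<close>)
  qed
  obtain U where U': "\<forall>j\<in>J. PU j (U j)" using bchoice[of J PU] ex by blast
  have U: "\<And>j. j \<in> J \<Longrightarrow> integrable M (U j)" "\<And>j \<omega>. j \<in> J \<Longrightarrow> 0 \<le> U j \<omega>"
      "\<And>j. j \<in> J \<Longrightarrow> expectation (U j) \<le> c * w * (2 ^ j / sqrt (real n))"
      "\<And>j \<omega> h. j \<in> J \<Longrightarrow> \<omega> \<in> space M \<Longrightarrow> (\<And>k. \<bar>h $ k\<bar> \<le> 2 ^ j / sqrt (real n)) \<Longrightarrow> \<bar>\<Sum>i<n. r i \<omega> h * trunc n i \<omega> / sqrt (real n)\<bar> \<le> U j \<omega>"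
    using U' unfolding PU_def by auto
  \<comment> \<open>The factor \<open>sqrt n\<close> undoes the normalization in
    \<open>chaining\<close>; with it the expectations are \<open>c * w\<close> times 2^-j, a series
    with sum at most 2.\<close>
  define W where "W \<omega> = (\<Sum>j\<in>J. sqrt (real n) / 4 ^ j * U j \<omega>)" for \<omega>
  show ?thesis
  proof (rule that[of W])
    show "integrable M W" unfolding W_def[abs_def] using U(1) by (intro Bochner_Integration.integrable_sum) auto
    show W0: "0 \<le> W \<omega>" for \<omega> unfolding W_def using U(2) by (intro sum_nonneg mult_nonneg_nonneg) auto
    have "expectation W = (\<Sum>j\<in>J. sqrt (real n) / 4 ^ j * expectation (U j))"
      unfolding W_def[abs_def] using U(1) by (subst Bochner_Integration.integral_sum) auto
    also have "\<dots> \<le> (\<Sum>j\<in>J. sqrt (real n) / 4 ^ j * (c * w * (2 ^ j / sqrt (real n))))"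
      using U(3) by (intro sum_mono mult_left_mono) auto
    also have "\<dots> = c * w * (\<Sum>j\<in>J. (1 / 2) ^ j)"
    proof -
      have "sqrt (real n) / 4 ^ j * (c * w * (2 ^ j / sqrt (real n))) = c * w * (1 / 2) ^ j" for j :: nat
      proof -
        have "(4::real) ^ j = 2 ^ j * 2 ^ j" by (simp add: power_mult_distrib[symmetric])
        then show ?thesis using sn by (simp add: power_divide)
      qed
      then show ?thesis by (simp add: sum_distrib_left)
    qed
    also have "\<dots> \<le> c * w * 2"
    proof (intro mult_left_mono)
      have "(\<Sum>j\<in>J. (1 / 2 :: real) ^ j) \<le> (\<Sum>j. (1 / 2) ^ j)"
        by (intro sum_le_suminf Jfin) (auto intro!: summable_geometric)
      also have "(\<Sum>j. (1 / 2 :: real) ^ j) = 2" by (subst suminf_geometric) auto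
      finally show "(\<Sum>j\<in>J. (1 / 2 :: real) ^ j) \<le> 2" .
    qed (use c0 w in auto)
    finally show "expectation W \<le> 2 * (real CARD('p) * (1 + 28 * real CARD('p) + 8 * exp (2 * C))) * w"
      by (simp add: c_def mult_ac)
    fix \<omega> and h :: "real^'p" assume om: "\<omega> \<in> space M" and h: "\<And>j. \<bar>h $ j\<bar> \<le> \<delta>"
    define Q where "Q j \<longleftrightarrow> (\<forall>k. \<bar>h $ k\<bar> \<le> 2 ^ j / sqrt (real n))" for j :: nat
    have "\<exists>j. Q j"
    proof -
      obtain j :: nat where "\<delta> * sqrt (real n) < 2 ^ j" using real_arch_pow[of 2 "\<delta> * sqrt (real n)"] by auto
      then have "\<delta> \<le> 2 ^ j / sqrt (real n)" using sn by (simp add: le_divide_eq)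
      then show ?thesis unfolding Q_def using h order_trans by blast
    qed
    \<comment> \<open>The least scale whose cube contains \<open>h\<close>. If
      \<open>j = Suc i\<close>, some coordinate exceeds \<open>2 ^ i / sqrt n\<close>, whence 4^j <=
      4 n |h|^2; the case \<open>j = 0\<close> accounts for the additive 1.\<close>
    define j where "j = (LEAST j. Q j)"
    have Qj: "Q j" unfolding j_def using \<open>\<exists>j. Q j\<close> by (rule LeastI_ex)
    have key: "j \<in> J \<and> 4 ^ j \<le> 1 + 4 * (real n * (norm h)\<^sup>2)"
    proof (cases j)
      case 0
      then show ?thesis using n by (simp add: J_def)
    next
      case (Suc i)
      then have "\<not> Q i" unfolding j_def by (metis lessI not_less_Least)
      then obtain k where k: "2 ^ i / sqrt (real n) < \<bar>h $ k\<bar>" by (auto simp: Q_def not_le)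
      then have "2 ^ i < \<bar>h $ k\<bar> * sqrt (real n)" using sn by (simp add: divide_less_eq)
      moreover have "\<bar>h $ k\<bar> * sqrt (real n) \<le> \<delta> * sqrt (real n)" using h[of k] by (intro mult_right_mono) auto
      ultimately have "2 ^ i < \<delta> * sqrt (real n)" by linarith
      then have jJ: "j \<in> J" by (simp add: J_def Suc)
      have "2 ^ i / sqrt (real n) \<le> norm h" using k component_le_norm_cart[of h k] by simp
      then have "2 ^ i \<le> sqrt (real n) * norm h" using sn by (simp add: divide_le_eq mult.commute)
      then have "(2 ^ i)\<^sup>2 \<le> (sqrt (real n) * norm h)\<^sup>2" by (intro power_mono) auto
      moreover have "(2 ^ i)\<^sup>2 = (4::real) ^ i" by (simp add: power2_eq_square flip: power_mult_distrib)
      moreover have "(sqrt (real n) * norm h)\<^sup>2 = real n * (norm h)\<^sup>2" by (simp add: power_mult_distrib)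
      ultimately have "4 ^ i \<le> real n * (norm h)\<^sup>2" by simp
      then show ?thesis using jJ by (simp add: Suc)
    qed
    have "\<bar>\<Sum>i<n. r i \<omega> h * trunc n i \<omega>\<bar> = sqrt (real n) * \<bar>\<Sum>i<n. r i \<omega> h * trunc n i \<omega> / sqrt (real n)\<bar>"
      using sn by (simp add: sum_divide_distrib[symmetric])
    also have "\<dots> \<le> sqrt (real n) * U j \<omega>"
      using U(4)[OF _ om, of j h] key Qj by (intro mult_left_mono) (auto simp: Q_def)
    also have "\<dots> = 4 ^ j * (sqrt (real n) / 4 ^ j * U j \<omega>)" by simp
    also have "\<dots> \<le> 4 ^ j * W \<omega>"
      unfolding W_def using key Jfin U(2) by (intro mult_left_mono member_le_sum[of j J "\<lambda>j. sqrt (real n) / 4 ^ j * U j \<omega>"]) auto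
    also have "\<dots> \<le> (1 + 4 * (real n * (norm h)\<^sup>2)) * W \<omega>" using key W0 by (intro mult_right_mono) auto
    finally show "\<bar>\<Sum>i<n. r i \<omega> h * trunc n i \<omega>\<bar> \<le> (1 + 4 * (real n * (norm h)\<^sup>2)) * W \<omega>" .
  qed
qed

text \<open>Union bound and Markov's inequality for squares: beyond the level \<open>sqrt n\<close>
  one has 1 <= e^2 / n.\<close>

lemma prob_truncated:
  "prob {\<omega>\<in>space M. \<exists>i<n. trunc n i \<omega> \<noteq> e i \<omega>} \<le> (\<Sum>i<n. lind 1 n i) / real n"
proof (cases "n = 0")
  case False
  let ?A = "\<lambda>i. {\<omega>\<in>space M. sqrt (real n) < \<bar>e i \<omega>\<bar>}"
  have "prob {\<omega>\<in>space M. \<exists>i<n. trunc n i \<omega> \<noteq> e i \<omega>} \<le> prob (\<Union>i<n. ?A i)"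
    by (intro finite_measure_mono) (auto simp: trunc_def not_le split: if_splits)
  also have "\<dots> \<le> (\<Sum>i<n. prob (?A i))" by (intro finite_measure_subadditive_finite) auto
  also have "\<dots> \<le> (\<Sum>i<n. lind 1 n i / real n)"
  proof (rule sum_mono)
    fix i
    have "prob (?A i) = expectation (indicator (?A i))" by simp
    also have "\<dots> \<le> expectation (\<lambda>\<omega>. (e i \<omega>)\<^sup>2 * (if 1 * sqrt (real n) < \<bar>e i \<omega>\<bar> then 1 else 0) / real n)"
    proof (rule integral_mono)
      show "integrable M (indicator (?A i) :: 'w \<Rightarrow> real)" by (simp add: integrable_real_indicator emeasure_eq_measure)
      show "integrable M (\<lambda>\<omega>. (e i \<omega>)\<^sup>2 * (if 1 * sqrt (real n) < \<bar>e i \<omega>\<bar> then 1 else 0) / real n)" using lind_int[of i "1 * sqrt (real n)"] by simp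
      fix \<omega> assume "\<omega> \<in> space M"
      show "indicator (?A i) \<omega> \<le> (e i \<omega>)\<^sup>2 * (if 1 * sqrt (real n) < \<bar>e i \<omega>\<bar> then 1 else 0) / real n"
      proof (cases "sqrt (real n) < \<bar>e i \<omega>\<bar>")
        case True
        then have "(sqrt (real n))\<^sup>2 \<le> \<bar>e i \<omega>\<bar>\<^sup>2" by (intro power_mono) auto
        then show ?thesis using True False \<open>n \<noteq> 0\<close> by (simp add: indicator_def)
      qed (simp add: indicator_def)
    qed
    also have "\<dots> = lind 1 n i / real n" unfolding lind_def by simp
    finally show "prob (?A i) \<le> lind 1 n i / real n" .
  qed
  finally show ?thesis by (simp add: sum_divide_distrib)
qed simp

text \<open>At the finitely many net points a mean-square bound suffices; off the net the error is
  \<open>d\<close> times the average of \<open>\<bar>e i\<bar>\<close>, of expectation at most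
  \<open>1 + C\<close>. As \<open>U\<close> does not depend on \<open>t\<close>, it may be evaluated
  at a data-dependent parameter.\<close>

lemma uniform_lln:
  fixes g :: "nat \<Rightarrow> 'w \<Rightarrow> 't \<Rightarrow> real"
  assumes g_meas: "\<And>i t. t \<in> T \<Longrightarrow> (\<lambda>\<omega>. g i \<omega> t) \<in> borel_measurable (F i)"
    and g_bd: "\<And>i \<omega> t. \<omega> \<in> space M \<Longrightarrow> t \<in> T \<Longrightarrow> \<bar>g i \<omega> t\<bar> \<le> K"
    and net: "\<And>d. 0 < d \<Longrightarrow> \<exists>S. finite S \<and> S \<subseteq> T \<and> (\<forall>t\<in>T. \<exists>s\<in>S. \<forall>i. \<forall>\<omega>\<in>space M. \<bar>g i \<omega> t - g i \<omega> s\<bar> \<le> d)"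
    and \<epsilon>: "0 < \<epsilon>"
  obtains U where "\<And>n. integrable M (U n)" "\<forall>\<^sub>F n in sequentially. expectation (U n) \<le> \<epsilon>"
    "\<And>n \<omega>. 0 \<le> U n \<omega>"
    "\<And>n \<omega> t. \<omega> \<in> space M \<Longrightarrow> t \<in> T \<Longrightarrow> \<bar>(\<Sum>i<n. g i \<omega> t * e i \<omega>) / real n\<bar> \<le> U n \<omega>"
proof -
  define d where "d = \<epsilon> / (2 * (1 + C))"
  have d: "0 < d" "d * (1 + C) = \<epsilon> / 2" using \<epsilon> C0 by (auto simp: d_def field_simps)
  obtain S where S: "finite S" "S \<subseteq> T" "\<And>t. t \<in> T \<Longrightarrow> \<exists>s\<in>S. \<forall>i. \<forall>\<omega>\<in>space M. \<bar>g i \<omega> t - g i \<omega> s\<bar> \<le> d"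
    using net[OF d(1)] by auto
  define A where "A n s \<omega> = (\<Sum>i<n. g i \<omega> s * e i \<omega>) / real n" for n s \<omega>
  define U where "U n \<omega> = (\<Sum>s\<in>S. \<bar>A n s \<omega>\<bar>) + d * ((\<Sum>i<n. \<bar>e i \<omega>\<bar>) / real n)" for n \<omega>
  have gM: "(\<lambda>\<omega>. g i \<omega> s) \<in> borel_measurable M" if "s \<in> S" for i s by (rule measM[OF g_meas]) (use that S in auto)
  have iA: "integrable M (A n s)" if s: "s \<in> S" for n s
    unfolding A_def[abs_def] using int_bounded_mult[OF e_int gM[OF s] g_bd] s S(2)
    by (intro integrable_divide Bochner_Integration.integrable_sum) blast
  have A2: "integrable M (\<lambda>\<omega>. (A n s \<omega>)\<^sup>2)" "expectation (\<lambda>\<omega>. (A n s \<omega>)\<^sup>2) \<le> K\<^sup>2 * C / real n" if s: "s \<in> S" for n s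
  proof -
    have sT: "s \<in> T" using s S(2) by auto
    have eq: "(\<lambda>\<omega>. (A n s \<omega>)\<^sup>2) = (\<lambda>\<omega>. (\<Sum>i<n. g i \<omega> s * e i \<omega>)\<^sup>2 / (real n)\<^sup>2)" by (simp add: A_def power_divide)
    note sm = second_moment[of "\<lambda>i \<omega>. g i \<omega> s" K n, OF g_meas[OF sT] g_bd[OF _ sT]]
    show "integrable M (\<lambda>\<omega>. (A n s \<omega>)\<^sup>2)" unfolding eq using sm(1) by simp
    have "expectation (\<lambda>\<omega>. (A n s \<omega>)\<^sup>2) = expectation (\<lambda>\<omega>. (\<Sum>i<n. g i \<omega> s * e i \<omega>)\<^sup>2) / (real n)\<^sup>2" unfolding eq by simp
    also have "\<dots> \<le> real n * (K\<^sup>2 * C) / (real n)\<^sup>2" using sm(2) by (intro divide_right_mono) auto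
    also have "\<dots> = K\<^sup>2 * C / real n" by (simp add: power2_eq_square)
    finally show "expectation (\<lambda>\<omega>. (A n s \<omega>)\<^sup>2) \<le> K\<^sup>2 * C / real n" .
  qed
  have A_lim: "(\<lambda>n. expectation (\<lambda>\<omega>. \<bar>A n s \<omega>\<bar>)) \<longlonglongrightarrow> 0" if s: "s \<in> S" for s
  proof (rule tendsto_sandwich[of "\<lambda>_. 0" _ _ "\<lambda>n. sqrt (K\<^sup>2 * C / real n)"])
    show "\<forall>\<^sub>F n in sequentially. expectation (\<lambda>\<omega>. \<bar>A n s \<omega>\<bar>) \<le> sqrt (K\<^sup>2 * C / real n)"
    proof (rule always_eventually, rule allI)
      fix n
      define m where "m = expectation (\<lambda>\<omega>. \<bar>A n s \<omega>\<bar>)"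
      have "0 \<le> expectation (\<lambda>\<omega>. (\<bar>A n s \<omega>\<bar> - m)\<^sup>2)" by (rule Bochner_Integration.integral_nonneg) simp
      also have "expectation (\<lambda>\<omega>. (\<bar>A n s \<omega>\<bar> - m)\<^sup>2) = expectation (\<lambda>\<omega>. (A n s \<omega>)\<^sup>2 - 2 * m * \<bar>A n s \<omega>\<bar> + m\<^sup>2)"
        by (simp add: power2_diff algebra_simps)
      also have "\<dots> = expectation (\<lambda>\<omega>. (A n s \<omega>)\<^sup>2) - m\<^sup>2"
        using A2(1)[OF s] iA[OF s] by (simp add: prob_space m_def[symmetric] power2_eq_square)
      finally have "m\<^sup>2 \<le> K\<^sup>2 * C / real n" using A2(2)[OF s, of n] by simp
      then show "m \<le> sqrt (K\<^sup>2 * C / real n)" by (rule real_le_rsqrt)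
    qed
    have "(\<lambda>n. sqrt (K\<^sup>2 * C / real n)) \<longlonglongrightarrow> sqrt 0" by (intro tendsto_real_sqrt lim_const_over_n)
    then show "(\<lambda>n. sqrt (K\<^sup>2 * C / real n)) \<longlonglongrightarrow> 0" by simp
  qed auto
  have iU: "integrable M (U n)" for n
    unfolding U_def[abs_def] using iA e_int by (auto intro!: Bochner_Integration.integrable_sum)
  have EU: "expectation (U n) \<le> (\<Sum>s\<in>S. expectation (\<lambda>\<omega>. \<bar>A n s \<omega>\<bar>)) + \<epsilon> / 2" for n
  proof -
    have "expectation (U n) = (\<Sum>s\<in>S. expectation (\<lambda>\<omega>. \<bar>A n s \<omega>\<bar>)) + d * ((\<Sum>i<n. expectation (\<lambda>\<omega>. \<bar>e i \<omega>\<bar>)) / real n)"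
      unfolding U_def[abs_def] using iA e_int by (simp add: Bochner_Integration.integral_sum)
    moreover have "(\<Sum>i<n. expectation (\<lambda>\<omega>. \<bar>e i \<omega>\<bar>)) / real n \<le> 1 + C"
    proof (cases "n = 0")
      case False
      have "(\<Sum>i<n. expectation (\<lambda>\<omega>. \<bar>e i \<omega>\<bar>)) \<le> (\<Sum>i<n. 1 + C)"
      proof (rule sum_mono)
        fix i
        have "expectation (\<lambda>\<omega>. \<bar>e i \<omega>\<bar>) \<le> expectation (\<lambda>\<omega>. 1 + (e i \<omega>)\<^sup>2)"
        proof (rule integral_mono)
          fix \<omega>
          have "0 \<le> (\<bar>e i \<omega>\<bar> - 1)\<^sup>2" by simp
          then have "2 * \<bar>e i \<omega>\<bar> \<le> 1 + (e i \<omega>)\<^sup>2" by (simp add: power2_diff)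
          then show "\<bar>e i \<omega>\<bar> \<le> 1 + (e i \<omega>)\<^sup>2" by simp
        qed (use e_int e_sq in auto)
        also have "\<dots> \<le> 1 + C" using e_sq var_le[of i] by (simp add: prob_space)
        finally show "expectation (\<lambda>\<omega>. \<bar>e i \<omega>\<bar>) \<le> 1 + C" .
      qed
      then show ?thesis using False by (simp add: divide_le_eq mult.commute)
    qed (use C0 in simp)
    then have "d * ((\<Sum>i<n. expectation (\<lambda>\<omega>. \<bar>e i \<omega>\<bar>)) / real n) \<le> d * (1 + C)" using d(1) by (intro mult_left_mono) auto
    ultimately show ?thesis using d(2) by simp
  qed
  show ?thesis
  proof (rule that[of U])
    show "integrable M (U n)" for n by (rule iU)
    have "(\<lambda>n. (\<Sum>s\<in>S. expectation (\<lambda>\<omega>. \<bar>A n s \<omega>\<bar>))) \<longlonglongrightarrow> (\<Sum>s\<in>S. 0)" by (intro tendsto_sum A_lim)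
    then have "\<forall>\<^sub>F n in sequentially. (\<Sum>s\<in>S. expectation (\<lambda>\<omega>. \<bar>A n s \<omega>\<bar>)) < \<epsilon> / 2"
      by (rule order_tendstoD(2)) (use \<epsilon> in simp)
    then show "\<forall>\<^sub>F n in sequentially. expectation (U n) \<le> \<epsilon>"
      by eventually_elim (use EU in \<open>smt (verit) field_sum_of_halves\<close>)
    show "0 \<le> U n \<omega>" for n \<omega> unfolding U_def using d(1) by (intro add_nonneg_nonneg sum_nonneg mult_nonneg_nonneg divide_nonneg_nonneg) auto
    fix n \<omega> t assume om: "\<omega> \<in> space M" and t: "t \<in> T"
    obtain s where s: "s \<in> S" "\<And>i. \<bar>g i \<omega> t - g i \<omega> s\<bar> \<le> d" using S(3)[OF t] om by blast
    have "(\<Sum>i<n. g i \<omega> t * e i \<omega>) / real n - A n s \<omega> = (\<Sum>i<n. (g i \<omega> t - g i \<omega> s) * e i \<omega>) / real n"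
      by (simp add: A_def diff_divide_distrib[symmetric] sum_subtractf[symmetric] left_diff_distrib)
    also have "\<bar>\<dots>\<bar> \<le> (\<Sum>i<n. d * \<bar>e i \<omega>\<bar>) / real n"
    proof -
      have "\<bar>\<Sum>i<n. (g i \<omega> t - g i \<omega> s) * e i \<omega>\<bar> \<le> (\<Sum>i<n. d * \<bar>e i \<omega>\<bar>)"
        by (intro order_trans[OF sum_abs] sum_mono) (simp add: abs_mult mult_right_mono s(2))
      then show ?thesis by (simp add: divide_right_mono)
    qed
    also have "\<dots> = d * ((\<Sum>i<n. \<bar>e i \<omega>\<bar>) / real n)" by (simp add: sum_distrib_left)
    finally have "\<bar>(\<Sum>i<n. g i \<omega> t * e i \<omega>) / real n - A n s \<omega>\<bar> \<le> d * ((\<Sum>i<n. \<bar>e i \<omega>\<bar>) / real n)" .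
    moreover have "\<bar>A n s \<omega>\<bar> \<le> (\<Sum>s\<in>S. \<bar>A n s \<omega>\<bar>)" using s(1) S(1) by (intro member_le_sum) auto
    ultimately show "\<bar>(\<Sum>i<n. g i \<omega> t * e i \<omega>) / real n\<bar> \<le> U n \<omega>" unfolding U_def by linarith
  qed
qed

end

section \<open>Convergence in probability\<close>

lemma cesaro_tendsto_0:
  fixes x :: "nat \<Rightarrow> real"
  assumes "x \<longlonglongrightarrow> 0"
  shows "(\<lambda>n. (\<Sum>i<n. x i) / real n) \<longlonglongrightarrow> 0"
proof (rule LIMSEQ_I)
  fix r :: real assume r: "0 < r"
  obtain N where N: "\<And>n. n \<ge> N \<Longrightarrow> \<bar>x n\<bar> < r / 2"
    using LIMSEQ_D[OF assms, of "r / 2"] r by auto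
  define c where "c = (\<Sum>i<N. \<bar>x i\<bar>)"
  have c0: "0 \<le> c" by (simp add: c_def sum_nonneg)
  obtain m :: nat where m: "real m > 2 * c / r" using reals_Archimedean2 by blast
  show "\<exists>no. \<forall>n\<ge>no. norm ((\<Sum>i<n. x i) / real n - 0) < r"
  proof (intro exI allI impI)
    fix n assume n: "n \<ge> N + m + 1"
    have "\<bar>\<Sum>i<n. x i\<bar> \<le> (\<Sum>i<n. \<bar>x i\<bar>)" by (rule sum_abs)
    also have "(\<Sum>i<n. \<bar>x i\<bar>) = c + (\<Sum>i\<in>{N..<n}. \<bar>x i\<bar>)"
    proof -
      have "{..<n} = {..<N} \<union> {N..<n}" using n by auto
      then have "(\<Sum>i<n. \<bar>x i\<bar>) = (\<Sum>i\<in>{..<N} \<union> {N..<n}. \<bar>x i\<bar>)" by (rule arg_cong)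
      also have "\<dots> = c + (\<Sum>i\<in>{N..<n}. \<bar>x i\<bar>)" unfolding c_def by (rule sum.union_disjoint) auto
      finally show ?thesis .
    qed
    also have "(\<Sum>i\<in>{N..<n}. \<bar>x i\<bar>) \<le> (\<Sum>i\<in>{N..<n}. r / 2)" using N by (intro sum_mono) (auto intro: less_imp_le)
    also have "\<dots> \<le> real n * (r / 2)" using r by (simp add: mult_right_mono)
    finally have 1: "\<bar>\<Sum>i<n. x i\<bar> \<le> c + real n * (r / 2)" by simp
    have "c < real m * (r / 2)" using m r by (simp add: field_simps)
    also have "\<dots> \<le> real n * (r / 2)" using n r by (intro mult_right_mono) auto
    finally have "\<bar>\<Sum>i<n. x i\<bar> < real n * r" using 1 by (simp add: field_simps)
    then show "norm ((\<Sum>i<n. x i) / real n - 0) < r" using n by (simp add: divide_less_eq mult.commute)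
  qed
qed

lemma measurable_continuous_on_comp:
  fixes g :: "'x::topological_space \<Rightarrow> 'b::topological_space"
  assumes "continuous_on S g" "X \<in> borel_measurable N" "\<And>\<omega>. \<omega> \<in> space N \<Longrightarrow> X \<omega> \<in> S"
  shows "(\<lambda>\<omega>. g (X \<omega>)) \<in> borel_measurable N"
proof -
  have "X \<in> measurable N (restrict_space borel S)"
    using assms by (intro measurable_restrict_space2) auto
  from measurable_compose[OF this borel_measurable_continuous_on_restrict[OF assms(1)]] show ?thesis .
qed

text \<open>The design space need not be second countable, so joint measurability is obtained from a
  partition of unity on the compact set \<open>XX\<close>.\<close>
lemma measurable_continuous_on_prod:
  fixes g :: "'t::metric_space \<Rightarrow> 'x::metric_space \<Rightarrow> 'b::euclidean_space"
  assumes cX: "compact XX" and cT: "compact \<Theta>" and cont: "continuous_on (XX \<times> \<Theta>) (\<lambda>(x, \<theta>). g \<theta> x)"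
    and X: "X \<in> borel_measurable N" "\<And>\<omega>. \<omega> \<in> space N \<Longrightarrow> X \<omega> \<in> XX"
    and T: "T \<in> borel_measurable N" "\<And>\<omega>. \<omega> \<in> space N \<Longrightarrow> T \<omega> \<in> \<Theta>"
  shows "(\<lambda>\<omega>. g (T \<omega>) (X \<omega>)) \<in> borel_measurable N"
proof -
  have approx: "\<exists>G. G \<in> borel_measurable N \<and> (\<forall>\<omega>\<in>space N. norm (G \<omega> - g (T \<omega>) (X \<omega>)) \<le> d)" if d: "0 < d" for d
  proof -
    obtain r where r: "0 < r" "\<And>x x' \<theta> \<theta>'. x \<in> XX \<Longrightarrow> x' \<in> XX \<Longrightarrow> \<theta> \<in> \<Theta> \<Longrightarrow> \<theta>' \<in> \<Theta> \<Longrightarrow>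
      dist x x' < r \<Longrightarrow> dist \<theta> \<theta>' < r \<Longrightarrow> dist (g \<theta> x) (g \<theta>' x') < d"
      by (rule uniformly_continuous_prodE[OF cX cT cont d]) blast
    obtain C where C: "C \<subseteq> XX" "finite C" "XX \<subseteq> (\<Union>c\<in>C. ball c r)"
      by (rule compactE_image[OF cX, of XX "\<lambda>c. ball c r"]) (use r in auto)
    define \<phi> where "\<phi> c \<omega> = max 0 (r - dist (X \<omega>) c)" for c \<omega>
    define s where "s \<omega> = (\<Sum>c\<in>C. \<phi> c \<omega>)" for \<omega>
    have \<phi>m: "\<phi> c \<in> borel_measurable N" for c
      unfolding \<phi>_def[abs_def]
      by (rule measurable_continuous_on_comp[of UNIV "\<lambda>x. max 0 (r - dist x c)"]) (auto intro!: continuous_intros X)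
    have sm: "s \<in> borel_measurable N" unfolding s_def[abs_def] by (intro borel_measurable_sum \<phi>m)
    have gm: "(\<lambda>\<omega>. g (T \<omega>) c) \<in> borel_measurable N" if "c \<in> C" for c
    proof (rule measurable_continuous_on_comp[of \<Theta> "\<lambda>\<theta>. g \<theta> c"])
      have "continuous_on \<Theta> ((\<lambda>(x, \<theta>). g \<theta> x) \<circ> (\<lambda>\<theta>. (c, \<theta>)))"
        by (intro continuous_on_compose continuous_on_subset[OF cont] continuous_intros) (use that C in auto)
      then show "continuous_on \<Theta> (\<lambda>\<theta>. g \<theta> c)" by (simp add: o_def)
    qed (use T in auto)
    define G where "G \<omega> = (\<Sum>c\<in>C. (\<phi> c \<omega> / s \<omega>) *\<^sub>R g (T \<omega>) c)" for \<omega>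
    have "G \<in> borel_measurable N" unfolding G_def[abs_def]
      by (intro borel_measurable_sum borel_measurable_scaleR borel_measurable_divide \<phi>m sm gm)
    moreover have "norm (G \<omega> - g (T \<omega>) (X \<omega>)) \<le> d" if w: "\<omega> \<in> space N" for \<omega>
    proof -
      have nn: "0 \<le> \<phi> c \<omega>" for c by (simp add: \<phi>_def)
      obtain c where c: "c \<in> C" "dist (X \<omega>) c < r" using C(3) X(2)[OF w] by (auto simp: dist_commute)
      have "0 < \<phi> c \<omega>" using c by (simp add: \<phi>_def)
      then have s0: "0 < s \<omega>" unfolding s_def using nn C(2) c(1) by (intro sum_pos2) auto
      have one: "(\<Sum>c\<in>C. \<phi> c \<omega> / s \<omega>) = 1" using s0 by (simp add: sum_divide_distrib[symmetric] s_def)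
      have "G \<omega> - g (T \<omega>) (X \<omega>) = (\<Sum>c\<in>C. (\<phi> c \<omega> / s \<omega>) *\<^sub>R (g (T \<omega>) c - g (T \<omega>) (X \<omega>)))"
        by (simp add: G_def scaleR_diff_right sum_subtractf scaleR_sum_left[symmetric] one)
      also have "norm \<dots> \<le> (\<Sum>c\<in>C. (\<phi> c \<omega> / s \<omega>) * d)"
      proof (rule sum_norm_le)
        fix c assume cC: "c \<in> C"
        show "norm ((\<phi> c \<omega> / s \<omega>) *\<^sub>R (g (T \<omega>) c - g (T \<omega>) (X \<omega>))) \<le> (\<phi> c \<omega> / s \<omega>) * d"
        proof (cases "dist (X \<omega>) c < r")
          case True
          then have "dist (g (T \<omega>) c) (g (T \<omega>) (X \<omega>)) < d"
            using C(1) cC X(2)[OF w] T(2)[OF w] r(1) by (intro r(2)) (auto simp: dist_commute)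
          then show ?thesis using nn[of c] s0 by (simp add: dist_norm mult_left_mono divide_right_mono)
        qed (simp add: \<phi>_def)
      qed
      also have "\<dots> = (\<Sum>c\<in>C. \<phi> c \<omega> / s \<omega>) * d" by (simp only: sum_distrib_right)
      also have "\<dots> = d" by (simp add: one)
      finally show ?thesis .
    qed
    ultimately show ?thesis by blast
  qed
  have "\<forall>k::nat. \<exists>G. G \<in> borel_measurable N \<and> (\<forall>\<omega>\<in>space N. norm (G \<omega> - g (T \<omega>) (X \<omega>)) \<le> 1 / real (Suc k))"
    using approx by simp
  from choice[OF this] obtain G where G: "\<And>k. G k \<in> borel_measurable N"
    "\<And>k \<omega>. \<omega> \<in> space N \<Longrightarrow> norm (G k \<omega> - g (T \<omega>) (X \<omega>)) \<le> 1 / real (Suc k)" by blast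
  show ?thesis
  proof (rule borel_measurable_LIMSEQ_metric[OF G(1)])
    fix \<omega> assume w: "\<omega> \<in> space N"
    have "(\<lambda>k. G k \<omega> - g (T \<omega>) (X \<omega>)) \<longlonglongrightarrow> 0"
      by (rule Lim_null_comparison[OF _ LIMSEQ_Suc[OF lim_1_over_n]]) (use G(2)[OF w] in auto)
    then show "(\<lambda>k. G k \<omega>) \<longlonglongrightarrow> g (T \<omega>) (X \<omega>)" by (simp add: LIM_zero_iff)
  qed
qed

section \<open>Null and tight sequences of random variables\<close>

context prob_space
begin

text \<open>Convergence in probability to 0, one-sided because it is meant for nonnegative
  \<open>R\<close>. The function \<open>prob\<close> is 0 on nonmeasurable sets, so the notion is
  informative only for measurable \<open>R\<close>.\<close>

definition prob_null :: "(nat \<Rightarrow> 'a \<Rightarrow> real) \<Rightarrow> bool" where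
  "prob_null R \<longleftrightarrow> (\<forall>d>0. (\<lambda>n. prob {\<omega>\<in>space M. d < R n \<omega>}) \<longlonglongrightarrow> 0)"

definition prob_tight :: "(nat \<Rightarrow> 'a \<Rightarrow> real) \<Rightarrow> bool" where
  "prob_tight R \<longleftrightarrow> (\<forall>d>0. \<exists>K. \<forall>\<^sub>F n in sequentially. prob {\<omega>\<in>space M. K < R n \<omega>} \<le> d)"

text \<open>The exceptional set only has to be covered by an event, so bad events can be collected
  as finite unions.\<close>

lemma prob_nullI:
  assumes "\<And>d c. 0 < d \<Longrightarrow> 0 < c \<Longrightarrow> \<forall>\<^sub>F n in sequentially. \<exists>B\<in>events. prob B \<le> c \<and> {\<omega>\<in>space M. d < R n \<omega>} \<subseteq> B"
  shows "prob_null R"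
  unfolding prob_null_def tendsto_iff
proof (intro allI impI)
  fix d c :: real assume d: "0 < d" and c: "0 < c"
  have "\<forall>\<^sub>F n in sequentially. \<exists>B\<in>events. prob B \<le> c / 2 \<and> {\<omega>\<in>space M. d < R n \<omega>} \<subseteq> B"
    using assms[OF d, of "c / 2"] c by auto
  then show "\<forall>\<^sub>F n in sequentially. dist (prob {\<omega>\<in>space M. d < R n \<omega>}) 0 < c"
  proof eventually_elim
    case (elim n)
    then obtain B where B: "B \<in> events" "prob B \<le> c / 2" "{\<omega>\<in>space M. d < R n \<omega>} \<subseteq> B" by auto
    then have "prob {\<omega>\<in>space M. d < R n \<omega>} \<le> prob B" by (intro finite_measure_mono)
    then show ?case using B c by (simp add: dist_real_def)
  qed
qed

lemma prob_nullD:
  assumes "prob_null R" "0 < d" "0 < c"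
  shows "\<forall>\<^sub>F n in sequentially. prob {\<omega>\<in>space M. d < R n \<omega>} \<le> c"
proof -
  have "(\<lambda>n. prob {\<omega>\<in>space M. d < R n \<omega>}) \<longlonglongrightarrow> 0" using assms by (simp add: prob_null_def)
  from order_tendstoD(2)[OF this assms(3)] show ?thesis by (rule eventually_mono) simp
qed

lemma prob_null_AE:
  assumes m: "\<And>n. R n \<in> borel_measurable M" and ae: "AE \<omega> in M. (\<lambda>n. R n \<omega>) \<longlonglongrightarrow> 0"
  shows "prob_null R"
  unfolding prob_null_def
proof (intro allI impI)
  fix d :: real assume d: "0 < d"
  note [measurable] = m
  have "(\<lambda>n. expectation (indicator {\<omega>\<in>space M. d < R n \<omega>} :: 'a \<Rightarrow> real)) \<longlonglongrightarrow> expectation (\<lambda>_. 0)"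
  proof (rule integral_dominated_convergence[where w="\<lambda>_. 1"])
    show "AE \<omega> in M. (\<lambda>n. indicator {\<omega>\<in>space M. d < R n \<omega>} \<omega> :: real) \<longlonglongrightarrow> 0"
      using ae
    proof eventually_elim
      case (elim \<omega>)
      then have "\<forall>\<^sub>F n in sequentially. R n \<omega> < d" using d by (rule order_tendstoD)
      then have "\<forall>\<^sub>F n in sequentially. (indicator {\<omega>\<in>space M. d < R n \<omega>} \<omega> :: real) = 0"
        by eventually_elim (auto simp: indicator_def)
      then show ?case by (rule tendsto_eventually)
    qed
  qed (auto simp: indicator_def)
  then show "(\<lambda>n. prob {\<omega>\<in>space M. d < R n \<omega>}) \<longlonglongrightarrow> 0" by simp
qed

lemma prob_markov:
  assumes "integrable M U" "\<And>\<omega>. \<omega> \<in> space M \<Longrightarrow> 0 \<le> U \<omega>" "0 < d"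
  shows "prob {\<omega>\<in>space M. d < U \<omega>} \<le> expectation U / d"
proof -
  have [measurable]: "U \<in> borel_measurable M" using assms(1) by simp
  have "prob {\<omega>\<in>space M. d < U \<omega>} \<le> prob {\<omega>\<in>space M. d \<le> U \<omega>}" by (intro finite_measure_mono) auto
  also have "\<dots> \<le> expectation U / d"
    by (rule integral_Markov_inequality_measure[OF assms(1), of "{}"]) (use assms in auto)
  finally show ?thesis .
qed

lemma prob_tight_perturb:
  assumes m: "\<And>n. A n \<in> borel_measurable M" "\<And>n. B n \<in> borel_measurable M"
    and t: "prob_tight A" and n: "prob_null B" and le: "\<And>n \<omega>. \<omega> \<in> space M \<Longrightarrow> R n \<omega> \<le> A n \<omega> + B n \<omega>"
  shows "prob_tight R"
  unfolding prob_tight_def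
proof (intro allI impI)
  fix d :: real assume d: "0 < d"
  note [measurable] = m
  obtain K where K: "\<forall>\<^sub>F n in sequentially. prob {\<omega>\<in>space M. K < A n \<omega>} \<le> d / 2"
    using t d unfolding prob_tight_def by (meson half_gt_zero)
  have N: "\<forall>\<^sub>F n in sequentially. prob {\<omega>\<in>space M. 1 < B n \<omega>} \<le> d / 2" using prob_nullD[OF n, of 1 "d / 2"] d by simp
  show "\<exists>K. \<forall>\<^sub>F n in sequentially. prob {\<omega>\<in>space M. K < R n \<omega>} \<le> d"
  proof (rule exI[of _ "K + 1"])
    show "\<forall>\<^sub>F n in sequentially. prob {\<omega>\<in>space M. K + 1 < R n \<omega>} \<le> d" using K N
    proof eventually_elim
      case (elim n)
      have "prob {\<omega>\<in>space M. K + 1 < R n \<omega>} \<le> prob ({\<omega>\<in>space M. K < A n \<omega>} \<union> {\<omega>\<in>space M. 1 < B n \<omega>})"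
        using le[of _ n] by (intro finite_measure_mono) force+
      also have "\<dots> \<le> prob {\<omega>\<in>space M. K < A n \<omega>} + prob {\<omega>\<in>space M. 1 < B n \<omega>}"
        by (intro measure_Un_le) auto
      finally show ?case using elim by simp
    qed
  qed
qed

lemma prob_null_mult_tight:
  assumes m: "\<And>n. A n \<in> borel_measurable M" "\<And>n. B n \<in> borel_measurable M"
    and t: "prob_tight A" and n: "prob_null B"
    and nn: "\<And>n \<omega>. \<omega> \<in> space M \<Longrightarrow> 0 \<le> A n \<omega>" "\<And>n \<omega>. \<omega> \<in> space M \<Longrightarrow> 0 \<le> B n \<omega>"
  shows "prob_null (\<lambda>n \<omega>. B n \<omega> * A n \<omega>)"
proof (rule prob_nullI)
  fix d c :: real assume d: "0 < d" and c: "0 < c"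
  note [measurable] = m
  obtain K0 where K0: "\<forall>\<^sub>F n in sequentially. prob {\<omega>\<in>space M. K0 < A n \<omega>} \<le> c / 2"
    using t c unfolding prob_tight_def by (meson half_gt_zero)
  define K where "K = max K0 1"
  have N: "\<forall>\<^sub>F n in sequentially. prob {\<omega>\<in>space M. d / K < B n \<omega>} \<le> c / 2"
    by (rule prob_nullD[OF n]) (use d c in \<open>auto simp: K_def\<close>)
  show "\<forall>\<^sub>F n in sequentially. \<exists>B'\<in>events. prob B' \<le> c \<and> {\<omega>\<in>space M. d < B n \<omega> * A n \<omega>} \<subseteq> B'"
    using K0 N
  proof eventually_elim
    case (elim n)
    let ?B = "{\<omega>\<in>space M. K0 < A n \<omega>} \<union> {\<omega>\<in>space M. d / K < B n \<omega>}"
    have "prob ?B \<le> prob {\<omega>\<in>space M. K0 < A n \<omega>} + prob {\<omega>\<in>space M. d / K < B n \<omega>}"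
      by (intro measure_Un_le) auto
    moreover have "B n \<omega> * A n \<omega> \<le> d" if "\<omega> \<in> space M" "A n \<omega> \<le> K0" "B n \<omega> \<le> d / K" for \<omega>
    proof -
      have "B n \<omega> * A n \<omega> \<le> d / K * K" using that nn[OF that(1), of n] d by (intro mult_mono) (auto simp: K_def)
      then show ?thesis by (simp add: K_def)
    qed
    ultimately show ?case using elim by (intro bexI[of _ ?B]) (auto simp: not_less[symmetric])
  qed
qed

lemma prob_null_add:
  assumes m: "\<And>n. A n \<in> borel_measurable M" "\<And>n. B n \<in> borel_measurable M"
    and A: "prob_null A" and B: "prob_null B" and le: "\<forall>\<^sub>F n in sequentially. \<forall>\<omega>\<in>space M. R n \<omega> \<le> A n \<omega> + B n \<omega>"
  shows "prob_null R"
proof (rule prob_nullI)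
  fix d c :: real assume d: "0 < d" and c: "0 < c"
  note [measurable] = m
  have a: "\<forall>\<^sub>F n in sequentially. prob {\<omega>\<in>space M. d / 2 < A n \<omega>} \<le> c / 2" by (rule prob_nullD[OF A]) (use d c in auto)
  have b: "\<forall>\<^sub>F n in sequentially. prob {\<omega>\<in>space M. d / 2 < B n \<omega>} \<le> c / 2" by (rule prob_nullD[OF B]) (use d c in auto)
  show "\<forall>\<^sub>F n in sequentially. \<exists>B'\<in>events. prob B' \<le> c \<and> {\<omega>\<in>space M. d < R n \<omega>} \<subseteq> B'"
    using a b le
  proof eventually_elim
    case (elim n)
    let ?B = "{\<omega>\<in>space M. d / 2 < A n \<omega>} \<union> {\<omega>\<in>space M. d / 2 < B n \<omega>}"
    have "prob ?B \<le> prob {\<omega>\<in>space M. d / 2 < A n \<omega>} + prob {\<omega>\<in>space M. d / 2 < B n \<omega>}"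
      by (intro measure_Un_le) auto
    then show ?case using elim by (intro bexI[of _ ?B]) (force, auto)
  qed
qed

lemma prob_null_cmult:
  assumes "prob_null R" "0 \<le> c"
  shows "prob_null (\<lambda>n \<omega>. R n \<omega> * c)"
  unfolding prob_null_def
proof (intro allI impI)
  fix d :: real assume d: "0 < d"
  show "(\<lambda>n. prob {\<omega>\<in>space M. d < R n \<omega> * c}) \<longlonglongrightarrow> 0"
  proof (cases "c = 0")
    case True
    then show ?thesis using d by simp
  next
    case False
    then have c: "0 < c" using assms(2) by simp
    have "(d < R n \<omega> * c) = (d / c < R n \<omega>)" for n \<omega> using c by (simp add: pos_divide_less_eq)
    moreover have "0 < d / c" using d c by simp
    ultimately show ?thesis using assms(1) unfolding prob_null_def by simp
  qed
qed

text \<open>\<open>iexp\<close> is 1-Lipschitz on the reals and has modulus 1: close arguments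
  contribute at most \<open>d\<close>, and the rare remaining outcomes at most 2.\<close>

lemma char_perturb:
  fixes Z T :: "nat \<Rightarrow> 'a \<Rightarrow> real^'p"
  assumes Z: "\<And>n. Z n \<in> borel_measurable M" and T: "\<And>n. T n \<in> borel_measurable M"
    and null: "prob_null (\<lambda>n \<omega>. norm (Z n \<omega> - T n \<omega>))"
    and cf: "(\<lambda>n. integral\<^sup>L M (\<lambda>\<omega>. iexp (t \<bullet> T n \<omega>))) \<longlonglongrightarrow> z"
  shows "(\<lambda>n. integral\<^sup>L M (\<lambda>\<omega>. iexp (t \<bullet> Z n \<omega>))) \<longlonglongrightarrow> z"
proof -
  note [measurable] = Z T
  have int: "integrable M (\<lambda>\<omega>. iexp (t \<bullet> Z n \<omega>))" "integrable M (\<lambda>\<omega>. iexp (t \<bullet> T n \<omega>))" for n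
    by (rule integrable_const_bound[of _ 1]; auto)+
  have lip: "cmod (iexp a - iexp b) \<le> \<bar>a - b\<bar>" for a b :: real
  proof -
    have "iexp a - iexp b = iexp b * (iexp (a - b) - 1)" by (simp add: algebra_simps exp_add[symmetric])
    then have "cmod (iexp a - iexp b) = cmod (iexp (a - b) - 1)" by (simp only: norm_mult norm_exp_i_times mult_1_left)
    also have "\<dots> \<le> \<bar>a - b\<bar>" using iexp_approx1[of "a - b" 0] by simp
    finally show ?thesis .
  qed
  have bound: "cmod (integral\<^sup>L M (\<lambda>\<omega>. iexp (t \<bullet> Z n \<omega>)) - integral\<^sup>L M (\<lambda>\<omega>. iexp (t \<bullet> T n \<omega>)))
    \<le> d + 2 * prob {\<omega>\<in>space M. d / (norm t + 1) < norm (Z n \<omega> - T n \<omega>)}" if d: "0 < d" for n d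
  proof -
    let ?A = "{\<omega>\<in>space M. d / (norm t + 1) < norm (Z n \<omega> - T n \<omega>)}"
    have "integral\<^sup>L M (\<lambda>\<omega>. iexp (t \<bullet> Z n \<omega>)) - integral\<^sup>L M (\<lambda>\<omega>. iexp (t \<bullet> T n \<omega>)) = integral\<^sup>L M (\<lambda>\<omega>. iexp (t \<bullet> Z n \<omega>) - iexp (t \<bullet> T n \<omega>))"
      using int by simp
    also have "cmod \<dots> \<le> expectation (\<lambda>\<omega>. cmod (iexp (t \<bullet> Z n \<omega>) - iexp (t \<bullet> T n \<omega>)))" by (rule integral_norm_bound)
    also have "\<dots> \<le> expectation (\<lambda>\<omega>. d + 2 * indicator ?A \<omega>)"
    proof (rule integral_mono)
      show "integrable M (\<lambda>\<omega>. cmod (iexp (t \<bullet> Z n \<omega>) - iexp (t \<bullet> T n \<omega>)))" using int by auto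
      show "integrable M (\<lambda>\<omega>. d + 2 * indicator ?A \<omega>)" by (auto intro!: integrable_real_indicator simp: emeasure_eq_measure)
      fix \<omega> assume w: "\<omega> \<in> space M"
      show "cmod (iexp (t \<bullet> Z n \<omega>) - iexp (t \<bullet> T n \<omega>)) \<le> d + 2 * indicator ?A \<omega>"
      proof (cases "\<omega> \<in> ?A")
        case True
        have "cmod (iexp (t \<bullet> Z n \<omega>) - iexp (t \<bullet> T n \<omega>)) \<le> 1 + 1"
          by (intro order_trans[OF norm_triangle_ineq4] add_mono) auto
        then show ?thesis using True d by simp
      next
        case False
        have "cmod (iexp (t \<bullet> Z n \<omega>) - iexp (t \<bullet> T n \<omega>)) \<le> \<bar>t \<bullet> (Z n \<omega> - T n \<omega>)\<bar>" using lip[of "t \<bullet> Z n \<omega>" "t \<bullet> T n \<omega>"] by (simp add: inner_diff_right)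
        also have "\<dots> \<le> norm t * norm (Z n \<omega> - T n \<omega>)" by (rule Cauchy_Schwarz_ineq2)
        also have "\<dots> \<le> (norm t + 1) * (d / (norm t + 1))" using False w d by (intro mult_mono) auto
        also have "\<dots> = d" using norm_ge_zero[of t] by (simp add: add_nonneg_eq_0_iff)
        finally show ?thesis using False by simp
      qed
    qed
    also have "\<dots> = d + 2 * prob ?A" by (simp add: integrable_real_indicator emeasure_eq_measure prob_space)
    finally show ?thesis .
  qed
  have "(\<lambda>n. integral\<^sup>L M (\<lambda>\<omega>. iexp (t \<bullet> Z n \<omega>)) - integral\<^sup>L M (\<lambda>\<omega>. iexp (t \<bullet> T n \<omega>))) \<longlonglongrightarrow> 0"
    unfolding tendsto_iff
  proof (intro allI impI)
    fix r :: real assume r: "0 < r"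
    have "\<forall>\<^sub>F n in sequentially. prob {\<omega>\<in>space M. (r / 4) / (norm t + 1) < norm (Z n \<omega> - T n \<omega>)} \<le> r / 4"
      by (rule prob_nullD[OF null]) (use r in \<open>auto intro!: divide_pos_pos add_nonneg_pos\<close>)
    then show "\<forall>\<^sub>F n in sequentially. dist (integral\<^sup>L M (\<lambda>\<omega>. iexp (t \<bullet> Z n \<omega>)) - integral\<^sup>L M (\<lambda>\<omega>. iexp (t \<bullet> T n \<omega>))) 0 < r"
    proof eventually_elim
      case (elim n)
      then show ?case using bound[of "r / 4" n] r by (simp add: dist_norm)
    qed
  qed
  from tendsto_add[OF this cf] show ?thesis by simp
qed

end

text \<open>A deterministic expansion of the squares. Only the sum of \<open>r i * et i\<close>
  resists a termwise bound, and the assumption \<open>ch\<close> supplies its chaining bound. Terms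
  linear in |u| are absorbed by 2 |u| <= 1 + |u|^2.\<close>

lemma lse_objective_expansion:
  fixes fi :: "nat \<Rightarrow> real^'p" and m :: "real^'p^'p"
  assumes n: "1 \<le> n" and K: "\<And>i. i < n \<Longrightarrow> norm (fi i) \<le> K" "0 \<le> K"
    and r: "\<And>i. i < n \<Longrightarrow> \<bar>r i\<bar> \<le> w * norm h" and w: "0 \<le> w" "w \<le> 1"
    and gr: "norm ((1 / real n) *\<^sub>R (\<Sum>i<n. outer_prod (fi i) (fi i)) - m) \<le> w"
    and df: "(\<Sum>i<n. \<bar>e i - et i\<bar>) / sqrt (real n) \<le> w"
    and ch: "\<bar>\<Sum>i<n. r i * et i\<bar> \<le> (1 + 4 * (real n * (norm h)\<^sup>2)) * s" and s: "0 \<le> s"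
  defines "u \<equiv> sqrt (real n) *\<^sub>R h" and "S \<equiv> (1 / sqrt (real n)) *\<^sub>R (\<Sum>i<n. et i *\<^sub>R fi i)"
  shows "\<bar>(\<Sum>i<n. (e i - (fi i \<bullet> h + r i))\<^sup>2) - (\<Sum>i<n. (e i)\<^sup>2) - (u \<bullet> (m *v u) - 2 * (u \<bullet> S))\<bar>
    \<le> (w * (3 * K + 3) + 8 * s) * (1 + (norm u)\<^sup>2)"
proof -
  have sn: "0 < sqrt (real n)" using n by simp
  have nu: "(norm u)\<^sup>2 = real n * (norm h)\<^sup>2" "norm u = sqrt (real n) * norm h"
    by (simp_all add: u_def power_mult_distrib)
  define D where "D = (\<Sum>i<n. \<bar>e i - et i\<bar>)"
  have D: "0 \<le> D" "D \<le> w * sqrt (real n)" using df sn by (auto simp: D_def sum_nonneg divide_le_eq)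
  \<comment> \<open>The first sum is compared with the form of \<open>m\<close>, the third is
    exactly the score term, and four are errors. The bounds that follow contribute \<open>w\<close>,
    \<open>w * (2 * K + 1)\<close>, \<open>w * K\<close>, \<open>w\<close> and \<open>8 * s\<close>
    times 1 + |u|^2.\<close>
  have split: "(\<Sum>i<n. (e i - (fi i \<bullet> h + r i))\<^sup>2) - (\<Sum>i<n. (e i)\<^sup>2)
      = (\<Sum>i<n. (fi i \<bullet> h)\<^sup>2) + (\<Sum>i<n. r i * (2 * (fi i \<bullet> h) + r i))
        - 2 * (\<Sum>i<n. et i * (fi i \<bullet> h)) - 2 * (\<Sum>i<n. (e i - et i) * (fi i \<bullet> h))
        - 2 * (\<Sum>i<n. r i * et i) - 2 * (\<Sum>i<n. (e i - et i) * r i)"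
    unfolding sum_distrib_left sum_subtractf[symmetric] sum.distrib[symmetric]
    by (intro sum.cong refl) (simp add: power2_eq_square algebra_simps)
  have g: "u \<bullet> (((1 / real n) *\<^sub>R (\<Sum>i<n. outer_prod (fi i) (fi i))) *v u) = (\<Sum>i<n. (fi i \<bullet> h)\<^sup>2)"
  proof -
    have "u \<bullet> (((1 / real n) *\<^sub>R (\<Sum>i<n. outer_prod (fi i) (fi i))) *v u) = (1 / real n) * (\<Sum>i<n. (fi i \<bullet> u)\<^sup>2)"
      by (simp add: scaleR_matrix_vector_assoc[symmetric] sum_matrix_vector inner_sum_right outer_prod_form)
    also have "\<dots> = (1 / real n) * (real n * (\<Sum>i<n. (fi i \<bullet> h)\<^sup>2))"
      by (simp add: u_def power_mult_distrib sum_distrib_left)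
    finally show ?thesis using n by simp
  qed
  have 1: "\<bar>(\<Sum>i<n. (fi i \<bullet> h)\<^sup>2) - u \<bullet> (m *v u)\<bar> \<le> w * (norm u)\<^sup>2"
  proof -
    have "(\<Sum>i<n. (fi i \<bullet> h)\<^sup>2) - u \<bullet> (m *v u) = u \<bullet> (((1 / real n) *\<^sub>R (\<Sum>i<n. outer_prod (fi i) (fi i)) - m) *v u)"
      unfolding g[symmetric] by (simp add: matrix_vector_mult_diff_rdistrib inner_diff_right)
    also have "\<bar>\<dots>\<bar> \<le> norm u * norm (((1 / real n) *\<^sub>R (\<Sum>i<n. outer_prod (fi i) (fi i)) - m) *v u)" by (rule Cauchy_Schwarz_ineq2)
    also have "\<dots> \<le> norm u * (w * norm u)"
      by (intro mult_left_mono order_trans[OF norm_matrix_vector_le] mult_right_mono gr) auto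
    finally show ?thesis by (simp add: power2_eq_square mult_ac)
  qed
  have fh: "\<bar>fi i \<bullet> h\<bar> \<le> K * norm h" if "i < n" for i
    using Cauchy_Schwarz_ineq2[of "fi i" h] K(1)[OF that] by (meson mult_right_mono norm_ge_zero order_trans)
  have 2: "\<bar>\<Sum>i<n. r i * (2 * (fi i \<bullet> h) + r i)\<bar> \<le> w * (2 * K + 1) * (norm u)\<^sup>2"
  proof -
    have "\<bar>\<Sum>i<n. r i * (2 * (fi i \<bullet> h) + r i)\<bar> \<le> (\<Sum>i<n. \<bar>r i * (2 * (fi i \<bullet> h) + r i)\<bar>)" by (rule sum_abs)
    also have "\<dots> \<le> (\<Sum>i<n. (w * norm h) * ((2 * K + 1) * norm h))"
    proof (rule sum_mono)
      fix i assume "i \<in> {..<n}"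
      then have i: "i < n" by simp
      have "w * norm h \<le> 1 * norm h" using w by (intro mult_right_mono) auto
      then have "\<bar>2 * (fi i \<bullet> h) + r i\<bar> \<le> (2 * K + 1) * norm h"
        using fh[OF i] r[OF i] by (simp add: algebra_simps)
      then show "\<bar>r i * (2 * (fi i \<bullet> h) + r i)\<bar> \<le> (w * norm h) * ((2 * K + 1) * norm h)"
        unfolding abs_mult using r[OF i] w by (intro mult_mono) auto
    qed
    also have "\<dots> = w * (2 * K + 1) * (norm u)\<^sup>2" by (simp add: nu power2_eq_square)
    finally show ?thesis .
  qed
  have eS: "(\<Sum>i<n. et i * (fi i \<bullet> h)) = u \<bullet> S"
    using sn by (simp add: u_def S_def inner_sum_right inner_commute sum_distrib_left[symmetric])
  have amgm: "2 * norm u \<le> 1 + (norm u)\<^sup>2" using sum_squares_bound[of 1 "norm u"] by simp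
  have 3: "\<bar>2 * (\<Sum>i<n. (e i - et i) * (fi i \<bullet> h))\<bar> \<le> w * K * (1 + (norm u)\<^sup>2)"
  proof -
    have "\<bar>\<Sum>i<n. (e i - et i) * (fi i \<bullet> h)\<bar> \<le> (\<Sum>i<n. \<bar>e i - et i\<bar> * (K * norm h))"
      by (intro order_trans[OF sum_abs] sum_mono) (simp add: abs_mult fh mult_left_mono)
    also have "\<dots> = D * (K * norm h)" by (simp add: D_def sum_distrib_right)
    also have "\<dots> \<le> (w * sqrt (real n)) * (K * norm h)" using D K(2) by (intro mult_right_mono) auto
    also have "\<dots> = w * K * norm u" by (simp add: nu mult_ac)
    finally have "\<bar>2 * (\<Sum>i<n. (e i - et i) * (fi i \<bullet> h))\<bar> \<le> w * K * (2 * norm u)" by simp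
    also have "\<dots> \<le> w * K * (1 + (norm u)\<^sup>2)" using amgm w K by (intro mult_left_mono) auto
    finally show ?thesis .
  qed
  have 4: "\<bar>2 * (\<Sum>i<n. (e i - et i) * r i)\<bar> \<le> w * (1 + (norm u)\<^sup>2)"
  proof -
    have "\<bar>\<Sum>i<n. (e i - et i) * r i\<bar> \<le> (\<Sum>i<n. \<bar>e i - et i\<bar> * (1 * norm h))"
    proof (intro order_trans[OF sum_abs] sum_mono)
      fix i assume "i \<in> {..<n}"
      then have "\<bar>r i\<bar> \<le> 1 * norm h" using r[of i] w mult_right_mono[of w 1 "norm h"] by simp
      then show "\<bar>(e i - et i) * r i\<bar> \<le> \<bar>e i - et i\<bar> * (1 * norm h)" unfolding abs_mult by (intro mult_left_mono) auto
    qed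
    also have "\<dots> = D * norm h" by (simp add: D_def sum_distrib_right)
    also have "\<dots> \<le> (w * sqrt (real n)) * norm h" using D by (intro mult_right_mono) auto
    also have "\<dots> = w * norm u" by (simp add: nu)
    finally have "\<bar>2 * (\<Sum>i<n. (e i - et i) * r i)\<bar> \<le> w * (2 * norm u)" by simp
    also have "\<dots> \<le> w * (1 + (norm u)\<^sup>2)" using amgm w by (intro mult_left_mono) auto
    finally show ?thesis .
  qed
  have 5: "\<bar>2 * (\<Sum>i<n. r i * et i)\<bar> \<le> 8 * s * (1 + (norm u)\<^sup>2)"
  proof -
    have "\<bar>2 * (\<Sum>i<n. r i * et i)\<bar> \<le> 2 * ((1 + 4 * (norm u)\<^sup>2) * s)" using ch by (simp add: nu(1))
    also have "\<dots> \<le> 2 * ((4 + 4 * (norm u)\<^sup>2) * s)" using s by (intro mult_left_mono mult_right_mono) auto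
    also have "\<dots> = 8 * s * (1 + (norm u)\<^sup>2)" by (simp add: algebra_simps)
    finally show ?thesis .
  qed
  have "w * (norm u)\<^sup>2 + w * (2 * K + 1) * (norm u)\<^sup>2 \<le> w * (1 + (norm u)\<^sup>2) + w * (2 * K + 1) * (1 + (norm u)\<^sup>2)"
    using w K by (intro add_mono mult_left_mono) auto
  moreover have "w * (1 + (norm u)\<^sup>2) + w * (2 * K + 1) * (1 + (norm u)\<^sup>2) + w * K * (1 + (norm u)\<^sup>2) + w * (1 + (norm u)\<^sup>2) + 8 * s * (1 + (norm u)\<^sup>2)
    = (w * (3 * K + 3) + 8 * s) * (1 + (norm u)\<^sup>2)" by (simp add: algebra_simps)
  ultimately show ?thesis using 1 2 3 4 5 unfolding split eS by linarith
qed

text \<open>Completing the square, the exact quadratic exceeds its value at \<open>u'\<close> by the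
  form of \<open>u - u'\<close>, so \<open>Q u \<le> Q u'\<close> bounds that form by the two
  approximation errors. The error at \<open>u\<close> grows like |u|^2 <= 2 |u - u'|^2 + 2 |u'|^2,
  and \<open>4 * \<eta> \<le> l\<close> moves its first part to the left.\<close>

lemma quadratic_argmin_close:
  fixes m :: "real^'p^'p"
  assumes sym: "transpose m = m" and lb: "\<And>v. l * (v \<bullet> v) \<le> v \<bullet> (m *v v)" and l: "0 < l"
    and S: "m *v u' = S"
    and a: "\<bar>Q u - q - (u \<bullet> (m *v u) - 2 * (u \<bullet> S))\<bar> \<le> \<eta> * (1 + (norm u)\<^sup>2)"
    and b: "\<bar>Q u' - q - (u' \<bullet> (m *v u') - 2 * (u' \<bullet> S))\<bar> \<le> \<eta> * (1 + (norm u')\<^sup>2)"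
    and min: "Q u \<le> Q u'" and \<eta>: "0 \<le> \<eta>" "4 * \<eta> \<le> l"
  shows "(norm (u - u'))\<^sup>2 \<le> 2 * \<eta> / l * (2 + 3 * (norm u')\<^sup>2)"
proof -
  define x where "x = (norm (u - u'))\<^sup>2"
  have e: "(u - u') \<bullet> (m *v (u - u')) = (u \<bullet> (m *v u) - 2 * (u \<bullet> S)) - (u' \<bullet> (m *v u') - 2 * (u' \<bullet> S))"
    using sym_matrix_inner[OF sym, of u' u] S
    by (simp add: matrix_vector_mult_diff_distrib inner_diff_left inner_diff_right inner_commute)
  have "l * x \<le> (u - u') \<bullet> (m *v (u - u'))" using lb[of "u - u'"] by (simp add: x_def dot_square_norm)
  also have "\<dots> \<le> \<eta> * (1 + (norm u)\<^sup>2) + \<eta> * (1 + (norm u')\<^sup>2)" unfolding e using a b min by linarith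
  also have "(norm u)\<^sup>2 \<le> 2 * x + 2 * (norm u')\<^sup>2"
  proof -
    have "norm u \<le> norm (u - u') + norm u'" using norm_triangle_ineq[of "u - u'" u'] by simp
    then have "(norm u)\<^sup>2 \<le> (norm (u - u') + norm u')\<^sup>2" by (intro power_mono) auto
    also have "\<dots> \<le> 2 * x + 2 * (norm u')\<^sup>2"
      using sum_squares_bound[of "norm (u - u')" "norm u'"] by (simp add: x_def power2_sum)
    finally show ?thesis .
  qed
  finally have "l * x \<le> \<eta> * (1 + (2 * x + 2 * (norm u')\<^sup>2)) + \<eta> * (1 + (norm u')\<^sup>2)"
    using \<eta> by (simp add: mult_left_mono)
  then have "l * x \<le> \<eta> * (2 + 3 * (norm u')\<^sup>2) + (2 * \<eta>) * x" by (simp add: algebra_simps)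
  also have "(2 * \<eta>) * x \<le> (l / 2) * x" using \<eta> by (intro mult_right_mono) (auto simp: x_def)
  finally have "l * x \<le> 2 * \<eta> * (2 + 3 * (norm u')\<^sup>2)" by (simp add: field_simps)
  then show ?thesis using l by (simp add: x_def field_simps)
qed

section \<open>Least squares estimation under the Wynn algorithm\<close>

text \<open>Mean value inequality: the gradient of the remainder at k is the difference of the
  regressors at \<open>\<theta>bar + k\<close> and \<open>\<theta>bar\<close>, small by uniform
  continuity and uniformly in \<open>x\<close>. Cubes are used because the chaining grids fill
  cubes, and the half-width \<open>2 * \<delta>\<close> leaves room for the dyadic rounding
  there.\<close>

lemma local_remainder_lipschitz:
  fixes \<mu> :: "'x::metric_space \<Rightarrow> real^'p \<Rightarrow> real" and f :: "real^'p \<Rightarrow> 'x \<Rightarrow> real^'p"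
  assumes cX: "compact XX" and cT: "compact \<Theta>" and cont: "continuous_on (XX \<times> \<Theta>) (\<lambda>(x, \<theta>). f \<theta> x)"
    and grad: "\<And>\<theta> x. \<theta> \<in> interior \<Theta> \<Longrightarrow> x \<in> XX \<Longrightarrow> (\<mu> x has_derivative (\<lambda>h. f \<theta> x \<bullet> h)) (at \<theta>)"
    and \<theta>bar: "\<theta>bar \<in> interior \<Theta>" and w: "0 < w"
  obtains \<delta> where "0 < \<delta>" "\<And>h. (\<forall>j. \<bar>h $ j\<bar> \<le> 2 * \<delta>) \<Longrightarrow> \<theta>bar + h \<in> interior \<Theta>"
    "\<And>x h h'. x \<in> XX \<Longrightarrow> (\<forall>j. \<bar>h $ j\<bar> \<le> 2 * \<delta>) \<Longrightarrow> (\<forall>j. \<bar>h' $ j\<bar> \<le> 2 * \<delta>) \<Longrightarrow>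
      \<bar>(\<mu> x (\<theta>bar + h) - \<mu> x \<theta>bar - f \<theta>bar x \<bullet> h) - (\<mu> x (\<theta>bar + h') - \<mu> x \<theta>bar - f \<theta>bar x \<bullet> h')\<bar> \<le> w * norm (h - h')"
proof -
  obtain r where r: "0 < r" "ball \<theta>bar r \<subseteq> interior \<Theta>" using \<theta>bar open_interior open_contains_ball by blast
  obtain d where d: "0 < d" "\<And>x x' \<theta> \<theta>'. x \<in> XX \<Longrightarrow> x' \<in> XX \<Longrightarrow> \<theta> \<in> \<Theta> \<Longrightarrow> \<theta>' \<in> \<Theta> \<Longrightarrow>
      dist x x' < d \<Longrightarrow> dist \<theta> \<theta>' < d \<Longrightarrow> dist (f \<theta> x) (f \<theta>' x') < w"
    by (rule uniformly_continuous_prodE[OF cX cT cont w]) blast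
  define p where "p = real CARD('p)"
  have p: "0 < p" by (simp add: p_def)
  \<comment> \<open>On this cube the sum of the coordinates, hence the norm, is at most
    \<open>min r d / 2\<close>.\<close>
  define \<delta> where "\<delta> = min r d / (4 * p)"
  have \<delta>: "0 < \<delta>" using r d p by (simp add: \<delta>_def)
  have nh: "norm h < min r d" if "\<And>j. \<bar>h $ j\<bar> \<le> 2 * \<delta>" for h :: "real^'p"
  proof -
    have "norm h \<le> (\<Sum>j\<in>UNIV. \<bar>h $ j\<bar>)" by (rule norm_le_l1_cart)
    also have "\<dots> \<le> (\<Sum>j\<in>(UNIV::'p set). 2 * \<delta>)" by (intro sum_mono that)
    also have "\<dots> = min r d / 2" using p by (simp add: \<delta>_def p_def)
    finally have "norm h \<le> min r d / 2" .
    moreover have "0 < min r d" using r d by simp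
    ultimately show ?thesis by linarith
  qed
  have int: "\<theta>bar + h \<in> interior \<Theta>" if "\<And>j. \<bar>h $ j\<bar> \<le> 2 * \<delta>" for h
    using nh[OF that] r(2) by (auto simp: dist_norm)
  show ?thesis
  proof (rule that[OF \<delta>])
    show "\<theta>bar + h \<in> interior \<Theta>" if "\<forall>j. \<bar>h $ j\<bar> \<le> 2 * \<delta>" for h using int that by blast
    fix x and h h' :: "real^'p"
    assume x: "x \<in> XX" and h: "\<forall>j. \<bar>h $ j\<bar> \<le> 2 * \<delta>" and h': "\<forall>j. \<bar>h' $ j\<bar> \<le> 2 * \<delta>"
    define S :: "(real^'p) set" where "S = cbox (\<chi> j. - (2 * \<delta>)) (\<chi> j. 2 * \<delta>)"
    have S: "k \<in> S \<longleftrightarrow> (\<forall>j. \<bar>k $ j\<bar> \<le> 2 * \<delta>)" for k by (auto simp: S_def mem_box_cart abs_le_iff minus_le_iff)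
    have "norm ((\<mu> x (\<theta>bar + h) - \<mu> x \<theta>bar - f \<theta>bar x \<bullet> h) - (\<mu> x (\<theta>bar + h') - \<mu> x \<theta>bar - f \<theta>bar x \<bullet> h')) \<le> w * norm (h - h')"
    proof (rule differentiable_bound[of S "\<lambda>h. \<mu> x (\<theta>bar + h) - \<mu> x \<theta>bar - f \<theta>bar x \<bullet> h" "\<lambda>k y. (f (\<theta>bar + k) x - f \<theta>bar x) \<bullet> y"])
      show "convex S" by (simp add: S_def)
      fix k assume k: "k \<in> S"
      then have ki: "\<theta>bar + k \<in> interior \<Theta>" using S int by blast
      have "((\<lambda>h. \<theta>bar + h) has_derivative (\<lambda>y. y)) (at k)" by (auto intro!: derivative_eq_intros)
      from has_derivative_compose[OF this grad[OF ki x]]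
      have D1: "((\<lambda>h. \<mu> x (\<theta>bar + h)) has_derivative (\<lambda>y. f (\<theta>bar + k) x \<bullet> y)) (at k)" .
      have D2: "((\<lambda>h. f \<theta>bar x \<bullet> h) has_derivative (\<lambda>y. f \<theta>bar x \<bullet> y)) (at k)"
        by (rule has_derivative_inner_right[OF has_derivative_ident])
      have "((\<lambda>h. \<mu> x (\<theta>bar + h) - \<mu> x \<theta>bar - f \<theta>bar x \<bullet> h) has_derivative (\<lambda>y. f (\<theta>bar + k) x \<bullet> y - 0 - f \<theta>bar x \<bullet> y)) (at k)"
        by (rule has_derivative_diff[OF has_derivative_diff[OF D1 has_derivative_const] D2])
      then show "((\<lambda>h. \<mu> x (\<theta>bar + h) - \<mu> x \<theta>bar - f \<theta>bar x \<bullet> h) has_derivative (\<lambda>y. (f (\<theta>bar + k) x - f \<theta>bar x) \<bullet> y)) (at k within S)"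
        using has_derivative_at_withinI[of _ _ k S] by (simp add: inner_diff_left)
      have "norm (f (\<theta>bar + k) x - f \<theta>bar x) \<le> w"
      proof -
        have "norm k < d" using nh[of k] k S by simp
        then have "dist (f (\<theta>bar + k) x) (f \<theta>bar x) < w"
          using x subsetD[OF interior_subset ki] subsetD[OF interior_subset \<theta>bar] d(1) by (intro d(2)) (simp_all add: dist_norm)
        then show ?thesis by (simp add: dist_norm)
      qed
      then show "onorm (\<lambda>y. (f (\<theta>bar + k) x - f \<theta>bar x) \<bullet> y) \<le> w"
      proof (intro onorm_bound)
        fix y
        assume b: "norm (f (\<theta>bar + k) x - f \<theta>bar x) \<le> w"
        have "norm ((f (\<theta>bar + k) x - f \<theta>bar x) \<bullet> y) \<le> norm (f (\<theta>bar + k) x - f \<theta>bar x) * norm y"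
          unfolding real_norm_def by (rule Cauchy_Schwarz_ineq2)
        also have "\<dots> \<le> w * norm y" by (rule mult_right_mono[OF b norm_ge_zero])
        finally show "norm ((f (\<theta>bar + k) x - f \<theta>bar x) \<bullet> y) \<le> w * norm y" .
      qed (use w in simp)
    qed (use S h h' in auto)
    then show "\<bar>(\<mu> x (\<theta>bar + h) - \<mu> x \<theta>bar - f \<theta>bar x \<bullet> h) - (\<mu> x (\<theta>bar + h') - \<mu> x \<theta>bar - f \<theta>bar x \<bullet> h')\<bar> \<le> w * norm (h - h')" by simp
  qed
qed

text \<open>Time is shifted so that observation \<open>Suc i\<close> is paired with
  \<open>F i\<close>, \<open>gram\<close> replaces empirical designs, and a determinant maximizer
  \<open>m\<close> over the hull is fixed in advance; its existence is shown when the locale is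
  instantiated.\<close>

locale wynn_regression = prob_space M for M :: "'w measure" +
  fixes XX :: "'x::metric_space set" and \<Theta> :: "(real^'p) set" and \<mu> :: "'x \<Rightarrow> real^'p \<Rightarrow> real"
    and f :: "real^'p \<Rightarrow> 'x \<Rightarrow> real^'p" and F :: "nat \<Rightarrow> 'w measure" and X :: "nat \<Rightarrow> 'w \<Rightarrow> 'x"
    and Y e :: "nat \<Rightarrow> 'w \<Rightarrow> real" and \<theta>bar :: "real^'p" and nst :: nat
    and \<theta>hat \<theta>LS :: "nat \<Rightarrow> 'w \<Rightarrow> real^'p" and \<sigma>2 :: real and m :: "real^'p^'p"
  assumes XX_compact: "compact XX" and \<Theta>_compact: "compact \<Theta>"
    and \<mu>_cont: "continuous_on (XX \<times> \<Theta>) (\<lambda>(x, \<theta>). \<mu> x \<theta>)"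
    and f_span: "\<forall>\<theta>\<in>\<Theta>. span (f \<theta> ` XX) = UNIV"
    and f_cont: "continuous_on (XX \<times> \<Theta>) (\<lambda>(x, \<theta>). f \<theta> x)"
    and f_grad: "\<And>\<theta> x. \<theta> \<in> interior \<Theta> \<Longrightarrow> x \<in> XX \<Longrightarrow> (\<mu> x has_derivative (\<lambda>h. f \<theta> x \<bullet> h)) (at \<theta>)"
    and sat_ident: "\<forall>z :: 'p \<Rightarrow> 'x. inj z \<and> range z \<subseteq> XX \<longrightarrow>
       (\<forall>\<theta>\<in>\<Theta>. \<forall>\<theta>'\<in>\<Theta>. (\<forall>j. \<mu> (z j) \<theta> = \<mu> (z j) \<theta>') \<longrightarrow> \<theta> = \<theta>')"
    and \<theta>bar_int: "\<theta>bar \<in> interior \<Theta>" and nst1: "1 \<le> nst"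
    and X_in: "\<And>i \<omega>. 1 \<le> i \<Longrightarrow> \<omega> \<in> space M \<Longrightarrow> X i \<omega> \<in> XX"
    and start: "\<And>\<theta> \<omega>. \<omega> \<in> space M \<Longrightarrow> \<theta> \<in> \<Theta> \<Longrightarrow> pos_def (gram f (\<lambda>i. X i \<omega>) nst \<theta>)"
    and \<theta>hat_in: "\<And>n \<omega>. nst \<le> n \<Longrightarrow> \<omega> \<in> space M \<Longrightarrow> \<theta>hat n \<omega> \<in> \<Theta>"
    and wynn: "\<And>n \<omega> x. nst \<le> n \<Longrightarrow> \<omega> \<in> space M \<Longrightarrow> x \<in> XX \<Longrightarrow>
       f (\<theta>hat n \<omega>) x \<bullet> (matrix_inv (gram f (\<lambda>i. X i \<omega>) n (\<theta>hat n \<omega>)) *v f (\<theta>hat n \<omega>) x)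
       \<le> f (\<theta>hat n \<omega>) (X (Suc n) \<omega>) \<bullet> (matrix_inv (gram f (\<lambda>i. X i \<omega>) n (\<theta>hat n \<omega>)) *v f (\<theta>hat n \<omega>) (X (Suc n) \<omega>))"
    and F_sub: "\<And>i. subalgebra M (F i)" and F_mono: "\<And>i. sets (F i) \<subseteq> sets (F (Suc i))"
    and X_meas: "\<And>i. X (Suc i) \<in> borel_measurable (F i)"
    and Y_meas: "\<And>i. Y (Suc i) \<in> borel_measurable (F (Suc i))"
    and Y_model: "\<And>i \<omega>. \<omega> \<in> space M \<Longrightarrow> Y (Suc i) \<omega> = \<mu> (X (Suc i) \<omega>) \<theta>bar + e (Suc i) \<omega>"
    and e_meas [measurable]: "\<And>i. e (Suc i) \<in> borel_measurable M"
    and e_sq_int: "\<And>i. integrable M (\<lambda>\<omega>. (e (Suc i) \<omega>)\<^sup>2)"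
    and e_mart: "\<And>i. AE \<omega> in M. real_cond_exp M (F i) (e (Suc i)) \<omega> = 0"
    and lindeberg: "\<And>\<epsilon>. 0 < \<epsilon> \<Longrightarrow> AE \<omega> in M. (\<lambda>n. (1 / real n) * (\<Sum>i<n. real_cond_exp M (F i)
        (\<lambda>\<omega>. (e (Suc i) \<omega>)\<^sup>2 * indicator {\<omega>. \<bar>e (Suc i) \<omega>\<bar> > \<epsilon> * sqrt (real n)} \<omega>) \<omega>)) \<longlonglongrightarrow> 0"
    and \<sigma>2_pos: "0 < \<sigma>2"
    and asym_homo: "AE \<omega> in M. (\<lambda>n. real_cond_exp M (F n) (\<lambda>\<omega>. (e (Suc n) \<omega>)\<^sup>2) \<omega>) \<longlonglongrightarrow> \<sigma>2"
    and \<theta>hat_cons: "AE \<omega> in M. (\<lambda>n. \<theta>hat n \<omega>) \<longlonglongrightarrow> \<theta>bar"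
    and \<theta>LS_meas [measurable]: "\<And>n. \<theta>LS n \<in> borel_measurable M"
    and \<theta>LS_in: "\<And>n \<omega>. 1 \<le> n \<Longrightarrow> \<omega> \<in> space M \<Longrightarrow> \<theta>LS n \<omega> \<in> \<Theta>"
    and \<theta>LS_min: "\<And>n \<omega> \<theta>. 1 \<le> n \<Longrightarrow> \<omega> \<in> space M \<Longrightarrow> \<theta> \<in> \<Theta> \<Longrightarrow>
       (\<Sum>i<n. (Y (Suc i) \<omega> - \<mu> (X (Suc i) \<omega>) (\<theta>LS n \<omega>))\<^sup>2) \<le> (\<Sum>i<n. (Y (Suc i) \<omega> - \<mu> (X (Suc i) \<omega>) \<theta>)\<^sup>2)"
    and m_in: "m \<in> info_hull f XX \<theta>bar" and m_max: "\<And>A. A \<in> info_hull f XX \<theta>bar \<Longrightarrow> det A \<le> det m"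
begin

section \<open>Measurability with respect to the filtration\<close>

lemma \<theta>bar_in: "\<theta>bar \<in> \<Theta>" using \<theta>bar_int interior_subset by blast

lemma space_F: "space (F i) = space M" using F_sub[of i] by (simp add: subalgebra_def)

lemma F_to_M: "W \<in> measurable (F i) N \<Longrightarrow> W \<in> measurable M N"
  by (rule measurable_from_subalg[OF F_sub])

lemma F_mono_le: "i \<le> j \<Longrightarrow> sets (F i) \<subseteq> sets (F j)"
  using F_mono by (rule lift_Suc_mono_le)

lemma F_le: "i \<le> j \<Longrightarrow> W \<in> measurable (F i) N \<Longrightarrow> W \<in> measurable (F j) N"
  by (rule measurable_from_subalg[of "F j" "F i"]) (auto simp: subalgebra_def space_F F_mono_le)

lemma cond_exp_locale: "finite_measure_subalgebra M (F i)"
  by (intro finite_measure_subalgebra.intro finite_measure_subalgebra_axioms.intro finite_measure_axioms F_sub)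

lemma \<mu>_cont_x: "\<theta> \<in> \<Theta> \<Longrightarrow> continuous_on XX (\<lambda>x. \<mu> x \<theta>)"
proof -
  assume "\<theta> \<in> \<Theta>"
  then have "continuous_on XX ((\<lambda>(x, \<theta>). \<mu> x \<theta>) \<circ> (\<lambda>x. (x, \<theta>)))"
    by (intro continuous_on_compose continuous_on_subset[OF \<mu>_cont] continuous_intros) auto
  then show ?thesis by (simp add: o_def)
qed

lemma f_cont_x: "\<theta> \<in> \<Theta> \<Longrightarrow> continuous_on XX (f \<theta>)"
proof -
  assume "\<theta> \<in> \<Theta>"
  then have "continuous_on XX ((\<lambda>(x, \<theta>). f \<theta> x) \<circ> (\<lambda>x. (x, \<theta>)))"
    by (intro continuous_on_compose continuous_on_subset[OF f_cont] continuous_intros) auto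
  then show ?thesis by (simp add: o_def)
qed

lemma comp_X_meas:
  fixes g :: "'x \<Rightarrow> 'b::topological_space"
  assumes "continuous_on XX g"
  shows "(\<lambda>\<omega>. g (X (Suc i) \<omega>)) \<in> borel_measurable (F i)"
  by (rule measurable_continuous_on_comp[OF assms X_meas]) (auto simp: space_F X_in)

lemma e_measF: "e (Suc i) \<in> borel_measurable (F (Suc i))"
proof -
  have "(\<lambda>\<omega>. \<mu> (X (Suc i) \<omega>) \<theta>bar) \<in> borel_measurable (F (Suc i))"
    by (rule F_le[OF _ comp_X_meas[OF \<mu>_cont_x[OF \<theta>bar_in]]]) simp
  then have "(\<lambda>\<omega>. Y (Suc i) \<omega> - \<mu> (X (Suc i) \<omega>) \<theta>bar) \<in> borel_measurable (F (Suc i))"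
    using Y_meas by measurable
  moreover have "e (Suc i) \<omega> = Y (Suc i) \<omega> - \<mu> (X (Suc i) \<omega>) \<theta>bar" if "\<omega> \<in> space (F (Suc i))" for \<omega>
    using Y_model[of \<omega> i] that by (simp add: space_F)
  ultimately show ?thesis by (simp cong: measurable_cong)
qed

section \<open>Gated errors and their limits\<close>

definition V0 :: "nat \<Rightarrow> 'w \<Rightarrow> real" where
  "V0 i = real_cond_exp M (F i) (\<lambda>\<omega>. (e (Suc i) \<omega>)\<^sup>2)"

text \<open>The gate depends on \<open>F i\<close> only, so multiplying an error by it preserves the
  martingale difference property. Nonnegativity is part of it because conditional expectations are
  determined only almost everywhere, whereas \<open>bounded_mds\<close> asks for bounds at every
  outcome.\<close>

definition good :: "nat \<Rightarrow> 'w \<Rightarrow> bool" where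
  "good i \<omega> \<longleftrightarrow> 0 \<le> V0 i \<omega> \<and> V0 i \<omega> \<le> \<sigma>2 + 1"

text \<open>Errors with a large conditional variance are removed. Since the conditional variances converge
  to \<open>\<sigma>2\<close>, almost surely only finitely many errors are affected.\<close>
definition et :: "nat \<Rightarrow> 'w \<Rightarrow> real" where
  "et i \<omega> = (if good i \<omega> then e (Suc i) \<omega> else 0)"

definition Vt :: "nat \<Rightarrow> 'w \<Rightarrow> real" where
  "Vt i \<omega> = (if good i \<omega> then V0 i \<omega> else 0)"

lemma V0_meas: "V0 i \<in> borel_measurable (F i)" unfolding V0_def by simp

lemma good_meas: "Measurable.pred (F i) (good i)"
  unfolding good_def[abs_def] using V0_meas[of i] by measurable

lemma gate_meas:
  fixes W :: "'w \<Rightarrow> real"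
  assumes "W \<in> borel_measurable (F i)"
  shows "(\<lambda>\<omega>. if good i \<omega> then W \<omega> else 0) \<in> borel_measurable (F i)"
  using assms good_meas[of i] by measurable

lemma gated_expectation:
  assumes W: "W \<in> borel_measurable (F i)" and g: "g \<in> borel_measurable M"
    and int: "integrable M (\<lambda>\<omega>. (if good i \<omega> then W \<omega> else 0) * g \<omega>)"
  shows "integrable M (\<lambda>\<omega>. (if good i \<omega> then W \<omega> else 0) * real_cond_exp M (F i) g \<omega>)"
    and "expectation (\<lambda>\<omega>. (if good i \<omega> then W \<omega> else 0) * g \<omega>) = expectation (\<lambda>\<omega>. (if good i \<omega> then W \<omega> else 0) * real_cond_exp M (F i) g \<omega>)"
proof -
  interpret S: finite_measure_subalgebra M "F i" by (rule cond_exp_locale)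
  show "integrable M (\<lambda>\<omega>. (if good i \<omega> then W \<omega> else 0) * real_cond_exp M (F i) g \<omega>)"
    by (rule S.real_cond_exp_intg(1)[OF int gate_meas[OF W] g])
  show "expectation (\<lambda>\<omega>. (if good i \<omega> then W \<omega> else 0) * g \<omega>) = expectation (\<lambda>\<omega>. (if good i \<omega> then W \<omega> else 0) * real_cond_exp M (F i) g \<omega>)"
    by (rule S.real_cond_exp_intg(2)[OF int gate_meas[OF W] g, symmetric])
qed

text \<open>Testing a gated error with \<open>W\<close> is testing the original error with the gated
  weight, which is again \<open>F i\<close>-measurable; \<open>gated_expectation\<close> then
  inserts the conditional expectation.\<close>

sublocale mds: bounded_mds M F et Vt "\<sigma>2 + 1"
proof unfold_locales
  show "subalgebra M (F i)" for i by (rule F_sub)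
  show "sets (F i) \<subseteq> sets (F j)" if "i \<le> j" for i j by (rule F_mono_le[OF that])
  have goodS: "Measurable.pred (F (Suc i)) (good i)" for i
    unfolding good_def[abs_def] using F_le[OF _ V0_meas[of i], of "Suc i"] by measurable
  show "et i \<in> borel_measurable (F (Suc i))" for i
    unfolding et_def[abs_def] using goodS[of i] e_measF[of i] by measurable
  show "Vt i \<in> borel_measurable (F i)" for i unfolding Vt_def[abs_def] by (rule gate_meas[OF V0_meas])
  have goodM: "Measurable.pred M (good i)" for i by (rule F_to_M[OF good_meas])
  have etM: "et i \<in> borel_measurable M" for i unfolding et_def[abs_def] using goodM[of i] by measurable
  show "integrable M (\<lambda>\<omega>. (et i \<omega>)\<^sup>2)" for i
  proof (rule Bochner_Integration.integrable_bound[OF e_sq_int[of i]])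
    show "(\<lambda>\<omega>. (et i \<omega>)\<^sup>2) \<in> borel_measurable M" using etM[of i] by measurable
  qed (auto simp: et_def)
  show "0 \<le> Vt i \<omega> \<and> Vt i \<omega> \<le> \<sigma>2 + 1" for i \<omega> using \<sigma>2_pos by (auto simp: Vt_def good_def)
  fix i and W :: "'w \<Rightarrow> real" assume W: "W \<in> borel_measurable (F i)"
  show "expectation (\<lambda>\<omega>. W \<omega> * et i \<omega>) = 0" if int: "integrable M (\<lambda>\<omega>. W \<omega> * et i \<omega>)"
  proof -
    have eq: "(\<lambda>\<omega>. W \<omega> * et i \<omega>) = (\<lambda>\<omega>. (if good i \<omega> then W \<omega> else 0) * e (Suc i) \<omega>)" by (auto simp: et_def)
    have "expectation (\<lambda>\<omega>. W \<omega> * et i \<omega>) = expectation (\<lambda>\<omega>. (if good i \<omega> then W \<omega> else 0) * real_cond_exp M (F i) (e (Suc i)) \<omega>)"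
      unfolding eq by (rule gated_expectation(2)[OF W e_meas int[unfolded eq]])
    also have "\<dots> = expectation (\<lambda>\<omega>. 0)"
    proof (rule integral_cong_AE)
      show "(\<lambda>\<omega>. (if good i \<omega> then W \<omega> else 0) * real_cond_exp M (F i) (e (Suc i)) \<omega>) \<in> borel_measurable M"
        using F_to_M[OF gate_meas[OF W]] by measurable
      show "AE \<omega> in M. (if good i \<omega> then W \<omega> else 0) * real_cond_exp M (F i) (e (Suc i)) \<omega> = 0"
        using e_mart[of i] by eventually_elim simp
    qed simp
    finally show ?thesis by simp
  qed
  show "expectation (\<lambda>\<omega>. W \<omega> * (et i \<omega>)\<^sup>2) = expectation (\<lambda>\<omega>. W \<omega> * Vt i \<omega>)" if int: "integrable M (\<lambda>\<omega>. W \<omega> * (et i \<omega>)\<^sup>2)"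
  proof -
    have eq: "(\<lambda>\<omega>. W \<omega> * (et i \<omega>)\<^sup>2) = (\<lambda>\<omega>. (if good i \<omega> then W \<omega> else 0) * (e (Suc i) \<omega>)\<^sup>2)" by (auto simp: et_def)
    have eq2: "(\<lambda>\<omega>. W \<omega> * Vt i \<omega>) = (\<lambda>\<omega>. (if good i \<omega> then W \<omega> else 0) * V0 i \<omega>)" by (auto simp: Vt_def)
    show ?thesis unfolding eq eq2 V0_def
      by (rule gated_expectation(2)[OF W _ int[unfolded eq]]) measurable
  qed
qed

lemma good_eventually: "AE \<omega> in M. \<forall>\<^sub>F i in sequentially. good i \<omega>"
proof -
  have "AE \<omega> in M. 0 \<le> V0 i \<omega>" for i
  proof -
    interpret S: finite_measure_subalgebra M "F i" by (rule cond_exp_locale)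
    show ?thesis unfolding V0_def by (rule S.real_cond_exp_pos) auto
  qed
  then have "AE \<omega> in M. \<forall>i. 0 \<le> V0 i \<omega>" by (simp add: AE_all_countable)
  moreover have "AE \<omega> in M. (\<lambda>n. V0 n \<omega>) \<longlonglongrightarrow> \<sigma>2" using asym_homo by (simp add: V0_def)
  ultimately show ?thesis
  proof eventually_elim
    case (elim \<omega>)
    have "\<forall>\<^sub>F i in sequentially. V0 i \<omega> < \<sigma>2 + 1" using elim(2) by (rule order_tendstoD) simp
    then show ?case by eventually_elim (use elim(1) in \<open>auto simp: good_def\<close>)
  qed
qed

lemma Vt_tendsto: "AE \<omega> in M. (\<lambda>i. Vt i \<omega>) \<longlonglongrightarrow> \<sigma>2"
  using good_eventually asym_homo
proof eventually_elim
  case (elim \<omega>)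
  have "(\<lambda>n. V0 n \<omega>) \<longlonglongrightarrow> \<sigma>2" using elim(2) by (simp add: V0_def)
  moreover have "\<forall>\<^sub>F i in sequentially. V0 i \<omega> = Vt i \<omega>" using elim(1) by eventually_elim (simp add: Vt_def)
  ultimately show ?case by (rule Lim_transform_eventually)
qed

definition defect :: "nat \<Rightarrow> 'w \<Rightarrow> real" where
  "defect n \<omega> = (\<Sum>i<n. \<bar>e (Suc i) \<omega> - et i \<omega>\<bar>) / sqrt (real n)"

lemma defect_meas [measurable]: "defect n \<in> borel_measurable M"
  unfolding defect_def[abs_def] by measurable

text \<open>The sum is eventually constant along almost every path, while the denominator
  grows.\<close>

lemma defect_null: "prob_null defect"
proof (rule prob_null_AE)
  show "AE \<omega> in M. (\<lambda>n. defect n \<omega>) \<longlonglongrightarrow> 0"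
    using good_eventually
  proof eventually_elim
    case (elim \<omega>)
    then obtain N where N: "\<And>i. i \<ge> N \<Longrightarrow> good i \<omega>" unfolding eventually_sequentially by auto
    define c where "c = (\<Sum>i<N. \<bar>e (Suc i) \<omega> - et i \<omega>\<bar>)"
    have "\<forall>\<^sub>F n in sequentially. c / sqrt (real n) = defect n \<omega>"
      using eventually_ge_at_top[of N]
    proof eventually_elim
      case (elim n)
      have "(\<Sum>i<n. \<bar>e (Suc i) \<omega> - et i \<omega>\<bar>) = c" unfolding c_def
        by (rule sum.mono_neutral_right) (use elim N in \<open>auto simp: et_def\<close>)
      then show ?case by (simp add: defect_def)
    qed
    moreover have "(\<lambda>n. c / sqrt (real n)) \<longlonglongrightarrow> 0"
      by (intro tendsto_divide_0[OF tendsto_const] filterlim_at_top_imp_at_infinity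
          filterlim_compose[OF sqrt_at_top filterlim_real_sequentially])
    ultimately show ?case by (rule Lim_transform_eventually[rotated])
  qed
qed measurable

text \<open>Dominated convergence turns the almost sure conditional condition into one for
  expectations. The gate supplies the dominating constant \<open>\<sigma>2 + 1\<close>, since each
  conditional truncated moment is at most the conditional variance.\<close>

lemma lindeberg_mean:
  assumes d: "0 < d"
  shows "(\<lambda>n. (\<Sum>i<n. mds.lind d n i) / real n) \<longlonglongrightarrow> 0"
proof -
  define g where "g n i \<omega> = (e (Suc i) \<omega>)\<^sup>2 * indicator {\<omega>. \<bar>e (Suc i) \<omega>\<bar> > d * sqrt (real n)} \<omega>" for n i \<omega>
  define ce where "ce n i = real_cond_exp M (F i) (g n i)" for n i
  have gM[measurable]: "g n i \<in> borel_measurable M" for n i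
  proof -
    have "g n i = (\<lambda>\<omega>. (e (Suc i) \<omega>)\<^sup>2 * (if d * sqrt (real n) < \<bar>e (Suc i) \<omega>\<bar> then 1 else 0))"
      by (auto simp: g_def indicator_def)
    then show ?thesis by simp
  qed
  have gi: "integrable M (g n i)" for n i
    by (rule Bochner_Integration.integrable_bound[OF e_sq_int[of i]]) (auto simp: g_def indicator_def)
  have ceM[measurable]: "ce n i \<in> borel_measurable M" for n i unfolding ce_def by simp
  have goodM[measurable]: "Measurable.pred M (good i)" for i by (rule F_to_M[OF good_meas])
  have ceb: "AE \<omega> in M. 0 \<le> ce n i \<omega> \<and> ce n i \<omega> \<le> V0 i \<omega>" for n i
  proof -
    interpret S: finite_measure_subalgebra M "F i" by (rule cond_exp_locale)
    have "AE \<omega> in M. 0 \<le> ce n i \<omega>" unfolding ce_def by (rule S.real_cond_exp_pos) (auto simp: g_def)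
    moreover have "AE \<omega> in M. ce n i \<omega> \<le> V0 i \<omega>" unfolding ce_def V0_def
      by (rule S.real_cond_exp_mono[OF _ gi e_sq_int]) (auto simp: g_def indicator_def)
    ultimately show ?thesis by eventually_elim simp
  qed
  then have ceb: "AE \<omega> in M. \<forall>n i. 0 \<le> ce n i \<omega> \<and> ce n i \<omega> \<le> V0 i \<omega>" by (simp add: AE_all_countable)
  define R where "R n \<omega> = (\<Sum>i<n. (if good i \<omega> then 1 else 0) * ce n i \<omega>) / real n" for n \<omega>
  have lind_eq: "integrable M (\<lambda>\<omega>. (if good i \<omega> then 1 else 0) * ce n i \<omega>)"
    "mds.lind d n i = expectation (\<lambda>\<omega>. (if good i \<omega> then 1 else 0) * ce n i \<omega>)" for n i
  proof -
    have eq: "(\<lambda>\<omega>. (et i \<omega>)\<^sup>2 * (if d * sqrt (real n) < \<bar>et i \<omega>\<bar> then 1 else 0)) = (\<lambda>\<omega>. (if good i \<omega> then 1 else 0) * g n i \<omega>)"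
      by (auto simp: et_def g_def indicator_def)
    have int: "integrable M (\<lambda>\<omega>. (if good i \<omega> then 1 else 0) * g n i \<omega>)"
      using mds.lind_int[of i "d * sqrt (real n)"] unfolding eq .
    have "(\<lambda>\<omega>. 1 :: real) \<in> borel_measurable (F i)" by simp
    note ge = gated_expectation[OF this gM int]
    show "integrable M (\<lambda>\<omega>. (if good i \<omega> then 1 else 0) * ce n i \<omega>)" unfolding ce_def by (rule ge(1))
    show "mds.lind d n i = expectation (\<lambda>\<omega>. (if good i \<omega> then 1 else 0) * ce n i \<omega>)"
      unfolding mds.lind_def eq ce_def by (rule ge(2))
  qed
  have "(\<lambda>n. expectation (R n)) \<longlonglongrightarrow> expectation (\<lambda>_. 0)"
  proof (rule integral_dominated_convergence[where w="\<lambda>_. \<sigma>2 + 1"])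
    show "R n \<in> borel_measurable M" for n unfolding R_def[abs_def] by measurable
    show "AE \<omega> in M. (\<lambda>n. R n \<omega>) \<longlonglongrightarrow> 0" using ceb lindeberg[OF d]
    proof eventually_elim
      case (elim \<omega>)
      have l: "(\<lambda>n. (1 / real n) * (\<Sum>i<n. ce n i \<omega>)) \<longlonglongrightarrow> 0" using elim(2) by (simp add: ce_def g_def[abs_def])
      show ?case
      proof (rule tendsto_sandwich[OF _ _ tendsto_const l])
        show "\<forall>\<^sub>F n in sequentially. 0 \<le> R n \<omega>"
          using elim(1) by (auto simp: R_def intro!: always_eventually divide_nonneg_nonneg sum_nonneg)
        show "\<forall>\<^sub>F n in sequentially. R n \<omega> \<le> (1 / real n) * (\<Sum>i<n. ce n i \<omega>)"
          using elim(1) by (auto simp: R_def intro!: always_eventually divide_right_mono sum_mono)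
      qed
    qed
    fix n show "AE \<omega> in M. norm (R n \<omega>) \<le> \<sigma>2 + 1" using ceb
    proof eventually_elim
      case (elim \<omega>)
      have b: "0 \<le> (if good i \<omega> then 1 else 0) * ce n i \<omega> \<and> (if good i \<omega> then 1 else 0) * ce n i \<omega> \<le> \<sigma>2 + 1" for i
        using elim[rule_format, of n i] \<sigma>2_pos by (auto simp: good_def)
      have "(\<Sum>i<n. (if good i \<omega> then 1 else 0) * ce n i \<omega>) \<le> (\<Sum>i<n. \<sigma>2 + 1)" by (rule sum_mono) (use b in auto)
      then have "R n \<omega> \<le> \<sigma>2 + 1" using \<sigma>2_pos by (cases "n = 0") (auto simp: R_def divide_le_eq mult.commute)
      moreover have "0 \<le> R n \<omega>" unfolding R_def by (intro divide_nonneg_nonneg sum_nonneg) (use b in auto)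
      ultimately show ?case by simp
    qed
  qed auto
  moreover have "expectation (R n) = (\<Sum>i<n. mds.lind d n i) / real n" for n
    unfolding R_def[abs_def] lind_eq(2) using lind_eq(1) by (simp add: Bochner_Integration.integral_sum)
  ultimately show ?thesis by simp
qed

lemma wynn_path_AE:
  assumes "\<omega> \<in> space M" "(\<lambda>n. \<theta>hat n \<omega>) \<longlonglongrightarrow> \<theta>bar"
  shows "wynn_path XX \<Theta> f (\<lambda>i. X i \<omega>) (\<lambda>n. \<theta>hat n \<omega>) \<theta>bar nst"
  by unfold_locales
    (use assms XX_compact \<Theta>_compact f_cont f_span nst1 X_in \<theta>hat_in \<theta>bar_in start wynn in auto)

lemma gram_tendsto: "AE \<omega> in M. (\<lambda>n. gram f (\<lambda>i. X i \<omega>) n \<theta>bar) \<longlonglongrightarrow> m"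
  using \<theta>hat_cons AE_space
proof eventually_elim
  case (elim \<omega>)
  show ?case by (rule wynn_path.gram_tendsto_det_max(1)[OF wynn_path_AE[OF elim(2,1)] m_in m_max])
qed

lemma m_sym: "transpose m = m" by (rule info_hull_psd(1)[OF m_in])

text \<open>The claim is not random, so its validity almost everywhere on a probability space is its
  validity.\<close>

lemma m_pos: "pos_def m"
proof -
  have "AE \<omega> in M. pos_def m" using \<theta>hat_cons AE_space
  proof eventually_elim
    case (elim \<omega>)
    show ?case by (rule wynn_path.gram_tendsto_det_max(2)[OF wynn_path_AE[OF elim(2,1)] m_in m_max])
  qed
  then show ?thesis by simp
qed

lemma outer_measurable:
  assumes "W \<in> borel_measurable N"
  shows "(\<lambda>\<omega>. outer_prod (W \<omega>) (W \<omega>) :: real^'p^'p) \<in> borel_measurable N"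
proof (rule measurable_compose[OF assms])
  show "(\<lambda>v. outer_prod v v :: real^'p^'p) \<in> borel_measurable borel"
    unfolding outer_prod_def by (intro borel_measurable_continuous_onI continuous_intros)
qed

lemma fX_meas: "\<theta> \<in> \<Theta> \<Longrightarrow> (\<lambda>\<omega>. f \<theta> (X (Suc i) \<omega>)) \<in> borel_measurable (F i)"
  by (rule comp_X_meas[OF f_cont_x])

lemma gram_Suc_index: "gram f (\<lambda>i. X i \<omega>) n \<theta> = (1 / real n) *\<^sub>R (\<Sum>i<n. outer_prod (f \<theta> (X (Suc i) \<omega>)) (f \<theta> (X (Suc i) \<omega>)))"
  by (simp add: gram_def sum.atLeast1_atMost_eq)

lemma gram_meas: "(\<lambda>\<omega>. gram f (\<lambda>i. X i \<omega>) n \<theta>bar) \<in> borel_measurable M"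
  unfolding gram_Suc_index
  by (intro borel_measurable_scaleR borel_measurable_const borel_measurable_sum outer_measurable F_to_M[OF fX_meas] \<theta>bar_in)

lemma gram_null: "prob_null (\<lambda>n \<omega>. norm (gram f (\<lambda>i. X i \<omega>) n \<theta>bar - m))"
proof (rule prob_null_AE)
  show "AE \<omega> in M. (\<lambda>n. norm (gram f (\<lambda>i. X i \<omega>) n \<theta>bar - m)) \<longlonglongrightarrow> 0"
    using gram_tendsto by eventually_elim (simp add: tendsto_norm_zero LIM_zero)
qed (use gram_meas in measurable)

lemma f_bound:
  obtains K where "0 < K" "\<And>x \<theta>. x \<in> XX \<Longrightarrow> \<theta> \<in> \<Theta> \<Longrightarrow> norm (f \<theta> x) \<le> K"
  by (rule bounded_prodE[OF XX_compact \<Theta>_compact f_cont]) blast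

text \<open>The basic inequality of least squares: compare the minimizer with
  \<open>\<theta>bar\<close>, expand, and cancel the squared errors.\<close>

lemma objective_diff:
  assumes w: "\<omega> \<in> space M" and n: "1 \<le> n"
  shows "(\<Sum>i<n. (\<mu> (X (Suc i) \<omega>) (\<theta>LS n \<omega>) - \<mu> (X (Suc i) \<omega>) \<theta>bar)\<^sup>2)
    \<le> 2 * (\<Sum>i<n. (\<mu> (X (Suc i) \<omega>) (\<theta>LS n \<omega>) - \<mu> (X (Suc i) \<omega>) \<theta>bar) * e (Suc i) \<omega>)"
proof -
  define g where "g i = \<mu> (X (Suc i) \<omega>) (\<theta>LS n \<omega>) - \<mu> (X (Suc i) \<omega>) \<theta>bar" for i
  have "(\<Sum>i<n. (e (Suc i) \<omega> - g i)\<^sup>2) \<le> (\<Sum>i<n. (e (Suc i) \<omega>)\<^sup>2)"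
    using \<theta>LS_min[OF n w \<theta>bar_in] Y_model[OF w] by (simp add: g_def algebra_simps)
  moreover have "(\<Sum>i<n. (e (Suc i) \<omega> - g i)\<^sup>2) = (\<Sum>i<n. (e (Suc i) \<omega>)\<^sup>2) - 2 * (\<Sum>i<n. g i * e (Suc i) \<omega>) + (\<Sum>i<n. (g i)\<^sup>2)"
    unfolding sum_distrib_left sum_subtractf[symmetric] sum.distrib[symmetric]
    by (intro sum.cong refl) (simp add: power2_eq_square algebra_simps)
  ultimately show ?thesis unfolding g_def[symmetric] by linarith
qed

text \<open>If the estimator were at distance \<open>\<epsilon>\<close>, the contrast would be at
  least b n, whereas \<open>objective_diff\<close> bounds it by twice the correlation with the
  errors, which outside three rare events is at most b n / 4.\<close>

theorem \<theta>LS_consistent: "prob_null (\<lambda>n \<omega>. norm (\<theta>LS n \<omega> - \<theta>bar))"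
proof (rule prob_nullI)
  fix \<epsilon> c :: real assume \<epsilon>: "0 < \<epsilon>" and c: "0 < c"
  obtain l where l: "0 < l" "\<And>v. l * (v \<bullet> v) \<le> v \<bullet> (m *v v)" by (rule spd_lower_bound[OF m_pos]) blast
  have l2: "0 < l / 2" using l by simp
  obtain b where b: "0 < b" "\<And>xs n \<theta>. 1 \<le> n \<Longrightarrow> (\<And>i. 1 \<le> i \<Longrightarrow> xs i \<in> XX) \<Longrightarrow>
    (\<And>v. l / 2 * (v \<bullet> v) \<le> v \<bullet> (gram f xs n \<theta>bar *v v)) \<Longrightarrow> \<theta> \<in> \<Theta> \<Longrightarrow> \<epsilon> \<le> dist \<theta> \<theta>bar \<Longrightarrow>
    b * real n \<le> (\<Sum>i=1..n. (\<mu> (xs i) \<theta> - \<mu> (xs i) \<theta>bar)\<^sup>2)"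
    by (rule contrast_lower_bound[OF XX_compact \<Theta>_compact \<mu>_cont sat_ident \<theta>bar_in f_cont l2 \<epsilon>]) blast
  obtain K where K: "0 < K" "\<And>x \<theta>. x \<in> XX \<Longrightarrow> \<theta> \<in> \<Theta> \<Longrightarrow> norm (\<mu> x \<theta>) \<le> K"
    by (rule bounded_prodE[OF XX_compact \<Theta>_compact \<mu>_cont]) blast
  define g where "g i \<omega> \<theta> = \<mu> (X (Suc i) \<omega>) \<theta> - \<mu> (X (Suc i) \<omega>) \<theta>bar" for i \<omega> \<theta>
  have g_meas: "(\<lambda>\<omega>. g i \<omega> \<theta>) \<in> borel_measurable (F i)" if "\<theta> \<in> \<Theta>" for i \<theta>
    unfolding g_def by (intro borel_measurable_diff comp_X_meas \<mu>_cont_x that \<theta>bar_in)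
  have g_bd: "\<bar>g i \<omega> \<theta>\<bar> \<le> 2 * K" if "\<omega> \<in> space M" "\<theta> \<in> \<Theta>" for i \<omega> \<theta>
    using K(2)[OF X_in[OF _ that(1), of "Suc i"] that(2)] K(2)[OF X_in[OF _ that(1), of "Suc i"] \<theta>bar_in] by (simp add: g_def)
  have net: "\<exists>S. finite S \<and> S \<subseteq> \<Theta> \<and> (\<forall>t\<in>\<Theta>. \<exists>s\<in>S. \<forall>i. \<forall>\<omega>\<in>space M. \<bar>g i \<omega> t - g i \<omega> s\<bar> \<le> d)" if d: "0 < d" for d
  proof -
    obtain r where r: "0 < r" "\<And>x x' \<theta> \<theta>'. x \<in> XX \<Longrightarrow> x' \<in> XX \<Longrightarrow> \<theta> \<in> \<Theta> \<Longrightarrow> \<theta>' \<in> \<Theta> \<Longrightarrow>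
      dist x x' < r \<Longrightarrow> dist \<theta> \<theta>' < r \<Longrightarrow> dist (\<mu> x \<theta>) (\<mu> x' \<theta>') < d"
      by (rule uniformly_continuous_prodE[OF XX_compact \<Theta>_compact \<mu>_cont d]) blast
    obtain S where S: "S \<subseteq> \<Theta>" "finite S" "\<Theta> \<subseteq> (\<Union>s\<in>S. ball s r)"
      by (rule compactE_image[OF \<Theta>_compact, of \<Theta> "\<lambda>s. ball s r"]) (use r in auto)
    have "\<exists>s\<in>S. \<forall>i. \<forall>\<omega>\<in>space M. \<bar>g i \<omega> t - g i \<omega> s\<bar> \<le> d" if t: "t \<in> \<Theta>" for t
    proof -
      obtain s where s: "s \<in> S" "dist t s < r" using S(3) t by (auto simp: dist_commute)
      have "\<bar>g i \<omega> t - g i \<omega> s\<bar> \<le> d" if "\<omega> \<in> space M" for i \<omega>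
      proof -
        have "dist (\<mu> (X (Suc i) \<omega>) t) (\<mu> (X (Suc i) \<omega>) s) < d"
          using S(1) s t r(1) X_in[OF _ that, of "Suc i"] by (intro r(2)) auto
        then show ?thesis by (simp add: g_def dist_real_def)
      qed
      then show ?thesis using s(1) by blast
    qed
    then show ?thesis using S by blast
  qed
  \<comment> \<open>Markov's inequality at level \<open>b / 8\<close> then has probability at most
    \<open>c / 3\<close>; the other two thirds go to the information matrix and to the
    defect.\<close>
  have "0 < c / 3 * (b / 8)" using c b by simp
  from mds.uniform_lln[of \<Theta> g "2 * K", OF g_meas g_bd net this]
  obtain U where U: "\<And>n. integrable M (U n)" "\<forall>\<^sub>F n in sequentially. expectation (U n) \<le> c / 3 * (b / 8)" "\<And>n \<omega>. 0 \<le> U n \<omega>"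
    "\<And>n \<omega> t. \<omega> \<in> space M \<Longrightarrow> t \<in> \<Theta> \<Longrightarrow> \<bar>(\<Sum>i<n. g i \<omega> t * et i \<omega>) / real n\<bar> \<le> U n \<omega>" by blast
  have UM: "U n \<in> borel_measurable M" for n using U(1) by simp
  have N1: "\<forall>\<^sub>F n in sequentially. prob {\<omega>\<in>space M. l / 2 < norm (gram f (\<lambda>i. X i \<omega>) n \<theta>bar - m)} \<le> c / 3"
    by (rule prob_nullD[OF gram_null l2]) (use c in simp)
  have N2: "\<forall>\<^sub>F n in sequentially. prob {\<omega>\<in>space M. b / (16 * K) < defect n \<omega>} \<le> c / 3"
    by (rule prob_nullD[OF defect_null]) (use c b K in auto)
  show "\<forall>\<^sub>F n in sequentially. \<exists>B\<in>events. prob B \<le> c \<and> {\<omega>\<in>space M. \<epsilon> < norm (\<theta>LS n \<omega> - \<theta>bar)} \<subseteq> B"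
    using N1 N2 U(2) eventually_ge_at_top[of 1]
  proof eventually_elim
    case (elim n)
    have n: "1 \<le> n" using elim by simp
    define B1 where "B1 = {\<omega>\<in>space M. l / 2 < norm (gram f (\<lambda>i. X i \<omega>) n \<theta>bar - m)}"
    define B2 where "B2 = {\<omega>\<in>space M. b / (16 * K) < defect n \<omega>}"
    define B3 where "B3 = {\<omega>\<in>space M. b / 8 < U n \<omega>}"
    have ev: "B1 \<in> events" "B2 \<in> events" "B3 \<in> events"
      unfolding B1_def B2_def B3_def using gram_meas[of n] UM[of n] by measurable
    have "prob B3 \<le> expectation (U n) / (b / 8)" unfolding B3_def by (rule prob_markov[OF U(1)]) (use U(3) b in auto)
    also have "\<dots> \<le> c / 3" using elim(3) b by (simp add: divide_le_eq)
    finally have "prob B3 \<le> c / 3" .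
    moreover have "prob (B1 \<union> B2 \<union> B3) \<le> prob B1 + prob B2 + prob B3"
      using measure_Un_le[of "B1 \<union> B2" M B3] measure_Un_le[of B1 M B2] ev by simp
    ultimately have pB: "prob (B1 \<union> B2 \<union> B3) \<le> c" using elim unfolding B1_def B2_def by simp
    have "norm (\<theta>LS n \<omega> - \<theta>bar) \<le> \<epsilon>" if w: "\<omega> \<in> space M" and nb: "\<omega> \<notin> B1 \<union> B2 \<union> B3" for \<omega>
    proof (rule ccontr)
      assume "\<not> norm (\<theta>LS n \<omega> - \<theta>bar) \<le> \<epsilon>"
      then have far: "\<epsilon> \<le> dist (\<theta>LS n \<omega>) \<theta>bar" by (simp add: dist_norm)
      have gn: "norm (m - gram f (\<lambda>i. X i \<omega>) n \<theta>bar) \<le> l / 2" using nb w by (auto simp: B1_def norm_minus_commute)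
      have quad: "l / 2 * (v \<bullet> v) \<le> v \<bullet> (gram f (\<lambda>i. X i \<omega>) n \<theta>bar *v v)" for v
        using form_diff_le[OF gn, of v] l(2)[of v] by (simp add: algebra_simps)
      define t where "t = \<theta>LS n \<omega>"
      have tT: "t \<in> \<Theta>" unfolding t_def by (rule \<theta>LS_in[OF n w])
      have "b * real n \<le> (\<Sum>i=1..n. (\<mu> (X i \<omega>) t - \<mu> (X i \<omega>) \<theta>bar)\<^sup>2)"
        by (rule b(2)[OF n X_in[OF _ w] quad tT]) (use far t_def in auto)
      also have "\<dots> = (\<Sum>i<n. (g i \<omega> t)\<^sup>2)" by (simp add: sum.atLeast1_atMost_eq g_def)
      also have "\<dots> \<le> 2 * (\<Sum>i<n. g i \<omega> t * e (Suc i) \<omega>)" using objective_diff[OF w n] by (simp add: g_def t_def)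
      also have "(\<Sum>i<n. g i \<omega> t * e (Suc i) \<omega>) = (\<Sum>i<n. g i \<omega> t * et i \<omega>) + (\<Sum>i<n. g i \<omega> t * (e (Suc i) \<omega> - et i \<omega>))"
        by (simp add: sum.distrib[symmetric] algebra_simps)
      finally have main: "b * real n \<le> 2 * ((\<Sum>i<n. g i \<omega> t * et i \<omega>) + (\<Sum>i<n. g i \<omega> t * (e (Suc i) \<omega> - et i \<omega>)))" .
      have "U n \<omega> \<le> b / 8" using nb w by (auto simp: B3_def)
      then have "\<bar>(\<Sum>i<n. g i \<omega> t * et i \<omega>) / real n\<bar> \<le> b / 8" by (rule order_trans[OF U(4)[OF w tT, of n]])
      then have s1: "(\<Sum>i<n. g i \<omega> t * et i \<omega>) \<le> real n * (b / 8)" using n by (simp add: abs_le_iff field_simps)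
      have "(\<Sum>i<n. g i \<omega> t * (e (Suc i) \<omega> - et i \<omega>)) \<le> (\<Sum>i<n. 2 * K * \<bar>e (Suc i) \<omega> - et i \<omega>\<bar>)"
      proof (rule sum_mono)
        fix i
        have "g i \<omega> t * (e (Suc i) \<omega> - et i \<omega>) \<le> \<bar>g i \<omega> t\<bar> * \<bar>e (Suc i) \<omega> - et i \<omega>\<bar>" by (simp flip: abs_mult)
        also have "\<dots> \<le> 2 * K * \<bar>e (Suc i) \<omega> - et i \<omega>\<bar>" by (intro mult_right_mono g_bd[OF w tT]) auto
        finally show "g i \<omega> t * (e (Suc i) \<omega> - et i \<omega>) \<le> 2 * K * \<bar>e (Suc i) \<omega> - et i \<omega>\<bar>" .
      qed
      also have "\<dots> = 2 * K * (sqrt (real n) * defect n \<omega>)"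
      proof -
        have "sqrt (real n) * defect n \<omega> = (\<Sum>i<n. \<bar>e (Suc i) \<omega> - et i \<omega>\<bar>)" using n by (simp add: defect_def)
        then show ?thesis by (simp only: sum_distrib_left)
      qed
      also have "\<dots> \<le> 2 * K * (real n * (b / (16 * K)))"
      proof (intro mult_left_mono mult_mono)
        have "sqrt (real n) * 1 \<le> sqrt (real n) * sqrt (real n)" using n by (intro mult_left_mono) auto
        then show "sqrt (real n) \<le> real n" by simp
        show "defect n \<omega> \<le> b / (16 * K)" using nb w by (auto simp: B2_def)
        show "0 \<le> defect n \<omega>" by (simp add: defect_def sum_nonneg)
      qed (use K in auto)
      also have "\<dots> = real n * (b / 8)" using K by simp
      finally have s2: "(\<Sum>i<n. g i \<omega> t * (e (Suc i) \<omega> - et i \<omega>)) \<le> real n * (b / 8)" .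
      have "b * real n \<le> 2 * (real n * (b / 8) + real n * (b / 8))"
        by (rule order_trans[OF main]) (intro mult_left_mono add_mono s1 s2, simp)
      then show False using b n by (simp add: field_simps)
    qed
    then show ?case using ev pB by (intro bexI[of _ "B1 \<union> B2 \<union> B3"]) (auto simp: not_le[symmetric])
  qed
qed

section \<open>The normalized score of the gated errors\<close>

definition score :: "nat \<Rightarrow> 'w \<Rightarrow> real^'p" where
  "score n \<omega> = (1 / sqrt (real n)) *\<^sub>R (\<Sum>i<n. et i \<omega> *\<^sub>R f \<theta>bar (X (Suc i) \<omega>))"

lemma score_meas [measurable]: "score n \<in> borel_measurable M"
  unfolding score_def[abs_def]
  by (intro borel_measurable_scaleR borel_measurable_const borel_measurable_sum F_to_M[OF fX_meas[OF \<theta>bar_in]]) measurable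

lemma inner_score: "a \<bullet> score n \<omega> = (\<Sum>i<n. (a \<bullet> f \<theta>bar (X (Suc i) \<omega>)) * et i \<omega>) / sqrt (real n)"
  by (simp add: score_def inner_sum_right mult.commute)

lemma coord_meas: "(\<lambda>\<omega>. a \<bullet> f \<theta>bar (X (Suc i) \<omega>)) \<in> borel_measurable (F i)"
  using fX_meas[OF \<theta>bar_in, of i] by measurable

text \<open>Second moments of the coordinates are bounded uniformly in \<open>n\<close> by
  \<open>mds.second_moment\<close>, and Markov's inequality applies to the squared norm.\<close>

lemma score_tight: "prob_tight (\<lambda>n \<omega>. norm (score n \<omega>))"
  unfolding prob_tight_def
proof (intro allI impI)
  fix d :: real assume d: "0 < d"
  obtain K where K: "0 < K" "\<And>x \<theta>. x \<in> XX \<Longrightarrow> \<theta> \<in> \<Theta> \<Longrightarrow> norm (f \<theta> x) \<le> K" by (rule f_bound) blast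
  define c where "c = real CARD('p) * (K\<^sup>2 * (\<sigma>2 + 1))"
  have c0: "0 < c" using K \<sigma>2_pos by (simp add: c_def)
  have sq: "integrable M (\<lambda>\<omega>. (norm (score n \<omega>))\<^sup>2) \<and> expectation (\<lambda>\<omega>. (norm (score n \<omega>))\<^sup>2) \<le> c" if n: "1 \<le> n" for n
  proof -
    define h where "h j i \<omega> = axis j 1 \<bullet> f \<theta>bar (X (Suc i) \<omega>)" for j :: 'p and i \<omega>
    have hb: "\<bar>h j i \<omega>\<bar> \<le> K" if "\<omega> \<in> space M" for j i \<omega>
      using component_le_norm_cart[of "f \<theta>bar (X (Suc i) \<omega>)" j] K(2)[OF X_in[OF _ that, of "Suc i"] \<theta>bar_in] by (simp add: h_def inner_axis')
    have hm: "h j i \<in> borel_measurable (F i)" for j i unfolding h_def by (rule coord_meas)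
    note sm = mds.second_moment[of "h j" K n for j, OF hm hb]
    have eq: "(norm (score n \<omega>))\<^sup>2 = (\<Sum>j\<in>UNIV. (\<Sum>i<n. h j i \<omega> * et i \<omega>)\<^sup>2 / real n)" for \<omega>
    proof -
      have "(norm (score n \<omega>))\<^sup>2 = (\<Sum>j\<in>UNIV. (axis j 1 \<bullet> score n \<omega>)\<^sup>2)"
        by (simp add: norm_vec_def L2_set_def inner_axis' sum_nonneg)
      then show ?thesis by (simp add: inner_score h_def power_divide)
    qed
    have int: "integrable M (\<lambda>\<omega>. (\<Sum>i<n. h j i \<omega> * et i \<omega>)\<^sup>2 / real n)" for j using sm(1)[of j] by simp
    have "expectation (\<lambda>\<omega>. (norm (score n \<omega>))\<^sup>2) = (\<Sum>j\<in>UNIV. expectation (\<lambda>\<omega>. (\<Sum>i<n. h j i \<omega> * et i \<omega>)\<^sup>2) / real n)"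
      unfolding eq using int by (simp add: Bochner_Integration.integral_sum)
    also have "\<dots> \<le> (\<Sum>j\<in>(UNIV::'p set). K\<^sup>2 * (\<sigma>2 + 1))"
      using sm(2) n by (intro sum_mono) (simp add: divide_le_eq mult.commute)
    finally show ?thesis unfolding eq using int by (simp add: c_def eq)
  qed
  define R where "R = sqrt (c / d)"
  have R: "0 < R" "R\<^sup>2 = c / d" using c0 d by (auto simp: R_def)
  show "\<exists>K. \<forall>\<^sub>F n in sequentially. prob {\<omega>\<in>space M. K < norm (score n \<omega>)} \<le> d"
  proof (rule exI[of _ R])
    show "\<forall>\<^sub>F n in sequentially. prob {\<omega>\<in>space M. R < norm (score n \<omega>)} \<le> d"
      using eventually_ge_at_top[of 1]
    proof eventually_elim
      case (elim n)
      have "prob {\<omega>\<in>space M. R < norm (score n \<omega>)} \<le> prob {\<omega>\<in>space M. R\<^sup>2 < (norm (score n \<omega>))\<^sup>2}"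
        using R(1) by (intro finite_measure_mono) (auto intro!: power_strict_mono)
      also have "\<dots> \<le> expectation (\<lambda>\<omega>. (norm (score n \<omega>))\<^sup>2) / R\<^sup>2"
        by (rule prob_markov) (use sq[OF elim] R(1) in auto)
      also have "\<dots> \<le> c / R\<^sup>2" using sq[OF elim] by (intro divide_right_mono) auto
      also have "\<dots> = d" using R c0 d by simp
      finally show ?case .
    qed
  qed
qed

text \<open>Cramer--Wold: the projection on \<open>a\<close> is a martingale transform with
  predictable weights, because \<open>X (Suc i)\<close> is \<open>F i\<close>-measurable. Its
  averaged conditional variance converges since the Gram matrices converge to \<open>m\<close> and
  the conditional variances to \<open>\<sigma>2\<close>.\<close>

lemma score_char:
  fixes B :: "real^'p^'p"
  shows "(\<lambda>n. integral\<^sup>L M (\<lambda>\<omega>. iexp (t \<bullet> (B *v score n \<omega>)))) \<longlonglongrightarrow>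
    complex_of_real (exp (- (\<sigma>2 * ((transpose B *v t) \<bullet> (m *v (transpose B *v t)))) / 2))"
proof -
  define a where "a = transpose B *v t"
  obtain K where K: "0 < K" "\<And>x \<theta>. x \<in> XX \<Longrightarrow> \<theta> \<in> \<Theta> \<Longrightarrow> norm (f \<theta> x) \<le> K" by (rule f_bound) blast
  define h where "h i \<omega> = a \<bullet> f \<theta>bar (X (Suc i) \<omega>)" for i \<omega>
  have hb: "\<bar>h i \<omega>\<bar> \<le> norm a * K + 1" if "\<omega> \<in> space M" for i \<omega>
  proof -
    have "\<bar>h i \<omega>\<bar> \<le> norm a * norm (f \<theta>bar (X (Suc i) \<omega>))" unfolding h_def by (rule Cauchy_Schwarz_ineq2)
    also have "\<dots> \<le> norm a * K" using K(2)[OF X_in[OF _ that, of "Suc i"] \<theta>bar_in] by (intro mult_left_mono) auto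
    finally show ?thesis by simp
  qed
  have K1: "0 < norm a * K + 1" using K by (simp add: add_nonneg_pos)
  have hm: "h i \<in> borel_measurable (F i)" for i unfolding h_def by (rule coord_meas)
  have "AE \<omega> in M. (\<lambda>n. (\<Sum>i<n. (h i \<omega>)\<^sup>2 * Vt i \<omega>) / real n) \<longlonglongrightarrow> \<sigma>2 * (a \<bullet> (m *v a))"
    using Vt_tendsto gram_tendsto AE_space
  proof eventually_elim
    case (elim \<omega>)
    have lim1: "(\<lambda>n. \<sigma>2 * (a \<bullet> (gram f (\<lambda>i. X i \<omega>) n \<theta>bar *v a))) \<longlonglongrightarrow> \<sigma>2 * (a \<bullet> (m *v a))"
      unfolding matrix_vector_mult_def by (intro tendsto_intros elim(2))
    \<comment> \<open>Replacing \<open>Vt i\<close> by its limit changes the average by a Cesaro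
      mean of a null sequence; what remains is \<open>\<sigma>2\<close> times the form of the Gram
      matrix.\<close>
    have "(\<lambda>i. (h i \<omega>)\<^sup>2 * (Vt i \<omega> - \<sigma>2)) \<longlonglongrightarrow> 0"
    proof (rule Lim_null_comparison)
      have "(\<lambda>i. (norm a * K + 1)\<^sup>2 * \<bar>Vt i \<omega> - \<sigma>2\<bar>) \<longlonglongrightarrow> (norm a * K + 1)\<^sup>2 * \<bar>\<sigma>2 - \<sigma>2\<bar>"
        by (intro tendsto_intros elim(1))
      then show "(\<lambda>i. (norm a * K + 1)\<^sup>2 * \<bar>Vt i \<omega> - \<sigma>2\<bar>) \<longlonglongrightarrow> 0" by simp
      show "\<forall>\<^sub>F i in sequentially. norm ((h i \<omega>)\<^sup>2 * (Vt i \<omega> - \<sigma>2)) \<le> (norm a * K + 1)\<^sup>2 * \<bar>Vt i \<omega> - \<sigma>2\<bar>"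
      proof (rule always_eventually, rule allI)
        fix i
        have "(h i \<omega>)\<^sup>2 \<le> (norm a * K + 1)\<^sup>2" using hb[OF elim(3), of i] K1 by (simp add: abs_le_square_iff[symmetric])
        then show "norm ((h i \<omega>)\<^sup>2 * (Vt i \<omega> - \<sigma>2)) \<le> (norm a * K + 1)\<^sup>2 * \<bar>Vt i \<omega> - \<sigma>2\<bar>"
          by (simp add: abs_mult mult_right_mono)
      qed
    qed
    from tendsto_add[OF lim1 cesaro_tendsto_0[OF this]]
    have "(\<lambda>n. \<sigma>2 * (a \<bullet> (gram f (\<lambda>i. X i \<omega>) n \<theta>bar *v a)) + (\<Sum>i<n. (h i \<omega>)\<^sup>2 * (Vt i \<omega> - \<sigma>2)) / real n) \<longlonglongrightarrow> \<sigma>2 * (a \<bullet> (m *v a))"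
      by simp
    moreover have "\<sigma>2 * (a \<bullet> (gram f (\<lambda>i. X i \<omega>) n \<theta>bar *v a)) + (\<Sum>i<n. (h i \<omega>)\<^sup>2 * (Vt i \<omega> - \<sigma>2)) / real n = (\<Sum>i<n. (h i \<omega>)\<^sup>2 * Vt i \<omega>) / real n" for n
    proof -
      have "a \<bullet> (gram f (\<lambda>i. X i \<omega>) n \<theta>bar *v a) = (\<Sum>i<n. (h i \<omega>)\<^sup>2) / real n"
        unfolding gram_form by (simp add: sum.atLeast1_atMost_eq h_def inner_commute)
      then show ?thesis
        by (simp add: right_diff_distrib sum_subtractf sum_distrib_left diff_divide_distrib mult.commute)
    qed
    ultimately show ?case by simp
  qed
  from mds.char_clt[of h, OF hm hb K1 this lindeberg_mean]
  have "(\<lambda>n. integral\<^sup>L M (\<lambda>\<omega>. iexp ((\<Sum>i<n. h i \<omega> * et i \<omega>) / sqrt (real n)))) \<longlonglongrightarrow> complex_of_real (exp (- (\<sigma>2 * (a \<bullet> (m *v a))) / 2))" .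
  moreover have "(\<Sum>i<n. h i \<omega> * et i \<omega>) / sqrt (real n) = t \<bullet> (B *v score n \<omega>)" for n \<omega>
  proof -
    have "(\<Sum>i<n. h i \<omega> * et i \<omega>) / sqrt (real n) = a \<bullet> score n \<omega>" by (simp add: inner_score h_def)
    also have "\<dots> = t \<bullet> (B *v score n \<omega>)" using inner_transpose_mult[of "score n \<omega>" B t] by (simp add: a_def inner_commute)
    finally show ?thesis .
  qed
  ultimately show ?thesis by (simp only: a_def)
qed

text \<open>In the local variable the objective is uniformly close to a quadratic with minimizer
  \<open>matrix_inv m *v score n \<omega>\<close>, and \<open>quadratic_argmin_close\<close>
  transfers this to the minimizers. The expansion holds only for |u| <= \<delta> sqrt n, which is
  why consistency comes first. Six bad events share the budget \<open>c\<close>.\<close>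

theorem lse_linearization:
  "prob_null (\<lambda>n \<omega>. norm (sqrt (real n) *\<^sub>R (\<theta>LS n \<omega> - \<theta>bar) - matrix_inv m *v score n \<omega>))"
proof (rule prob_nullI)
  fix \<epsilon> c :: real assume \<epsilon>: "0 < \<epsilon>" and c: "0 < c"
  obtain l where l: "0 < l" "\<And>v. l * (v \<bullet> v) \<le> v \<bullet> (m *v v)" by (rule spd_lower_bound[OF m_pos]) blast
  obtain K where K: "0 < K" "\<And>x \<theta>. x \<in> XX \<Longrightarrow> \<theta> \<in> \<Theta> \<Longrightarrow> norm (f \<theta> x) \<le> K" by (rule f_bound) blast
  define c1 where "c1 = 2 * (real CARD('p) * (1 + 28 * real CARD('p) + 8 * exp (2 * (\<sigma>2 + 1))))"
  have c1: "0 < c1" unfolding c1_def by (intro mult_pos_pos add_pos_pos) auto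
  obtain R0 where R0: "\<forall>\<^sub>F n in sequentially. prob {\<omega>\<in>space M. R0 < norm (score n \<omega>)} \<le> c / 6"
    using score_tight[unfolded prob_tight_def, rule_format, of "c / 6"] c by auto
  define R where "R = max R0 0 / l"
  have R: "0 \<le> R" using l by (simp add: R_def)
  have Rs: "norm (matrix_inv m *v score n \<omega>) \<le> R" if "norm (score n \<omega>) \<le> R0" for n \<omega>
  proof -
    have "norm (matrix_inv m *v score n \<omega>) \<le> norm (score n \<omega>) / l" by (rule norm_matrix_inv_vector_le[OF l(2,1)])
    also have "\<dots> \<le> R" unfolding R_def using that l by (intro divide_right_mono) auto
    finally show ?thesis .
  qed
  \<comment> \<open>3 K + 11 = (3 K + 3) + 8, the coefficients of \<open>w\<close> and of the
    chaining bound in \<open>lse_objective_expansion\<close>; outside the bad events both quantities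
    are at most \<open>q\<close>.\<close>
  define \<kappa> where "\<kappa> = 3 * K + 11"
  have \<kappa>: "0 < \<kappa>" using K by (simp add: \<kappa>_def)
  \<comment> \<open>The four bounds serve, in order: \<open>w \<le> q \<le> 1\<close>, the
    probability of \<open>B3\<close>, the condition \<open>4 * \<eta> \<le> l\<close>, and the final
    distance \<open>\<epsilon>\<close>.\<close>
  define q where "q = min 1 (min (c / (6 * c1)) (min (l / (4 * \<kappa>)) (\<epsilon>\<^sup>2 * l / (2 * \<kappa> * (2 + 3 * R\<^sup>2)))))"
  have R2: "0 < 2 + 3 * R\<^sup>2" by (intro add_pos_nonneg) auto
  have q: "0 < q" "q \<le> 1" "c1 * q \<le> c / 6" "4 * (\<kappa> * q) \<le> l" "2 * (\<kappa> * q) / l * (2 + 3 * R\<^sup>2) \<le> \<epsilon>\<^sup>2"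
  proof -
    show "0 < q" unfolding q_def using c c1 l \<kappa> \<epsilon> R2 by simp
    show "q \<le> 1" by (simp add: q_def)
    have "q \<le> c / (6 * c1)" by (simp add: q_def)
    then show "c1 * q \<le> c / 6" using c1 by (simp add: field_simps)
    have "q \<le> l / (4 * \<kappa>)" by (simp add: q_def)
    then show "4 * (\<kappa> * q) \<le> l" using \<kappa> by (simp add: field_simps)
    have "q \<le> \<epsilon>\<^sup>2 * l / (2 * \<kappa> * (2 + 3 * R\<^sup>2))" by (simp add: q_def)
    then have "q * (2 * \<kappa> * (2 + 3 * R\<^sup>2)) \<le> \<epsilon>\<^sup>2 * l" using \<kappa> R2 by (subst (asm) pos_le_divide_eq) auto
    then show "2 * (\<kappa> * q) / l * (2 + 3 * R\<^sup>2) \<le> \<epsilon>\<^sup>2" using l(1) by (simp add: pos_divide_le_eq mult_ac)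
  qed
  \<comment> \<open>Chaining bounds the expectation by \<open>c1 * q\<^sup>2\<close>; with Markov's
    inequality at level \<open>q\<close> both the bound and the exceptional probability are of order
    \<open>q\<close>.\<close>
  define w where "w = q\<^sup>2"
  have w: "0 < w" "w \<le> q" "w \<le> 1"
    using q by (auto simp: w_def power2_eq_square mult_le_one mult_left_le)
  obtain \<delta> where \<delta>: "0 < \<delta>" "\<And>h. (\<forall>j. \<bar>h $ j\<bar> \<le> 2 * \<delta>) \<Longrightarrow> \<theta>bar + h \<in> interior \<Theta>"
    "\<And>x h h'. x \<in> XX \<Longrightarrow> (\<forall>j. \<bar>h $ j\<bar> \<le> 2 * \<delta>) \<Longrightarrow> (\<forall>j. \<bar>h' $ j\<bar> \<le> 2 * \<delta>) \<Longrightarrow>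
      \<bar>(\<mu> x (\<theta>bar + h) - \<mu> x \<theta>bar - f \<theta>bar x \<bullet> h) - (\<mu> x (\<theta>bar + h') - \<mu> x \<theta>bar - f \<theta>bar x \<bullet> h')\<bar> \<le> w * norm (h - h')"
  proof (rule local_remainder_lipschitz[OF XX_compact \<Theta>_compact f_cont f_grad \<theta>bar_int w(1)])
    fix \<delta>
    assume "0 < \<delta>" "\<And>h. (\<forall>j. \<bar>h $ j\<bar> \<le> 2 * \<delta>) \<Longrightarrow> \<theta>bar + h \<in> interior \<Theta>"
      "\<And>x h h'. x \<in> XX \<Longrightarrow> (\<forall>j. \<bar>h $ j\<bar> \<le> 2 * \<delta>) \<Longrightarrow> (\<forall>j. \<bar>h' $ j\<bar> \<le> 2 * \<delta>) \<Longrightarrow>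
      \<bar>(\<mu> x (\<theta>bar + h) - \<mu> x \<theta>bar - f \<theta>bar x \<bullet> h) - (\<mu> x (\<theta>bar + h') - \<mu> x \<theta>bar - f \<theta>bar x \<bullet> h')\<bar> \<le> w * norm (h - h')"
    then show thesis by (rule that)
  qed
  define r where "r i \<omega> h = \<mu> (X (Suc i) \<omega>) (\<theta>bar + h) - \<mu> (X (Suc i) \<omega>) \<theta>bar - f \<theta>bar (X (Suc i) \<omega>) \<bullet> h" for i \<omega> h
  have r_meas: "(\<lambda>\<omega>. r i \<omega> h) \<in> borel_measurable (F i)" if h: "\<And>j. \<bar>h $ j\<bar> \<le> 2 * \<delta>" for i h
  proof -
    have "\<theta>bar + h \<in> \<Theta>" using \<delta>(2)[of h] h interior_subset by blast
    then have "(\<lambda>\<omega>. \<mu> (X (Suc i) \<omega>) (\<theta>bar + h)) \<in> borel_measurable (F i)" by (intro comp_X_meas \<mu>_cont_x)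
    moreover have "(\<lambda>\<omega>. \<mu> (X (Suc i) \<omega>) \<theta>bar) \<in> borel_measurable (F i)" by (intro comp_X_meas \<mu>_cont_x \<theta>bar_in)
    moreover have "(\<lambda>\<omega>. f \<theta>bar (X (Suc i) \<omega>) \<bullet> h) \<in> borel_measurable (F i)" using coord_meas[of h i] by (simp add: inner_commute)
    ultimately show ?thesis unfolding r_def by (intro borel_measurable_diff)
  qed
  have r0: "r i \<omega> 0 = 0" for i \<omega> by (simp add: r_def)
  have r_lip: "\<bar>r i \<omega> h - r i \<omega> h'\<bar> \<le> w * norm (h - h')"
    if "\<omega> \<in> space M" "\<And>j. \<bar>h $ j\<bar> \<le> 2 * \<delta>" "\<And>j. \<bar>h' $ j\<bar> \<le> 2 * \<delta>" for i \<omega> h h'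
    unfolding r_def by (rule \<delta>(3)) (use X_in that in auto)
  have N1: "\<forall>\<^sub>F n in sequentially. prob {\<omega>\<in>space M. w < norm (gram f (\<lambda>i. X i \<omega>) n \<theta>bar - m)} \<le> c / 6"
    by (rule prob_nullD[OF gram_null w(1)]) (use c in simp)
  have N2: "\<forall>\<^sub>F n in sequentially. prob {\<omega>\<in>space M. \<delta> < norm (\<theta>LS n \<omega> - \<theta>bar)} \<le> c / 6"
    by (rule prob_nullD[OF \<theta>LS_consistent \<delta>(1)]) (use c in simp)
  have N5: "\<forall>\<^sub>F n in sequentially. prob {\<omega>\<in>space M. w < defect n \<omega>} \<le> c / 6"
    by (rule prob_nullD[OF defect_null w(1)]) (use c in simp)
  have N4: "\<forall>\<^sub>F n in sequentially. (\<Sum>i<n. mds.lind 1 n i) / real n < c / 6"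
    by (rule order_tendstoD(2)[OF lindeberg_mean]) (use c in auto)
  have "filterlim (\<lambda>n. sqrt (real n)) at_top sequentially"
    by (rule filterlim_compose[OF sqrt_at_top filterlim_real_sequentially])
  \<comment> \<open>The first bound is a precondition of \<open>multiscale_chaining\<close>; by the
    second, the approximate minimizer, of norm at most \<open>R\<close>, lies in the region of the
    expansion.\<close>
  then have N6: "\<forall>\<^sub>F n in sequentially. max (1 / (2 * \<delta>)) (R / \<delta>) \<le> sqrt (real n)" unfolding filterlim_at_top by blast
  show "\<forall>\<^sub>F n in sequentially. \<exists>B\<in>events. prob B \<le> c \<and>
      {\<omega>\<in>space M. \<epsilon> < norm (sqrt (real n) *\<^sub>R (\<theta>LS n \<omega> - \<theta>bar) - matrix_inv m *v score n \<omega>)} \<subseteq> B"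
    using N1 N2 N4 N5 N6 R0 eventually_ge_at_top[of 1]
  proof eventually_elim
    case (elim n)
    have n: "1 \<le> n" and sn: "0 < sqrt (real n)" using elim by auto
    have n2: "1 \<le> 2 * \<delta> * sqrt (real n)" "R \<le> \<delta> * sqrt (real n)" using elim(5) \<delta>(1) by (auto simp: field_simps)
    obtain W where W: "integrable M W" "\<And>\<omega>. 0 \<le> W \<omega>" "expectation W \<le> c1 * w"
      and W4: "\<And>\<omega> h. \<omega> \<in> space M \<Longrightarrow> (\<forall>j. \<bar>h $ j\<bar> \<le> \<delta>) \<Longrightarrow>
        \<bar>\<Sum>i<n. r i \<omega> h * mds.trunc n i \<omega>\<bar> \<le> (1 + 4 * (real n * (norm h)\<^sup>2)) * W \<omega>"
    proof (rule mds.multiscale_chaining[OF \<delta>(1) w(1) n n2(1) r_meas r0 r_lip])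
      fix W assume A: "integrable M W" "\<And>\<omega>. 0 \<le> W \<omega>"
        "expectation W \<le> 2 * (real CARD('p) * (1 + 28 * real CARD('p) + 8 * exp (2 * (\<sigma>2 + 1)))) * w"
        and B: "\<And>\<omega> h. \<omega> \<in> space M \<Longrightarrow> (\<And>j. \<bar>h $ j\<bar> \<le> \<delta>) \<Longrightarrow>
          \<bar>\<Sum>i<n. r i \<omega> h * mds.trunc n i \<omega>\<bar> \<le> (1 + 4 * (real n * (norm h)\<^sup>2)) * W \<omega>"
      show thesis by (rule that[OF A[folded c1_def] B]) auto
    qed
    define B1 where "B1 = {\<omega>\<in>space M. w < norm (gram f (\<lambda>i. X i \<omega>) n \<theta>bar - m)}"
    define B2 where "B2 = {\<omega>\<in>space M. \<delta> < norm (\<theta>LS n \<omega> - \<theta>bar)}"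
    define B3 where "B3 = {\<omega>\<in>space M. q < W \<omega>}"
    \<comment> \<open>Off this event the truncated and the gated errors coincide, so the chaining
      bound speaks about \<open>et\<close>.\<close>
    define B4 where "B4 = {\<omega>\<in>space M. \<exists>i<n. mds.trunc n i \<omega> \<noteq> et i \<omega>}"
    define B5 where "B5 = {\<omega>\<in>space M. w < defect n \<omega>}"
    define B6 where "B6 = {\<omega>\<in>space M. R0 < norm (score n \<omega>)}"
    have WM: "W \<in> borel_measurable M" using W(1) by simp
    have ev: "B1 \<in> events" "B2 \<in> events" "B3 \<in> events" "B4 \<in> events" "B5 \<in> events" "B6 \<in> events"
      unfolding B1_def B2_def B3_def B4_def B5_def B6_def using gram_meas[of n] WM by measurable
    have "prob B3 \<le> expectation W / q" unfolding B3_def by (rule prob_markov[OF W(1)]) (use W(2) q in auto)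
    also have "\<dots> \<le> c1 * w / q" using W(3) q by (intro divide_right_mono) auto
    also have "\<dots> = c1 * q" using q by (simp add: w_def power2_eq_square)
    finally have p3: "prob B3 \<le> c / 6" using q(3) by simp
    have p4: "prob B4 \<le> c / 6" using mds.prob_truncated[of n] elim(3) unfolding B4_def by linarith
    have "prob (B1 \<union> B2 \<union> B3 \<union> B4 \<union> B5 \<union> B6) \<le> prob B1 + prob B2 + prob B3 + prob B4 + prob B5 + prob B6"
      using measure_Un_le[of "B1 \<union> B2 \<union> B3 \<union> B4 \<union> B5" M B6] measure_Un_le[of "B1 \<union> B2 \<union> B3 \<union> B4" M B5]
        measure_Un_le[of "B1 \<union> B2 \<union> B3" M B4] measure_Un_le[of "B1 \<union> B2" M B3] measure_Un_le[of B1 M B2] ev by simp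
    also have "\<dots> \<le> c" using elim p3 p4 unfolding B1_def B2_def B5_def B6_def by simp
    finally have pB: "prob (B1 \<union> B2 \<union> B3 \<union> B4 \<union> B5 \<union> B6) \<le> c" .
    have main: "norm (sqrt (real n) *\<^sub>R (\<theta>LS n \<omega> - \<theta>bar) - matrix_inv m *v score n \<omega>) \<le> \<epsilon>"
      if om: "\<omega> \<in> space M" and nb: "\<omega> \<notin> B1 \<union> B2 \<union> B3 \<union> B4 \<union> B5 \<union> B6" for \<omega>
    proof -
      define \<eta> where "\<eta> = w * (3 * K + 3) + 8 * W \<omega>"
      have Wq: "W \<omega> \<le> q" using nb om by (auto simp: B3_def)
      have \<eta>: "0 \<le> \<eta>" "\<eta> \<le> \<kappa> * q"
      proof -
        show "0 \<le> \<eta>" using w K W(2)[of \<omega>] by (simp add: \<eta>_def)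
        have "w * (3 * K + 3) \<le> q * (3 * K + 3)" using w K by (intro mult_right_mono) auto
        then show "\<eta> \<le> \<kappa> * q" using Wq by (simp add: \<eta>_def \<kappa>_def algebra_simps)
      qed
      define fi where "fi i = f \<theta>bar (X (Suc i) \<omega>)" for i
      define Q where "Q u = (\<Sum>i<n. (e (Suc i) \<omega> - (fi i \<bullet> (u /\<^sub>R sqrt (real n)) + r i \<omega> (u /\<^sub>R sqrt (real n))))\<^sup>2)" for u
      define q0 where "q0 = (\<Sum>i<n. (e (Suc i) \<omega>)\<^sup>2)"
      have expand: "\<bar>Q u - q0 - (u \<bullet> (m *v u) - 2 * (u \<bullet> score n \<omega>))\<bar> \<le> \<eta> * (1 + (norm u)\<^sup>2)"
        if u: "norm u \<le> \<delta> * sqrt (real n)" for u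
      proof -
        define h where "h = u /\<^sub>R sqrt (real n)"
        have uh: "sqrt (real n) *\<^sub>R h = u" using sn by (simp add: h_def)
        have "norm h \<le> \<delta>" using u sn by (simp add: h_def divide_inverse[symmetric] pos_divide_le_eq mult.commute)
        then have hj: "\<bar>h $ j\<bar> \<le> \<delta>" for j using component_le_norm_cart[of h j] by simp
        have hj2: "\<bar>h $ j\<bar> \<le> 2 * \<delta>" for j using hj[of j] \<delta>(1) by simp
        have rb: "\<bar>r i \<omega> h\<bar> \<le> w * norm h" for i
          using r_lip[OF om hj2, of 0 i] r0 \<delta>(1) by simp
        have tr: "mds.trunc n i \<omega> = et i \<omega>" if "i < n" for i using nb om that by (auto simp: B4_def)
        have ch: "\<bar>\<Sum>i<n. r i \<omega> h * et i \<omega>\<bar> \<le> (1 + 4 * (real n * (norm h)\<^sup>2)) * W \<omega>"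
          using W4[OF om, of h] hj tr by simp
        have "\<bar>(\<Sum>i<n. (e (Suc i) \<omega> - (fi i \<bullet> h + r i \<omega> h))\<^sup>2) - (\<Sum>i<n. (e (Suc i) \<omega>)\<^sup>2)
            - ((sqrt (real n) *\<^sub>R h) \<bullet> (m *v (sqrt (real n) *\<^sub>R h)) - 2 * ((sqrt (real n) *\<^sub>R h) \<bullet> ((1 / sqrt (real n)) *\<^sub>R (\<Sum>i<n. et i \<omega> *\<^sub>R fi i))))\<bar>
          \<le> (w * (3 * K + 3) + 8 * W \<omega>) * (1 + (norm (sqrt (real n) *\<^sub>R h))\<^sup>2)"
        proof (rule lse_objective_expansion[OF n])
          show "norm (fi i) \<le> K" for i unfolding fi_def by (rule K(2)[OF X_in[OF _ om] \<theta>bar_in]) simp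
          show "norm ((1 / real n) *\<^sub>R (\<Sum>i<n. outer_prod (fi i) (fi i)) - m) \<le> w"
            using nb om unfolding fi_def gram_Suc_index[symmetric] by (auto simp: B1_def)
          show "(\<Sum>i<n. \<bar>e (Suc i) \<omega> - et i \<omega>\<bar>) / sqrt (real n) \<le> w"
            using nb om unfolding defect_def[symmetric] by (auto simp: B5_def)
        qed (use K w rb ch W(2) in auto)
        then show ?thesis by (simp only: uh Q_def q0_def h_def[symmetric] score_def fi_def[symmetric] \<eta>_def)
      qed
      define u where "u = sqrt (real n) *\<^sub>R (\<theta>LS n \<omega> - \<theta>bar)"
      define u' where "u' = matrix_inv m *v score n \<omega>"
      have nu: "norm u \<le> \<delta> * sqrt (real n)" using nb om sn by (auto simp: u_def B2_def mult.commute)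
      have u'R: "norm u' \<le> R" unfolding u'_def by (rule Rs) (use nb om in \<open>auto simp: B6_def\<close>)
      have nu': "norm u' \<le> \<delta> * sqrt (real n)" using u'R n2(2) by simp
      have Qobj: "Q v = (\<Sum>i<n. (Y (Suc i) \<omega> - \<mu> (X (Suc i) \<omega>) (\<theta>bar + v /\<^sub>R sqrt (real n)))\<^sup>2)" for v
        unfolding Q_def r_def fi_def using Y_model[OF om] by (simp add: algebra_simps)
      have "\<theta>bar + u /\<^sub>R sqrt (real n) = \<theta>LS n \<omega>" using sn by (simp add: u_def)
      moreover have "\<theta>bar + u' /\<^sub>R sqrt (real n) \<in> \<Theta>"
      proof -
        have "norm (u' /\<^sub>R sqrt (real n)) \<le> \<delta>" using nu' sn by (simp add: divide_inverse[symmetric] pos_divide_le_eq mult.commute)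
        then have "\<bar>(u' /\<^sub>R sqrt (real n)) $ j\<bar> \<le> 2 * \<delta>" for j
          using component_le_norm_cart[of "u' /\<^sub>R sqrt (real n)" j] \<delta>(1) by linarith
        then show ?thesis using \<delta>(2)[of "u' /\<^sub>R sqrt (real n)"] interior_subset by blast
      qed
      ultimately have min: "Q u \<le> Q u'" unfolding Qobj using \<theta>LS_min[OF n om] by simp
      have "m *v u' = score n \<omega>" unfolding u'_def using matrix_inv_mult[OF pos_def_invertible[OF m_pos]] by simp
      from quadratic_argmin_close[OF m_sym l(2,1) this expand[OF nu] expand[OF nu'] min \<eta>(1)]
      have "(norm (u - u'))\<^sup>2 \<le> 2 * \<eta> / l * (2 + 3 * (norm u')\<^sup>2)" using \<eta>(2) q(4) by linarith
      also have "\<dots> \<le> 2 * (\<kappa> * q) / l * (2 + 3 * R\<^sup>2)"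
      proof (intro mult_mono divide_right_mono mult_left_mono \<eta>)
        have "(norm u')\<^sup>2 \<le> R\<^sup>2" using u'R by (intro power_mono) auto
        then show "2 + 3 * (norm u')\<^sup>2 \<le> 2 + 3 * R\<^sup>2" by simp
      qed (use l q \<kappa> in auto)
      also have "\<dots> \<le> \<epsilon>\<^sup>2" by (rule q(5))
      finally have "norm (u - u') \<le> \<epsilon>" by (rule power2_le_imp_le) (use \<epsilon> in simp)
      then show ?thesis by (simp add: u_def u'_def)
    qed
    show ?case
    proof (intro bexI conjI subsetI)
      show "B1 \<union> B2 \<union> B3 \<union> B4 \<union> B5 \<union> B6 \<in> events" by (intro sets.Un ev)
      fix \<omega> assume "\<omega> \<in> {\<omega>\<in>space M. \<epsilon> < norm (sqrt (real n) *\<^sub>R (\<theta>LS n \<omega> - \<theta>bar) - matrix_inv m *v score n \<omega>)}"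
      then have \<omega>: "\<omega> \<in> space M" "\<not> norm (sqrt (real n) *\<^sub>R (\<theta>LS n \<omega> - \<theta>bar) - matrix_inv m *v score n \<omega>) \<le> \<epsilon>" by auto
      show "\<omega> \<in> B1 \<union> B2 \<union> B3 \<union> B4 \<union> B5 \<union> B6" using \<omega>(2) main[OF \<omega>(1)] by (rule contrapos_np)
    qed (rule pB)
  qed
qed

section \<open>From the score to the limit laws\<close>

lemma scaled_error_meas: "(\<lambda>\<omega>. sqrt (real n) *\<^sub>R (\<theta>LS n \<omega> - \<theta>bar)) \<in> borel_measurable M"
  by measurable

lemma matrix_vector_meas:
  assumes "W \<in> borel_measurable M"
  shows "(\<lambda>\<omega>. (B :: real^'p^'p) *v W \<omega>) \<in> borel_measurable M"
  by (rule measurable_compose[OF assms])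
    (intro borel_measurable_continuous_onI linear_continuous_on matrix_vector_mul_bounded_linear)

lemma linear_score_tight: "prob_tight (\<lambda>n \<omega>. norm ((B :: real^'p^'p) *v score n \<omega>))"
  unfolding prob_tight_def
proof (intro allI impI)
  fix d :: real assume d: "0 < d"
  obtain R where R: "\<forall>\<^sub>F n in sequentially. prob {\<omega>\<in>space M. R < norm (score n \<omega>)} \<le> d"
    using score_tight d unfolding prob_tight_def by blast
  show "\<exists>K. \<forall>\<^sub>F n in sequentially. prob {\<omega>\<in>space M. K < norm (B *v score n \<omega>)} \<le> d"
  proof (rule exI[of _ "norm B * R"])
    show "\<forall>\<^sub>F n in sequentially. prob {\<omega>\<in>space M. norm B * R < norm (B *v score n \<omega>)} \<le> d" using R
    proof eventually_elim
      case (elim n)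
      have "R < norm (score n \<omega>)" if "norm B * R < norm (B *v score n \<omega>)" for \<omega>
      proof -
        have "norm B * R < norm B * norm (score n \<omega>)" using that norm_matrix_vector_le[of B "score n \<omega>"] by linarith
        then show ?thesis by (simp add: mult_less_cancel_left_disj)
      qed
      then have "prob {\<omega>\<in>space M. norm B * R < norm (B *v score n \<omega>)} \<le> prob {\<omega>\<in>space M. R < norm (score n \<omega>)}"
        by (intro finite_measure_mono) auto
      then show ?case using elim by simp
    qed
  qed
qed

text \<open>Common end of both limit laws: \<open>Z\<close> has the same limiting characteristic
  function as a linear image of the score and inherits its tightness. The assumption
  \<open>cov\<close> says, as quadratic forms, that \<sigma>2 B m B^T is \<open>C\<close>.\<close>

lemma conv_distr_linear_score:
  fixes B C :: "real^'p^'p" and Z :: "nat \<Rightarrow> 'w \<Rightarrow> real^'p"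
  assumes Z: "\<And>n. Z n \<in> borel_measurable M" and null: "prob_null (\<lambda>n \<omega>. norm (Z n \<omega> - B *v score n \<omega>))"
    and C: "transpose C = C" "pos_def C"
    and cov: "\<And>t. \<sigma>2 * ((transpose B *v t) \<bullet> (m *v (transpose B *v t))) = t \<bullet> (C *v t)"
  shows "conv_distr M Z (mv_normal C)"
proof (rule conv_distr_char_tight[OF prob_space_axioms mv_normal_char(2,3)[OF C] Z])
  note Tm = matrix_vector_meas[OF score_meas, of B]
  fix t
  show "(\<lambda>n. integral\<^sup>L M (\<lambda>\<omega>. iexp (t \<bullet> Z n \<omega>))) \<longlonglongrightarrow> integral\<^sup>L (mv_normal C) (\<lambda>x. iexp (t \<bullet> x))"
    unfolding mv_normal_char(1)[OF C] cov[symmetric]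
    by (rule char_perturb[OF Z Tm null score_char])
next
  fix d :: real assume d: "0 < d"
  note Tm = matrix_vector_meas[OF score_meas, of B]
  have "prob_tight (\<lambda>n \<omega>. norm (Z n \<omega>))"
  proof (rule prob_tight_perturb[OF _ _ linear_score_tight[of B] null])
    show "norm (Z n \<omega>) \<le> norm (B *v score n \<omega>) + norm (Z n \<omega> - B *v score n \<omega>)" for n \<omega>
      using norm_triangle_ineq[of "B *v score n \<omega>" "Z n \<omega> - B *v score n \<omega>"] by simp
  qed (use Z Tm in measurable)
  then show "\<exists>R. \<forall>\<^sub>F n in sequentially. prob {\<omega>\<in>space M. R < norm (Z n \<omega>)} \<le> d"
    using d unfolding prob_tight_def by blast
qed

text \<open>With \<open>B = matrix_inv m\<close> the covariance is m^-1 (\<sigma>2 m) m^-1.\<close>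

theorem lse_asymptotic_normal:
  "conv_distr M (\<lambda>n \<omega>. sqrt (real n) *\<^sub>R (\<theta>LS n \<omega> - \<theta>bar)) (mv_normal (\<sigma>2 *\<^sub>R matrix_inv m))"
proof (rule conv_distr_linear_score[OF scaled_error_meas lse_linearization])
  have inv: "invertible m" by (rule pos_def_invertible[OF m_pos])
  have sym: "transpose (matrix_inv m) = matrix_inv m" by (rule sym_matrix_inv[OF m_sym inv])
  show "transpose (\<sigma>2 *\<^sub>R matrix_inv m) = \<sigma>2 *\<^sub>R matrix_inv m" by (simp only: transpose_scaleR sym)
  show "pos_def (\<sigma>2 *\<^sub>R matrix_inv m)"
    using pos_def_matrix_inv[OF m_sym m_pos] \<sigma>2_pos
    by (simp add: pos_def_def scaleR_matrix_vector_assoc[symmetric])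
  show "\<sigma>2 * ((transpose (matrix_inv m) *v t) \<bullet> (m *v (transpose (matrix_inv m) *v t))) = t \<bullet> ((\<sigma>2 *\<^sub>R matrix_inv m) *v t)" for t
    unfolding sym by (simp add: matrix_inv_mult[OF inv] scaleR_matrix_vector_assoc[symmetric] inner_commute)
qed

section \<open>Studentization by the square root of the information matrix\<close>

lemma gram_spd:
  assumes "nst \<le> n" "\<omega> \<in> space M" "\<theta> \<in> \<Theta>"
  shows "pos_def (gram f (\<lambda>i. X i \<omega>) n \<theta>)"
  unfolding pos_def_def
proof (intro allI impI)
  fix v :: "real^'p" assume "v \<noteq> 0"
  then have "0 < real nst / real n * (v \<bullet> (gram f (\<lambda>i. X i \<omega>) nst \<theta> *v v))"
    using start[OF assms(2,3)] nst1 assms(1) by (auto simp: pos_def_def intro!: mult_pos_pos)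
  also have "\<dots> \<le> v \<bullet> (gram f (\<lambda>i. X i \<omega>) n \<theta> *v v)" by (rule gram_form_mono[OF nst1 assms(1)])
  finally show "0 < v \<bullet> (gram f (\<lambda>i. X i \<omega>) n \<theta> *v v)" .
qed

text \<open>The index 0 is separated because the estimator is known to lie in
  \<open>\<Theta>\<close> only from 1 on; there the matrix is the constant 0.\<close>

lemma gram_LS_meas [measurable]: "(\<lambda>\<omega>. gram f (\<lambda>i. X i \<omega>) n (\<theta>LS n \<omega>)) \<in> borel_measurable M"
proof (cases "n = 0")
  case True
  then show ?thesis by (simp add: gram_def)
next
  case False
  then have n: "1 \<le> n" by simp
  have "(\<lambda>\<omega>. f (\<theta>LS n \<omega>) (X (Suc i) \<omega>)) \<in> borel_measurable M" for i
    by (rule measurable_continuous_on_prod[OF XX_compact \<Theta>_compact f_cont F_to_M[OF X_meas] X_in \<theta>LS_meas \<theta>LS_in[OF n]]) auto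
  then show ?thesis unfolding gram_Suc_index
    by (intro borel_measurable_scaleR borel_measurable_const borel_measurable_sum outer_measurable)
qed

text \<open>Passage through \<open>\<theta>bar\<close>: \<open>gram_null\<close> treats the true
  parameter, and consistency with uniform continuity of \<open>f\<close> the change of
  parameter.\<close>

lemma gram_LS_null: "prob_null (\<lambda>n \<omega>. norm (gram f (\<lambda>i. X i \<omega>) n (\<theta>LS n \<omega>) - m))"
proof (rule prob_null_add[of "\<lambda>n \<omega>. norm (gram f (\<lambda>i. X i \<omega>) n (\<theta>LS n \<omega>) - gram f (\<lambda>i. X i \<omega>) n \<theta>bar)", OF _ _ _ gram_null])
  show "(\<lambda>\<omega>. norm (gram f (\<lambda>i. X i \<omega>) n \<theta>bar - m)) \<in> borel_measurable M" for n
    using gram_meas[of n] by measurable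
  show "(\<lambda>\<omega>. norm (gram f (\<lambda>i. X i \<omega>) n (\<theta>LS n \<omega>) - gram f (\<lambda>i. X i \<omega>) n \<theta>bar)) \<in> borel_measurable M" for n
    using gram_meas[of n] by measurable
  show "\<forall>\<^sub>F n in sequentially. \<forall>\<omega>\<in>space M. norm (gram f (\<lambda>i. X i \<omega>) n (\<theta>LS n \<omega>) - m)
      \<le> norm (gram f (\<lambda>i. X i \<omega>) n (\<theta>LS n \<omega>) - gram f (\<lambda>i. X i \<omega>) n \<theta>bar) + norm (gram f (\<lambda>i. X i \<omega>) n \<theta>bar - m)"
  proof (intro always_eventually allI ballI)
    fix n \<omega>
    show "norm (gram f (\<lambda>i. X i \<omega>) n (\<theta>LS n \<omega>) - m)
      \<le> norm (gram f (\<lambda>i. X i \<omega>) n (\<theta>LS n \<omega>) - gram f (\<lambda>i. X i \<omega>) n \<theta>bar) + norm (gram f (\<lambda>i. X i \<omega>) n \<theta>bar - m)"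
      using norm_triangle_ineq[of "gram f (\<lambda>i. X i \<omega>) n (\<theta>LS n \<omega>) - gram f (\<lambda>i. X i \<omega>) n \<theta>bar" "gram f (\<lambda>i. X i \<omega>) n \<theta>bar - m"] by simp
  qed
  show "prob_null (\<lambda>n \<omega>. norm (gram f (\<lambda>i. X i \<omega>) n (\<theta>LS n \<omega>) - gram f (\<lambda>i. X i \<omega>) n \<theta>bar))"
  proof (rule prob_nullI)
    fix d c :: real assume d: "0 < d" and c: "0 < c"
    obtain K where K: "0 < K" "\<And>x \<theta>. x \<in> XX \<Longrightarrow> \<theta> \<in> \<Theta> \<Longrightarrow> norm (f \<theta> x) \<le> K" by (rule f_bound) blast
    have dK: "0 < d / (2 * K)" using d K by simp
    obtain r where r: "0 < r" "\<And>x x' \<theta> \<theta>'. x \<in> XX \<Longrightarrow> x' \<in> XX \<Longrightarrow> \<theta> \<in> \<Theta> \<Longrightarrow> \<theta>' \<in> \<Theta> \<Longrightarrow>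
      dist x x' < r \<Longrightarrow> dist \<theta> \<theta>' < r \<Longrightarrow> dist (f \<theta> x) (f \<theta>' x') < d / (2 * K)"
      by (rule uniformly_continuous_prodE[OF XX_compact \<Theta>_compact f_cont dK]) blast
    have "\<forall>\<^sub>F n in sequentially. prob {\<omega>\<in>space M. r / 2 < norm (\<theta>LS n \<omega> - \<theta>bar)} \<le> c"
      by (rule prob_nullD[OF \<theta>LS_consistent _ c]) (use r in simp)
    then show "\<forall>\<^sub>F n in sequentially. \<exists>B\<in>events. prob B \<le> c \<and>
        {\<omega>\<in>space M. d < norm (gram f (\<lambda>i. X i \<omega>) n (\<theta>LS n \<omega>) - gram f (\<lambda>i. X i \<omega>) n \<theta>bar)} \<subseteq> B"
      using eventually_ge_at_top[of 1]
    proof eventually_elim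
      case (elim n)
      have close: "norm (gram f (\<lambda>i. X i \<omega>) n (\<theta>LS n \<omega>) - gram f (\<lambda>i. X i \<omega>) n \<theta>bar) \<le> d"
        if om: "\<omega> \<in> space M" and near: "norm (\<theta>LS n \<omega> - \<theta>bar) \<le> r / 2" for \<omega>
      proof -
        note tT = \<theta>LS_in[OF elim(2) om]
        have "norm (gram f (\<lambda>i. X i \<omega>) n (\<theta>LS n \<omega>) - gram f (\<lambda>i. X i \<omega>) n \<theta>bar) \<le> 2 * K * (d / (2 * K))"
        proof (rule norm_gram_diff[OF _ _ _ elim(2)])
          fix i :: nat assume "1 \<le> i"
          note xi = X_in[OF this om]
          show "norm (f (\<theta>LS n \<omega>) (X i \<omega>)) \<le> K" "norm (f \<theta>bar (X i \<omega>)) \<le> K" using K(2)[OF xi] tT \<theta>bar_in by auto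
          have "dist (f (\<theta>LS n \<omega>) (X i \<omega>)) (f \<theta>bar (X i \<omega>)) < d / (2 * K)"
            by (rule r(2)[OF xi xi tT \<theta>bar_in]) (use r near in \<open>auto simp: dist_norm\<close>)
          then show "norm (f (\<theta>LS n \<omega>) (X i \<omega>) - f \<theta>bar (X i \<omega>)) \<le> d / (2 * K)" by (simp add: dist_norm)
        qed
        then show ?thesis using K by simp
      qed
      show ?case
      proof (intro bexI conjI subsetI)
        show "prob {\<omega>\<in>space M. r / 2 < norm (\<theta>LS n \<omega> - \<theta>bar)} \<le> c" by (rule elim(1))
        show "{\<omega>\<in>space M. r / 2 < norm (\<theta>LS n \<omega> - \<theta>bar)} \<in> events" by measurable
        fix \<omega> assume "\<omega> \<in> {\<omega>\<in>space M. d < norm (gram f (\<lambda>i. X i \<omega>) n (\<theta>LS n \<omega>) - gram f (\<lambda>i. X i \<omega>) n \<theta>bar)}"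
        then have \<omega>: "\<omega> \<in> space M" "\<not> norm (gram f (\<lambda>i. X i \<omega>) n (\<theta>LS n \<omega>) - gram f (\<lambda>i. X i \<omega>) n \<theta>bar) \<le> d" by auto
        then have "\<not> norm (\<theta>LS n \<omega> - \<theta>bar) \<le> r / 2" using close by blast
        then show "\<omega> \<in> {\<omega>\<in>space M. r / 2 < norm (\<theta>LS n \<omega> - \<theta>bar)}" using \<omega>(1) by simp
      qed
    qed
  qed
qed

text \<open>The information matrix may be singular for \<open>n < nst\<close>, where \<open>matrix_sqrt\<close> has a junk value;
  replacing it by \<open>m\<close> there gives a measurable family.\<close>
definition info_LS :: "nat \<Rightarrow> 'w \<Rightarrow> real^'p^'p" where
  "info_LS n \<omega> = (if n < nst then m else gram f (\<lambda>i. X i \<omega>) n (\<theta>LS n \<omega>))"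

lemma info_LS_spd: "\<omega> \<in> space M \<Longrightarrow> info_LS n \<omega> \<in> {A. transpose A = A \<and> pos_def A}"
  using m_sym m_pos transpose_gram gram_spd[of n \<omega> "\<theta>LS n \<omega>"] \<theta>LS_in[of n \<omega>] nst1 by (auto simp: info_LS_def)

lemma sqrt_info_LS_meas [measurable]: "(\<lambda>\<omega>. matrix_sqrt (info_LS n \<omega>)) \<in> borel_measurable M"
proof (rule measurable_continuous_on_comp[OF continuous_on_matrix_sqrt _ info_LS_spd])
  show "info_LS n \<in> borel_measurable M" by (cases "n < nst") (simp_all add: info_LS_def[abs_def])
qed

lemma sqrt_info_LS_null: "prob_null (\<lambda>n \<omega>. norm (matrix_sqrt (info_LS n \<omega>) - matrix_sqrt m))"
proof (rule prob_nullI)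
  fix d c :: real assume d: "0 < d" and c: "0 < c"
  have "m \<in> {A. transpose A = A \<and> pos_def A}" using m_sym m_pos by simp
  with continuous_on_matrix_sqrt[unfolded continuous_on_iff] d
  obtain r where r: "0 < r" "\<And>A. A \<in> {A. transpose A = A \<and> pos_def A} \<Longrightarrow> dist A m < r \<Longrightarrow> dist (matrix_sqrt A) (matrix_sqrt m) < d"
    by blast
  have "\<forall>\<^sub>F n in sequentially. prob {\<omega>\<in>space M. r / 2 < norm (gram f (\<lambda>i. X i \<omega>) n (\<theta>LS n \<omega>) - m)} \<le> c"
    by (rule prob_nullD[OF gram_LS_null _ c]) (use r in simp)
  then show "\<forall>\<^sub>F n in sequentially. \<exists>B\<in>events. prob B \<le> c \<and>
      {\<omega>\<in>space M. d < norm (matrix_sqrt (info_LS n \<omega>) - matrix_sqrt m)} \<subseteq> B"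
    using eventually_ge_at_top[of nst]
  proof eventually_elim
    case (elim n)
    show ?case
    proof (intro bexI conjI subsetI)
      show "prob {\<omega>\<in>space M. r / 2 < norm (gram f (\<lambda>i. X i \<omega>) n (\<theta>LS n \<omega>) - m)} \<le> c" by (rule elim(1))
      show "{\<omega>\<in>space M. r / 2 < norm (gram f (\<lambda>i. X i \<omega>) n (\<theta>LS n \<omega>) - m)} \<in> events" by measurable
      fix \<omega> assume \<omega>: "\<omega> \<in> {\<omega>\<in>space M. d < norm (matrix_sqrt (info_LS n \<omega>) - matrix_sqrt m)}"
      then have "\<not> dist (info_LS n \<omega>) m < r" using r(2)[OF info_LS_spd[of \<omega> n]] by (auto simp: dist_norm)
      then show "\<omega> \<in> {\<omega>\<in>space M. r / 2 < norm (gram f (\<lambda>i. X i \<omega>) n (\<theta>LS n \<omega>) - m)}"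
        using \<omega> elim(2) r(1) by (auto simp: info_LS_def dist_norm)
    qed
  qed
qed

text \<open>A Slutsky argument: s (A u) - B score = s ((A - Q) u + Q (u - u')), where the first term
  is a null factor times a tight one and the second is null by linearization.\<close>

theorem lse_studentized_info_LS:
  "conv_distr M (\<lambda>n \<omega>. (sqrt (real n) / sqrt \<sigma>2) *\<^sub>R (matrix_sqrt (info_LS n \<omega>) *v (\<theta>LS n \<omega> - \<theta>bar))) (mv_normal (mat 1))"
proof -
  define s where "s = 1 / sqrt \<sigma>2"
  have s: "0 \<le> s" "\<sigma>2 * (s * s) = 1" using \<sigma>2_pos by (auto simp: s_def)
  define Q where "Q = matrix_sqrt m"
  note Qp = matrix_sqrt_props[OF m_sym m_pos, folded Q_def]
  \<comment> \<open>Limit form of the studentized error: the estimated root is replaced by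
    \<open>Q\<close> and the scaled error by its linearization.\<close>
  define B where "B = s *\<^sub>R (Q ** matrix_inv m)"
  define u where "u n \<omega> = sqrt (real n) *\<^sub>R (\<theta>LS n \<omega> - \<theta>bar)" for n \<omega>
  define u' where "u' n \<omega> = matrix_inv m *v score n \<omega>" for n \<omega>
  have inv: "invertible m" by (rule pos_def_invertible[OF m_pos])
  have um[measurable]: "u n \<in> borel_measurable M" for n unfolding u_def[abs_def] by measurable
  have u'm[measurable]: "u' n \<in> borel_measurable M" for n unfolding u'_def[abs_def] by (rule matrix_vector_meas) measurable
  have lin: "prob_null (\<lambda>n \<omega>. norm (u n \<omega> - u' n \<omega>))" unfolding u_def u'_def by (rule lse_linearization)
  have tight: "prob_tight (\<lambda>n \<omega>. norm (u n \<omega>))"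
  proof (rule prob_tight_perturb[OF _ _ linear_score_tight[of "matrix_inv m"] lin])
    show "norm (u n \<omega>) \<le> norm (matrix_inv m *v score n \<omega>) + norm (u n \<omega> - u' n \<omega>)" for n \<omega>
      unfolding u'_def[symmetric] using norm_triangle_ineq[of "u' n \<omega>" "u n \<omega> - u' n \<omega>"] by simp
    show "(\<lambda>\<omega>. norm (matrix_inv m *v score n \<omega>)) \<in> borel_measurable M" for n
      unfolding u'_def[symmetric] by measurable
  qed measurable
  have eq: "(sqrt (real n) / sqrt \<sigma>2) *\<^sub>R (A *v (\<theta>LS n \<omega> - \<theta>bar)) = s *\<^sub>R (A *v u n \<omega>)" for n \<omega> and A :: "real^'p^'p"
    by (simp add: s_def u_def matrix_vector_mult_scaleR)
  have Zm: "(\<lambda>\<omega>. s *\<^sub>R (matrix_sqrt (info_LS n \<omega>) *v u n \<omega>)) \<in> borel_measurable M" for n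
  proof -
    have "(\<lambda>p. fst p *v snd p :: real^'p) \<in> borel_measurable (borel :: ((real^'p^'p) \<times> (real^'p)) measure)"
      unfolding matrix_vector_mult_def by (intro borel_measurable_continuous_onI continuous_intros)
    from measurable_compose[OF borel_measurable_Pair[OF sqrt_info_LS_meas um] this]
    show ?thesis by simp
  qed
  have nm: "(\<lambda>\<omega>. norm (matrix_sqrt (info_LS n \<omega>) - matrix_sqrt m)) \<in> borel_measurable M"
    "(\<lambda>\<omega>. norm (u n \<omega>)) \<in> borel_measurable M" "(\<lambda>\<omega>. norm (u n \<omega> - u' n \<omega>)) \<in> borel_measurable M" for n
    by measurable
  have null: "prob_null (\<lambda>n \<omega>. norm (s *\<^sub>R (matrix_sqrt (info_LS n \<omega>) *v u n \<omega>) - B *v score n \<omega>))"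
  proof (rule prob_null_add[OF _ _ prob_null_cmult[OF prob_null_mult_tight[OF _ _ tight sqrt_info_LS_null] s(1)]
        prob_null_cmult[OF lin, of "s * norm Q"]])
    show "\<forall>\<^sub>F n in sequentially. \<forall>\<omega>\<in>space M. norm (s *\<^sub>R (matrix_sqrt (info_LS n \<omega>) *v u n \<omega>) - B *v score n \<omega>)
      \<le> norm (matrix_sqrt (info_LS n \<omega>) - matrix_sqrt m) * norm (u n \<omega>) * s + norm (u n \<omega> - u' n \<omega>) * (s * norm Q)"
    proof (intro always_eventually allI ballI)
      fix n \<omega>
      define A where "A = matrix_sqrt (info_LS n \<omega>)"
      have "B *v score n \<omega> = s *\<^sub>R (Q *v u' n \<omega>)"
        by (simp add: B_def u'_def scaleR_matrix_vector_assoc[symmetric] matrix_vector_mul_assoc)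
      then have "s *\<^sub>R (A *v u n \<omega>) - B *v score n \<omega> = s *\<^sub>R ((A - Q) *v u n \<omega> + Q *v (u n \<omega> - u' n \<omega>))"
        by (simp add: matrix_vector_mult_diff_rdistrib matrix_vector_mult_diff_distrib scaleR_diff_right)
      then have "norm (s *\<^sub>R (A *v u n \<omega>) - B *v score n \<omega>) = s * norm ((A - Q) *v u n \<omega> + Q *v (u n \<omega> - u' n \<omega>))"
        using s by simp
      also have "\<dots> \<le> s * (norm (A - Q) * norm (u n \<omega>) + norm Q * norm (u n \<omega> - u' n \<omega>))"
        by (intro mult_left_mono s norm_triangle_le add_mono norm_matrix_vector_le)
      finally show "norm (s *\<^sub>R (matrix_sqrt (info_LS n \<omega>) *v u n \<omega>) - B *v score n \<omega>)
        \<le> norm (matrix_sqrt (info_LS n \<omega>) - matrix_sqrt m) * norm (u n \<omega>) * s + norm (u n \<omega> - u' n \<omega>) * (s * norm Q)"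
        by (simp add: A_def Q_def algebra_simps)
    qed
    show "0 \<le> s * norm Q" using s by simp
  qed (intro borel_measurable_times borel_measurable_const nm norm_ge_zero)+
  \<comment> \<open>In matrix form \<sigma>2 s^2 Q m^-1 m m^-1 Q = Q m^-1 Q = I, because Q Q =
    m.\<close>
  have cov: "\<sigma>2 * ((transpose B *v t) \<bullet> (m *v (transpose B *v t))) = t \<bullet> (mat 1 *v t)" for t
  proof -
    define w where "w = matrix_inv m *v (Q *v t)"
    have mw: "m *v w = Q *v t" unfolding w_def by (rule matrix_inv_mult(3)[OF inv])
    have "Q *v (Q *v w) = Q *v t" unfolding mw[symmetric] by (simp add: matrix_vector_mul_assoc Qp(3))
    then have Qw: "Q *v w = t" using matrix_inv_mult(4)[OF pos_def_invertible[OF Qp(2)]] by metis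
    have "transpose B *v t = s *\<^sub>R w"
      unfolding B_def transpose_scaleR matrix_transpose_mul Qp(1) sym_matrix_inv[OF m_sym inv] w_def
      by (simp add: scaleR_matrix_vector_assoc[symmetric] matrix_vector_mul_assoc)
    then have "\<sigma>2 * ((transpose B *v t) \<bullet> (m *v (transpose B *v t))) = \<sigma>2 * (s * s) * (w \<bullet> (Q *v t))"
      by (simp add: matrix_vector_mult_scaleR mw)
    also have "\<dots> = t \<bullet> t" using sym_matrix_inner[OF Qp(1), of w t] s Qw by simp
    finally show ?thesis by simp
  qed
  have I: "transpose (mat 1 :: real^'p^'p) = mat 1" "pos_def (mat 1 :: real^'p^'p)"
    by (auto simp: pos_def_def)
  show ?thesis unfolding eq by (rule conv_distr_linear_score[OF Zm null I cov])
qed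

text \<open>From \<open>nst\<close> on the surrogate \<open>info_LS\<close> is the information
  matrix itself, and finitely many indices do not affect a limit.\<close>

theorem lse_studentized:
  "conv_distr M (\<lambda>n \<omega>. (sqrt (real n) / sqrt \<sigma>2) *\<^sub>R
     (matrix_sqrt (info_matrix f (emp_design (\<lambda>i. X i \<omega>) n) (\<theta>LS n \<omega>)) *v (\<theta>LS n \<omega> - \<theta>bar))) (mv_normal (mat 1))"
  unfolding conv_distr_def
proof (intro allI impI)
  fix g :: "real^'p \<Rightarrow> real" assume g: "continuous_on UNIV g \<and> bounded (range g)"
  note lim = lse_studentized_info_LS[unfolded conv_distr_def, rule_format, OF g]
  show "(\<lambda>n. integral\<^sup>L M (\<lambda>\<omega>. g ((sqrt (real n) / sqrt \<sigma>2) *\<^sub>R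
     (matrix_sqrt (info_matrix f (emp_design (\<lambda>i. X i \<omega>) n) (\<theta>LS n \<omega>)) *v (\<theta>LS n \<omega> - \<theta>bar))))) \<longlonglongrightarrow> integral\<^sup>L (mv_normal (mat 1)) g"
  proof (rule Lim_transform_eventually[OF lim])
    show "\<forall>\<^sub>F n in sequentially.
       integral\<^sup>L M (\<lambda>\<omega>. g ((sqrt (real n) / sqrt \<sigma>2) *\<^sub>R (matrix_sqrt (info_LS n \<omega>) *v (\<theta>LS n \<omega> - \<theta>bar)))) =
       integral\<^sup>L M (\<lambda>\<omega>. g ((sqrt (real n) / sqrt \<sigma>2) *\<^sub>R
         (matrix_sqrt (info_matrix f (emp_design (\<lambda>i. X i \<omega>) n) (\<theta>LS n \<omega>)) *v (\<theta>LS n \<omega> - \<theta>bar))))"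
      using eventually_ge_at_top[of nst]
    proof eventually_elim
      case (elim n)
      then have "1 \<le> n" "\<not> n < nst" using nst1 by auto
      then show ?case by (simp only: info_LS_def if_False info_matrix_emp_design)
    qed
  qed
qed

end

text \<open>What remains is to instantiate the locale. Compactness of the hull provides
  \<open>m\<close> without reference to a design, and uniqueness of the maximizer identifies
  \<open>m\<close> with the information matrix of any locally D-optimal design.\<close>

theorem theorem3p2:
  fixes XX :: "'x::metric_space set"
    and \<Theta> :: "(real^'p) set"
    and \<mu> :: "'x \<Rightarrow> real^'p \<Rightarrow> real"
    and f :: "real^'p \<Rightarrow> 'x \<Rightarrow> real^'p"
    and M :: "'w measure"
    and F :: "nat \<Rightarrow> 'w measure"
    and X :: "nat \<Rightarrow> 'w \<Rightarrow> 'x"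
    and Y e :: "nat \<Rightarrow> 'w \<Rightarrow> real"
    and \<theta>bar :: "real^'p"
    and nst :: nat
    and x0 :: "nat \<Rightarrow> 'x"
    and \<theta>hat \<theta>LS :: "nat \<Rightarrow> 'w \<Rightarrow> real^'p"
    and \<sigma>2 :: real
  assumes XX_compact: "compact XX"
    and \<Theta>_compact: "compact \<Theta>"
    and \<Theta>_int: "interior \<Theta> \<noteq> {}"
    and \<mu>_cont: "continuous_on (XX \<times> \<Theta>) (\<lambda>(x, \<theta>). \<mu> x \<theta>)"
    and \<mu>_C2: "\<forall>x\<in>XX. twice_cont_diff_on (interior \<Theta>) (\<mu> x)"
    and f_span: "\<forall>\<theta>\<in>\<Theta>. span (f \<theta> ` XX) = UNIV"
    and f_cont: "continuous_on (XX \<times> \<Theta>) (\<lambda>(x, \<theta>). f \<theta> x)"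
    and f_grad: "\<forall>\<theta>\<in>interior \<Theta>. \<forall>x\<in>XX.
                   (\<mu> x has_derivative (\<lambda>h. f \<theta> x \<bullet> h)) (at \<theta>)"
    and sat_ident: "\<forall>z :: 'p \<Rightarrow> 'x. inj z \<and> range z \<subseteq> XX \<longrightarrow>
                     (\<forall>\<theta>\<in>\<Theta>. \<forall>\<theta>'\<in>\<Theta>. (\<forall>j. \<mu> (z j) \<theta> = \<mu> (z j) \<theta>') \<longrightarrow> \<theta> = \<theta>')"
    and prob: "prob_space M"
    and \<theta>bar_int: "\<theta>bar \<in> interior \<Theta>"
    (* starting design *)
    and x0_in: "\<forall>i\<in>{1..nst}. x0 i \<in> XX"
    and start_pd: "\<forall>\<theta>\<in>\<Theta>. pos_def (info_matrix f (emp_design x0 nst) \<theta>)"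
    and X_start: "\<forall>i\<in>{1..nst}. \<forall>\<omega>\<in>space M. X i \<omega> = x0 i"
    (* adaptive estimators: functions of the data, valued in Theta *)
    and \<theta>hat_in: "\<forall>n\<ge>nst. \<forall>\<omega>\<in>space M. \<theta>hat n \<omega> \<in> \<Theta>"
    and \<theta>hat_data: "\<forall>n\<ge>nst. \<forall>\<omega>\<in>space M. \<forall>\<omega>'\<in>space M.
                     (\<forall>i\<in>{1..n}. X i \<omega> = X i \<omega>' \<and> Y i \<omega> = Y i \<omega>') \<longrightarrow> \<theta>hat n \<omega> = \<theta>hat n \<omega>'"
    (* Wynn step *)
    and wynn: "\<forall>n\<ge>nst. \<forall>\<omega>\<in>space M. X (Suc n) \<omega> \<in> XX \<and>
                 (\<forall>x\<in>XX.
                    f (\<theta>hat n \<omega>) x \<bullet> (matrix_inv (info_matrix f (emp_design (\<lambda>i. X i \<omega>) n) (\<theta>hat n \<omega>))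
                                          *v f (\<theta>hat n \<omega>) x)
                  \<le> f (\<theta>hat n \<omega>) (X (Suc n) \<omega>) \<bullet>
                      (matrix_inv (info_matrix f (emp_design (\<lambda>i. X i \<omega>) n) (\<theta>hat n \<omega>))
                         *v f (\<theta>hat n \<omega>) (X (Suc n) \<omega>)))"
    (* (A1) *)
    and F_sub: "\<forall>i. subalgebra M (F i)"
    and F_mono: "\<forall>i. sets (F i) \<subseteq> sets (F (Suc i))"
    and X_meas: "\<forall>i\<ge>1. X i \<in> borel_measurable (F (i - 1))"
    and Y_meas: "\<forall>i\<ge>1. Y i \<in> borel_measurable (F i)"
    (* (A2) *)
    and Y_model: "\<forall>i\<ge>1. \<forall>\<omega>\<in>space M. Y i \<omega> = \<mu> (X i \<omega>) \<theta>bar + e i \<omega>"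
    and e_meas: "\<forall>i\<ge>1. e i \<in> borel_measurable M"
    and e_sq_int: "\<forall>i\<ge>1. integrable M (\<lambda>\<omega>. (e i \<omega>)\<^sup>2)"
    and e_mart: "\<forall>i\<ge>1. AE \<omega> in M. real_cond_exp M (F (i - 1)) (e i) \<omega> = 0"
    and e_var_bdd: "AE \<omega> in M. \<exists>C. \<forall>i\<ge>1.
                      real_cond_exp M (F (i - 1)) (\<lambda>\<omega>. (e i \<omega>)\<^sup>2) \<omega> \<le> C"
    (* (L) *)
    and lindeberg: "\<forall>\<epsilon>>0. AE \<omega> in M.
        (\<lambda>n. (1 / real n) * (\<Sum>i=1..n. real_cond_exp M (F (i - 1))
              (\<lambda>\<omega>. (e i \<omega>)\<^sup>2 * indicator {\<omega>. \<bar>e i \<omega>\<bar> > \<epsilon> * sqrt (real n)} \<omega>) \<omega>))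
        \<longlonglongrightarrow> 0"
    (* (AH) *)
    and \<sigma>2_pos: "\<sigma>2 > 0"
    and asym_homo: "AE \<omega> in M. (\<lambda>n. real_cond_exp M (F (n - 1)) (\<lambda>\<omega>. (e n \<omega>)\<^sup>2) \<omega>) \<longlonglongrightarrow> \<sigma>2"
    (* strong consistency of the adaptive estimators *)
    and \<theta>hat_cons: "AE \<omega> in M. (\<lambda>n. \<theta>hat n \<omega>) \<longlonglongrightarrow> \<theta>bar"
    (* adaptive least squares estimators *)
    and \<theta>LS_meas: "\<forall>n. \<theta>LS n \<in> borel_measurable M"
    and \<theta>LS_min: "\<forall>n\<ge>1. \<forall>\<omega>\<in>space M. \<theta>LS n \<omega> \<in> \<Theta> \<and>
        (\<forall>\<theta>\<in>\<Theta>. (\<Sum>i=1..n. (Y i \<omega> - \<mu> (X i \<omega>) (\<theta>LS n \<omega>))\<^sup>2) \<le> (\<Sum>i=1..n. (Y i \<omega> - \<mu> (X i \<omega>) \<theta>)\<^sup>2))"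
  shows "conv_distr M
           (\<lambda>n \<omega>. (sqrt (real n) / sqrt \<sigma>2) *\<^sub>R
              (matrix_sqrt (info_matrix f (emp_design (\<lambda>i. X i \<omega>) n) (\<theta>LS n \<omega>)) *v (\<theta>LS n \<omega> - \<theta>bar)))
           (mv_normal (mat 1))
       \<and> (\<forall>\<xi>star. locally_D_optimal XX f \<theta>bar \<xi>star \<longrightarrow>
            conv_distr M (\<lambda>n \<omega>. sqrt (real n) *\<^sub>R (\<theta>LS n \<omega> - \<theta>bar))
              (mv_normal (\<sigma>2 *\<^sub>R matrix_inv (info_matrix f \<xi>star \<theta>bar))))"
proof -
  interpret prob_space M by (rule prob)
  have \<theta>bar_in: "\<theta>bar \<in> \<Theta>" using \<theta>bar_int interior_subset by blast
  \<comment> \<open>An empty starting design would have information matrix 0, against positive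
    definiteness.\<close>
  have nst1: "1 \<le> nst"
  proof (rule ccontr)
    assume "\<not> 1 \<le> nst"
    then have "info_matrix f (emp_design x0 nst) \<theta>bar = 0"
      by (simp add: info_matrix_def supp_design_def emp_design_def)
    then have "pos_def (0 :: real^'p^'p)" using start_pd \<theta>bar_in by metis
    moreover have "axis undefined 1 \<noteq> (0 :: real^'p)" by (simp add: axis_eq_0_iff)
    ultimately show False unfolding pos_def_def by (metis inner_zero_right less_irrefl matrix_vector_mult_0)
  qed
  have X_in: "X i \<omega> \<in> XX" if "1 \<le> i" "\<omega> \<in> space M" for i \<omega>
  proof (cases "i \<le> nst")
    case True
    then show ?thesis using X_start x0_in that by auto
  next
    case False
    then obtain n where n: "i = Suc n" "nst \<le> n" by (cases i) auto
    then show ?thesis using wynn that(2) by auto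
  qed
  have gram_start: "pos_def (gram f (\<lambda>i. X i \<omega>) nst \<theta>)" if "\<omega> \<in> space M" "\<theta> \<in> \<Theta>" for \<omega> \<theta>
  proof -
    have "gram f (\<lambda>i. X i \<omega>) nst \<theta> = gram f x0 nst \<theta>" using X_start that(1) by (simp add: gram_def)
    then show ?thesis using start_pd that(2) info_matrix_emp_design[OF nst1, of f x0 \<theta>] by metis
  qed
  have wynn_max: "f (\<theta>hat n \<omega>) x \<bullet> (matrix_inv (gram f (\<lambda>i. X i \<omega>) n (\<theta>hat n \<omega>)) *v f (\<theta>hat n \<omega>) x)
      \<le> f (\<theta>hat n \<omega>) (X (Suc n) \<omega>) \<bullet> (matrix_inv (gram f (\<lambda>i. X i \<omega>) n (\<theta>hat n \<omega>)) *v f (\<theta>hat n \<omega>) (X (Suc n) \<omega>))"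
    if "nst \<le> n" "\<omega> \<in> space M" "x \<in> XX" for n \<omega> x
  proof -
    have "1 \<le> n" using that nst1 by simp
    from wynn[rule_format, OF that(1,2), THEN conjunct2, rule_format, OF that(3)] show ?thesis
      unfolding info_matrix_emp_design[OF \<open>1 \<le> n\<close>] .
  qed
  have "continuous_on XX ((\<lambda>(x, \<theta>). f \<theta> x) \<circ> (\<lambda>x. (x, \<theta>bar)))"
    using \<theta>bar_in by (intro continuous_on_compose continuous_on_subset[OF f_cont] continuous_intros) auto
  then have "continuous_on XX (f \<theta>bar)" by (simp add: o_def)
  then have cpt: "compact (info_hull f XX \<theta>bar)" by (rule compact_info_hull[OF XX_compact])
  obtain \<omega>0 where "\<omega>0 \<in> space M" using not_empty by blast
  then have "gram f (\<lambda>i. X i \<omega>0) 1 \<theta>bar \<in> info_hull f XX \<theta>bar" by (intro gram_in_info_hull) (auto simp: X_in)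
  then obtain m where m: "m \<in> info_hull f XX \<theta>bar" "\<And>A. A \<in> info_hull f XX \<theta>bar \<Longrightarrow> det A \<le> det m"
    using continuous_attains_sup[OF cpt _ continuous_on_det] by blast
  interpret wynn_regression M XX \<Theta> \<mu> f F X Y e \<theta>bar nst \<theta>hat \<theta>LS \<sigma>2 m
  proof unfold_locales
    show "Y (Suc i) \<omega> = \<mu> (X (Suc i) \<omega>) \<theta>bar + e (Suc i) \<omega>" if "\<omega> \<in> space M" for i \<omega>
      using Y_model that by simp
    show "AE \<omega> in M. (\<lambda>n. (1 / real n) * (\<Sum>i<n. real_cond_exp M (F i)
        (\<lambda>\<omega>. (e (Suc i) \<omega>)\<^sup>2 * indicator {\<omega>. \<bar>e (Suc i) \<omega>\<bar> > \<epsilon> * sqrt (real n)} \<omega>) \<omega>)) \<longlonglongrightarrow> 0" if "0 < \<epsilon>" for \<epsilon>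
      using lindeberg[rule_format, OF that] by (simp only: One_nat_def sum.atLeast1_atMost_eq diff_Suc_Suc diff_zero)
    show "AE \<omega> in M. (\<lambda>n. real_cond_exp M (F n) (\<lambda>\<omega>. (e (Suc n) \<omega>)\<^sup>2) \<omega>) \<longlonglongrightarrow> \<sigma>2"
      using asym_homo by eventually_elim (drule LIMSEQ_Suc, simp)
    show "(\<Sum>i<n. (Y (Suc i) \<omega> - \<mu> (X (Suc i) \<omega>) (\<theta>LS n \<omega>))\<^sup>2) \<le> (\<Sum>i<n. (Y (Suc i) \<omega> - \<mu> (X (Suc i) \<omega>) \<theta>)\<^sup>2)"
      if "1 \<le> n" "\<omega> \<in> space M" "\<theta> \<in> \<Theta>" for n \<omega> \<theta>
      using \<theta>LS_min[rule_format, OF that(1,2), THEN conjunct2, rule_format, OF that(3)]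
      by (simp only: One_nat_def sum.atLeast1_atMost_eq)
    show "X (Suc i) \<in> borel_measurable (F i)" for i using X_meas[rule_format, of "Suc i"] by simp
    show "AE \<omega> in M. real_cond_exp M (F i) (e (Suc i)) \<omega> = 0" for i using e_mart[rule_format, of "Suc i"] by simp
  qed (use XX_compact \<Theta>_compact \<mu>_cont f_span f_cont f_grad sat_ident \<theta>bar_int nst1 X_in gram_start \<theta>hat_in
      wynn_max F_sub F_mono Y_meas e_meas e_sq_int \<sigma>2_pos \<theta>hat_cons \<theta>LS_meas \<theta>LS_min m in \<open>blast | simp\<close>)+
  \<comment> \<open>The maximum over designs is the maximum over the hull, since \<open>m\<close>
    itself comes from a design; strict concavity then identifies the matrices and not only their
    determinants.\<close>
  have opt: "info_matrix f \<xi>star \<theta>bar = m" if "locally_D_optimal XX f \<theta>bar \<xi>star" for \<xi>star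
  proof -
    have design: "is_design XX \<xi>star"
      and max: "\<And>\<eta>. is_design XX \<eta> \<Longrightarrow> det (info_matrix f \<eta> \<theta>bar) \<le> det (info_matrix f \<xi>star \<theta>bar)"
      using that by (auto simp: locally_D_optimal_def)
    have hull: "info_matrix f \<xi>star \<theta>bar \<in> info_hull f XX \<theta>bar" by (rule info_matrix_in_info_hull[OF design])
    obtain \<eta> where \<eta>: "is_design XX \<eta>" "info_matrix f \<eta> \<theta>bar = m" by (rule info_hull_design[OF m(1)])
    have eq: "det (info_matrix f \<xi>star \<theta>bar) = det m" using m(2)[OF hull] max[OF \<eta>(1)] \<eta>(2) by simp
    show ?thesis by (rule info_hull_det_max_unique[OF m(1) hull _ eq spd_det_pos[OF m_sym m_pos]]) (rule m(2))
  qed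
  show ?thesis using lse_studentized lse_asymptotic_normal opt by auto
qed

end
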